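(* Let $k$ be a field of characteristic zero, $N\ge2$, and $\mathcal{E}_N$ the Fomin–Kirillov algebra. (1) Biproduct bosonisation in the category of left $S_N$-crossed modules gives an ordinary Hopf algebra $\mathcal{E}_N{>\!\!\!\triangleleft\!\cdot}\,kS_N$, generated by $\mathcal{E}_N$ and $kS_N$ (as vector space $\mathcal{E}_N\otimes kS_N$), with $$g[ij]=[g(i)\,g(j)]\,g\quad\forall g\in S_N,\qquad\Delta[ij]=[ij]\otimes1+(ij)\otimes[ij],\qquad\epsilon[ij]=0,$$ extending the Hopf algebra structure of the group algebra $kS_N$. (2) Bosonisation in the equivalent category of right $k(S_N)$-crossed modules gives an ordinary Hopf algebra $k(S_N){\cdot\!\triangleright\!\!\!<}\,\mathcal{E}_N$, generated by $k(S_N)$ and $\mathcal{E}_N$ (as vector space $k(S_N)\otimes\mathcal{E}_N$), with $$[ij]f=R_{(ij)}(f)[ij]\quad\forall f\in k(S_N),\qquad\Delta[ij]=\sum_{g\in S_N}[g(i)\,g(j)]\otimes\delta_g+1\otimes[ij],\qquad \epsilon[ij]=0,$$ extending the Hopf algebra structure of $k(S_N)$.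
   Context: The Fomin–Kirillov algebra $\mathcal{E}_N$ is the associative unital $k$-algebra generated by $[ij]$, $i\neq j\in\{1,\dots,N\}$, with relations $[ij]=-[ji]$, $[ij]^2=0$, $[ij][km]=[km][ij]$, and $[ij][jk]+[jk][ki]+[ki][ij]=0$ for distinct $i,j,k,m$. It is a Hopf algebra in the braided category of left $S_N$-crossed modules ($S_N$-graded $S_N$-modules with $h.V_g\subseteq V_{hgh^{-1}}$, braiding $\Psi(v\otimes w)=|v|.w\otimes v$), with $g.[ij]=[g(i)\,g(j)]$, degree $|[ij]|=(ij)$, and $\underline\Delta[ij]=[ij]\otimes1+1\otimes[ij]$, $\underline\epsilon[ij]=0$. $k(S_N)$ is the Hopf algebra of functions on $S_N$ with $\Delta(f)(g,h)=f(gh)$, $\epsilon(f)=f(e)$; $\delta_g$ is the Kronecker delta function at $g$; and $R_a(f)(g)=f(ga)$. The biproduct bosonisation of a braided group $B$ in the category of crossed modules over a Hopf algebra $H$ is the ordinary Hopf algebra on $B\otimes H$ (or $H\otimes B$ for right crossed modules) given by the simultaneous cross product and cross coproduct by the action and coaction of $H$ on $B$. *)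

theory Defs
  imports "HOL-Algebra.Sym_Groups" "HOL-Algebra.QuotRing" "HOL-Algebra.Subrings" "HOL-Algebra.Module"
begin

section \<open>Linear algebra over a field given as a HOL-Algebra structure\<close>

text \<open>
  Vector spaces and algebras over \<open>K\<close> are \<open>module\<close> records. A record that only serves as a
  vector space carries irrelevant \<open>mult\<close> and \<open>one\<close> fields.
\<close>

definition ground :: "('k, 'm) ring_scheme \<Rightarrow> ('k, 'k) module" where
  "ground K = \<lparr>carrier = carrier K, mult = mult K, one = one K, zero = zero K, add = add K,
               smult = mult K\<rparr>"

definition lin_map ::
  "('k, 'm) ring_scheme \<Rightarrow> ('k, 'a, 'c) module_scheme \<Rightarrow> ('k, 'b, 'd) module_scheme \<Rightarrow> ('a \<Rightarrow> 'b) set"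
  where
  "lin_map K V W = {f \<in> carrier V \<rightarrow> carrier W.
     (\<forall>x\<in>carrier V. \<forall>y\<in>carrier V. f (x \<oplus>\<^bsub>V\<^esub> y) = f x \<oplus>\<^bsub>W\<^esub> f y) \<and>
     (\<forall>a\<in>carrier K. \<forall>x\<in>carrier V. f (a \<odot>\<^bsub>V\<^esub> x) = a \<odot>\<^bsub>W\<^esub> f x)}"

definition alg_hom ::
  "('k, 'm) ring_scheme \<Rightarrow> ('k, 'a, 'c) module_scheme \<Rightarrow> ('k, 'b, 'd) module_scheme \<Rightarrow> ('a \<Rightarrow> 'b) set"
  where "alg_hom K A B = ring_hom A B \<inter> lin_map K A B"

definition lin_span :: "('k, 'm) ring_scheme \<Rightarrow> ('k, 'a, 'c) module_scheme \<Rightarrow> 'a set \<Rightarrow> 'a set" where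
  "lin_span K V S = \<Inter>{U. submodule U K V \<and> S \<subseteq> U}"

definition alg_span :: "('k, 'm) ring_scheme \<Rightarrow> ('k, 'a, 'c) module_scheme \<Rightarrow> 'a set \<Rightarrow> 'a set" where
  "alg_span K A S = \<Inter>{U. subring U A \<and> submodule U K A \<and> S \<subseteq> U}"

text \<open>The library locale \<open>algebra\<close> is restricted to commutative algebras.\<close>

locale k_algebra =
  fixes K :: "('k, 'm) ring_scheme" and A :: "('k, 'a, 'c) module_scheme"
  assumes is_field: "field K"
    and is_module: "module K A"
    and is_ring: "ring A"
    and smult_mult_left: "\<lbrakk>a \<in> carrier K; x \<in> carrier A; y \<in> carrier A\<rbrakk>
      \<Longrightarrow> (a \<odot>\<^bsub>A\<^esub> x) \<otimes>\<^bsub>A\<^esub> y = a \<odot>\<^bsub>A\<^esub> (x \<otimes>\<^bsub>A\<^esub> y)"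
    and smult_mult_right: "\<lbrakk>a \<in> carrier K; x \<in> carrier A; y \<in> carrier A\<rbrakk>
      \<Longrightarrow> x \<otimes>\<^bsub>A\<^esub> (a \<odot>\<^bsub>A\<^esub> y) = a \<odot>\<^bsub>A\<^esub> (x \<otimes>\<^bsub>A\<^esub> y)"

definition supp :: "('k, 'm) ring_scheme \<Rightarrow> ('x \<Rightarrow> 'k) \<Rightarrow> 'x set" where
  "supp K f = {x. f x \<noteq> \<zero>\<^bsub>K\<^esub>}"

definition single :: "('k, 'm) ring_scheme \<Rightarrow> 'x \<Rightarrow> 'x \<Rightarrow> 'k" where
  "single K x = (\<lambda>y. if y = x then \<one>\<^bsub>K\<^esub> else \<zero>\<^bsub>K\<^esub>)"

definition free_mod :: "('k, 'm) ring_scheme \<Rightarrow> 'x set \<Rightarrow> ('k, 'x \<Rightarrow> 'k) module" where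
  "free_mod K X =
     \<lparr>carrier = {f. range f \<subseteq> carrier K \<and> finite (supp K f) \<and> supp K f \<subseteq> X},
      mult = undefined, one = undefined,
      zero = (\<lambda>_. \<zero>\<^bsub>K\<^esub>), add = (\<lambda>f g x. f x \<oplus>\<^bsub>K\<^esub> g x),
      smult = (\<lambda>a f x. a \<otimes>\<^bsub>K\<^esub> f x)\<rparr>"

definition monoid_algebra ::
  "('k, 'm) ring_scheme \<Rightarrow> ('x, 'n) monoid_scheme \<Rightarrow> ('k, 'x \<Rightarrow> 'k) module" where
  "monoid_algebra K M = (free_mod K (carrier M))
     \<lparr>mult := (\<lambda>f g z. \<Oplus>\<^bsub>K\<^esub>p\<in>{(x, y). x \<in> supp K f \<and> y \<in> supp K g \<and> x \<otimes>\<^bsub>M\<^esub> y = z}.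
                         f (fst p) \<otimes>\<^bsub>K\<^esub> g (snd p)),
      one := single K \<one>\<^bsub>M\<^esub>\<rparr>"

definition free_alg :: "('k, 'm) ring_scheme \<Rightarrow> 'x set \<Rightarrow> ('k, 'x list \<Rightarrow> 'k) module" where
  "free_alg K X = monoid_algebra K \<lparr>carrier = lists X, mult = (@), one = []\<rparr>"

text \<open>The quotient by a subspace or by a two-sided ideal; the scalar action is on cosets.\<close>

definition quot :: "('k, 'a, 'c) module_scheme \<Rightarrow> 'a set \<Rightarrow> ('k, 'a set) module" where
  "quot V U = ring.extend (V Quot U)
     (module.fields (\<lambda>a X. \<Union>x\<in>X. U +>\<^bsub>V\<^esub> (a \<odot>\<^bsub>V\<^esub> x)))"


section \<open>Tensor products over \<open>K\<close>\<close>

definition tensor_rels ::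
  "('k, 'm) ring_scheme \<Rightarrow> ('k, 'a, 'c) module_scheme \<Rightarrow> ('k, 'b, 'd) module_scheme
    \<Rightarrow> ('a \<times> 'b \<Rightarrow> 'k) set" where
  "tensor_rels K V W =
    (let F = free_mod K (carrier V \<times> carrier W) in
      {single K (v \<oplus>\<^bsub>V\<^esub> v', w) \<ominus>\<^bsub>F\<^esub> (single K (v, w) \<oplus>\<^bsub>F\<^esub> single K (v', w)) | v v' w.
         v \<in> carrier V \<and> v' \<in> carrier V \<and> w \<in> carrier W} \<union>
      {single K (v, w \<oplus>\<^bsub>W\<^esub> w') \<ominus>\<^bsub>F\<^esub> (single K (v, w) \<oplus>\<^bsub>F\<^esub> single K (v, w')) | v w w'.
         v \<in> carrier V \<and> w \<in> carrier W \<and> w' \<in> carrier W} \<union>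
      {single K (a \<odot>\<^bsub>V\<^esub> v, w) \<ominus>\<^bsub>F\<^esub> (a \<odot>\<^bsub>F\<^esub> single K (v, w)) | a v w.
         a \<in> carrier K \<and> v \<in> carrier V \<and> w \<in> carrier W} \<union>
      {single K (v, a \<odot>\<^bsub>W\<^esub> w) \<ominus>\<^bsub>F\<^esub> (a \<odot>\<^bsub>F\<^esub> single K (v, w)) | a v w.
         a \<in> carrier K \<and> v \<in> carrier V \<and> w \<in> carrier W})"

definition tensor ::
  "('k, 'm) ring_scheme \<Rightarrow> ('k, 'a, 'c) module_scheme \<Rightarrow> ('k, 'b, 'd) module_scheme
    \<Rightarrow> ('k, ('a \<times> 'b \<Rightarrow> 'k) set) module" where
  "tensor K V W =
    (let F = free_mod K (carrier V \<times> carrier W) in quot F (lin_span K F (tensor_rels K V W)))"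

text \<open>The pure tensor of two vectors.\<close>

definition pt ::
  "('k, 'm) ring_scheme \<Rightarrow> ('k, 'a, 'c) module_scheme \<Rightarrow> ('k, 'b, 'd) module_scheme
    \<Rightarrow> 'a \<Rightarrow> 'b \<Rightarrow> ('a \<times> 'b \<Rightarrow> 'k) set" where
  "pt K V W v w =
    (let F = free_mod K (carrier V \<times> carrier W)
     in lin_span K F (tensor_rels K V W) +>\<^bsub>F\<^esub> single K (v, w))"

text \<open>
  For a bilinear \<open>\<phi>\<close> with values in \<open>U\<close>, the map \<open>tlift K U \<phi>\<close> is the linear map out of the tensor
  product that sends the pure tensor of \<open>v\<close> and \<open>w\<close> to \<open>\<phi> v w\<close>; the value below does not depend on
  the representative \<open>f\<close> of the class \<open>t\<close>. In Sweedler notation, \<open>tlift K U \<phi> (\<Delta> h)\<close> is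
  \<open>\<Sum> \<phi> h\<^sub>1 h\<^sub>2\<close>.
\<close>

definition tlift ::
  "('k, 'm) ring_scheme \<Rightarrow> ('k, 'u, 'd) module_scheme \<Rightarrow> ('a \<Rightarrow> 'b \<Rightarrow> 'u)
    \<Rightarrow> ('a \<times> 'b \<Rightarrow> 'k) set \<Rightarrow> 'u" where
  "tlift K U \<phi> t =
    (THE u. \<exists>f\<in>t. u = (\<Oplus>\<^bsub>U\<^esub>p\<in>supp K f. f p \<odot>\<^bsub>U\<^esub> \<phi> (fst p) (snd p)))"

definition tensor_alg ::
  "('k, 'm) ring_scheme \<Rightarrow> ('k, 'a, 'c) module_scheme \<Rightarrow> ('k, 'b, 'd) module_scheme
    \<Rightarrow> ('k, ('a \<times> 'b \<Rightarrow> 'k) set) module" where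
  "tensor_alg K A B = (let T = tensor K A B in T
     \<lparr>mult := (\<lambda>s t. tlift K T (\<lambda>a b. tlift K T (\<lambda>a' b'.
                 pt K A B (a \<otimes>\<^bsub>A\<^esub> a') (b \<otimes>\<^bsub>B\<^esub> b')) t) s),
      one := pt K A B \<one>\<^bsub>A\<^esub> \<one>\<^bsub>B\<^esub>\<rparr>)"

text \<open>
  The braided tensor square of \<open>B\<close>, with product
  \<open>(a \<otimes> b)(a' \<otimes> b') = a \<Psi>(b \<otimes> a') b'\<close> for a braiding given by the bilinear map \<open>\<Psi>\<close>.
\<close>

definition braided_square ::
  "('k, 'm) ring_scheme \<Rightarrow> ('k, 'a, 'c) module_scheme \<Rightarrow> ('a \<Rightarrow> 'a \<Rightarrow> ('a \<times> 'a \<Rightarrow> 'k) set)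
    \<Rightarrow> ('k, ('a \<times> 'a \<Rightarrow> 'k) set) module" where
  "braided_square K B \<Psi> = (let T = tensor K B B in T
     \<lparr>mult := (\<lambda>s t. tlift K T (\<lambda>a b. tlift K T (\<lambda>a' b'.
                 tlift K T (\<lambda>x y. pt K B B (a \<otimes>\<^bsub>B\<^esub> x) (y \<otimes>\<^bsub>B\<^esub> b')) (\<Psi> b a')) t) s),
      one := pt K B B \<one>\<^bsub>B\<^esub> \<one>\<^bsub>B\<^esub>\<rparr>)"


section \<open>Hopf algebras\<close>

record ('k, 'a) hopf = "('k, 'a) module" +
  comult :: "'a \<Rightarrow> ('a \<times> 'a \<Rightarrow> 'k) set"
  counit :: "'a \<Rightarrow> 'k"

locale k_coalgebra =
  fixes K :: "('k, 'm) ring_scheme" and C :: "('k, 'a, 'c) hopf_scheme"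
  assumes is_field: "field K"
    and is_module: "module K C"
    and comult_linear: "comult C \<in> lin_map K C (tensor K C C)"
    and counit_linear: "counit C \<in> lin_map K C (ground K)"
    and coassoc: "c \<in> carrier C \<Longrightarrow>
      tlift K (tensor K C (tensor K C C)) (\<lambda>x y. pt K C (tensor K C C) x (comult C y)) (comult C c) =
      tlift K (tensor K C (tensor K C C)) (\<lambda>x y.
        tlift K (tensor K C (tensor K C C)) (\<lambda>x1 x2. pt K C (tensor K C C) x1 (pt K C C x2 y))
          (comult C x)) (comult C c)"
    and counit_left: "c \<in> carrier C \<Longrightarrow> tlift K C (\<lambda>x y. counit C x \<odot>\<^bsub>C\<^esub> y) (comult C c) = c"
    and counit_right: "c \<in> carrier C \<Longrightarrow> tlift K C (\<lambda>x y. counit C y \<odot>\<^bsub>C\<^esub> x) (comult C c) = c"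

definition is_antipode ::
  "('k, 'm) ring_scheme \<Rightarrow> ('k, 'a, 'c) hopf_scheme \<Rightarrow> ('a \<Rightarrow> 'a) \<Rightarrow> bool" where
  "is_antipode K A S \<longleftrightarrow> S \<in> lin_map K A A \<and> (\<forall>a\<in>carrier A.
     tlift K A (\<lambda>x y. S x \<otimes>\<^bsub>A\<^esub> y) (comult A a) = counit A a \<odot>\<^bsub>A\<^esub> \<one>\<^bsub>A\<^esub> \<and>
     tlift K A (\<lambda>x y. x \<otimes>\<^bsub>A\<^esub> S y) (comult A a) = counit A a \<odot>\<^bsub>A\<^esub> \<one>\<^bsub>A\<^esub>)"

locale hopf_algebra =
  fixes K :: "('k, 'm) ring_scheme" and A :: "('k, 'a, 'c) hopf_scheme"
  assumes is_algebra: "k_algebra K A"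
    and is_coalgebra: "k_coalgebra K A"
    and comult_hom: "comult A \<in> alg_hom K A (tensor_alg K A A)"
    and counit_hom: "counit A \<in> alg_hom K A (ground K)"
    and antipode: "\<exists>S. is_antipode K A S"

definition hopf_hom ::
  "('k, 'm) ring_scheme \<Rightarrow> ('k, 'a, 'c) hopf_scheme \<Rightarrow> ('k, 'b, 'd) hopf_scheme \<Rightarrow> ('a \<Rightarrow> 'b) set"
  where
  "hopf_hom K A B = {f \<in> alg_hom K A B. \<forall>a\<in>carrier A.
     comult B (f a) = tlift K (tensor K B B) (\<lambda>x y. pt K B B (f x) (f y)) (comult A a) \<and>
     counit B (f a) = counit A a}"

definition group_algebra ::
  "('k, 'm) ring_scheme \<Rightarrow> ('g, 'n) monoid_scheme \<Rightarrow> ('k, 'g \<Rightarrow> 'k) hopf" where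
  "group_algebra K G = (let A = monoid_algebra K G in module.extend A
     (hopf.fields
       (\<lambda>f. \<Oplus>\<^bsub>tensor K A A\<^esub>g\<in>supp K f. f g \<odot>\<^bsub>tensor K A A\<^esub> pt K A A (single K g) (single K g))
       (\<lambda>f. \<Oplus>\<^bsub>K\<^esub>g\<in>supp K f. f g)))"

text \<open>
  The algebra of functions on a group \<open>G\<close> (finite, where it is used), functions being extended by
  zero outside \<open>carrier G\<close>. The tensor square of this algebra is identified with the functions on
  \<open>G \<times> G\<close>, so the coproduct of \<open>f\<close>, that is \<open>(g, h) \<mapsto> f (g h)\<close>, becomes
  \<open>\<Sum>\<^sub>g\<^sub>,\<^sub>h f (g h) \<delta>\<^sub>g \<otimes> \<delta>\<^sub>h\<close>. The delta functions are the functions \<open>single K g\<close>.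
\<close>

definition fun_alg ::
  "('k, 'm) ring_scheme \<Rightarrow> ('g, 'n) monoid_scheme \<Rightarrow> ('k, 'g \<Rightarrow> 'k) module" where
  "fun_alg K G =
     \<lparr>carrier = {f. range f \<subseteq> carrier K \<and> supp K f \<subseteq> carrier G},
      mult = (\<lambda>f f' g. f g \<otimes>\<^bsub>K\<^esub> f' g),
      one = (\<lambda>g. if g \<in> carrier G then \<one>\<^bsub>K\<^esub> else \<zero>\<^bsub>K\<^esub>),
      zero = (\<lambda>_. \<zero>\<^bsub>K\<^esub>), add = (\<lambda>f f' g. f g \<oplus>\<^bsub>K\<^esub> f' g),
      smult = (\<lambda>a f g. a \<otimes>\<^bsub>K\<^esub> f g)\<rparr>"

definition function_algebra ::
  "('k, 'm) ring_scheme \<Rightarrow> ('g, 'n) monoid_scheme \<Rightarrow> ('k, 'g \<Rightarrow> 'k) hopf" where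
  "function_algebra K G = (let A = fun_alg K G in module.extend A
     (hopf.fields
       (\<lambda>f. \<Oplus>\<^bsub>tensor K A A\<^esub>p\<in>carrier G \<times> carrier G.
              f (fst p \<otimes>\<^bsub>G\<^esub> snd p) \<odot>\<^bsub>tensor K A A\<^esub> pt K A A (single K (fst p)) (single K (snd p)))
       (\<lambda>f. f \<one>\<^bsub>G\<^esub>)))"

definition right_transl ::
  "('k, 'm) ring_scheme \<Rightarrow> ('g, 'n) monoid_scheme \<Rightarrow> 'g \<Rightarrow> ('g \<Rightarrow> 'k) \<Rightarrow> 'g \<Rightarrow> 'k" where
  "right_transl K G a f = (\<lambda>g. if g \<in> carrier G then f (g \<otimes>\<^bsub>G\<^esub> a) else \<zero>\<^bsub>K\<^esub>)"


section \<open>Left crossed modules, braided groups and biproduct bosonisation\<close>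

text \<open>
  A left coaction is written \<open>v \<mapsto> v\<^sup>1 \<otimes> v\<^sup>0\<close>, with \<open>v\<^sup>1\<close> in \<open>H\<close>. The compatibility condition reads
  \<open>h\<^sub>1 v\<^sup>1 \<otimes> h\<^sub>2.v\<^sup>0 = (h\<^sub>1.v)\<^sup>1 h\<^sub>2 \<otimes> (h\<^sub>1.v)\<^sup>0\<close>. For \<open>H = K G\<close> a coaction \<open>v \<mapsto> g \<otimes> v\<close> on the
  degree \<open>g\<close> part is a \<open>G\<close>-grading, and the condition says that \<open>h\<close> maps degree \<open>g\<close> to degree
  \<open>h g h\<^sup>-\<^sup>1\<close>.
\<close>

locale left_crossed_module =
  fixes K :: "('k, 'm) ring_scheme" and H :: "('k, 'h, 'c) hopf_scheme"
    and V :: "('k, 'a, 'd) module_scheme"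
    and act :: "'h \<Rightarrow> 'a \<Rightarrow> 'a" and coact :: "'a \<Rightarrow> ('h \<times> 'a \<Rightarrow> 'k) set"
  assumes is_module: "module K V"
    and act_linear_right: "h \<in> carrier H \<Longrightarrow> act h \<in> lin_map K V V"
    and act_linear_left: "v \<in> carrier V \<Longrightarrow> (\<lambda>h. act h v) \<in> lin_map K H V"
    and act_act: "\<lbrakk>h \<in> carrier H; h' \<in> carrier H; v \<in> carrier V\<rbrakk>
      \<Longrightarrow> act (h \<otimes>\<^bsub>H\<^esub> h') v = act h (act h' v)"
    and one_act: "v \<in> carrier V \<Longrightarrow> act \<one>\<^bsub>H\<^esub> v = v"
    and coact_linear: "coact \<in> lin_map K V (tensor K H V)"
    and coact_coact: "v \<in> carrier V \<Longrightarrow>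
      tlift K (tensor K H (tensor K H V)) (\<lambda>h w. pt K H (tensor K H V) h (coact w)) (coact v) =
      tlift K (tensor K H (tensor K H V)) (\<lambda>h w.
        tlift K (tensor K H (tensor K H V)) (\<lambda>h1 h2. pt K H (tensor K H V) h1 (pt K H V h2 w))
          (comult H h)) (coact v)"
    and counit_coact: "v \<in> carrier V \<Longrightarrow> tlift K V (\<lambda>h w. counit H h \<odot>\<^bsub>V\<^esub> w) (coact v) = v"
    and crossed: "\<lbrakk>h \<in> carrier H; v \<in> carrier V\<rbrakk> \<Longrightarrow>
      tlift K (tensor K H V) (\<lambda>h1 h2.
        tlift K (tensor K H V) (\<lambda>x w. pt K H V (h1 \<otimes>\<^bsub>H\<^esub> x) (act h2 w)) (coact v)) (comult H h) =
      tlift K (tensor K H V) (\<lambda>h1 h2.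
        tlift K (tensor K H V) (\<lambda>x w. pt K H V (x \<otimes>\<^bsub>H\<^esub> h2) w) (coact (act h1 v))) (comult H h)"

text \<open>\<open>\<Psi>(v \<otimes> w) = v\<^sup>1.w \<otimes> v\<^sup>0\<close>; for group gradings this is \<open>|v|.w \<otimes> v\<close>.\<close>

definition left_braiding ::
  "('k, 'm) ring_scheme \<Rightarrow> ('k, 'a, 'd) module_scheme \<Rightarrow> ('h \<Rightarrow> 'a \<Rightarrow> 'a)
    \<Rightarrow> ('a \<Rightarrow> ('h \<times> 'a \<Rightarrow> 'k) set) \<Rightarrow> 'a \<Rightarrow> 'a \<Rightarrow> ('a \<times> 'a \<Rightarrow> 'k) set" where
  "left_braiding K V act coact v w =
    tlift K (tensor K V V) (\<lambda>x v'. pt K V V (act x w) v') (coact v)"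

text \<open>
  A Hopf algebra in the braided category of left crossed \<open>H\<close>-modules: all structure maps are
  morphisms of the category, and the coproduct is multiplicative for the braided tensor product.
\<close>

locale left_braided_group =
  fixes K :: "('k, 'm) ring_scheme" and H :: "('k, 'h, 'c) hopf_scheme"
    and B :: "('k, 'a, 'd) hopf_scheme"
    and act :: "'h \<Rightarrow> 'a \<Rightarrow> 'a" and coact :: "'a \<Rightarrow> ('h \<times> 'a \<Rightarrow> 'k) set"
  assumes base_hopf: "hopf_algebra K H"
    and crossed_module: "left_crossed_module K H B act coact"
    and is_algebra: "k_algebra K B"
    and is_coalgebra: "k_coalgebra K B"
    and act_mult: "\<lbrakk>h \<in> carrier H; b \<in> carrier B; c \<in> carrier B\<rbrakk> \<Longrightarrow>
      act h (b \<otimes>\<^bsub>B\<^esub> c) = tlift K B (\<lambda>h1 h2. act h1 b \<otimes>\<^bsub>B\<^esub> act h2 c) (comult H h)"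
    and act_one: "h \<in> carrier H \<Longrightarrow> act h \<one>\<^bsub>B\<^esub> = counit H h \<odot>\<^bsub>B\<^esub> \<one>\<^bsub>B\<^esub>"
    and coact_hom: "coact \<in> alg_hom K B (tensor_alg K H B)"
    and act_comult: "\<lbrakk>h \<in> carrier H; b \<in> carrier B\<rbrakk> \<Longrightarrow>
      comult B (act h b) = tlift K (tensor K B B) (\<lambda>h1 h2.
        tlift K (tensor K B B) (\<lambda>b1 b2. pt K B B (act h1 b1) (act h2 b2)) (comult B b)) (comult H h)"
    and act_counit: "\<lbrakk>h \<in> carrier H; b \<in> carrier B\<rbrakk> \<Longrightarrow>
      counit B (act h b) = counit H h \<otimes>\<^bsub>K\<^esub> counit B b"
    and coact_comult: "b \<in> carrier B \<Longrightarrow>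
      tlift K (tensor K H (tensor K B B)) (\<lambda>x c. pt K H (tensor K B B) x (comult B c)) (coact b) =
      tlift K (tensor K H (tensor K B B)) (\<lambda>b1 b2.
        tlift K (tensor K H (tensor K B B)) (\<lambda>x1 c1.
          tlift K (tensor K H (tensor K B B)) (\<lambda>x2 c2.
            pt K H (tensor K B B) (x1 \<otimes>\<^bsub>H\<^esub> x2) (pt K B B c1 c2)) (coact b2)) (coact b1))
        (comult B b)"
    and coact_counit: "b \<in> carrier B \<Longrightarrow>
      tlift K H (\<lambda>x c. counit B c \<odot>\<^bsub>H\<^esub> x) (coact b) = counit B b \<odot>\<^bsub>H\<^esub> \<one>\<^bsub>H\<^esub>"
    and comult_hom: "comult B \<in> alg_hom K B (braided_square K B (left_braiding K B act coact))"
    and counit_hom: "counit B \<in> alg_hom K B (ground K)"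
    and antipode: "\<exists>S. is_antipode K B S \<and>
      (\<forall>h\<in>carrier H. \<forall>b\<in>carrier B. S (act h b) = act h (S b)) \<and>
      (\<forall>b\<in>carrier B. coact (S b) = tlift K (tensor K H B) (\<lambda>x c. pt K H B x (S c)) (coact b))"

text \<open>
  On \<open>B \<otimes> H\<close>: the cross product \<open>(b \<otimes> h)(c \<otimes> g) = b (h\<^sub>1.c) \<otimes> h\<^sub>2 g\<close> and the cross coproduct
  \<open>\<Delta>(b \<otimes> h) = (b\<^sub>1 \<otimes> b\<^sub>2\<^sup>1 h\<^sub>1) \<otimes> (b\<^sub>2\<^sup>0 \<otimes> h\<^sub>2)\<close>.
\<close>

definition left_biproduct ::
  "('k, 'm) ring_scheme \<Rightarrow> ('k, 'h, 'c) hopf_scheme \<Rightarrow> ('k, 'a, 'd) hopf_scheme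
    \<Rightarrow> ('h \<Rightarrow> 'a \<Rightarrow> 'a) \<Rightarrow> ('a \<Rightarrow> ('h \<times> 'a \<Rightarrow> 'k) set) \<Rightarrow> ('k, ('a \<times> 'h \<Rightarrow> 'k) set) hopf" where
  "left_biproduct K H B act coact = (let T = tensor K B H; TT = tensor K T T in module.extend
     (T\<lparr>mult := (\<lambda>s t. tlift K T (\<lambda>b h. tlift K T (\<lambda>c g.
                  tlift K T (\<lambda>h1 h2. pt K B H (b \<otimes>\<^bsub>B\<^esub> act h1 c) (h2 \<otimes>\<^bsub>H\<^esub> g)) (comult H h)) t) s),
        one := pt K B H \<one>\<^bsub>B\<^esub> \<one>\<^bsub>H\<^esub>\<rparr>)
     (hopf.fields
       (tlift K TT (\<lambda>b h. tlift K TT (\<lambda>b1 b2. tlift K TT (\<lambda>x c. tlift K TT (\<lambda>h1 h2.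
          pt K T T (pt K B H b1 (x \<otimes>\<^bsub>H\<^esub> h1)) (pt K B H c h2))
          (comult H h)) (coact b2)) (comult B b)))
       (tlift K (ground K) (\<lambda>b h. counit B b \<otimes>\<^bsub>K\<^esub> counit H h))))"


section \<open>Right crossed modules, braided groups and biproduct bosonisation\<close>

text \<open>
  A right coaction is written \<open>v \<mapsto> v\<^sup>0 \<otimes> v\<^sup>1\<close>, with \<open>v\<^sup>1\<close> in \<open>H\<close>; \<open>act v h\<close> is the right action
  \<open>v.h\<close>. The compatibility condition reads
  \<open>v\<^sup>0.h\<^sub>1 \<otimes> v\<^sup>1 h\<^sub>2 = (v.h\<^sub>2)\<^sup>0 \<otimes> h\<^sub>1 (v.h\<^sub>2)\<^sup>1\<close>.
\<close>

locale right_crossed_module =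
  fixes K :: "('k, 'm) ring_scheme" and H :: "('k, 'h, 'c) hopf_scheme"
    and V :: "('k, 'a, 'd) module_scheme"
    and act :: "'a \<Rightarrow> 'h \<Rightarrow> 'a" and coact :: "'a \<Rightarrow> ('a \<times> 'h \<Rightarrow> 'k) set"
  assumes is_module: "module K V"
    and act_linear_left: "h \<in> carrier H \<Longrightarrow> (\<lambda>v. act v h) \<in> lin_map K V V"
    and act_linear_right: "v \<in> carrier V \<Longrightarrow> act v \<in> lin_map K H V"
    and act_act: "\<lbrakk>h \<in> carrier H; h' \<in> carrier H; v \<in> carrier V\<rbrakk>
      \<Longrightarrow> act v (h \<otimes>\<^bsub>H\<^esub> h') = act (act v h) h'"
    and act_one: "v \<in> carrier V \<Longrightarrow> act v \<one>\<^bsub>H\<^esub> = v"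
    and coact_linear: "coact \<in> lin_map K V (tensor K V H)"
    and coact_coact: "v \<in> carrier V \<Longrightarrow>
      tlift K (tensor K (tensor K V H) H) (\<lambda>w h. pt K (tensor K V H) H (coact w) h) (coact v) =
      tlift K (tensor K (tensor K V H) H) (\<lambda>w h.
        tlift K (tensor K (tensor K V H) H) (\<lambda>h1 h2. pt K (tensor K V H) H (pt K V H w h1) h2)
          (comult H h)) (coact v)"
    and counit_coact: "v \<in> carrier V \<Longrightarrow> tlift K V (\<lambda>w h. counit H h \<odot>\<^bsub>V\<^esub> w) (coact v) = v"
    and crossed: "\<lbrakk>h \<in> carrier H; v \<in> carrier V\<rbrakk> \<Longrightarrow>
      tlift K (tensor K V H) (\<lambda>h1 h2.
        tlift K (tensor K V H) (\<lambda>w x. pt K V H (act w h1) (x \<otimes>\<^bsub>H\<^esub> h2)) (coact v)) (comult H h) =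
      tlift K (tensor K V H) (\<lambda>h1 h2.
        tlift K (tensor K V H) (\<lambda>w x. pt K V H w (h1 \<otimes>\<^bsub>H\<^esub> x)) (coact (act v h2))) (comult H h)"

text \<open>\<open>\<Psi>(v \<otimes> w) = w\<^sup>0 \<otimes> v.w\<^sup>1\<close>\<close>

definition right_braiding ::
  "('k, 'm) ring_scheme \<Rightarrow> ('k, 'a, 'd) module_scheme \<Rightarrow> ('a \<Rightarrow> 'h \<Rightarrow> 'a)
    \<Rightarrow> ('a \<Rightarrow> ('a \<times> 'h \<Rightarrow> 'k) set) \<Rightarrow> 'a \<Rightarrow> 'a \<Rightarrow> ('a \<times> 'a \<Rightarrow> 'k) set" where
  "right_braiding K V act coact v w =
    tlift K (tensor K V V) (\<lambda>w' x. pt K V V w' (act v x)) (coact w)"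

locale right_braided_group =
  fixes K :: "('k, 'm) ring_scheme" and H :: "('k, 'h, 'c) hopf_scheme"
    and B :: "('k, 'a, 'd) hopf_scheme"
    and act :: "'a \<Rightarrow> 'h \<Rightarrow> 'a" and coact :: "'a \<Rightarrow> ('a \<times> 'h \<Rightarrow> 'k) set"
  assumes base_hopf: "hopf_algebra K H"
    and crossed_module: "right_crossed_module K H B act coact"
    and is_algebra: "k_algebra K B"
    and is_coalgebra: "k_coalgebra K B"
    and act_mult: "\<lbrakk>h \<in> carrier H; b \<in> carrier B; c \<in> carrier B\<rbrakk> \<Longrightarrow>
      act (b \<otimes>\<^bsub>B\<^esub> c) h = tlift K B (\<lambda>h1 h2. act b h1 \<otimes>\<^bsub>B\<^esub> act c h2) (comult H h)"
    and act_unit: "h \<in> carrier H \<Longrightarrow> act \<one>\<^bsub>B\<^esub> h = counit H h \<odot>\<^bsub>B\<^esub> \<one>\<^bsub>B\<^esub>"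
    and coact_hom: "coact \<in> alg_hom K B (tensor_alg K B H)"
    and act_comult: "\<lbrakk>h \<in> carrier H; b \<in> carrier B\<rbrakk> \<Longrightarrow>
      comult B (act b h) = tlift K (tensor K B B) (\<lambda>h1 h2.
        tlift K (tensor K B B) (\<lambda>b1 b2. pt K B B (act b1 h1) (act b2 h2)) (comult B b)) (comult H h)"
    and act_counit: "\<lbrakk>h \<in> carrier H; b \<in> carrier B\<rbrakk> \<Longrightarrow>
      counit B (act b h) = counit B b \<otimes>\<^bsub>K\<^esub> counit H h"
    and coact_comult: "b \<in> carrier B \<Longrightarrow>
      tlift K (tensor K (tensor K B B) H) (\<lambda>c x. pt K (tensor K B B) H (comult B c) x) (coact b) =
      tlift K (tensor K (tensor K B B) H) (\<lambda>b1 b2.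
        tlift K (tensor K (tensor K B B) H) (\<lambda>c1 x1.
          tlift K (tensor K (tensor K B B) H) (\<lambda>c2 x2.
            pt K (tensor K B B) H (pt K B B c1 c2) (x1 \<otimes>\<^bsub>H\<^esub> x2)) (coact b2)) (coact b1))
        (comult B b)"
    and coact_counit: "b \<in> carrier B \<Longrightarrow>
      tlift K H (\<lambda>c x. counit B c \<odot>\<^bsub>H\<^esub> x) (coact b) = counit B b \<odot>\<^bsub>H\<^esub> \<one>\<^bsub>H\<^esub>"
    and comult_hom: "comult B \<in> alg_hom K B (braided_square K B (right_braiding K B act coact))"
    and counit_hom: "counit B \<in> alg_hom K B (ground K)"
    and antipode: "\<exists>S. is_antipode K B S \<and>
      (\<forall>h\<in>carrier H. \<forall>b\<in>carrier B. S (act b h) = act (S b) h) \<and>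
      (\<forall>b\<in>carrier B. coact (S b) = tlift K (tensor K B H) (\<lambda>c x. pt K B H (S c) x) (coact b))"

text \<open>
  On \<open>H \<otimes> B\<close>: the cross product \<open>(h \<otimes> b)(g \<otimes> c) = h g\<^sub>1 \<otimes> (b.g\<^sub>2) c\<close> and the cross coproduct
  \<open>\<Delta>(h \<otimes> b) = (h\<^sub>1 \<otimes> b\<^sub>1\<^sup>0) \<otimes> (h\<^sub>2 b\<^sub>1\<^sup>1 \<otimes> b\<^sub>2)\<close>.
\<close>

definition right_biproduct ::
  "('k, 'm) ring_scheme \<Rightarrow> ('k, 'h, 'c) hopf_scheme \<Rightarrow> ('k, 'a, 'd) hopf_scheme
    \<Rightarrow> ('a \<Rightarrow> 'h \<Rightarrow> 'a) \<Rightarrow> ('a \<Rightarrow> ('a \<times> 'h \<Rightarrow> 'k) set) \<Rightarrow> ('k, ('h \<times> 'a \<Rightarrow> 'k) set) hopf" where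
  "right_biproduct K H B act coact = (let T = tensor K H B; TT = tensor K T T in module.extend
     (T\<lparr>mult := (\<lambda>s t. tlift K T (\<lambda>h b. tlift K T (\<lambda>g c.
                  tlift K T (\<lambda>g1 g2. pt K H B (h \<otimes>\<^bsub>H\<^esub> g1) (act b g2 \<otimes>\<^bsub>B\<^esub> c)) (comult H g)) t) s),
        one := pt K H B \<one>\<^bsub>H\<^esub> \<one>\<^bsub>B\<^esub>\<rparr>)
     (hopf.fields
       (tlift K TT (\<lambda>h b. tlift K TT (\<lambda>b1 b2. tlift K TT (\<lambda>c x. tlift K TT (\<lambda>h1 h2.
          pt K T T (pt K H B h1 c) (pt K H B (h2 \<otimes>\<^bsub>H\<^esub> x) b2))
          (comult H h)) (coact b1)) (comult B b)))
       (tlift K (ground K) (\<lambda>h b. counit H h \<otimes>\<^bsub>K\<^esub> counit B b))))"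

text \<open>
  The equivalence between left \<open>K G\<close>-crossed modules and right \<open>K(G)\<close>-crossed modules for a finite
  group \<open>G\<close>, on objects: the coaction \<open>v \<mapsto> v\<^sup>1 \<otimes> v\<^sup>0\<close> of \<open>K G\<close> becomes the action
  \<open>v.f = \<langle>f, v\<^sup>1\<rangle> v\<^sup>0\<close> of \<open>K(G)\<close>, which is \<open>f(|v|) v\<close> for homogeneous \<open>v\<close>, and the action of
  \<open>K G\<close> becomes the coaction \<open>v \<mapsto> \<Sum>\<^sub>g g.v \<otimes> \<delta>\<^sub>g\<close>.
\<close>

definition dual_act ::
  "('k, 'm) ring_scheme \<Rightarrow> ('g, 'n) monoid_scheme \<Rightarrow> ('k, 'a, 'd) module_scheme
    \<Rightarrow> ('a \<Rightarrow> (('g \<Rightarrow> 'k) \<times> 'a \<Rightarrow> 'k) set) \<Rightarrow> 'a \<Rightarrow> ('g \<Rightarrow> 'k) \<Rightarrow> 'a" where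
  "dual_act K G V coact v f =
    tlift K V (\<lambda>x w. (\<Oplus>\<^bsub>K\<^esub>g\<in>carrier G. f g \<otimes>\<^bsub>K\<^esub> x g) \<odot>\<^bsub>V\<^esub> w) (coact v)"

definition dual_coact ::
  "('k, 'm) ring_scheme \<Rightarrow> ('g, 'n) monoid_scheme \<Rightarrow> ('k, 'a, 'd) module_scheme
    \<Rightarrow> (('g \<Rightarrow> 'k) \<Rightarrow> 'a \<Rightarrow> 'a) \<Rightarrow> 'a \<Rightarrow> ('a \<times> ('g \<Rightarrow> 'k) \<Rightarrow> 'k) set" where
  "dual_coact K G V act v =
    (\<Oplus>\<^bsub>tensor K V (function_algebra K G)\<^esub>g\<in>carrier G.
       pt K V (function_algebra K G) (act (single K g) v) (single K g))"


section \<open>The Fomin--Kirillov algebra\<close>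

definition fk_pairs :: "nat \<Rightarrow> (nat \<times> nat) set" where
  "fk_pairs N = {(i, j). i \<in> {1..N} \<and> j \<in> {1..N} \<and> i \<noteq> j}"

definition fk_rels :: "('k, 'm) ring_scheme \<Rightarrow> nat \<Rightarrow> ((nat \<times> nat) list \<Rightarrow> 'k) set" where
  "fk_rels K N = (let F = free_alg K (fk_pairs N); x = (\<lambda>i j. single K [(i, j)]) in
     {x i j \<oplus>\<^bsub>F\<^esub> x j i | i j. i \<in> {1..N} \<and> j \<in> {1..N} \<and> i \<noteq> j} \<union>
     {x i j \<otimes>\<^bsub>F\<^esub> x i j | i j. i \<in> {1..N} \<and> j \<in> {1..N} \<and> i \<noteq> j} \<union>
     {x i j \<otimes>\<^bsub>F\<^esub> x l m \<ominus>\<^bsub>F\<^esub> x l m \<otimes>\<^bsub>F\<^esub> x i j | i j l m.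
        {i, j, l, m} \<subseteq> {1..N} \<and> distinct [i, j, l, m]} \<union>
     {x i j \<otimes>\<^bsub>F\<^esub> x j l \<oplus>\<^bsub>F\<^esub> x j l \<otimes>\<^bsub>F\<^esub> x l i \<oplus>\<^bsub>F\<^esub> x l i \<otimes>\<^bsub>F\<^esub> x i j | i j l.
        {i, j, l} \<subseteq> {1..N} \<and> distinct [i, j, l]})"

type_synonym 'k fk = "((nat \<times> nat) list \<Rightarrow> 'k) set"

definition fk_alg :: "('k, 'm) ring_scheme \<Rightarrow> nat \<Rightarrow> ('k, 'k fk) module" where
  "fk_alg K N = (let F = free_alg K (fk_pairs N) in quot F (genideal F (fk_rels K N)))"

text \<open>The generator \<open>[ij]\<close>, for distinct \<open>i\<close> and \<open>j\<close> in \<open>{1..N}\<close>.\<close>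

definition fk_gen :: "('k, 'm) ring_scheme \<Rightarrow> nat \<Rightarrow> nat \<Rightarrow> nat \<Rightarrow> 'k fk" where
  "fk_gen K N i j = (let F = free_alg K (fk_pairs N)
     in genideal F (fk_rels K N) +>\<^bsub>F\<^esub> single K [(i, j)])"

text \<open>
  The algebra map out of the Fomin--Kirillov algebra with prescribed values on the generators. It is
  unique on the carrier; it exists when \<open>B\<close> is an algebra in which the values satisfy the relations.
\<close>

definition fk_hom ::
  "('k, 'm) ring_scheme \<Rightarrow> nat \<Rightarrow> ('k, 'b, 'd) module_scheme \<Rightarrow> (nat \<Rightarrow> nat \<Rightarrow> 'b) \<Rightarrow> 'k fk \<Rightarrow> 'b" where
  "fk_hom K N B \<phi> = (THE f. f \<in> extensional (carrier (fk_alg K N)) \<and> f \<in> alg_hom K (fk_alg K N) B \<and>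
     (\<forall>(i, j)\<in>fk_pairs N. f (fk_gen K N i j) = \<phi> i j))"

text \<open>The action of \<open>S\<^sub>N\<close> by algebra automorphisms, extended linearly to the group algebra.\<close>

definition fk_act :: "('k, 'm) ring_scheme \<Rightarrow> nat \<Rightarrow> ((nat \<Rightarrow> nat) \<Rightarrow> 'k) \<Rightarrow> 'k fk \<Rightarrow> 'k fk" where
  "fk_act K N h v = (\<Oplus>\<^bsub>fk_alg K N\<^esub>g\<in>carrier (sym_group N).
     h g \<odot>\<^bsub>fk_alg K N\<^esub> fk_hom K N (fk_alg K N) (\<lambda>i j. fk_gen K N (g i) (g j)) v)"

text \<open>
  The multiplicative \<open>S\<^sub>N\<close>-grading in which \<open>[ij]\<close> has degree the transposition \<open>(ij)\<close>, as a coaction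
  of the group algebra.
\<close>

definition fk_coact ::
  "('k, 'm) ring_scheme \<Rightarrow> nat \<Rightarrow> 'k fk \<Rightarrow> (((nat \<Rightarrow> nat) \<Rightarrow> 'k) \<times> 'k fk \<Rightarrow> 'k) set" where
  "fk_coact K N = (let H = group_algebra K (sym_group N); E = fk_alg K N in
     fk_hom K N (tensor_alg K H E)
       (\<lambda>i j. pt K H E (single K (transpose i j)) (fk_gen K N i j)))"

definition fk_comult :: "('k, 'm) ring_scheme \<Rightarrow> nat \<Rightarrow> 'k fk \<Rightarrow> ('k fk \<times> 'k fk \<Rightarrow> 'k) set" where
  "fk_comult K N = (let E = fk_alg K N in
     fk_hom K N (braided_square K E (left_braiding K E (fk_act K N) (fk_coact K N)))
       (\<lambda>i j. pt K E E (fk_gen K N i j) \<one>\<^bsub>E\<^esub> \<oplus>\<^bsub>tensor K E E\<^esub> pt K E E \<one>\<^bsub>E\<^esub> (fk_gen K N i j)))"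

definition fk :: "('k, 'm) ring_scheme \<Rightarrow> nat \<Rightarrow> ('k, 'k fk) hopf" where
  "fk K N = module.extend (fk_alg K N)
     (hopf.fields (fk_comult K N) (fk_hom K N (ground K) (\<lambda>i j. \<zero>\<^bsub>K\<^esub>)))"

end

theory Submission
  imports Defs
begin

text \<open>
  All identities are between linear maps, so they are checked on pure tensors of elements that are
  homogeneous for the grading by the symmetric group; there the braiding, the action and the
  coaction are explicit. The braided square and both bosonisations multiply by
  \<open>(v \<otimes> w)(v' \<otimes> w') = v s\<^sub>w(v') \<otimes> w w'\<close> for a family of endomorphisms \<open>s\<^sub>w\<close>, so one associativity argument
  covers all three. For the Fomin--Kirillov algebra the point is that its generators are primitive:
  if \<open>x\<close> is a generator of degree \<open>t\<close>, then left multiplication by \<open>x\<close> satisfies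
  \<open>\<Delta>(x c) = L\<^sub>x(\<Delta> c)\<close> with \<open>L\<^sub>x(a \<otimes> b) = x a \<otimes> b + (t.a) \<otimes> x b\<close>. Coassociativity, the counit laws,
  equivariance and the antipode laws therefore follow by induction on words. The antipode is the algebra
  map to the braided opposite that sends each generator to its negative. On the side of functions on
  the group, the delta functions serve as the basis.
\<close>

text \<open>Tensors are cosets of formal sums and \<open>tlift\<close> is a definite description, so
  nothing can be computed before the integrand is known to be bilinear; this explains the recurring
  blocks that split nested expressions by \<open>lins\<close> and its extensions. Degrees belong to
  words and not to their classes: \<open>Hm d\<close> is a spanning family closed under products and
  conjugation, while the coaction records the degree linearly. Action, coaction, coproduct and
  antipode exist by the universal property, that is, by checking the relations in four targets. The
  critical check is the three-term relation in the braided square, where the mixed terms cancel in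
  pairs because (ij) sends [jl] to [il] and [il] = -[li]. In both bosonisations the coproduct at a
  group element or function and b is a fixed linear map applied to \<open>comult E b\<close>, so the
  laws of E pass to them; where the comparison depends on degrees it is made only on tensors whose
  total degree is that of b. The two sides share one braiding, because v.\<delta>_g vanishes unless
  g is the degree of v.\<close>

lemma lin_mapI:
  assumes "\<And>x. x \<in> carrier V \<Longrightarrow> f x \<in> carrier W"
    and "\<And>x y. x \<in> carrier V \<Longrightarrow> y \<in> carrier V \<Longrightarrow> f (x \<oplus>\<^bsub>V\<^esub> y) = f x \<oplus>\<^bsub>W\<^esub> f y"
    and "\<And>a x. a \<in> carrier K \<Longrightarrow> x \<in> carrier V \<Longrightarrow> f (a \<odot>\<^bsub>V\<^esub> x) = a \<odot>\<^bsub>W\<^esub> f x"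
  shows "f \<in> lin_map K V W"
  using assms by (auto simp: lin_map_def)

lemma lin_map_closed: "f \<in> lin_map K V W \<Longrightarrow> x \<in> carrier V \<Longrightarrow> f x \<in> carrier W"
  by (auto simp: lin_map_def)

lemma lin_map_add: "f \<in> lin_map K V W \<Longrightarrow> x \<in> carrier V \<Longrightarrow> y \<in> carrier V \<Longrightarrow>
    f (x \<oplus>\<^bsub>V\<^esub> y) = f x \<oplus>\<^bsub>W\<^esub> f y"
  by (auto simp: lin_map_def)

lemma lin_map_smult: "f \<in> lin_map K V W \<Longrightarrow> a \<in> carrier K \<Longrightarrow> x \<in> carrier V \<Longrightarrow>
    f (a \<odot>\<^bsub>V\<^esub> x) = a \<odot>\<^bsub>W\<^esub> f x"
  by (auto simp: lin_map_def)

lemma module_closures: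
  assumes "module K V"
  shows "\<zero>\<^bsub>V\<^esub> \<in> carrier V"
    and "\<And>x y. x \<in> carrier V \<Longrightarrow> y \<in> carrier V \<Longrightarrow> x \<oplus>\<^bsub>V\<^esub> y \<in> carrier V"
    and "\<And>a x. a \<in> carrier K \<Longrightarrow> x \<in> carrier V \<Longrightarrow> a \<odot>\<^bsub>V\<^esub> x \<in> carrier V"
    and "\<And>x. x \<in> carrier V \<Longrightarrow> \<ominus>\<^bsub>V\<^esub> x \<in> carrier V"
    and "\<And>x y. x \<in> carrier V \<Longrightarrow> y \<in> carrier V \<Longrightarrow> x \<ominus>\<^bsub>V\<^esub> y \<in> carrier V"
proof -
  interpret module K V by fact
  show "\<zero>\<^bsub>V\<^esub> \<in> carrier V"
    and "\<And>x y. x \<in> carrier V \<Longrightarrow> y \<in> carrier V \<Longrightarrow> x \<oplus>\<^bsub>V\<^esub> y \<in> carrier V"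
    and "\<And>a x. a \<in> carrier K \<Longrightarrow> x \<in> carrier V \<Longrightarrow> a \<odot>\<^bsub>V\<^esub> x \<in> carrier V"
    and "\<And>x. x \<in> carrier V \<Longrightarrow> \<ominus>\<^bsub>V\<^esub> x \<in> carrier V"
    and "\<And>x y. x \<in> carrier V \<Longrightarrow> y \<in> carrier V \<Longrightarrow> x \<ominus>\<^bsub>V\<^esub> y \<in> carrier V"
    by auto
qed

text \<open>Additive inverses become scalar multiples, so linear maps and submodules respect them
  through their scalar law alone.\<close>

lemma module_minus_eq:
  assumes "module K V" "x \<in> carrier V"
  shows "\<ominus>\<^bsub>V\<^esub> x = (\<ominus>\<^bsub>K\<^esub> \<one>\<^bsub>K\<^esub>) \<odot>\<^bsub>V\<^esub> x"
proof -
  interpret module K V by fact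
  show ?thesis using assms(2) smult_l_minus[of "\<one>\<^bsub>K\<^esub>" x] by simp
qed

lemma lin_map_zero:
  assumes "f \<in> lin_map K V W" "module K V" "module K W"
  shows "f \<zero>\<^bsub>V\<^esub> = \<zero>\<^bsub>W\<^esub>"
proof -
  interpret V: module K V by fact
  interpret W: module K W by fact
  have "f (\<zero>\<^bsub>K\<^esub> \<odot>\<^bsub>V\<^esub> \<zero>\<^bsub>V\<^esub>) = \<zero>\<^bsub>K\<^esub> \<odot>\<^bsub>W\<^esub> f \<zero>\<^bsub>V\<^esub>"
    by (rule lin_map_smult[OF assms(1)]) auto
  thus ?thesis using lin_map_closed[OF assms(1)] by simp
qed

lemma lin_map_minus:
  assumes "f \<in> lin_map K V W" "module K V" "module K W" "x \<in> carrier V"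
  shows "f (\<ominus>\<^bsub>V\<^esub> x) = \<ominus>\<^bsub>W\<^esub> f x"
proof -
  interpret V: module K V by fact
  show ?thesis
    using module_minus_eq[OF assms(2,4)] module_minus_eq[OF assms(3) lin_map_closed[OF assms(1,4)]]
      lin_map_smult[OF assms(1) _ assms(4)] by simp
qed

lemma lin_map_diff:
  assumes "f \<in> lin_map K V W" "module K V" "module K W" "x \<in> carrier V" "y \<in> carrier V"
  shows "f (x \<ominus>\<^bsub>V\<^esub> y) = f x \<ominus>\<^bsub>W\<^esub> f y"
  using assms by (simp add: a_minus_def lin_map_add lin_map_minus module_closures)

lemma lin_map_finsum:
  assumes f: "f \<in> lin_map K V W" and V: "module K V" and W: "module K W"
    and A: "finite A" and g: "\<And>a. a \<in> A \<Longrightarrow> g a \<in> carrier V"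
  shows "f (\<Oplus>\<^bsub>V\<^esub>a\<in>A. g a) = (\<Oplus>\<^bsub>W\<^esub>a\<in>A. f (g a))"
proof -
  interpret V: module K V by fact
  interpret W: module K W by fact
  show ?thesis using A g
  proof (induction A rule: finite_induct)
    case empty
    then show ?case using lin_map_zero[OF f V W] by simp
  next
    case (insert a A)
    then have "g \<in> A \<rightarrow> carrier V" "(\<lambda>a. f (g a)) \<in> A \<rightarrow> carrier W" "f (g a) \<in> carrier W"
      using lin_map_closed[OF f] by auto
    then show ?case using insert lin_map_add[OF f] by simp
  qed
qed

lemma finsum_closedI: "module K V \<Longrightarrow> (\<And>a. a \<in> A \<Longrightarrow> g a \<in> carrier V) \<Longrightarrow> finsum V g A \<in> carrier V"
proof -
  assume "module K V" and *: "\<And>a. a \<in> A \<Longrightarrow> g a \<in> carrier V"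
  interpret module K V by fact
  show ?thesis using * by (auto intro: finsum_closed)
qed

lemma lin_id: "(\<lambda>x. x) \<in> lin_map K V V"
  by (auto simp: lin_map_def)

lemma lin_comp: "g \<in> lin_map K V W \<Longrightarrow> f \<in> lin_map K U V \<Longrightarrow> (\<lambda>x. g (f x)) \<in> lin_map K U W"
  by (auto simp: lin_map_def Pi_def)

lemma lin_zero: "module K W \<Longrightarrow> (\<lambda>x. \<zero>\<^bsub>W\<^esub>) \<in> lin_map K V W"
proof -
  assume "module K W"
  interpret module K W by fact
  show ?thesis by (auto simp: lin_map_def)
qed

lemma lin_add:
  assumes "module K V" "module K W" "f \<in> lin_map K V W" "g \<in> lin_map K V W"
  shows "(\<lambda>x. f x \<oplus>\<^bsub>W\<^esub> g x) \<in> lin_map K V W"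
proof -
  interpret V: module K V by fact
  interpret W: module K W by fact
  show ?thesis using assms(3,4)
    by (intro lin_mapI) (auto simp: lin_map_add lin_map_closed lin_map_smult W.a_ac W.smult_r_distr)
qed

lemma lin_smult:
  assumes "module K V" "module K W" "a \<in> carrier K" "f \<in> lin_map K V W"
  shows "(\<lambda>x. a \<odot>\<^bsub>W\<^esub> f x) \<in> lin_map K V W"
proof -
  interpret V: module K V by fact
  interpret W: module K W by fact
  show ?thesis
  proof (rule lin_mapI)
    fix c x assume "c \<in> carrier K" "x \<in> carrier V"
    then show "a \<odot>\<^bsub>W\<^esub> f (c \<odot>\<^bsub>V\<^esub> x) = c \<odot>\<^bsub>W\<^esub> (a \<odot>\<^bsub>W\<^esub> f x)"
      using assms(3) lin_map_closed[OF assms(4)] W.smult_assoc1[of a c "f x"] W.smult_assoc1[of c a "f x"]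
        V.R.m_comm[of a c] lin_map_smult[OF assms(4)] by simp
  qed (use assms(3,4) in \<open>auto simp: lin_map_add lin_map_closed W.smult_r_distr\<close>)
qed

lemma lin_finsum:
  assumes "module K V" "module K W" "finite A" "\<And>a. a \<in> A \<Longrightarrow> f a \<in> lin_map K V W"
  shows "(\<lambda>x. \<Oplus>\<^bsub>W\<^esub>a\<in>A. f a x) \<in> lin_map K V W"
proof -
  interpret V: module K V by fact
  interpret W: module K W by fact
  have cl: "f a x \<in> carrier W" if "a \<in> A" "x \<in> carrier V" for a x
    using lin_map_closed[OF assms(4)] that by simp
  show ?thesis
  proof (intro lin_mapI)
    fix x y assume xy: "x \<in> carrier V" "y \<in> carrier V"
    have "(\<Oplus>\<^bsub>W\<^esub>a\<in>A. f a (x \<oplus>\<^bsub>V\<^esub> y)) = (\<Oplus>\<^bsub>W\<^esub>a\<in>A. f a x \<oplus>\<^bsub>W\<^esub> f a y)"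
      by (rule W.finsum_cong') (use xy cl lin_map_add[OF assms(4)] in auto)
    also have "\<dots> = (\<Oplus>\<^bsub>W\<^esub>a\<in>A. f a x) \<oplus>\<^bsub>W\<^esub> (\<Oplus>\<^bsub>W\<^esub>a\<in>A. f a y)"
      by (rule W.finsum_addf) (use xy cl in auto)
    finally show "(\<Oplus>\<^bsub>W\<^esub>a\<in>A. f a (x \<oplus>\<^bsub>V\<^esub> y)) = (\<Oplus>\<^bsub>W\<^esub>a\<in>A. f a x) \<oplus>\<^bsub>W\<^esub> (\<Oplus>\<^bsub>W\<^esub>a\<in>A. f a y)" .
  next
    fix c x assume "c \<in> carrier K" "x \<in> carrier V"
    then show "(\<Oplus>\<^bsub>W\<^esub>a\<in>A. f a (c \<odot>\<^bsub>V\<^esub> x)) = c \<odot>\<^bsub>W\<^esub> (\<Oplus>\<^bsub>W\<^esub>a\<in>A. f a x)"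
      using cl assms(3,4)
      by (subst W.finsum_smult_ldistr) (auto intro!: W.finsum_cong' simp: lin_map_smult[OF assms(4)])
  qed (use cl in \<open>auto intro: W.finsum_closed\<close>)
qed

lemma ground_simps [simp]:
  "carrier (ground K) = carrier K" "mult (ground K) = mult K" "one (ground K) = one K"
  "zero (ground K) = zero K" "add (ground K) = add K" "smult (ground K) = mult K"
  by (auto simp: ground_def)

lemma lin_scal:
  assumes "module K V" "module K W" "k \<in> lin_map K V (ground K)" "w \<in> carrier W"
  shows "(\<lambda>x. k x \<odot>\<^bsub>W\<^esub> w) \<in> lin_map K V W"
proof -
  interpret V: module K V by fact
  interpret W: module K W by fact
  have "k x \<in> carrier K" if "x \<in> carrier V" for x
    using lin_map_closed[OF assms(3) that] by simp
  then show ?thesis using assms(4) lin_map_add[OF assms(3)] lin_map_smult[OF assms(3)]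
    by (intro lin_mapI) (auto simp: W.smult_l_distr W.smult_assoc1)
qed

text \<open>Membership in \<open>lin_map\<close> constrains only values on the carrier, and
  operations defined by records often agree with a convenient formula only there.\<close>

lemma lin_map_cong:
  assumes "f \<in> lin_map K V W" "\<And>x. x \<in> carrier V \<Longrightarrow> f x = g x" "module K V"
  shows "g \<in> lin_map K V W"
proof -
  interpret V: module K V by fact
  show ?thesis using assms(1) assms(2)[symmetric]
    by (intro lin_mapI) (auto simp: lin_map_closed lin_map_add lin_map_smult)
qed

subsection \<open>Linear spans\<close>

lemma submoduleI':
  assumes "module K V" "H \<subseteq> carrier V" "\<zero>\<^bsub>V\<^esub> \<in> H"
    "\<And>a b. a \<in> H \<Longrightarrow> b \<in> H \<Longrightarrow> a \<oplus>\<^bsub>V\<^esub> b \<in> H"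
    "\<And>a x. a \<in> carrier K \<Longrightarrow> x \<in> H \<Longrightarrow> a \<odot>\<^bsub>V\<^esub> x \<in> H"
  shows "submodule H K V"
proof -
  interpret V: module K V by fact
  show ?thesis
  proof (rule V.submoduleI)
    fix a assume "a \<in> H"
    then show "\<ominus>\<^bsub>V\<^esub> a \<in> H" using module_minus_eq[OF assms(1)] assms(2,5) by auto
  qed (use assms in auto)
qed

lemma submoduleD:
  assumes "module K V" "submodule H K V"
  shows "H \<subseteq> carrier V" "\<zero>\<^bsub>V\<^esub> \<in> H"
    "\<And>a b. a \<in> H \<Longrightarrow> b \<in> H \<Longrightarrow> a \<oplus>\<^bsub>V\<^esub> b \<in> H"
    "\<And>a x. a \<in> carrier K \<Longrightarrow> x \<in> H \<Longrightarrow> a \<odot>\<^bsub>V\<^esub> x \<in> H"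
    "\<And>a b. a \<in> H \<Longrightarrow> b \<in> H \<Longrightarrow> a \<ominus>\<^bsub>V\<^esub> b \<in> H"
proof -
  interpret V: module K V by fact
  show "H \<subseteq> carrier V"
    "\<And>a b. a \<in> H \<Longrightarrow> b \<in> H \<Longrightarrow> a \<oplus>\<^bsub>V\<^esub> b \<in> H"
    "\<And>a x. a \<in> carrier K \<Longrightarrow> x \<in> H \<Longrightarrow> a \<odot>\<^bsub>V\<^esub> x \<in> H"
    "\<And>a b. a \<in> H \<Longrightarrow> b \<in> H \<Longrightarrow> a \<ominus>\<^bsub>V\<^esub> b \<in> H"
    using V.submoduleE[OF assms(2)] by (auto simp: a_minus_def)
  interpret H: submodule H K V by fact
  show "\<zero>\<^bsub>V\<^esub> \<in> H" using H.one_closed by simp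
qed

lemma lin_span_superset: "S \<subseteq> lin_span K V S"
  by (auto simp: lin_span_def)

lemma lin_span_base: "s \<in> S \<Longrightarrow> s \<in> lin_span K V S"
  by (auto simp: lin_span_def)

lemma lin_span_least: "submodule U K V \<Longrightarrow> S \<subseteq> U \<Longrightarrow> lin_span K V S \<subseteq> U"
  by (auto simp: lin_span_def)

lemma submodule_lin_span:
  assumes "module K V" "S \<subseteq> carrier V"
  shows "submodule (lin_span K V S) K V"
proof -
  interpret V: module K V by fact
  show ?thesis
  proof (rule submoduleI'[OF assms(1)])
    show "lin_span K V S \<subseteq> carrier V"
      by (rule lin_span_least[OF V.carrier_is_submodule assms(2)])
  qed (auto simp: lin_span_def submoduleD[OF assms(1)])
qed

lemma lin_span_closed: "module K V \<Longrightarrow> S \<subseteq> carrier V \<Longrightarrow> lin_span K V S \<subseteq> carrier V"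
  using submodule_lin_span submoduleD(1) by blast

text \<open>The equaliser of two linear maps is a submodule. All later checks on generators or pure
  tensors rest on this.\<close>

lemma lin_span_eqI:
  assumes V: "module K V" and W: "module K W" and f: "f \<in> lin_map K V W" and g: "g \<in> lin_map K V W"
    and S: "S \<subseteq> carrier V" and eq: "\<And>s. s \<in> S \<Longrightarrow> f s = g s" and t: "t \<in> lin_span K V S"
  shows "f t = g t"
proof -
  interpret V: module K V by fact
  have "submodule {x \<in> carrier V. f x = g x} K V"
    by (rule submoduleI'[OF V])
      (use lin_map_zero[OF f V W] lin_map_zero[OF g V W] f g in \<open>auto simp: lin_map_add lin_map_smult\<close>)
  then have "lin_span K V S \<subseteq> {x \<in> carrier V. f x = g x}"
    by (rule lin_span_least) (use S eq in auto)
  with t show ?thesis by auto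
qed

text \<open>The preimage of a submodule is a submodule, so it contains a span as soon as it contains
  the generators.\<close>

lemma lin_map_lin_span:
  assumes V: "module K V" and W: "module K W" and f: "f \<in> lin_map K V W"
    and S: "S \<subseteq> carrier V" and U: "submodule U K W" and im: "\<And>s. s \<in> S \<Longrightarrow> f s \<in> U"
    and t: "t \<in> lin_span K V S"
  shows "f t \<in> U"
proof -
  interpret V: module K V by fact
  have "submodule {x \<in> carrier V. f x \<in> U} K V"
    by (rule submoduleI'[OF V])
      (use lin_map_zero[OF f V W] f submoduleD[OF W U] in \<open>auto simp: lin_map_add lin_map_smult\<close>)
  then have "lin_span K V S \<subseteq> {x \<in> carrier V. f x \<in> U}"
    by (rule lin_span_least) (use S im in auto)
  with t show ?thesis by auto
qed

lemma finsum_mem_submodule: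
  assumes V: "module K V" and U: "submodule U K V" and A: "finite A" and "\<And>a. a \<in> A \<Longrightarrow> g a \<in> U"
  shows "finsum V g A \<in> U"
proof -
  interpret V: module K V by fact
  note D = submoduleD[OF V U]
  show ?thesis using A assms(4)
  proof (induction A rule: finite_induct)
    case (insert a A)
    then have "g \<in> A \<rightarrow> carrier V" "g a \<in> carrier V" using D(1) by auto
    then show ?case using insert D by simp
  qed (use D in simp)
qed

subsection \<open>Free modules\<close>

text \<open>The linear extension of \<phi> from the basis. Its body is the expression inside
  \<open>tlift\<close>, with pairs as basis, so that the value of \<open>tlift\<close> on a coset is
  \<open>free_lift\<close> of a representative.\<close>

definition free_lift where
  "free_lift K Z \<phi> f = (\<Oplus>\<^bsub>Z\<^esub>x\<in>supp K f. f x \<odot>\<^bsub>Z\<^esub> \<phi> x)"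

lemma free_mod_simps [simp]:
  "zero (free_mod K X) = (\<lambda>_. \<zero>\<^bsub>K\<^esub>)"
  "add (free_mod K X) = (\<lambda>f g x. f x \<oplus>\<^bsub>K\<^esub> g x)"
  "smult (free_mod K X) = (\<lambda>a f x. a \<otimes>\<^bsub>K\<^esub> f x)"
  by (auto simp: free_mod_def)

lemma free_mod_carrier:
  "f \<in> carrier (free_mod K X) \<longleftrightarrow> (\<forall>x. f x \<in> carrier K) \<and> finite (supp K f) \<and> supp K f \<subseteq> X"
  by (auto simp: free_mod_def)

lemma module_function_space:
  assumes "cring K" and zero: "zero V = (\<lambda>_. \<zero>\<^bsub>K\<^esub>)" and add: "add V = (\<lambda>f g x. f x \<oplus>\<^bsub>K\<^esub> g x)"
    and smult: "smult V = (\<lambda>a f x. a \<otimes>\<^bsub>K\<^esub> f x)"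
    and car: "\<And>f x. f \<in> carrier V \<Longrightarrow> f x \<in> carrier K"
    and z: "(\<lambda>_. \<zero>\<^bsub>K\<^esub>) \<in> carrier V"
    and a: "\<And>f g. f \<in> carrier V \<Longrightarrow> g \<in> carrier V \<Longrightarrow> (\<lambda>x. f x \<oplus>\<^bsub>K\<^esub> g x) \<in> carrier V"
    and s: "\<And>c f. c \<in> carrier K \<Longrightarrow> f \<in> carrier V \<Longrightarrow> (\<lambda>x. c \<otimes>\<^bsub>K\<^esub> f x) \<in> carrier V"
  shows "module K V"
proof -
  interpret K: cring K by fact
  show ?thesis
  proof (rule moduleI)
    show "abelian_group V"
    proof (rule abelian_groupI)
      fix f assume f: "f \<in> carrier V"
      then have "(\<lambda>x. (\<ominus>\<^bsub>K\<^esub> \<one>\<^bsub>K\<^esub>) \<otimes>\<^bsub>K\<^esub> f x) \<in> carrier V" by (intro s) auto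
      moreover have "(\<lambda>x. (\<ominus>\<^bsub>K\<^esub> \<one>\<^bsub>K\<^esub>) \<otimes>\<^bsub>K\<^esub> f x) \<oplus>\<^bsub>V\<^esub> f = \<zero>\<^bsub>V\<^esub>"
        using car[OF f] by (auto simp: zero add K.l_minus K.l_neg)
      ultimately show "\<exists>g\<in>carrier V. g \<oplus>\<^bsub>V\<^esub> f = \<zero>\<^bsub>V\<^esub>" by blast
    qed (use car in \<open>auto simp: zero add z a K.a_ac fun_eq_iff\<close>)
  qed (use car in \<open>auto simp: zero add smult s K.l_distr K.r_distr K.m_assoc fun_eq_iff assms(1)\<close>)
qed

lemma finsum_apply:
  assumes "cring K" and zero: "zero V = (\<lambda>_. \<zero>\<^bsub>K\<^esub>)" and add: "add V = (\<lambda>f g x. f x \<oplus>\<^bsub>K\<^esub> g x)"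
    and V: "module K V"
    and car: "\<And>f x. f \<in> carrier V \<Longrightarrow> f x \<in> carrier K"
    and A: "finite A" and g: "\<And>a. a \<in> A \<Longrightarrow> g a \<in> carrier V"
  shows "finsum V g A x = (\<Oplus>\<^bsub>K\<^esub>a\<in>A. g a x)"
proof -
  interpret K: cring K by fact
  interpret V: module K V by fact
  show ?thesis using A g
  proof (induction A rule: finite_induct)
    case (insert a A)
    then have "g \<in> A \<rightarrow> carrier V" "g a \<in> carrier V" "(\<lambda>a. g a x) \<in> A \<rightarrow> carrier K" using car by auto
    then show ?case using insert car by (simp add: add)
  qed (simp add: zero)
qed

locale kvect =
  fixes K :: "('k, 'm) ring_scheme"
  assumes field_K: "field K"

sublocale kvect \<subseteq> K: field K
  by (rule field_K)

context kvect
begin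

lemma cring_K: "cring K" by unfold_locales

lemma module_ground: "module K (ground K)"
  by (rule moduleI[OF cring_K]) (auto simp: K.l_distr K.r_distr K.m_assoc K.a_ac K.l_neg intro!: abelian_groupI K.add.l_inv_ex)

lemma supp_single: "supp K (single K x) = {x}"
  by (auto simp: supp_def single_def)

lemma single_closed [simp]: "x \<in> X \<Longrightarrow> single K x \<in> carrier (free_mod K X)"
  unfolding free_mod_carrier supp_single by (auto simp: single_def)

lemma supp_add: "supp K (\<lambda>x. f x \<oplus>\<^bsub>K\<^esub> g x) \<subseteq> supp K f \<union> supp K g"
  by (auto simp: supp_def)

lemma supp_mult: "c \<in> carrier K \<Longrightarrow> supp K (\<lambda>x. c \<otimes>\<^bsub>K\<^esub> f x) \<subseteq> supp K f"
  by (auto simp: supp_def)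

lemma module_free_mod: "module K (free_mod K X)"
proof (rule module_function_space[OF cring_K])
  fix f g assume "f \<in> carrier (free_mod K X)" "g \<in> carrier (free_mod K X)"
  then show "(\<lambda>x. f x \<oplus>\<^bsub>K\<^esub> g x) \<in> carrier (free_mod K X)"
    using supp_add[of f g] finite_subset[of "supp K (\<lambda>x. f x \<oplus>\<^bsub>K\<^esub> g x)" "supp K f \<union> supp K g"]
    by (auto simp: free_mod_carrier)
next
  fix c f assume "c \<in> carrier K" "f \<in> carrier (free_mod K X)"
  then show "(\<lambda>x. c \<otimes>\<^bsub>K\<^esub> f x) \<in> carrier (free_mod K X)"
    using supp_mult[of c f] finite_subset[of "supp K (\<lambda>x. c \<otimes>\<^bsub>K\<^esub> f x)" "supp K f"]
    by (auto simp: free_mod_carrier)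
qed (auto simp: free_mod_carrier supp_def)

text \<open>Additivity compares sums over the supports of f, g and their sum, and supports may
  shrink under cancellation. Padding with zero terms moves all three to one index set.\<close>

lemma free_lift_superset:
  assumes "module K Z" "f \<in> carrier (free_mod K X)" "\<phi> \<in> A \<rightarrow> carrier Z" "finite A" "supp K f \<subseteq> A"
  shows "free_lift K Z \<phi> f = (\<Oplus>\<^bsub>Z\<^esub>x\<in>A. f x \<odot>\<^bsub>Z\<^esub> \<phi> x)"
proof -
  interpret Z: module K Z by fact
  show ?thesis unfolding free_lift_def
  proof (rule Z.add.finprod_mono_neutral_cong_left)
    fix x assume x: "x \<in> A - supp K f"
    then have "\<phi> x \<in> carrier Z" "f x = \<zero>\<^bsub>K\<^esub>" using assms(3) by (auto simp: supp_def)
    then show "f x \<odot>\<^bsub>Z\<^esub> \<phi> x = \<zero>\<^bsub>Z\<^esub>" by simp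
  qed (use assms in \<open>auto simp: free_mod_carrier\<close>)
qed

lemma free_lift_lin:
  assumes Z: "module K Z" and \<phi>: "\<phi> \<in> X \<rightarrow> carrier Z"
  shows "free_lift K Z \<phi> \<in> lin_map K (free_mod K X) Z"
proof -
  interpret Z: module K Z by fact
  interpret F: module K "free_mod K X" by (rule module_free_mod)
  have cl: "f x \<odot>\<^bsub>Z\<^esub> \<phi> x \<in> carrier Z" if "f \<in> carrier (free_mod K X)" "x \<in> X" for f x
    using that \<phi> by (auto simp: free_mod_carrier)
  show ?thesis
  proof (rule lin_mapI)
    fix f assume f: "f \<in> carrier (free_mod K X)"
    then show "free_lift K Z \<phi> f \<in> carrier Z"
      unfolding free_lift_def using cl[OF f] by (auto intro!: Z.finsum_closed simp: free_mod_carrier)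
  next
    fix f g assume f: "f \<in> carrier (free_mod K X)" and g: "g \<in> carrier (free_mod K X)"
    let ?A = "supp K f \<union> supp K g"
    have A: "finite ?A" "?A \<subseteq> X" "supp K (f \<oplus>\<^bsub>free_mod K X\<^esub> g) \<subseteq> ?A" "\<phi> \<in> ?A \<rightarrow> carrier Z"
      using f g \<phi> by (auto simp: free_mod_carrier supp_def)
    have mem: "\<And>x. x \<in> ?A \<Longrightarrow> \<phi> x \<in> carrier Z" "\<And>x. f x \<in> carrier K" "\<And>x. g x \<in> carrier K"
      using A f g by (auto simp: free_mod_carrier)
    have "free_lift K Z \<phi> (f \<oplus>\<^bsub>free_mod K X\<^esub> g)
        = (\<Oplus>\<^bsub>Z\<^esub>x\<in>?A. (f \<oplus>\<^bsub>free_mod K X\<^esub> g) x \<odot>\<^bsub>Z\<^esub> \<phi> x)"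
      by (rule free_lift_superset[OF Z F.a_closed[OF f g] A(4,1,3)])
    also have "\<dots> = (\<Oplus>\<^bsub>Z\<^esub>x\<in>?A. f x \<odot>\<^bsub>Z\<^esub> \<phi> x \<oplus>\<^bsub>Z\<^esub> g x \<odot>\<^bsub>Z\<^esub> \<phi> x)"
      by (rule Z.finsum_cong') (use mem in \<open>auto intro!: Z.smult_l_distr\<close>)
    also have "\<dots> = (\<Oplus>\<^bsub>Z\<^esub>x\<in>?A. f x \<odot>\<^bsub>Z\<^esub> \<phi> x) \<oplus>\<^bsub>Z\<^esub> (\<Oplus>\<^bsub>Z\<^esub>x\<in>?A. g x \<odot>\<^bsub>Z\<^esub> \<phi> x)"
      by (rule Z.finsum_addf) (use mem in auto)
    also have "\<dots> = free_lift K Z \<phi> f \<oplus>\<^bsub>Z\<^esub> free_lift K Z \<phi> g"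
      by (simp only: free_lift_superset[OF Z f A(4,1)] free_lift_superset[OF Z g A(4,1)] Un_upper1 Un_upper2)
    finally show "free_lift K Z \<phi> (f \<oplus>\<^bsub>free_mod K X\<^esub> g) = free_lift K Z \<phi> f \<oplus>\<^bsub>Z\<^esub> free_lift K Z \<phi> g" .
  next
    fix c f assume c: "c \<in> carrier K" and f: "f \<in> carrier (free_mod K X)"
    have A: "finite (supp K f)" "supp K f \<subseteq> X" "supp K (c \<odot>\<^bsub>free_mod K X\<^esub> f) \<subseteq> supp K f" "\<phi> \<in> supp K f \<rightarrow> carrier Z"
      using f c \<phi> by (auto simp: free_mod_carrier supp_def)
    have mem: "\<And>x. x \<in> supp K f \<Longrightarrow> \<phi> x \<in> carrier Z" "\<And>x. f x \<in> carrier K"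
      using A f by (auto simp: free_mod_carrier)
    have "free_lift K Z \<phi> (c \<odot>\<^bsub>free_mod K X\<^esub> f)
        = (\<Oplus>\<^bsub>Z\<^esub>x\<in>supp K f. (c \<odot>\<^bsub>free_mod K X\<^esub> f) x \<odot>\<^bsub>Z\<^esub> \<phi> x)"
      by (rule free_lift_superset[OF Z F.smult_closed[OF c f] A(4,1,3)])
    also have "\<dots> = (\<Oplus>\<^bsub>Z\<^esub>x\<in>supp K f. c \<odot>\<^bsub>Z\<^esub> (f x \<odot>\<^bsub>Z\<^esub> \<phi> x))"
      by (rule Z.finsum_cong') (use mem c in \<open>auto intro!: Z.smult_assoc1\<close>)
    also have "\<dots> = c \<odot>\<^bsub>Z\<^esub> free_lift K Z \<phi> f"
      unfolding free_lift_def by (rule Z.finsum_smult_ldistr[symmetric]) (use A mem c in auto)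
    finally show "free_lift K Z \<phi> (c \<odot>\<^bsub>free_mod K X\<^esub> f) = c \<odot>\<^bsub>Z\<^esub> free_lift K Z \<phi> f" .
  qed
qed

lemma free_lift_single:
  assumes Z: "module K Z" and "\<phi> x \<in> carrier Z"
  shows "free_lift K Z \<phi> (single K x) = \<phi> x"
proof -
  interpret Z: module K Z by fact
  show ?thesis unfolding free_lift_def supp_single using assms by (simp add: single_def)
qed

lemma free_mod_expand:
  assumes f: "f \<in> carrier (free_mod K X)"
  shows "f = (\<Oplus>\<^bsub>free_mod K X\<^esub>x\<in>supp K f. f x \<odot>\<^bsub>free_mod K X\<^esub> single K x)"
proof
  interpret F: module K "free_mod K X" by (rule module_free_mod)
  fix y
  have fK: "f x \<in> carrier K" for x using f by (auto simp: free_mod_carrier)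
  have smc: "f x \<odot>\<^bsub>free_mod K X\<^esub> single K x \<in> carrier (free_mod K X)" if "x \<in> supp K f" for x
    using f that by (intro F.smult_closed fK single_closed) (auto simp: free_mod_carrier)
  have gK: "\<And>g x. g \<in> carrier (free_mod K X) \<Longrightarrow> g x \<in> carrier K" by (auto simp: free_mod_carrier)
  have "(\<Oplus>\<^bsub>free_mod K X\<^esub>x\<in>supp K f. f x \<odot>\<^bsub>free_mod K X\<^esub> single K x) y
      = (\<Oplus>\<^bsub>K\<^esub>x\<in>supp K f. (f x \<odot>\<^bsub>free_mod K X\<^esub> single K x) y)"
    by (rule finsum_apply[OF cring_K _ _ module_free_mod])
      (use f smc gK in \<open>auto simp del: free_mod_simps(3), auto simp: free_mod_carrier\<close>)
  also have "\<dots> = (\<Oplus>\<^bsub>K\<^esub>x\<in>supp K f. if y = x then f x else \<zero>\<^bsub>K\<^esub>)"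
    by (rule K.finsum_cong') (use fK in \<open>auto simp: single_def\<close>)
  also have "\<dots> = f y"
  proof (cases "y \<in> supp K f")
    case True
    then show ?thesis using f fK K.finsum_singleton[of y "supp K f" f]
      by (auto simp: free_mod_carrier)
  next
    case False
    then have "(\<Oplus>\<^bsub>K\<^esub>x\<in>supp K f. if y = x then f x else \<zero>\<^bsub>K\<^esub>) = (\<Oplus>\<^bsub>K\<^esub>x\<in>supp K f. \<zero>\<^bsub>K\<^esub>)"
      by (intro K.finsum_cong') auto
    with False show ?thesis by (simp add: supp_def)
  qed
  finally show "f y = (\<Oplus>\<^bsub>free_mod K X\<^esub>x\<in>supp K f. f x \<odot>\<^bsub>free_mod K X\<^esub> single K x) y" by simp
qed

lemma free_mod_span: "lin_span K (free_mod K X) (single K ` X) = carrier (free_mod K X)"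
proof
  interpret F: module K "free_mod K X" by (rule module_free_mod)
  have sub: "submodule (lin_span K (free_mod K X) (single K ` X)) K (free_mod K X)"
    by (rule submodule_lin_span[OF module_free_mod]) auto
  then show "lin_span K (free_mod K X) (single K ` X) \<subseteq> carrier (free_mod K X)"
    by (rule submoduleD(1)[OF module_free_mod])
  show "carrier (free_mod K X) \<subseteq> lin_span K (free_mod K X) (single K ` X)"
  proof
    fix f assume f: "f \<in> carrier (free_mod K X)"
    have "f x \<odot>\<^bsub>free_mod K X\<^esub> single K x \<in> lin_span K (free_mod K X) (single K ` X)" if "x \<in> supp K f" for x
      using f that by (intro submoduleD(4)[OF module_free_mod sub] lin_span_base) (auto simp: free_mod_carrier)
    then show "f \<in> lin_span K (free_mod K X) (single K ` X)"
      using f by (subst free_mod_expand[OF f], intro finsum_mem_submodule[OF module_free_mod sub])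
        (auto simp: free_mod_carrier)
  qed
qed

end

subsection \<open>Quotients and tensor products\<close>

text \<open>Fixing one argument leaves an ordinary member of \<open>lin_map\<close>, which is the
  form that the introduction rules for linearity can split further.\<close>

definition bilin where
  "bilin K V W Z = {\<phi>. (\<forall>w\<in>carrier W. (\<lambda>v. \<phi> v w) \<in> lin_map K V Z) \<and>
                      (\<forall>v\<in>carrier V. (\<lambda>w. \<phi> v w) \<in> lin_map K W Z)}"

lemma module_diff_zero:
  assumes "module K Z" "x \<ominus>\<^bsub>Z\<^esub> y = \<zero>\<^bsub>Z\<^esub>" "x \<in> carrier Z" "y \<in> carrier Z"
  shows "x = y"
proof -
  interpret Z: module K Z by fact
  have "x = (x \<ominus>\<^bsub>Z\<^esub> y) \<oplus>\<^bsub>Z\<^esub> y" using assms(3,4) by (simp add: a_minus_def Z.a_assoc Z.l_neg)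
  with assms(2,4) show ?thesis by simp
qed

lemma bilinI:
  assumes "\<And>w. w \<in> carrier W \<Longrightarrow> (\<lambda>v. \<phi> v w) \<in> lin_map K V Z"
    and "\<And>v. v \<in> carrier V \<Longrightarrow> (\<lambda>w. \<phi> v w) \<in> lin_map K W Z"
  shows "\<phi> \<in> bilin K V W Z"
  using assms by (auto simp: bilin_def)

lemma bilin_left: "\<phi> \<in> bilin K V W Z \<Longrightarrow> w \<in> carrier W \<Longrightarrow> (\<lambda>v. \<phi> v w) \<in> lin_map K V Z"
  by (auto simp: bilin_def)

lemma bilin_right: "\<phi> \<in> bilin K V W Z \<Longrightarrow> v \<in> carrier V \<Longrightarrow> (\<lambda>w. \<phi> v w) \<in> lin_map K W Z"
  by (auto simp: bilin_def)

lemma bilin_closed: "\<phi> \<in> bilin K V W Z \<Longrightarrow> v \<in> carrier V \<Longrightarrow> w \<in> carrier W \<Longrightarrow> \<phi> v w \<in> carrier Z"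
  using lin_map_closed[OF bilin_right] .

lemma quot_simps [simp]:
  "carrier (quot V U) = a_rcosets\<^bsub>V\<^esub> U" "zero (quot V U) = U" "add (quot V U) = set_add V"
  "mult (quot V U) = rcoset_mult V U" "one (quot V U) = U +>\<^bsub>V\<^esub> \<one>\<^bsub>V\<^esub>"
  "smult (quot V U) = (\<lambda>a X. \<Union>x\<in>X. U +>\<^bsub>V\<^esub> (a \<odot>\<^bsub>V\<^esub> x))"
  by (auto simp: quot_def FactRing_def ring.defs module.defs)

locale quot_space =
  fixes K :: "('k, 'm) ring_scheme" and V :: "('k, 'a, 'c) module_scheme" and U
  assumes V: "module K V" and U: "submodule U K V"

sublocale quot_space \<subseteq> V: module K V by (rule V)

context quot_space
begin

lemma abelian_subgroup_U: "abelian_subgroup U V"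
  using U V.abelian_group_axioms by (intro abelian_subgroupI3 additive_subgroupI) (auto simp: submodule_def)

interpretation U: abelian_subgroup U V by (rule abelian_subgroup_U)

lemma quot_carrier: "carrier (quot V U) = (\<lambda>x. U +>\<^bsub>V\<^esub> x) ` carrier V"
  by (auto simp: A_RCOSETS_def')

lemma quot_add: "x \<in> carrier V \<Longrightarrow> y \<in> carrier V \<Longrightarrow>
    (U +>\<^bsub>V\<^esub> x) \<oplus>\<^bsub>quot V U\<^esub> (U +>\<^bsub>V\<^esub> y) = U +>\<^bsub>V\<^esub> (x \<oplus>\<^bsub>V\<^esub> y)"
  by (simp add: U.a_rcos_sum)

lemma quot_eq:
  assumes "x \<in> carrier V" "y \<in> carrier V"
  shows "U +>\<^bsub>V\<^esub> x = U +>\<^bsub>V\<^esub> y \<longleftrightarrow> x \<ominus>\<^bsub>V\<^esub> y \<in> U"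
proof
  assume "U +>\<^bsub>V\<^esub> x = U +>\<^bsub>V\<^esub> y"
  then have "x \<in> U +>\<^bsub>V\<^esub> y" using U.a_rcos_self[OF assms(1)] by simp
  then show "x \<ominus>\<^bsub>V\<^esub> y \<in> U" using U.a_rcos_module[OF assms(2,1)] by (simp add: a_minus_def)
next
  assume "x \<ominus>\<^bsub>V\<^esub> y \<in> U"
  then have "x \<in> U +>\<^bsub>V\<^esub> y" using U.a_rcos_module[OF assms(2,1)] by (simp add: a_minus_def)
  then show "U +>\<^bsub>V\<^esub> x = U +>\<^bsub>V\<^esub> y" using U.a_repr_independence'[OF _ assms(2)] by simp
qed

lemma quot_rep:
  assumes "x \<in> carrier V" "y \<in> U +>\<^bsub>V\<^esub> x"
  shows "y \<in> carrier V" "U +>\<^bsub>V\<^esub> y = U +>\<^bsub>V\<^esub> x"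
  using assms U.a_elemrcos_carrier U.a_repr_independence' by auto

lemma quot_self: "x \<in> carrier V \<Longrightarrow> x \<in> U +>\<^bsub>V\<^esub> x"
  by (rule U.a_rcos_self)

text \<open>The scalar action on a coset is a union over its representatives. Their multiples differ
  by elements of U, so all cosets in the union coincide, and the union is not empty.\<close>

lemma quot_smult:
  assumes "a \<in> carrier K" "x \<in> carrier V"
  shows "a \<odot>\<^bsub>quot V U\<^esub> (U +>\<^bsub>V\<^esub> x) = U +>\<^bsub>V\<^esub> (a \<odot>\<^bsub>V\<^esub> x)"
proof -
  have "U +>\<^bsub>V\<^esub> (a \<odot>\<^bsub>V\<^esub> y) = U +>\<^bsub>V\<^esub> (a \<odot>\<^bsub>V\<^esub> x)" if "y \<in> U +>\<^bsub>V\<^esub> x" for y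
  proof -
    have y: "y \<in> carrier V" "y \<ominus>\<^bsub>V\<^esub> x \<in> U"
      using quot_rep[OF assms(2) that] quot_eq[of y x] assms by auto
    have "a \<odot>\<^bsub>V\<^esub> y \<ominus>\<^bsub>V\<^esub> a \<odot>\<^bsub>V\<^esub> x = a \<odot>\<^bsub>V\<^esub> (y \<ominus>\<^bsub>V\<^esub> x)"
      using assms y by (simp add: a_minus_def V.smult_r_distr V.smult_r_minus)
    with submoduleD(4)[OF V U assms(1) y(2)] show ?thesis using quot_eq assms y by simp
  qed
  moreover have "U +>\<^bsub>V\<^esub> x \<noteq> {}" using quot_self[OF assms(2)] by auto
  ultimately have "(\<Union>y\<in>U +>\<^bsub>V\<^esub> x. U +>\<^bsub>V\<^esub> (a \<odot>\<^bsub>V\<^esub> y)) = (\<Union>y\<in>U +>\<^bsub>V\<^esub> x. U +>\<^bsub>V\<^esub> (a \<odot>\<^bsub>V\<^esub> x))"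
    by (intro SUP_cong) auto
  with \<open>U +>\<^bsub>V\<^esub> x \<noteq> {}\<close> show ?thesis by simp
qed

lemma quot_zero: "U = U +>\<^bsub>V\<^esub> \<zero>\<^bsub>V\<^esub>"
  using V.a_coset_add_zero[OF submoduleD(1)[OF V U]] by simp

lemma module_quot: "module K (quot V U)"
proof (rule moduleI)
  show "cring K" by unfold_locales
  have "\<exists>Y\<in>carrier (quot V U). Y \<oplus>\<^bsub>quot V U\<^esub> X = \<zero>\<^bsub>quot V U\<^esub>" if "X \<in> carrier (quot V U)" for X
  proof -
    obtain x where x: "x \<in> carrier V" "X = U +>\<^bsub>V\<^esub> x" using \<open>X \<in> _\<close> unfolding quot_carrier by blast
    have "(U +>\<^bsub>V\<^esub> (\<ominus>\<^bsub>V\<^esub> x)) \<oplus>\<^bsub>quot V U\<^esub> X = U"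
      using x quot_zero by (simp add: quot_add V.l_neg del: quot_simps)
    with x show ?thesis unfolding quot_carrier by auto
  qed
  moreover have "U \<oplus>\<^bsub>quot V U\<^esub> (U +>\<^bsub>V\<^esub> x) = U +>\<^bsub>V\<^esub> x" if "x \<in> carrier V" for x
    using quot_add[OF V.zero_closed that] quot_zero that by simp
  moreover have "U \<in> carrier (quot V U)" unfolding quot_carrier using quot_zero V.zero_closed by blast
  ultimately show "abelian_group (quot V U)"
    by (intro abelian_groupI)
      (auto simp: quot_carrier quot_add V.a_ac quot_simps(2) simp del: quot_simps(1,3,4,5,6))
qed (auto simp: quot_carrier quot_add quot_smult V.smult_l_distr V.smult_r_distr V.smult_assoc1 simp del: quot_simps)

lemma quot_proj_lin: "(\<lambda>x. U +>\<^bsub>V\<^esub> x) \<in> lin_map K V (quot V U)"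
  by (rule lin_mapI) (auto simp: quot_carrier quot_add quot_smult simp del: quot_simps)

end

declare quot_simps [simp del]

lemma lin_span_image:
  assumes V: "module K V" and W: "module K W" and f: "f \<in> lin_map K V W"
    and S: "S \<subseteq> carrier V" "lin_span K V S = carrier V" and im: "carrier W \<subseteq> f ` carrier V"
  shows "lin_span K W (f ` S) = carrier W"
proof -
  have fS: "f ` S \<subseteq> carrier W" using S lin_map_closed[OF f] by auto
  have "f t \<in> lin_span K W (f ` S)" if "t \<in> carrier V" for t
    by (rule lin_map_lin_span[OF V W f S(1) submodule_lin_span[OF W fS]])
      (use that S in \<open>auto intro: lin_span_base\<close>)
  with im lin_span_closed[OF W fS] show ?thesis by auto
qed

context kvect
begin

lemma tensor_rels_closed:
  assumes V: "module K V" and W: "module K W"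
  shows "tensor_rels K V W \<subseteq> carrier (free_mod K (carrier V \<times> carrier W))"
proof -
  interpret V: module K V by fact
  interpret W: module K W by fact
  interpret F: module K "free_mod K (carrier V \<times> carrier W)" by (rule module_free_mod)
  show ?thesis
    unfolding tensor_rels_def Let_def
    by (auto simp del: free_mod_simps intro!: F.minus_closed F.a_closed F.smult_closed single_closed)
qed

lemma quot_space_tensor:
  assumes V: "module K V" and W: "module K W"
  shows "quot_space K (free_mod K (carrier V \<times> carrier W))
    (lin_span K (free_mod K (carrier V \<times> carrier W)) (tensor_rels K V W))"
  by (intro quot_space.intro module_free_mod submodule_lin_span tensor_rels_closed assms)

lemma module_tensor:
  assumes V: "module K V" and W: "module K W"
  shows "module K (tensor K V W)"
  unfolding tensor_def Let_def by (rule quot_space.module_quot[OF quot_space_tensor[OF assms]])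

text \<open>The four families in \<open>tensor_rels\<close> are the differences whose vanishing in
  the quotient gives the two additivity and the two scalar laws.\<close>

lemma pt_bilin_aux:
  assumes V: "module K V" and W: "module K W"
  defines "F \<equiv> free_mod K (carrier V \<times> carrier W)"
  defines "T \<equiv> tensor K V W"
  shows pt_closed: "\<And>v w. v \<in> carrier V \<Longrightarrow> w \<in> carrier W \<Longrightarrow> pt K V W v w \<in> carrier T"
    and pt_add_left: "\<And>v v' w. v \<in> carrier V \<Longrightarrow> v' \<in> carrier V \<Longrightarrow> w \<in> carrier W \<Longrightarrow>
      pt K V W (v \<oplus>\<^bsub>V\<^esub> v') w = pt K V W v w \<oplus>\<^bsub>T\<^esub> pt K V W v' w"
    and pt_add_right: "\<And>v w w'. v \<in> carrier V \<Longrightarrow> w \<in> carrier W \<Longrightarrow> w' \<in> carrier W \<Longrightarrow>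
      pt K V W v (w \<oplus>\<^bsub>W\<^esub> w') = pt K V W v w \<oplus>\<^bsub>T\<^esub> pt K V W v w'"
    and pt_smult_left: "\<And>a v w. a \<in> carrier K \<Longrightarrow> v \<in> carrier V \<Longrightarrow> w \<in> carrier W \<Longrightarrow>
      pt K V W (a \<odot>\<^bsub>V\<^esub> v) w = a \<odot>\<^bsub>T\<^esub> pt K V W v w"
    and pt_smult_right: "\<And>a v w. a \<in> carrier K \<Longrightarrow> v \<in> carrier V \<Longrightarrow> w \<in> carrier W \<Longrightarrow>
      pt K V W v (a \<odot>\<^bsub>W\<^esub> w) = a \<odot>\<^bsub>T\<^esub> pt K V W v w"
proof -
  interpret V: module K V by fact
  interpret W: module K W by fact
  interpret F: module K F unfolding F_def by (rule module_free_mod)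
  let ?R = "tensor_rels K V W" and ?U = "lin_span K F (tensor_rels K V W)"
  interpret Q: quot_space K F ?U unfolding F_def by (rule quot_space_tensor[OF V W])
  have T: "T = quot F ?U" by (simp add: T_def F_def tensor_def Let_def)
  have pt: "pt K V W v w = ?U +>\<^bsub>F\<^esub> single K (v, w)" for v w by (simp add: pt_def F_def Let_def)
  have s: "single K (v, w) \<in> carrier F" if "v \<in> carrier V" "w \<in> carrier W" for v w
    using that by (simp add: F_def)
  have U1: "single K (v \<oplus>\<^bsub>V\<^esub> v', w) \<ominus>\<^bsub>F\<^esub> (single K (v, w) \<oplus>\<^bsub>F\<^esub> single K (v', w)) \<in> ?U"
    if "v \<in> carrier V" "v' \<in> carrier V" "w \<in> carrier W" for v v' w
    unfolding F_def by (rule lin_span_base, unfold tensor_rels_def Let_def) (use that in blast)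
  have U2: "single K (v, w \<oplus>\<^bsub>W\<^esub> w') \<ominus>\<^bsub>F\<^esub> (single K (v, w) \<oplus>\<^bsub>F\<^esub> single K (v, w')) \<in> ?U"
    if "v \<in> carrier V" "w \<in> carrier W" "w' \<in> carrier W" for v w w'
    unfolding F_def by (rule lin_span_base, unfold tensor_rels_def Let_def) (use that in blast)
  have U3: "single K (a \<odot>\<^bsub>V\<^esub> v, w) \<ominus>\<^bsub>F\<^esub> (a \<odot>\<^bsub>F\<^esub> single K (v, w)) \<in> ?U"
    if "a \<in> carrier K" "v \<in> carrier V" "w \<in> carrier W" for a v w
    unfolding F_def by (rule lin_span_base, unfold tensor_rels_def Let_def) (use that in blast)
  have U4: "single K (v, a \<odot>\<^bsub>W\<^esub> w) \<ominus>\<^bsub>F\<^esub> (a \<odot>\<^bsub>F\<^esub> single K (v, w)) \<in> ?U"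
    if "a \<in> carrier K" "v \<in> carrier V" "w \<in> carrier W" for a v w
    unfolding F_def by (rule lin_span_base, unfold tensor_rels_def Let_def) (use that in blast)
  show "pt K V W v w \<in> carrier T" if "v \<in> carrier V" "w \<in> carrier W" for v w
    unfolding T pt Q.quot_carrier using s that by blast
  show "pt K V W (v \<oplus>\<^bsub>V\<^esub> v') w = pt K V W v w \<oplus>\<^bsub>T\<^esub> pt K V W v' w"
    if "v \<in> carrier V" "v' \<in> carrier V" "w \<in> carrier W" for v v' w
    unfolding T pt using that s
    by (subst Q.quot_add, simp, simp, subst Q.quot_eq)
      (auto simp: U1)
  show "pt K V W v (w \<oplus>\<^bsub>W\<^esub> w') = pt K V W v w \<oplus>\<^bsub>T\<^esub> pt K V W v w'"
    if "v \<in> carrier V" "w \<in> carrier W" "w' \<in> carrier W" for v w w'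
    unfolding T pt using that s
    by (subst Q.quot_add, simp, simp, subst Q.quot_eq)
      (auto simp: U2)
  show "pt K V W (a \<odot>\<^bsub>V\<^esub> v) w = a \<odot>\<^bsub>T\<^esub> pt K V W v w"
    if "a \<in> carrier K" "v \<in> carrier V" "w \<in> carrier W" for a v w
    unfolding T pt using that s
    by (subst Q.quot_smult, simp, simp, subst Q.quot_eq)
      (auto simp: U3)
  show "pt K V W v (a \<odot>\<^bsub>W\<^esub> w) = a \<odot>\<^bsub>T\<^esub> pt K V W v w"
    if "a \<in> carrier K" "v \<in> carrier V" "w \<in> carrier W" for a v w
    unfolding T pt using that s
    by (subst Q.quot_smult, simp, simp, subst Q.quot_eq)
      (auto simp: U4)
qed

lemma pt_bilin:
  assumes "module K V" "module K W"
  shows "pt K V W \<in> bilin K V W (tensor K V W)"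
  by (intro bilinI lin_mapI)
    (auto simp: pt_closed pt_add_left pt_add_right pt_smult_left pt_smult_right assms)

lemma tensor_span_all:
  assumes V: "module K V" and W: "module K W"
  shows "lin_span K (tensor K V W) {pt K V W v w |v w. v \<in> carrier V \<and> w \<in> carrier W} = carrier (tensor K V W)"
proof -
  let ?F = "free_mod K (carrier V \<times> carrier W)"
  let ?U = "lin_span K ?F (tensor_rels K V W)"
  interpret Q: quot_space K ?F ?U by (rule quot_space_tensor[OF V W])
  have "lin_span K (quot ?F ?U) ((\<lambda>x. ?U +>\<^bsub>?F\<^esub> x) ` (single K ` (carrier V \<times> carrier W))) = carrier (quot ?F ?U)"
    by (rule lin_span_image[OF module_free_mod Q.module_quot Q.quot_proj_lin])
      (auto simp: free_mod_span Q.quot_carrier simp del: quot_simps)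
  moreover have "(\<lambda>x. ?U +>\<^bsub>?F\<^esub> x) ` (single K ` (carrier V \<times> carrier W)) =
      {pt K V W v w |v w. v \<in> carrier V \<and> w \<in> carrier W}"
    by (auto simp: pt_def Let_def image_iff)
  ultimately show ?thesis by (simp add: tensor_def Let_def)
qed

text \<open>The slots are relaxed one after the other: with a generator on the left the right slot
  extends to its span, and then the left slot follows.\<close>

lemma tensor_span:
  assumes V: "module K V" and W: "module K W" and SV: "SV \<subseteq> carrier V" "lin_span K V SV = carrier V"
    and SW: "SW \<subseteq> carrier W" "lin_span K W SW = carrier W"
  shows "lin_span K (tensor K V W) {pt K V W v w |v w. v \<in> SV \<and> w \<in> SW} = carrier (tensor K V W)"
proof -
  let ?T = "tensor K V W" and ?S = "{pt K V W v w |v w. v \<in> SV \<and> w \<in> SW}"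
  note T = module_tensor[OF V W]
  have S: "?S \<subseteq> carrier ?T" using SV SW pt_closed[OF V W] by blast
  note sub = submodule_lin_span[OF T S]
  have 1: "pt K V W v w \<in> lin_span K ?T ?S" if "v \<in> SV" "w \<in> carrier W" for v w
    by (rule lin_map_lin_span[OF W T bilin_right[OF pt_bilin[OF V W]] SW(1) sub])
      (use that SV SW in \<open>auto intro!: lin_span_base\<close>)
  have 2: "pt K V W v w \<in> lin_span K ?T ?S" if "v \<in> carrier V" "w \<in> carrier W" for v w
    by (rule lin_map_lin_span[OF V T bilin_left[OF pt_bilin[OF V W]] SV(1) sub])
      (use that SV SW 1 in auto)
  have "lin_span K ?T {pt K V W v w |v w. v \<in> carrier V \<and> w \<in> carrier W} \<subseteq> lin_span K ?T ?S"
    by (rule lin_span_least[OF sub]) (use 2 in auto)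
  then show ?thesis using lin_span_closed[OF T S] by (auto simp: tensor_span_all[OF V W])
qed

text \<open>The universal property of the tensor product. The definite description in
  \<open>tlift\<close> denotes because the linear extension to the free module kills
  \<open>tensor_rels\<close>, hence their span, and so is constant on cosets.\<close>

lemma tlift_pt_lin:
  assumes V: "module K V" and W: "module K W" and Z: "module K Z" and \<phi>: "\<phi> \<in> bilin K V W Z"
  shows tlift_lin: "tlift K Z \<phi> \<in> lin_map K (tensor K V W) Z"
    and tlift_pt: "\<And>v w. v \<in> carrier V \<Longrightarrow> w \<in> carrier W \<Longrightarrow> tlift K Z \<phi> (pt K V W v w) = \<phi> v w"
proof -
  interpret V: module K V by fact
  interpret W: module K W by fact
  interpret Z: module K Z by fact
  let ?F = "free_mod K (carrier V \<times> carrier W)"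
  interpret F: module K ?F by (rule module_free_mod)
  let ?R = "tensor_rels K V W" and ?U = "lin_span K ?F (tensor_rels K V W)"
  interpret Q: quot_space K ?F ?U by (rule quot_space_tensor[OF V W])
  let ?\<phi> = "\<lambda>p. \<phi> (fst p) (snd p)"
  let ?f = "free_lift K Z ?\<phi>"
  note cl = bilin_closed[OF \<phi>]
  have f: "?f \<in> lin_map K ?F Z" by (rule free_lift_lin[OF Z]) (use cl in auto)
  have s: "single K (v, w) \<in> carrier ?F" if "v \<in> carrier V" "w \<in> carrier W" for v w
    using that by simp
  have fs: "?f (single K (v, w)) = \<phi> v w" if "v \<in> carrier V" "w \<in> carrier W" for v w
    using free_lift_single[OF Z, of ?\<phi> "(v, w)"] that cl by simp
  have self: "x \<in> carrier Z \<Longrightarrow> x \<ominus>\<^bsub>Z\<^esub> x = \<zero>\<^bsub>Z\<^esub>" for x by (simp add: a_minus_def Z.r_neg)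
  have diff: "?f (x \<ominus>\<^bsub>?F\<^esub> y) = ?f x \<ominus>\<^bsub>Z\<^esub> ?f y" if "x \<in> carrier ?F" "y \<in> carrier ?F" for x y
    by (rule lin_map_diff[OF f module_free_mod Z that])
  have R0: "?f r = \<zero>\<^bsub>Z\<^esub>" if "r \<in> ?R" for r
    using that unfolding tensor_rels_def Let_def
    by (elim UnE CollectE exE conjE)
      (simp_all add: diff lin_map_add[OF f] lin_map_smult[OF f] fs self cl
        lin_map_add[OF bilin_left[OF \<phi>]] lin_map_add[OF bilin_right[OF \<phi>]]
        lin_map_smult[OF bilin_left[OF \<phi>]] lin_map_smult[OF bilin_right[OF \<phi>]]
        F.a_closed[simplified] F.smult_closed[simplified] del: free_mod_simps)
  have U0: "?f u = \<zero>\<^bsub>Z\<^esub>" if "u \<in> ?U" for u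
    by (rule lin_span_eqI[OF module_free_mod Z f lin_zero[OF Z] tensor_rels_closed[OF V W] R0 that])
  have wd: "?f x = ?f y" if "x \<in> carrier ?F" "y \<in> carrier ?F" "x \<ominus>\<^bsub>?F\<^esub> y \<in> ?U" for x y
  proof -
    have "?f x \<ominus>\<^bsub>Z\<^esub> ?f y = \<zero>\<^bsub>Z\<^esub>" using U0[OF that(3)] diff[OF that(1,2)] by metis
    then show ?thesis by (rule module_diff_zero[OF Z _ lin_map_closed[OF f that(1)] lin_map_closed[OF f that(2)]])
  qed
  have key: "tlift K Z \<phi> (?U +>\<^bsub>?F\<^esub> x) = ?f x" if "x \<in> carrier ?F" for x
    unfolding tlift_def free_lift_def[symmetric]
  proof (rule the_equality)
    show "\<exists>f\<in>?U +>\<^bsub>?F\<^esub> x. ?f x = ?f f" using Q.quot_self[OF that] by blast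
    fix u assume "\<exists>f\<in>?U +>\<^bsub>?F\<^esub> x. u = ?f f"
    then obtain y where y: "y \<in> ?U +>\<^bsub>?F\<^esub> x" "u = ?f y" by blast
    with Q.quot_rep[OF that y(1)] show "u = ?f x" using wd[of y x] Q.quot_eq[of y x] that by simp
  qed
  show "tlift K Z \<phi> (pt K V W v w) = \<phi> v w" if "v \<in> carrier V" "w \<in> carrier W" for v w
    using key[OF s[OF that]] fs[OF that] by (simp add: pt_def Let_def)
  show "tlift K Z \<phi> \<in> lin_map K (tensor K V W) Z"
    unfolding tensor_def Let_def
  proof (rule lin_mapI)
    fix X assume "X \<in> carrier (quot ?F ?U)"
    then show "tlift K Z \<phi> X \<in> carrier Z"
      using lin_map_closed[OF f] by (auto simp: Q.quot_carrier key simp del: quot_simps)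
  next
    fix X Y assume "X \<in> carrier (quot ?F ?U)" "Y \<in> carrier (quot ?F ?U)"
    then show "tlift K Z \<phi> (X \<oplus>\<^bsub>quot ?F ?U\<^esub> Y) = tlift K Z \<phi> X \<oplus>\<^bsub>Z\<^esub> tlift K Z \<phi> Y"
      using lin_map_add[OF f]
      by (auto simp: Q.quot_carrier Q.quot_add key F.a_closed simp del: quot_simps free_mod_simps)
  next
    fix a X assume "a \<in> carrier K" "X \<in> carrier (quot ?F ?U)"
    then show "tlift K Z \<phi> (a \<odot>\<^bsub>quot ?F ?U\<^esub> X) = a \<odot>\<^bsub>Z\<^esub> tlift K Z \<phi> X"
      using lin_map_smult[OF f]
      by (auto simp: Q.quot_carrier Q.quot_smult key F.smult_closed simp del: quot_simps free_mod_simps)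
  qed
qed

lemma tlift_closed:
  "\<lbrakk>t \<in> carrier (tensor K V W); module K V; module K W; module K Z; \<phi> \<in> bilin K V W Z\<rbrakk>
    \<Longrightarrow> tlift K Z \<phi> t \<in> carrier Z"
  by (rule lin_map_closed[OF tlift_lin])

lemma lin_pt1:
  "\<lbrakk>module K V; module K W; w \<in> carrier W; f \<in> lin_map K U V\<rbrakk> \<Longrightarrow>
    (\<lambda>x. pt K V W (f x) w) \<in> lin_map K U (tensor K V W)"
  by (rule lin_comp[OF bilin_left[OF pt_bilin]])

lemma lin_pt2:
  "\<lbrakk>module K V; module K W; v \<in> carrier V; f \<in> lin_map K U W\<rbrakk> \<Longrightarrow>
    (\<lambda>x. pt K V W v (f x)) \<in> lin_map K U (tensor K V W)"
  by (rule lin_comp[OF bilin_right[OF pt_bilin]])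

lemma lin_tlift1:
  "\<lbrakk>f \<in> lin_map K U (tensor K V W); module K V; module K W; module K Z; \<phi> \<in> bilin K V W Z\<rbrakk> \<Longrightarrow>
    (\<lambda>x. tlift K Z \<phi> (f x)) \<in> lin_map K U Z"
  by (rule lin_comp[OF tlift_lin])

lemma tensor_lin_eqI:
  assumes "t \<in> carrier (tensor K V W)"
    and V: "module K V" and W: "module K W" and Z: "module K Z"
    and f: "(\<lambda>t. f t) \<in> lin_map K (tensor K V W) Z" and g: "(\<lambda>t. g t) \<in> lin_map K (tensor K V W) Z"
    and eq: "\<And>v w. v \<in> carrier V \<Longrightarrow> w \<in> carrier W \<Longrightarrow> f (pt K V W v w) = g (pt K V W v w)"
  shows "f t = g t"
  by (rule lin_span_eqI[OF module_tensor[OF V W] Z f g,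
        where S = "{pt K V W v w |v w. v \<in> carrier V \<and> w \<in> carrier W}"])
    (use assms eq pt_closed[OF V W] tensor_span_all[OF V W] in auto)

text \<open>Both sides of each law are linear in the tensor t, so pure tensors decide. Iterated
  Sweedler sums need linearity in a parameter of the integrand as well as in the tensor, which is
  \<open>lin_tlift1\<close>.\<close>

lemma lin_tlift2:
  assumes t: "t \<in> carrier (tensor K V W)"
    and V: "module K V" and W: "module K W" and Z: "module K Z" and U: "module K U"
    and \<phi>: "\<And>x. x \<in> carrier U \<Longrightarrow> \<phi> x \<in> bilin K V W Z"
    and l: "\<And>v w. v \<in> carrier V \<Longrightarrow> w \<in> carrier W \<Longrightarrow> (\<lambda>x. \<phi> x v w) \<in> lin_map K U Z"
  shows "(\<lambda>x. tlift K Z (\<phi> x) t) \<in> lin_map K U Z"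
proof -
  interpret U: module K U by fact
  interpret Z: module K Z by fact
  note T = module_tensor[OF V W]
  note tl = tlift_lin[OF V W Z \<phi>] and tp = tlift_pt[OF V W Z \<phi>]
  show ?thesis
  proof (rule lin_mapI)
    fix x assume "x \<in> carrier U"
    then show "tlift K Z (\<phi> x) t \<in> carrier Z" using lin_map_closed[OF tl t] by simp
  next
    fix x y assume xy: "x \<in> carrier U" "y \<in> carrier U"
    show "tlift K Z (\<phi> (x \<oplus>\<^bsub>U\<^esub> y)) t = tlift K Z (\<phi> x) t \<oplus>\<^bsub>Z\<^esub> tlift K Z (\<phi> y) t"
      by (rule tensor_lin_eqI[OF t V W Z tl lin_add[OF T Z tl tl]])
        (use xy in \<open>auto simp: tp lin_map_add[OF l]\<close>)
  next
    fix a x assume xy: "a \<in> carrier K" "x \<in> carrier U"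
    show "tlift K Z (\<phi> (a \<odot>\<^bsub>U\<^esub> x)) t = a \<odot>\<^bsub>Z\<^esub> tlift K Z (\<phi> x) t"
      by (rule tensor_lin_eqI[OF t V W Z tl lin_smult[OF T Z xy(1) tl]])
        (use xy in \<open>auto simp: tp lin_map_smult[OF l]\<close>)
  qed
qed

end

text \<open>Rules that follow the syntax of a nested expression in \<open>pt\<close>,
  \<open>tlift\<close>, products and sums down to its variable. Bilinearity of an explicit formula
  is then settled by applying them repeatedly; the later collections extend this one by the
  structure maps at hand.\<close>

named_theorems lins

lemma finsum_prod:
  assumes Z: "module K Z" and A: "finite A" and B: "finite B"
    and f: "\<And>a b. a \<in> A \<Longrightarrow> b \<in> B \<Longrightarrow> f a b \<in> carrier Z"
  shows "(\<Oplus>\<^bsub>Z\<^esub>p\<in>A \<times> B. f (fst p) (snd p)) = (\<Oplus>\<^bsub>Z\<^esub>a\<in>A. \<Oplus>\<^bsub>Z\<^esub>b\<in>B. f a b)"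
proof -
  interpret Z: module K Z by fact
  show ?thesis using A f
  proof (induction A rule: finite_induct)
    case (insert a A)
    have "(\<Oplus>\<^bsub>Z\<^esub>p\<in>Pair a ` B. f (fst p) (snd p)) = (\<Oplus>\<^bsub>Z\<^esub>b\<in>B. f a b)"
      using insert by (subst Z.finsum_reindex) (auto intro: inj_onI)
    moreover have "insert a A \<times> B = Pair a ` B \<union> A \<times> B" by auto
    moreover have "(\<Oplus>\<^bsub>Z\<^esub>p\<in>Pair a ` B \<union> A \<times> B. f (fst p) (snd p))
       = (\<Oplus>\<^bsub>Z\<^esub>p\<in>Pair a ` B. f (fst p) (snd p)) \<oplus>\<^bsub>Z\<^esub> (\<Oplus>\<^bsub>Z\<^esub>p\<in>A \<times> B. f (fst p) (snd p))"
      using insert B by (intro Z.finsum_Un_disjoint) auto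
    moreover have "(\<Oplus>\<^bsub>Z\<^esub>b\<in>B. f a b) \<in> carrier Z" "(\<lambda>a. \<Oplus>\<^bsub>Z\<^esub>b\<in>B. f a b) \<in> A \<rightarrow> carrier Z"
      using insert by (auto intro!: Z.finsum_closed)
    ultimately show ?case using insert by simp
  qed simp
qed

subsection \<open>Algebras\<close>

lemma k_algebra_mult_bilin:
  assumes "k_algebra K A"
  shows "mult A \<in> bilin K A A A"
proof -
  interpret k_algebra K A by fact
  interpret A: ring A by (rule is_ring)
  show ?thesis
    by (intro bilinI lin_mapI) (auto simp: A.l_distr A.r_distr smult_mult_left smult_mult_right)
qed

lemma lin_mult1: "\<lbrakk>k_algebra K A; a \<in> carrier A; f \<in> lin_map K U A\<rbrakk> \<Longrightarrow>
    (\<lambda>x. f x \<otimes>\<^bsub>A\<^esub> a) \<in> lin_map K U A"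
  by (rule lin_comp[OF bilin_left[OF k_algebra_mult_bilin]])

lemma lin_mult2: "\<lbrakk>k_algebra K A; a \<in> carrier A; f \<in> lin_map K U A\<rbrakk> \<Longrightarrow>
    (\<lambda>x. a \<otimes>\<^bsub>A\<^esub> f x) \<in> lin_map K U A"
  by (rule lin_comp[OF bilin_right[OF k_algebra_mult_bilin]])

lemma abelian_group_module: "module K V \<Longrightarrow> abelian_group V"
  by (simp add: module_def)

lemma bilin_eq_on_span:
  assumes V: "module K V" and W: "module K W" and Z: "module K Z"
    and f: "f \<in> bilin K V W Z" and g: "g \<in> bilin K V W Z"
    and S: "S \<subseteq> carrier V" "lin_span K V S = carrier V"
    and T: "T \<subseteq> carrier W" "lin_span K W T = carrier W"
    and eq: "\<And>s t. s \<in> S \<Longrightarrow> t \<in> T \<Longrightarrow> f s t = g s t"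
    and v: "v \<in> carrier V" and w: "w \<in> carrier W"
  shows "f v w = g v w"
proof -
  have 1: "f s w = g s w" if "s \<in> S" for s
    by (rule lin_span_eqI[OF W Z bilin_right[OF f] bilin_right[OF g] T(1) eq])
      (use that S T w in auto)
  show ?thesis
    by (rule lin_span_eqI[OF V Z bilin_left[OF f w] bilin_left[OF g w] S(1) 1]) (use S v in auto)
qed

text \<open>Both bracketings are linear in each of the three factors, so associativity extends from
  S one factor at a time.\<close>

lemma k_algebraI_span:
  assumes K: "field K" and A: "module K A" and m: "mult A \<in> bilin K A A A"
    and one: "\<one>\<^bsub>A\<^esub> \<in> carrier A" and S: "S \<subseteq> carrier A" "lin_span K A S = carrier A"
    and assoc: "\<And>x y z. x \<in> S \<Longrightarrow> y \<in> S \<Longrightarrow> z \<in> S \<Longrightarrow> (x \<otimes>\<^bsub>A\<^esub> y) \<otimes>\<^bsub>A\<^esub> z = x \<otimes>\<^bsub>A\<^esub> (y \<otimes>\<^bsub>A\<^esub> z)"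
    and l1: "\<And>x. x \<in> S \<Longrightarrow> \<one>\<^bsub>A\<^esub> \<otimes>\<^bsub>A\<^esub> x = x" and r1: "\<And>x. x \<in> S \<Longrightarrow> x \<otimes>\<^bsub>A\<^esub> \<one>\<^bsub>A\<^esub> = x"
  shows "k_algebra K A"
proof -
  interpret A: module K A by fact
  note cl = bilin_closed[OF m]
  note L = bilin_left[OF m] and R = bilin_right[OF m]
  have Scl: "s \<in> S \<Longrightarrow> s \<in> carrier A" for s using S by auto
  have a1: "(x \<otimes>\<^bsub>A\<^esub> y) \<otimes>\<^bsub>A\<^esub> z = x \<otimes>\<^bsub>A\<^esub> (y \<otimes>\<^bsub>A\<^esub> z)"
    if "x \<in> carrier A" "y \<in> S" "z \<in> S" for x y z
    by (rule lin_span_eqI[OF A A lin_comp[OF L L] L S(1) assoc[OF _ that(2,3)]])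
      (use that S cl Scl in auto)
  have a2: "(x \<otimes>\<^bsub>A\<^esub> y) \<otimes>\<^bsub>A\<^esub> z = x \<otimes>\<^bsub>A\<^esub> (y \<otimes>\<^bsub>A\<^esub> z)"
    if "x \<in> carrier A" "y \<in> carrier A" "z \<in> S" for x y z
    by (rule lin_span_eqI[OF A A lin_comp[OF L R] lin_comp[OF R L] S(1) a1[OF that(1) _ that(3)]])
      (use that S cl Scl in auto)
  have a3: "(x \<otimes>\<^bsub>A\<^esub> y) \<otimes>\<^bsub>A\<^esub> z = x \<otimes>\<^bsub>A\<^esub> (y \<otimes>\<^bsub>A\<^esub> z)"
    if "x \<in> carrier A" "y \<in> carrier A" "z \<in> carrier A" for x y z
    by (rule lin_span_eqI[OF A A R lin_comp[OF R R] S(1) a2[OF that(1,2)]])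
      (use that S cl Scl in auto)
  have l: "\<one>\<^bsub>A\<^esub> \<otimes>\<^bsub>A\<^esub> x = x" if "x \<in> carrier A" for x
    by (rule lin_span_eqI[OF A A R lin_id S(1) l1]) (use that S one in auto)
  have r: "x \<otimes>\<^bsub>A\<^esub> \<one>\<^bsub>A\<^esub> = x" if "x \<in> carrier A" for x
    by (rule lin_span_eqI[OF A A L lin_id S(1) r1]) (use that S one in auto)
  have "ring A"
    by (intro ringI A.abelian_group_axioms monoidI) (auto simp: cl one a3 l r lin_map_add[OF L] lin_map_add[OF R])
  then show ?thesis
    by (intro k_algebra.intro K A) (auto simp: lin_map_smult[OF L] lin_map_smult[OF R])
qed

subsection \<open>Records with the same linear structure\<close>

text \<open>Algebra and Hopf records, tensor algebras and biproducts are different terms over the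
  same vector space. The constants \<open>tensor\<close>, \<open>pt\<close>, \<open>tlift\<close>
  and \<open>lin_map\<close> depend only on these four fields, so facts can be rewritten from one
  record to another.\<close>

definition same_lin where
  "same_lin V V' \<longleftrightarrow> carrier V = carrier V' \<and> add V = add V' \<and> zero V = zero V' \<and> smult V = smult V'"

lemma tensor_cong: "same_lin V V' \<Longrightarrow> same_lin W W' \<Longrightarrow> tensor K V W = tensor K V' W'"
  by (simp add: same_lin_def tensor_def tensor_rels_def)

lemma pt_cong: "same_lin V V' \<Longrightarrow> same_lin W W' \<Longrightarrow> pt K V W = pt K V' W'"
  by (simp add: same_lin_def pt_def tensor_rels_def fun_eq_iff)

lemma finsum_record_cong: "carrier V = carrier V' \<Longrightarrow> add V = add V' \<Longrightarrow> zero V = zero V' \<Longrightarrow> finsum V = finsum V'"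
  by (intro ext) (simp add: finsum_def finprod_def)

lemma tlift_cong:
  assumes "same_lin V V'"
  shows "tlift K V = tlift K V'"
proof -
  have eq: "finsum V = finsum V'" "smult V = smult V'" using assms finsum_record_cong[of V V'] by (auto simp: same_lin_def)
  \<comment> \<open>The two records may have different types, so one cannot replace the other.
    Abstracting \<open>tlift\<close> over its sum and its scalar action leaves functions of equal
    type to compare.\<close>
  have 1: "tlift K V = (\<lambda>s m \<phi> t. THE u. \<exists>f\<in>t. u = s (\<lambda>p. m (f p) (\<phi> (fst p) (snd p))) (supp K f)) (finsum V) (smult V)"
    by (intro ext) (simp only: tlift_def)
  have 2: "tlift K V' = (\<lambda>s m \<phi> t. THE u. \<exists>f\<in>t. u = s (\<lambda>p. m (f p) (\<phi> (fst p) (snd p))) (supp K f)) (finsum V') (smult V')"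
    by (intro ext) (simp only: tlift_def)
  show ?thesis unfolding 1 2 eq ..
qed

lemma lin_map_cong_record: "same_lin V V' \<Longrightarrow> same_lin W W' \<Longrightarrow> lin_map K V W = lin_map K V' W'"
  by (simp add: same_lin_def lin_map_def)

lemma lin_span_cong: "same_lin V V' \<Longrightarrow> lin_span K V = lin_span K V'"
  by (simp add: same_lin_def lin_span_def submodule_def submodule_axioms_def fun_eq_iff subgroup_def a_inv_def m_inv_def)

lemma module_cong:
  assumes "same_lin V V'" "module K V"
  shows "module K V'"
proof -
  interpret V: module K V by fact
  have eq: "carrier V' = carrier V" "add V' = add V" "zero V' = zero V" "smult V' = smult V"
    using assms(1) by (auto simp: same_lin_def)
  have "\<exists>y\<in>carrier V. y \<oplus>\<^bsub>V\<^esub> x = \<zero>\<^bsub>V\<^esub>" if "x \<in> carrier V" for x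
    using that V.l_neg[OF that] V.a_inv_closed[OF that] by blast
  then have "abelian_group V'"
    by (intro abelian_groupI) (auto simp: eq V.a_ac)
  then show ?thesis
    by (intro moduleI V.R.is_cring)
      (auto simp: eq V.smult_l_distr V.smult_r_distr V.smult_assoc1)
qed

lemma same_lin_refl: "same_lin V V"
  by (simp add: same_lin_def)

lemma k_algebra_cong:
  assumes A: "k_algebra K A" and eq: "carrier B = carrier A" "add B = add A" "zero B = zero A"
    "smult B = smult A" "one B = one A"
    and m: "\<And>x y. x \<in> carrier A \<Longrightarrow> y \<in> carrier A \<Longrightarrow> x \<otimes>\<^bsub>B\<^esub> y = x \<otimes>\<^bsub>A\<^esub> y"
  shows "k_algebra K B"
proof -
  interpret A: k_algebra K A by fact
  interpret Am: module K A by (rule A.is_module)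
  interpret Ar: ring A by (rule A.is_ring)
  have "module K B"
    by (rule module_cong[OF _ A.is_module]) (simp add: same_lin_def eq)
  moreover have "ring B"
    by (intro ringI abelian_group_module[OF \<open>module K B\<close>] monoidI) (auto simp: eq m Ar.m_assoc Ar.l_distr Ar.r_distr)
  ultimately show ?thesis
    by (intro k_algebra.intro A.is_field) (auto simp: eq m A.smult_mult_left A.smult_mult_right)
qed

lemma alg_hom_lin: "f \<in> alg_hom K A B \<Longrightarrow> f \<in> lin_map K A B"
  by (simp add: alg_hom_def)

lemma alg_hom_closed: "f \<in> alg_hom K A B \<Longrightarrow> x \<in> carrier A \<Longrightarrow> f x \<in> carrier B"
  using lin_map_closed[OF alg_hom_lin] .

lemma alg_hom_mult: "f \<in> alg_hom K A B \<Longrightarrow> x \<in> carrier A \<Longrightarrow> y \<in> carrier A \<Longrightarrow>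
    f (x \<otimes>\<^bsub>A\<^esub> y) = f x \<otimes>\<^bsub>B\<^esub> f y"
  by (simp add: alg_hom_def ring_hom_def)

lemma alg_hom_one: "f \<in> alg_hom K A B \<Longrightarrow> f \<one>\<^bsub>A\<^esub> = \<one>\<^bsub>B\<^esub>"
  by (simp add: alg_hom_def ring_hom_def)

lemma alg_homI:
  assumes "f \<in> lin_map K A B" "f \<one>\<^bsub>A\<^esub> = \<one>\<^bsub>B\<^esub>"
    "\<And>x y. x \<in> carrier A \<Longrightarrow> y \<in> carrier A \<Longrightarrow> f (x \<otimes>\<^bsub>A\<^esub> y) = f x \<otimes>\<^bsub>B\<^esub> f y"
  shows "f \<in> alg_hom K A B"
  using assms by (auto simp: alg_hom_def ring_hom_def lin_map_def)

lemma alg_homI_span: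
  assumes A: "module K A" and B: "module K B" and f: "f \<in> lin_map K A B" and f1: "f \<one>\<^bsub>A\<^esub> = \<one>\<^bsub>B\<^esub>"
    and mA: "mult A \<in> bilin K A A A" and mB: "mult B \<in> bilin K B B B"
    and S: "S \<subseteq> carrier A" "lin_span K A S = carrier A"
    and m: "\<And>x y. x \<in> S \<Longrightarrow> y \<in> S \<Longrightarrow> f (x \<otimes>\<^bsub>A\<^esub> y) = f x \<otimes>\<^bsub>B\<^esub> f y"
  shows "f \<in> alg_hom K A B"
proof (rule alg_homI[OF f f1])
  fix x y assume "x \<in> carrier A" "y \<in> carrier A"
  have 1: "(\<lambda>x y. f (x \<otimes>\<^bsub>A\<^esub> y)) \<in> bilin K A A B"
    by (intro bilinI lin_comp[OF f] bilin_left[OF mA] bilin_right[OF mA])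
  have 2: "(\<lambda>x y. f x \<otimes>\<^bsub>B\<^esub> f y) \<in> bilin K A A B"
    by (intro bilinI lin_comp[OF bilin_left[OF mB] f] lin_comp[OF bilin_right[OF mB] f] lin_map_closed[OF f])
  show "f (x \<otimes>\<^bsub>A\<^esub> y) = f x \<otimes>\<^bsub>B\<^esub> f y"
    by (rule bilin_eq_on_span[OF A A B 1 2 S S m]) (assumption | fact)+
qed

lemma alg_hom_comp: "g \<in> alg_hom K B C \<Longrightarrow> f \<in> alg_hom K A B \<Longrightarrow> (\<lambda>x. g (f x)) \<in> alg_hom K A C"
proof -
  assume g: "g \<in> alg_hom K B C" and f: "f \<in> alg_hom K A B"
  show ?thesis
    by (rule alg_homI[OF lin_comp[OF alg_hom_lin[OF g] alg_hom_lin[OF f]]])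
      (simp_all add: alg_hom_one[OF f] alg_hom_one[OF g] alg_hom_mult[OF f] alg_hom_mult[OF g] alg_hom_closed[OF f])
qed

lemma lin_span_carrier: "module K V \<Longrightarrow> lin_span K V (carrier V) = carrier V"
  using lin_span_closed[of K V "carrier V"] lin_span_superset[of "carrier V" K V] by auto

context kvect
begin

lemmas [lins] = lin_id lin_pt1 lin_pt2 lin_tlift1 lin_tlift2 bilinI module_tensor lin_mult1 lin_mult2
  lin_smult lin_add lin_finsum pt_closed tlift_closed

text \<open>Every product on a tensor product used here is a doubly nested \<open>tlift\<close> of a
  map linear in four arguments. This serves the tensor algebra, the braided square and both
  biproducts.\<close>

lemma tlift2_bilin_pt:
  assumes A: "module K A" and B: "module K B" and C: "module K C" and D: "module K D" and Z: "module K Z"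
    and X1: "\<And>a b. a \<in> carrier A \<Longrightarrow> b \<in> carrier B \<Longrightarrow> X a b \<in> bilin K C D Z"
    and X2: "\<And>c d. c \<in> carrier C \<Longrightarrow> d \<in> carrier D \<Longrightarrow> (\<lambda>a b. X a b c d) \<in> bilin K A B Z"
  shows tlift2_bilin: "(\<lambda>s t. tlift K Z (\<lambda>a b. tlift K Z (\<lambda>c d. X a b c d) t) s)
      \<in> bilin K (tensor K A B) (tensor K C D) Z"
    and tlift2_pt: "\<And>a b c d. \<lbrakk>a \<in> carrier A; b \<in> carrier B; c \<in> carrier C; d \<in> carrier D\<rbrakk> \<Longrightarrow>
      tlift K Z (\<lambda>a b. tlift K Z (\<lambda>c d. X a b c d) (pt K C D c d)) (pt K A B a b) = X a b c d"
proof -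
  have 1: "(\<lambda>a b. tlift K Z (X a b) t) \<in> bilin K A B Z" if "t \<in> carrier (tensor K C D)" for t
    using that by (intro bilinI lin_tlift2[OF that C D Z] A B X1 bilin_left[OF X2] bilin_right[OF X2])
  have 2: "(\<lambda>c d. tlift K Z (\<lambda>a b. X a b c d) s) \<in> bilin K C D Z" if "s \<in> carrier (tensor K A B)" for s
    by (intro bilinI lin_tlift2[OF that A B Z] C D X2 bilin_left[OF X1] bilin_right[OF X1])
  show "(\<lambda>s t. tlift K Z (\<lambda>a b. tlift K Z (\<lambda>c d. X a b c d) t) s) \<in> bilin K (tensor K A B) (tensor K C D) Z"
  proof (intro bilinI)
    fix t assume "t \<in> carrier (tensor K C D)"
    then show "(\<lambda>s. tlift K Z (\<lambda>a b. tlift K Z (X a b) t) s) \<in> lin_map K (tensor K A B) Z"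
      by (intro tlift_lin A B Z 1)
  next
    fix s assume s: "s \<in> carrier (tensor K A B)"
    show "(\<lambda>t. tlift K Z (\<lambda>a b. tlift K Z (X a b) t) s) \<in> lin_map K (tensor K C D) Z"
      by (intro lin_tlift2[OF s A B Z] module_tensor C D 1 tlift_lin Z X1)
  qed
  show "tlift K Z (\<lambda>a b. tlift K Z (\<lambda>c d. X a b c d) (pt K C D c d)) (pt K A B a b) = X a b c d"
    if "a \<in> carrier A" "b \<in> carrier B" "c \<in> carrier C" "d \<in> carrier D" for a b c d
    using that by (subst tlift_pt[OF A B Z 1[OF pt_closed[OF C D]]]) (auto simp: tlift_pt[OF C D Z X1])
qed

lemma tensor_same_lin [simp]:
  "carrier (tensor_alg K A B) = carrier (tensor K A B)" "add (tensor_alg K A B) = add (tensor K A B)"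
  "zero (tensor_alg K A B) = zero (tensor K A B)" "smult (tensor_alg K A B) = smult (tensor K A B)"
  "one (tensor_alg K A B) = pt K A B \<one>\<^bsub>A\<^esub> \<one>\<^bsub>B\<^esub>"
  "carrier (braided_square K B \<Psi>) = carrier (tensor K B B)"
  "add (braided_square K B \<Psi>) = add (tensor K B B)"
  "zero (braided_square K B \<Psi>) = zero (tensor K B B)"
  "smult (braided_square K B \<Psi>) = smult (tensor K B B)"
  "one (braided_square K B \<Psi>) = pt K B B \<one>\<^bsub>B\<^esub> \<one>\<^bsub>B\<^esub>"
  by (auto simp: tensor_alg_def braided_square_def Let_def)

lemma same_lin_tensor_alg: "same_lin (tensor_alg K A B) (tensor K A B)"
  "same_lin (braided_square K A \<Psi>) (tensor K A A)"
  by (simp_all add: same_lin_def)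

lemma tensor_alg_mult:
  assumes A: "k_algebra K A" and B: "k_algebra K B"
  shows tensor_alg_mult_bilin: "mult (tensor_alg K A B) \<in> bilin K (tensor K A B) (tensor K A B) (tensor K A B)"
    and tensor_alg_mult_pt: "\<And>a b a' b'. \<lbrakk>a \<in> carrier A; b \<in> carrier B; a' \<in> carrier A; b' \<in> carrier B\<rbrakk> \<Longrightarrow>
      pt K A B a b \<otimes>\<^bsub>tensor_alg K A B\<^esub> pt K A B a' b' = pt K A B (a \<otimes>\<^bsub>A\<^esub> a') (b \<otimes>\<^bsub>B\<^esub> b')"
proof -
  note mA = k_algebra.is_module[OF A] and mB = k_algebra.is_module[OF B]
  have cl: "\<And>a a'. a \<in> carrier A \<Longrightarrow> a' \<in> carrier A \<Longrightarrow> a \<otimes>\<^bsub>A\<^esub> a' \<in> carrier A"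
    "\<And>a a'. a \<in> carrier B \<Longrightarrow> a' \<in> carrier B \<Longrightarrow> a \<otimes>\<^bsub>B\<^esub> a' \<in> carrier B"
    using bilin_closed[OF k_algebra_mult_bilin[OF A]] bilin_closed[OF k_algebra_mult_bilin[OF B]] by auto
  have eq: "mult (tensor_alg K A B) = (\<lambda>s t. tlift K (tensor K A B) (\<lambda>a b. tlift K (tensor K A B) (\<lambda>a' b'.
                 pt K A B (a \<otimes>\<^bsub>A\<^esub> a') (b \<otimes>\<^bsub>B\<^esub> b')) t) s)"
    by (simp add: tensor_alg_def Let_def)
  have X1: "(\<lambda>a' b'. pt K A B (a \<otimes>\<^bsub>A\<^esub> a') (b \<otimes>\<^bsub>B\<^esub> b')) \<in> bilin K A B (tensor K A B)"
    if "a \<in> carrier A" "b \<in> carrier B" for a b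
    using that by - (rule lins | assumption | simp add: mA mB cl A B)+
  have X2: "(\<lambda>a b. pt K A B (a \<otimes>\<^bsub>A\<^esub> a') (b \<otimes>\<^bsub>B\<^esub> b')) \<in> bilin K A B (tensor K A B)"
    if "a' \<in> carrier A" "b' \<in> carrier B" for a' b'
    using that by - (rule lins | assumption | simp add: mA mB cl A B)+
  note T = module_tensor[OF mA mB]
  show "mult (tensor_alg K A B) \<in> bilin K (tensor K A B) (tensor K A B) (tensor K A B)"
    unfolding eq by (rule tlift2_bilin[OF mA mB mA mB T X1 X2])
  show "pt K A B a b \<otimes>\<^bsub>tensor_alg K A B\<^esub> pt K A B a' b' = pt K A B (a \<otimes>\<^bsub>A\<^esub> a') (b \<otimes>\<^bsub>B\<^esub> b')"
    if "a \<in> carrier A" "b \<in> carrier B" "a' \<in> carrier A" "b' \<in> carrier B" for a b a' b'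
    unfolding eq by (rule tlift2_pt[OF mA mB mA mB T X1 X2 that])
qed

lemma braided_square_mult:
  assumes A: "k_algebra K A" and \<Psi>: "\<Psi> \<in> bilin K A A (tensor K A A)"
  shows braided_square_mult_bilin: "mult (braided_square K A \<Psi>) \<in> bilin K (tensor K A A) (tensor K A A) (tensor K A A)"
    and braided_square_mult_pt: "\<And>a b a' b'. \<lbrakk>a \<in> carrier A; b \<in> carrier A; a' \<in> carrier A; b' \<in> carrier A\<rbrakk> \<Longrightarrow>
      pt K A A a b \<otimes>\<^bsub>braided_square K A \<Psi>\<^esub> pt K A A a' b' =
      tlift K (tensor K A A) (\<lambda>x y. pt K A A (a \<otimes>\<^bsub>A\<^esub> x) (y \<otimes>\<^bsub>A\<^esub> b')) (\<Psi> b a')"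
proof -
  note mA = k_algebra.is_module[OF A]
  have cl: "\<And>a a'. a \<in> carrier A \<Longrightarrow> a' \<in> carrier A \<Longrightarrow> a \<otimes>\<^bsub>A\<^esub> a' \<in> carrier A"
    using bilin_closed[OF k_algebra_mult_bilin[OF A]] by auto
  have eq: "mult (braided_square K A \<Psi>) = (\<lambda>s t. tlift K (tensor K A A) (\<lambda>a b. tlift K (tensor K A A) (\<lambda>a' b'.
                 tlift K (tensor K A A) (\<lambda>x y. pt K A A (a \<otimes>\<^bsub>A\<^esub> x) (y \<otimes>\<^bsub>A\<^esub> b')) (\<Psi> b a')) t) s)"
    by (simp add: braided_square_def Let_def)
  note \<Psi>r = lin_comp[OF bilin_right[OF \<Psi>]] and \<Psi>l = lin_comp[OF bilin_left[OF \<Psi>]] and \<Psi>c = bilin_closed[OF \<Psi>]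
  have X1: "(\<lambda>a' b'. tlift K (tensor K A A) (\<lambda>x y. pt K A A (a \<otimes>\<^bsub>A\<^esub> x) (y \<otimes>\<^bsub>A\<^esub> b')) (\<Psi> b a')) \<in> bilin K A A (tensor K A A)"
    if "a \<in> carrier A" "b \<in> carrier A" for a b
    using that by - (rule lins \<Psi>r \<Psi>c | assumption | simp add: mA cl A)+
  have X2: "(\<lambda>a b. tlift K (tensor K A A) (\<lambda>x y. pt K A A (a \<otimes>\<^bsub>A\<^esub> x) (y \<otimes>\<^bsub>A\<^esub> b')) (\<Psi> b a')) \<in> bilin K A A (tensor K A A)"
    if "a' \<in> carrier A" "b' \<in> carrier A" for a' b'
    using that by - (rule lins \<Psi>l \<Psi>c | assumption | simp add: mA cl A)+
  note T = module_tensor[OF mA mA]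
  show "mult (braided_square K A \<Psi>) \<in> bilin K (tensor K A A) (tensor K A A) (tensor K A A)"
    unfolding eq by (rule tlift2_bilin[OF mA mA mA mA T X1 X2])
  show "pt K A A a b \<otimes>\<^bsub>braided_square K A \<Psi>\<^esub> pt K A A a' b' =
      tlift K (tensor K A A) (\<lambda>x y. pt K A A (a \<otimes>\<^bsub>A\<^esub> x) (y \<otimes>\<^bsub>A\<^esub> b')) (\<Psi> b a')"
    if "a \<in> carrier A" "b \<in> carrier A" "a' \<in> carrier A" "b' \<in> carrier A" for a b a' b'
    unfolding eq by (rule tlift2_pt[OF mA mA mA mA T X1 X2 that])
qed

text \<open>R pairs a spanning element w of W with an endomorphism by which w moves past V. It is a
  relation, not a function, because a class such as zero may carry several degrees. What
  associativity asks of the twists is that each is multiplicative and that w w' is twisted by the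
  composite.\<close>

lemma smash_k_algebra:
  assumes V: "k_algebra K V" and W: "k_algebra K W"
    and R: "\<And>s b. (s, b) \<in> R \<Longrightarrow> b \<in> carrier W" "lin_span K W (snd ` R) = carrier W"
    and hom: "\<And>s b. (s, b) \<in> R \<Longrightarrow> s \<in> alg_hom K V V"
    and closed: "\<And>s b s' b'. (s, b) \<in> R \<Longrightarrow> (s', b') \<in> R \<Longrightarrow>
      \<exists>s''. (s'', b \<otimes>\<^bsub>W\<^esub> b') \<in> R \<and> (\<forall>v\<in>carrier V. s'' v = s (s' v))"
    and unit: "\<exists>s. (s, \<one>\<^bsub>W\<^esub>) \<in> R \<and> (\<forall>v\<in>carrier V. s v = v)"
    and X: "same_lin X (tensor K V W)" "one X = pt K V W \<one>\<^bsub>V\<^esub> \<one>\<^bsub>W\<^esub>"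
    and m: "mult X \<in> bilin K (tensor K V W) (tensor K V W) (tensor K V W)"
    and mpt: "\<And>a a' s b s' b'. a \<in> carrier V \<Longrightarrow> a' \<in> carrier V \<Longrightarrow> (s, b) \<in> R \<Longrightarrow> (s', b') \<in> R \<Longrightarrow>
      pt K V W a b \<otimes>\<^bsub>X\<^esub> pt K V W a' b' = pt K V W (a \<otimes>\<^bsub>V\<^esub> s a') (b \<otimes>\<^bsub>W\<^esub> b')"
  shows "k_algebra K X"
proof -
  note mV = k_algebra.is_module[OF V] and mW = k_algebra.is_module[OF W]
  note T = module_tensor[OF mV mW]
  interpret V: ring V by (rule k_algebra.is_ring[OF V])
  interpret W: ring W by (rule k_algebra.is_ring[OF W])
  let ?S = "{pt K V W v w |v w. v \<in> carrier V \<and> w \<in> snd ` R}"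
  have RW: "snd ` R \<subseteq> carrier W" using R(1) by auto
  have S: "?S \<subseteq> carrier (tensor K V W)" "lin_span K (tensor K V W) ?S = carrier (tensor K V W)"
    using pt_closed[OF mV mW] RW tensor_span[OF mV mW subset_refl lin_span_carrier[OF mV] RW R(2)] by blast+
  have carX: "carrier X = carrier (tensor K V W)" using X by (simp add: same_lin_def)
  have mX: "module K X"
    using T X(1) module_cong[of "tensor K V W" X] by (auto simp: same_lin_def)
  show ?thesis
  proof (rule k_algebraI_span[OF field_K mX, where S = ?S])
    show "mult X \<in> bilin K X X X"
      using m X(1) by (simp add: bilin_def lin_map_cong_record[OF X(1) X(1)] carX)
    show "\<one>\<^bsub>X\<^esub> \<in> carrier X" unfolding X(2) carX by (intro pt_closed mV mW) auto
    show "?S \<subseteq> carrier X" "lin_span K X ?S = carrier X" using S by (simp_all add: carX lin_span_cong[OF X(1)])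
  next
    fix x y z assume "x \<in> ?S" "y \<in> ?S" "z \<in> ?S"
    then obtain v w s v' w' s' v'' w'' s'' where
      x: "x = pt K V W v w" "v \<in> carrier V" "(s, w) \<in> R" and
      y: "y = pt K V W v' w'" "v' \<in> carrier V" "(s', w') \<in> R" and
      z: "z = pt K V W v'' w''" "v'' \<in> carrier V" "(s'', w'') \<in> R" by force
    obtain t where t: "(t, w \<otimes>\<^bsub>W\<^esub> w') \<in> R" "\<And>v. v \<in> carrier V \<Longrightarrow> t v = s (s' v)"
      using closed[OF x(3) y(3)] by blast
    obtain t' where t': "(t', w' \<otimes>\<^bsub>W\<^esub> w'') \<in> R" using closed[OF y(3) z(3)] by blast
    note c = alg_hom_closed[OF hom[OF x(3)]] alg_hom_closed[OF hom[OF y(3)]] R(1)[OF x(3)] R(1)[OF y(3)] R(1)[OF z(3)]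
    \<comment> \<open>The twist t of w w' acts as s after s', so both bracketings have first leg v
      s(v') s(s'(v'')).\<close>
    have "x \<otimes>\<^bsub>X\<^esub> y \<otimes>\<^bsub>X\<^esub> z = pt K V W ((v \<otimes>\<^bsub>V\<^esub> s v') \<otimes>\<^bsub>V\<^esub> t v'') ((w \<otimes>\<^bsub>W\<^esub> w') \<otimes>\<^bsub>W\<^esub> w'')"
      using x y z t c by (simp add: mpt)
    also have "\<dots> = x \<otimes>\<^bsub>X\<^esub> (y \<otimes>\<^bsub>X\<^esub> z)"
      using x y z t c t' by (simp add: mpt V.m_assoc W.m_assoc alg_hom_mult[OF hom[OF x(3)]])
    finally show "x \<otimes>\<^bsub>X\<^esub> y \<otimes>\<^bsub>X\<^esub> z = x \<otimes>\<^bsub>X\<^esub> (y \<otimes>\<^bsub>X\<^esub> z)" .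
  next
    fix x assume "x \<in> ?S"
    then obtain v w s where x: "x = pt K V W v w" "v \<in> carrier V" "(s, w) \<in> R" by force
    from unit obtain e where e: "(e, \<one>\<^bsub>W\<^esub>) \<in> R" "\<And>v. v \<in> carrier V \<Longrightarrow> e v = v" by blast
    show "\<one>\<^bsub>X\<^esub> \<otimes>\<^bsub>X\<^esub> x = x" unfolding X(2) x using x e R(1)[OF x(3)] mpt[OF V.one_closed x(2) e(1) x(3)] by simp
    show "x \<otimes>\<^bsub>X\<^esub> \<one>\<^bsub>X\<^esub> = x" unfolding X(2) x
      using x e R(1)[OF x(3)] alg_hom_one[OF hom[OF x(3)]] mpt[OF x(2) V.one_closed x(3) e(1)] by simp
  qed
qed

lemma alg_hom_id: "(\<lambda>x. x) \<in> alg_hom K A A"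
  by (rule alg_homI) (auto simp: lin_map_def)

lemma k_algebra_tensor_alg:
  assumes A: "k_algebra K A" and B: "k_algebra K B"
  shows "k_algebra K (tensor_alg K A B)"
proof (rule smash_k_algebra[OF A B, where R = "{(\<lambda>x. x, b) |b. b \<in> carrier B}"])
  interpret B: ring B by (rule k_algebra.is_ring[OF B])
  have "snd ` {(\<lambda>x. x, b) |b. b \<in> carrier B} = carrier B" by force
  then show "lin_span K B (snd ` {(\<lambda>x. x, b) |b. b \<in> carrier B}) = carrier B"
    using lin_span_carrier[OF k_algebra.is_module[OF B]] by metis
  show "\<exists>s. (s, \<one>\<^bsub>B\<^esub>) \<in> {(\<lambda>x. x, b) |b. b \<in> carrier B} \<and> (\<forall>v\<in>carrier A. s v = v)" by auto
  show "\<exists>s''. (s'', b \<otimes>\<^bsub>B\<^esub> b') \<in> {(\<lambda>x. x, b) |b. b \<in> carrier B} \<and> (\<forall>v\<in>carrier A. s'' v = s (s' v))"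
    if "(s, b) \<in> {(\<lambda>x. x, b) |b. b \<in> carrier B}" "(s', b') \<in> {(\<lambda>x. x, b) |b. b \<in> carrier B}" for s b s' b'
    using that by auto
  show "mult (tensor_alg K A B) \<in> bilin K (tensor K A B) (tensor K A B) (tensor K A B)"
    by (rule tensor_alg_mult_bilin[OF A B])
qed (auto simp: alg_hom_id same_lin_def tensor_alg_mult_pt[OF A B])

subsection \<open>Monoid algebras\<close>

lemma monoid_algebra_simps [simp]:
  "carrier (monoid_algebra K M) = carrier (free_mod K (carrier M))"
  "add (monoid_algebra K M) = add (free_mod K (carrier M))"
  "zero (monoid_algebra K M) = zero (free_mod K (carrier M))"
  "smult (monoid_algebra K M) = smult (free_mod K (carrier M))"
  "one (monoid_algebra K M) = single K \<one>\<^bsub>M\<^esub>"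
  by (simp_all add: monoid_algebra_def)

lemma same_lin_monoid_algebra: "same_lin (monoid_algebra K M) (free_mod K (carrier M))"
  by (simp add: same_lin_def)

text \<open>Rewriting the convolution as a double linear extension makes its bilinearity and its
  values on basis elements inherit from \<open>free_lift\<close>.\<close>

lemma monoid_algebra_mult_sum:
  assumes M: "monoid M" and f: "f \<in> carrier (free_mod K (carrier M))" and g: "g \<in> carrier (free_mod K (carrier M))"
  shows "f \<otimes>\<^bsub>monoid_algebra K M\<^esub> g = free_lift K (free_mod K (carrier M))
    (\<lambda>x. free_lift K (free_mod K (carrier M)) (\<lambda>y. single K (x \<otimes>\<^bsub>M\<^esub> y)) g) f"
proof
  fix z
  let ?F = "free_mod K (carrier M)" and ?P = "supp K f \<times> supp K g"
  let ?s = "\<lambda>p. (f (fst p) \<otimes>\<^bsub>K\<^esub> g (snd p)) \<odot>\<^bsub>?F\<^esub> single K (fst p \<otimes>\<^bsub>M\<^esub> snd p)"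
  interpret M: monoid M by fact
  interpret F: module K ?F by (rule module_free_mod)
  have fin: "finite (supp K f)" "finite (supp K g)" "supp K f \<subseteq> carrier M" "supp K g \<subseteq> carrier M"
    and fK: "f x \<in> carrier K" "g x \<in> carrier K" for x using f g by (auto simp: free_mod_carrier)
  have s: "single K (x \<otimes>\<^bsub>M\<^esub> y) \<in> carrier ?F" if "x \<in> supp K f" "y \<in> supp K g" for x y
    using that fin by (intro single_closed M.m_closed) auto
  have sc2: "?s (x, y) \<in> carrier ?F" if "x \<in> supp K f" "y \<in> supp K g" for x y
    using s[OF that] fK by (simp del: free_mod_simps)
  then have sc: "?s p \<in> carrier ?F" if "p \<in> ?P" for p using that by auto
  let ?L = "free_lift K ?F (\<lambda>x. free_lift K ?F (\<lambda>y. single K (x \<otimes>\<^bsub>M\<^esub> y)) g) f"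
  have "?L = (\<Oplus>\<^bsub>?F\<^esub>x\<in>supp K f. \<Oplus>\<^bsub>?F\<^esub>y\<in>supp K g. ?s (x, y))"
    unfolding free_lift_def
  proof (rule F.finsum_cong')
    fix x assume x: "x \<in> supp K f"
    show "f x \<odot>\<^bsub>?F\<^esub> (\<Oplus>\<^bsub>?F\<^esub>y\<in>supp K g. g y \<odot>\<^bsub>?F\<^esub> single K (x \<otimes>\<^bsub>M\<^esub> y)) = (\<Oplus>\<^bsub>?F\<^esub>y\<in>supp K g. ?s (x, y))"
      by (subst F.finsum_smult_ldistr)
        (use fin fK s[OF x] F.smult_closed in \<open>auto intro!: F.finsum_cong' simp: F.smult_assoc1 simp del: free_mod_simps\<close>)
  qed (use sc in \<open>auto intro!: F.finsum_closed simp del: free_mod_simps\<close>)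
  also have "\<dots> = (\<Oplus>\<^bsub>?F\<^esub>p\<in>?P. ?s p)"
    using finsum_prod[OF module_free_mod fin(1,2), of "\<lambda>x y. ?s (x, y)", OF sc2] by (simp del: free_mod_simps)
  finally have "?L z = (\<Oplus>\<^bsub>?F\<^esub>p\<in>?P. ?s p) z" by simp
  also have "\<dots> = (\<Oplus>\<^bsub>K\<^esub>p\<in>?P. ?s p z)"
    by (rule finsum_apply[OF cring_K _ _ module_free_mod]) (use sc fin in \<open>auto simp: free_mod_carrier\<close>)
  \<comment> \<open>A basis vector at x y is seen at z only if x y = z, so the product of the
    supports shrinks to the index set of the convolution.\<close>
  also have "\<dots> = (\<Oplus>\<^bsub>K\<^esub>p\<in>{(x, y). x \<in> supp K f \<and> y \<in> supp K g \<and> x \<otimes>\<^bsub>M\<^esub> y = z}. f (fst p) \<otimes>\<^bsub>K\<^esub> g (snd p))"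
    by (rule K.add.finprod_mono_neutral_cong_right)
      (use fin fK in \<open>auto simp: single_def\<close>)
  finally show "(f \<otimes>\<^bsub>monoid_algebra K M\<^esub> g) z = ?L z"
    by (simp add: monoid_algebra_def)
qed

lemma monoid_algebra_single:
  assumes M: "monoid M" and "x \<in> carrier M" "y \<in> carrier M"
  shows "single K x \<otimes>\<^bsub>monoid_algebra K M\<^esub> single K y = single K (x \<otimes>\<^bsub>M\<^esub> y)"
  using assms by (simp add: monoid_algebra_mult_sum[OF M] free_lift_single[OF module_free_mod] single_closed monoid.m_closed)

lemma monoid_algebra_mult_bilin:
  assumes M: "monoid M"
  shows "mult (monoid_algebra K M) \<in> bilin K (free_mod K (carrier M)) (free_mod K (carrier M)) (free_mod K (carrier M))"
proof -
  let ?F = "free_mod K (carrier M)" and ?m = "mult (monoid_algebra K M)"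
  note m = module_free_mod[of "carrier M"]
  have r: "free_lift K ?F (\<lambda>y. single K (x \<otimes>\<^bsub>M\<^esub> y)) \<in> lin_map K ?F ?F" if "x \<in> carrier M" for x
    using that M by (intro free_lift_lin[OF m]) (auto intro!: single_closed monoid.m_closed)
  show ?thesis
  proof (rule bilinI)
    fix g assume g: "g \<in> carrier ?F"
    show "(\<lambda>f. ?m f g) \<in> lin_map K ?F ?F"
      by (rule lin_map_cong[OF free_lift_lin[OF m] _ m, of "\<lambda>x. free_lift K ?F (\<lambda>y. single K (x \<otimes>\<^bsub>M\<^esub> y)) g"])
        (use lin_map_closed[OF r g] g in \<open>auto simp: monoid_algebra_mult_sum[OF M]\<close>)
  next
    fix f assume f: "f \<in> carrier ?F"
    then have "finite (supp K f)" "\<And>x. f x \<in> carrier K" "\<And>x. x \<in> supp K f \<Longrightarrow> x \<in> carrier M"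
      by (auto simp: free_mod_carrier)
    then have "(\<lambda>g. \<Oplus>\<^bsub>?F\<^esub>x\<in>supp K f. f x \<odot>\<^bsub>?F\<^esub> free_lift K ?F (\<lambda>y. single K (x \<otimes>\<^bsub>M\<^esub> y)) g) \<in> lin_map K ?F ?F"
      by (intro lin_finsum lin_smult m r)
    then show "(\<lambda>g. ?m f g) \<in> lin_map K ?F ?F"
      by (rule lin_map_cong) (simp_all add: monoid_algebra_mult_sum[OF M f] free_lift_def[of K ?F _ f] m)
  qed
qed

lemma k_algebra_monoid_algebra:
  assumes M: "monoid M"
  shows "k_algebra K (monoid_algebra K M)"
proof (rule k_algebraI_span[OF field_K, where S = "single K ` carrier M"])
  interpret M: monoid M by fact
  note sl = same_lin_monoid_algebra[of M]
  show "module K (monoid_algebra K M)"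
    using module_cong[OF _ module_free_mod, of "carrier M" "monoid_algebra K M"] by (simp add: same_lin_def)
  show "mult (monoid_algebra K M) \<in> bilin K (monoid_algebra K M) (monoid_algebra K M) (monoid_algebra K M)"
    using monoid_algebra_mult_bilin[OF M] by (simp add: bilin_def lin_map_cong_record[OF sl sl])
  show "lin_span K (monoid_algebra K M) (single K ` carrier M) = carrier (monoid_algebra K M)"
    using free_mod_span[of "carrier M"] by (simp add: lin_span_cong[OF sl])
qed (use M in \<open>auto simp: monoid_algebra_single[OF M] monoid.m_closed monoid.m_assoc\<close>)

lemma free_lift_alg_hom:
  assumes M: "monoid M" and B: "k_algebra K B"
    and \<phi>: "\<phi> \<in> carrier M \<rightarrow> carrier B" "\<phi> \<one>\<^bsub>M\<^esub> = \<one>\<^bsub>B\<^esub>"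
      "\<And>x y. x \<in> carrier M \<Longrightarrow> y \<in> carrier M \<Longrightarrow> \<phi> (x \<otimes>\<^bsub>M\<^esub> y) = \<phi> x \<otimes>\<^bsub>B\<^esub> \<phi> y"
  shows "free_lift K B \<phi> \<in> alg_hom K (monoid_algebra K M) B"
proof (rule alg_homI_span[where S = "single K ` carrier M"])
  interpret M: monoid M by fact
  note A = k_algebra_monoid_algebra[OF M]
  note sl = same_lin_monoid_algebra[of M]
  note mB = k_algebra.is_module[OF B]
  show "module K (monoid_algebra K M)" by (rule k_algebra.is_module[OF A])
  show "module K B" by (rule mB)
  show "free_lift K B \<phi> \<in> lin_map K (monoid_algebra K M) B"
    using free_lift_lin[OF mB \<phi>(1)] by (simp add: lin_map_cong_record[OF sl same_lin_refl])
  show "free_lift K B \<phi> \<one>\<^bsub>monoid_algebra K M\<^esub> = \<one>\<^bsub>B\<^esub>" using \<phi>(1,2) free_lift_single[OF mB, of \<phi> "\<one>\<^bsub>M\<^esub>"] funcset_mem[OF \<phi>(1) M.one_closed] by simp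
  show "lin_span K (monoid_algebra K M) (single K ` carrier M) = carrier (monoid_algebra K M)"
    using free_mod_span[of "carrier M"] by (simp add: lin_span_cong[OF sl])
  fix x y assume "x \<in> single K ` carrier M" "y \<in> single K ` carrier M"
  then show "free_lift K B \<phi> (x \<otimes>\<^bsub>monoid_algebra K M\<^esub> y) = free_lift K B \<phi> x \<otimes>\<^bsub>B\<^esub> free_lift K B \<phi> y"
    using \<phi> M.m_closed bilin_closed[OF k_algebra_mult_bilin[OF B]] by (auto simp: monoid_algebra_single[OF M] free_lift_single[OF mB] Pi_iff)
qed (use k_algebra_mult_bilin[OF B] k_algebra_mult_bilin[OF k_algebra_monoid_algebra[OF M]] in auto)

subsection \<open>Quotients by ideals\<close>

text \<open>Scaling by a is multiplication by the ring element a 1, which an ideal absorbs.\<close>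

lemma ideal_submodule:
  assumes A: "k_algebra K A" and I: "ideal I A"
  shows "submodule I K A"
proof -
  interpret A: k_algebra K A by fact
  interpret I: ideal I A by fact
  have "a \<odot>\<^bsub>A\<^esub> x \<in> I" if "a \<in> carrier K" "x \<in> I" for a x
  proof -
    have x: "x \<in> carrier A" using that I.a_subset by auto
    have c: "a \<odot>\<^bsub>A\<^esub> \<one>\<^bsub>A\<^esub> \<in> carrier A" using module_closures(3)[OF A.is_module that(1)] by simp
    have "(a \<odot>\<^bsub>A\<^esub> \<one>\<^bsub>A\<^esub>) \<otimes>\<^bsub>A\<^esub> x = a \<odot>\<^bsub>A\<^esub> x"
      using A.smult_mult_left[OF that(1) _ x, of "\<one>\<^bsub>A\<^esub>"] x by simp
    with I.I_l_closed[OF that(2) c] show ?thesis by simp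
  qed
  then show ?thesis by (intro submoduleI'[OF A.is_module]) (use I.a_subset in auto)
qed

lemma k_algebra_quot:
  assumes A: "k_algebra K A" and I: "ideal I A"
  shows "k_algebra K (quot A I)" and quot_proj_alg_hom: "(\<lambda>x. I +>\<^bsub>A\<^esub> x) \<in> alg_hom K A (quot A I)"
proof -
  interpret A: k_algebra K A by fact
  interpret I: ideal I A by fact
  interpret Q: quot_space K A I by (intro quot_space.intro A.is_module ideal_submodule A I)
  have m: "(I +>\<^bsub>A\<^esub> x) \<otimes>\<^bsub>quot A I\<^esub> (I +>\<^bsub>A\<^esub> y) = I +>\<^bsub>A\<^esub> (x \<otimes>\<^bsub>A\<^esub> y)" if "x \<in> carrier A" "y \<in> carrier A" for x y
    using I.rcoset_mult_add[OF that] by (simp add: quot_simps)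
  have one: "\<one>\<^bsub>quot A I\<^esub> = I +>\<^bsub>A\<^esub> \<one>\<^bsub>A\<^esub>" by (simp add: quot_simps)
  note c = Q.quot_carrier
  note ops = m one Q.quot_add Q.quot_smult
  show "k_algebra K (quot A I)"
  proof (rule k_algebraI_span[OF field_K Q.module_quot _ _ subset_refl lin_span_carrier[OF Q.module_quot]])
    show "mult (quot A I) \<in> bilin K (quot A I) (quot A I) (quot A I)"
      by (intro bilinI lin_mapI)
        (auto simp: c ops I.l_distr I.r_distr A.smult_mult_left A.smult_mult_right)
  qed (auto simp: c ops I.m_assoc)
  show "(\<lambda>x. I +>\<^bsub>A\<^esub> x) \<in> alg_hom K A (quot A I)"
    by (rule alg_homI[OF Q.quot_proj_lin]) (auto simp: ops)
qed

text \<open>The kernel of f is an ideal that contains R, hence the ideal generated by R. So f is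
  constant on cosets and any choice of representatives defines the same map.\<close>

lemma quot_alg_lift:
  assumes A: "k_algebra K A" and B: "k_algebra K B" and f: "f \<in> alg_hom K A B"
    and R: "R \<subseteq> carrier A" "\<And>r. r \<in> R \<Longrightarrow> f r = \<zero>\<^bsub>B\<^esub>"
  obtains g where "g \<in> alg_hom K (quot A (genideal A R)) B"
    "\<And>x. x \<in> carrier A \<Longrightarrow> g (genideal A R +>\<^bsub>A\<^esub> x) = f x"
proof -
  interpret A: k_algebra K A by fact
  interpret Ar: ring A by (rule A.is_ring)
  interpret B: k_algebra K B by fact
  interpret Br: ring B by (rule B.is_ring)
  let ?I = "genideal A R"
  interpret I: ideal ?I A by (rule Ar.genideal_ideal[OF R(1)])
  note I = I.ideal_axioms
  interpret Q: quot_space K A ?I by (intro quot_space.intro A.is_module ideal_submodule A I)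
  note flin = alg_hom_lin[OF f]
  let ?N = "{x \<in> carrier A. f x = \<zero>\<^bsub>B\<^esub>}"
  have "submodule ?N K A"
    by (rule submoduleI'[OF A.is_module])
      (use lin_map_zero[OF flin A.is_module B.is_module] module_closures[OF B.is_module] in
        \<open>auto simp: lin_map_add[OF flin] lin_map_smult[OF flin] module.smult_r_null[OF B.is_module]\<close>)
  then have "ideal ?N A"
    by (intro idealI A.is_ring) (auto simp: submodule_def alg_hom_mult[OF f] alg_hom_closed[OF f])
  then have "?I \<subseteq> ?N" by (rule Ar.genideal_minimal) (use R in auto)
  then have N: "f x = \<zero>\<^bsub>B\<^esub>" if "x \<in> ?I" for x using that by auto
  have wd: "f x = f y" if "x \<in> carrier A" "y \<in> carrier A" "?I +>\<^bsub>A\<^esub> x = ?I +>\<^bsub>A\<^esub> y" for x y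
    using N[of "x \<ominus>\<^bsub>A\<^esub> y"] Q.quot_eq[OF that(1,2)] that(3) lin_map_diff[OF flin A.is_module B.is_module that(1,2)]
    by (intro module_diff_zero[OF B.is_module _ alg_hom_closed[OF f that(1)] alg_hom_closed[OF f that(2)]]) simp
  define g where "g X = f (SOME x. x \<in> carrier A \<and> X = ?I +>\<^bsub>A\<^esub> x)" for X
  have g: "g (?I +>\<^bsub>A\<^esub> x) = f x" if "x \<in> carrier A" for x
  proof -
    have s: "(SOME y. y \<in> carrier A \<and> ?I +>\<^bsub>A\<^esub> x = ?I +>\<^bsub>A\<^esub> y) \<in> carrier A \<and>
      ?I +>\<^bsub>A\<^esub> x = ?I +>\<^bsub>A\<^esub> (SOME y. y \<in> carrier A \<and> ?I +>\<^bsub>A\<^esub> x = ?I +>\<^bsub>A\<^esub> y)"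
      by (rule someI_ex) (use that in blast)
    show ?thesis unfolding g_def by (rule wd[OF conjunct1[OF s] that conjunct2[OF s, symmetric]])
  qed
  note p = quot_proj_alg_hom[OF A I]
  have "g \<in> alg_hom K (quot A ?I) B"
  proof (intro alg_homI lin_mapI, unfold Q.quot_carrier)
    show "g \<one>\<^bsub>quot A ?I\<^esub> = \<one>\<^bsub>B\<^esub>"
      by (simp only: alg_hom_one[OF p, symmetric] g Ar.one_closed alg_hom_one[OF f])
  qed (elim imageE; simp only: g alg_hom_closed[OF f] alg_hom_lin[OF p, THEN lin_map_add, symmetric]
      alg_hom_lin[OF p, THEN lin_map_smult, symmetric] alg_hom_mult[OF p, symmetric] Ar.a_closed Ar.m_closed
      module_closures(3)[OF A.is_module] lin_map_add[OF flin] lin_map_smult[OF flin] alg_hom_mult[OF f])+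
  with g that show ?thesis by blast
qed

lemma tlift_pt_id:
  assumes V: "module K V" and W: "module K W" and t: "t \<in> carrier (tensor K V W)"
  shows "tlift K (tensor K V W) (pt K V W) t = t"
  by (rule tensor_lin_eqI[OF t V W module_tensor[OF V W] tlift_lin[OF V W module_tensor[OF V W] pt_bilin[OF V W]] lin_id])
    (rule tlift_pt[OF V W module_tensor[OF V W] pt_bilin[OF V W]])

end

subsection \<open>Finite sums\<close>

lemma finsum_delta:
  assumes "module K Z" "finite A" "a \<in> A" "x \<in> carrier Z"
  shows "(\<Oplus>\<^bsub>Z\<^esub>u\<in>A. if u = a then x else \<zero>\<^bsub>Z\<^esub>) = x"
proof -
  interpret Z: module K Z by fact
  have "(\<Oplus>\<^bsub>Z\<^esub>u\<in>A. if a = u then x else \<zero>\<^bsub>Z\<^esub>) = x"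
    using Z.finsum_singleton[OF assms(3,2), of "\<lambda>_. x"] assms(4) by simp
  moreover have "(\<lambda>u. if u = a then x else \<zero>\<^bsub>Z\<^esub>) = (\<lambda>u. if a = u then x else \<zero>\<^bsub>Z\<^esub>)" by auto
  ultimately show ?thesis by simp
qed

text \<open>Most sums over the group below are taken against delta functions, whose orthogonality
  leaves a single index.\<close>

lemma finsum_only:
  assumes Z: "module K Z" and A: "finite A" "a \<in> A" and x: "f a \<in> carrier Z"
    and eq: "\<And>u. u \<in> A \<Longrightarrow> u \<noteq> a \<Longrightarrow> f u = \<zero>\<^bsub>Z\<^esub>"
  shows "(\<Oplus>\<^bsub>Z\<^esub>u\<in>A. f u) = f a"
proof -
  interpret Z: module K Z by fact
  have "(\<Oplus>\<^bsub>Z\<^esub>u\<in>A. f u) = (\<Oplus>\<^bsub>Z\<^esub>u\<in>A. if u = a then f a else \<zero>\<^bsub>Z\<^esub>)"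
    by (rule Z.finsum_cong') (use eq x in auto)
  with finsum_delta[OF Z A x] show ?thesis by simp
qed

lemma finsum_congI:
  assumes "module K Z" "\<And>a. a \<in> A \<Longrightarrow> g a \<in> carrier Z" "\<And>a. a \<in> A \<Longrightarrow> f a = g a"
  shows "finsum Z f A = finsum Z g A"
proof -
  interpret Z: module K Z by fact
  show ?thesis by (rule Z.finsum_cong') (use assms in auto)
qed

lemma finsum_swap:
  assumes Z: "module K Z" and A: "finite A" and B: "finite B"
    and f: "\<And>a b. a \<in> A \<Longrightarrow> b \<in> B \<Longrightarrow> f a b \<in> carrier Z"
  shows "(\<Oplus>\<^bsub>Z\<^esub>a\<in>A. \<Oplus>\<^bsub>Z\<^esub>b\<in>B. f a b) = (\<Oplus>\<^bsub>Z\<^esub>b\<in>B. \<Oplus>\<^bsub>Z\<^esub>a\<in>A. f a b)"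
proof -
  interpret Z: module K Z by fact
  have inj: "inj_on (\<lambda>p. (snd p, fst p)) (B \<times> A)" by (auto intro: inj_onI)
  have "(\<Oplus>\<^bsub>Z\<^esub>p\<in>A \<times> B. f (fst p) (snd p)) = (\<Oplus>\<^bsub>Z\<^esub>p\<in>(\<lambda>p. (snd p, fst p)) ` (B \<times> A). f (fst p) (snd p))"
    by (rule Z.add.finprod_cong') (use f in \<open>auto simp: image_iff\<close>)
  also have "\<dots> = (\<Oplus>\<^bsub>Z\<^esub>p\<in>B \<times> A. f (snd p) (fst p))"
    by (subst Z.finsum_reindex[OF _ inj]) (use f in auto)
  finally show ?thesis using finsum_prod[OF Z A B, of f] finsum_prod[OF Z B A, of "\<lambda>b a. f a b"] f by simp
qed

lemma finsum_reindex_bij: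
  assumes Z: "module K Z" and h: "bij_betw h A B" and f: "\<And>b. b \<in> B \<Longrightarrow> f b \<in> carrier Z"
  shows "(\<Oplus>\<^bsub>Z\<^esub>b\<in>B. f b) = (\<Oplus>\<^bsub>Z\<^esub>a\<in>A. f (h a))"
proof -
  interpret Z: module K Z by fact
  have "(\<Oplus>\<^bsub>Z\<^esub>b\<in>h ` A. f b) = (\<Oplus>\<^bsub>Z\<^esub>a\<in>A. f (h a))"
    by (rule Z.finsum_reindex) (use assms in \<open>auto simp: bij_betw_def\<close>)
  with h show ?thesis by (simp add: bij_betw_def)
qed

subsection \<open>The Hopf algebras of a finite group\<close>

text \<open>The mirror image of \<open>right_transl\<close>: the coproduct of f is the sum over u of
  \<delta>_u \<otimes> L_u f as well as the sum over v of R_v f \<otimes> \<delta>_v.\<close>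

definition left_transl where
  "left_transl K G a f = (\<lambda>g. if g \<in> carrier G then f (a \<otimes>\<^bsub>G\<^esub> g) else \<zero>\<^bsub>K\<^esub>)"

lemma group_algebra_simps [simp]:
  "carrier (group_algebra K G) = carrier (monoid_algebra K G)"
  "add (group_algebra K G) = add (monoid_algebra K G)"
  "zero (group_algebra K G) = zero (monoid_algebra K G)"
  "smult (group_algebra K G) = smult (monoid_algebra K G)"
  "one (group_algebra K G) = one (monoid_algebra K G)"
  "mult (group_algebra K G) = mult (monoid_algebra K G)"
  by (simp_all add: group_algebra_def Let_def module.defs hopf.defs)

lemma function_algebra_simps [simp]:
  "carrier (function_algebra K G) = {f. range f \<subseteq> carrier K \<and> supp K f \<subseteq> carrier G}"
  "add (function_algebra K G) = (\<lambda>f f' g. f g \<oplus>\<^bsub>K\<^esub> f' g)"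
  "zero (function_algebra K G) = (\<lambda>_. \<zero>\<^bsub>K\<^esub>)"
  "smult (function_algebra K G) = (\<lambda>a f g. a \<otimes>\<^bsub>K\<^esub> f g)"
  "one (function_algebra K G) = (\<lambda>g. if g \<in> carrier G then \<one>\<^bsub>K\<^esub> else \<zero>\<^bsub>K\<^esub>)"
  "mult (function_algebra K G) = (\<lambda>f f' g. f g \<otimes>\<^bsub>K\<^esub> f' g)"
  by (simp_all add: function_algebra_def fun_alg_def Let_def module.defs hopf.defs)

locale kgroup = kvect K for K :: "('k, 'm) ring_scheme" +
  fixes G :: "('g, 'n) monoid_scheme"
  assumes group_G: "group G" and finite_G: "finite (carrier G)"

sublocale kgroup \<subseteq> G: group G
  by (rule group_G)

context kgroup
begin

abbreviation "KG \<equiv> group_algebra K G"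
abbreviation Gmult (infixl "\<cdot>" 70) where "g \<cdot> h \<equiv> g \<otimes>\<^bsub>G\<^esub> h"
abbreviation "inv\<^sub>G \<equiv> m_inv G"
abbreviation oneG ("\<one>\<^sub>G") where "\<one>\<^sub>G \<equiv> \<one>\<^bsub>G\<^esub>"
abbreviation KGmult (infixl "\<otimes>\<^sub>H" 70) where "x \<otimes>\<^sub>H y \<equiv> x \<otimes>\<^bsub>KG\<^esub> y"
abbreviation oneKG ("\<one>\<^sub>H") where "\<one>\<^sub>H \<equiv> \<one>\<^bsub>KG\<^esub>"
abbreviation "FG \<equiv> function_algebra K G"
abbreviation "\<R> \<equiv> right_transl K G"
abbreviation FGmult (infixl "\<otimes>\<^sub>F" 70) where "x \<otimes>\<^sub>F y \<equiv> x \<otimes>\<^bsub>FG\<^esub> y"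
abbreviation FGsmult (infixr "\<odot>\<^sub>F" 75) where "x \<odot>\<^sub>F y \<equiv> x \<odot>\<^bsub>FG\<^esub> y"
abbreviation oneFG ("\<one>\<^sub>F") where "\<one>\<^sub>F \<equiv> \<one>\<^bsub>FG\<^esub>"
abbreviation \<delta> where "\<delta> \<equiv> single K"

lemma monoid_G: "monoid G" by unfold_locales

lemma algebra_KG: "k_algebra K KG"
  by (rule k_algebra_cong[OF k_algebra_monoid_algebra[OF monoid_G]]) auto

lemmas module_KG = k_algebra.is_module[OF algebra_KG]

lemma same_lin_KG: "same_lin KG (free_mod K (carrier G))" "same_lin KG (monoid_algebra K G)"
    "same_lin (monoid_algebra K G) KG"
  by (simp_all add: same_lin_def)

text \<open>The coproduct of \<open>group_algebra\<close> is defined in the tensor square of the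
  underlying \<open>monoid_algebra\<close>; this identifies it with the tensor square of the Hopf
  record.\<close>

lemma tensor_KG_monoid_algebra:
  "tensor K (monoid_algebra K G) (monoid_algebra K G) = tensor K KG KG"
  "pt K (monoid_algebra K G) (monoid_algebra K G) = pt K KG KG"
  by (simp_all add: tensor_cong[OF same_lin_KG(3) same_lin_KG(3)] pt_cong[OF same_lin_KG(3) same_lin_KG(3)])

lemma \<delta>_KG [simp]: "g \<in> carrier G \<Longrightarrow> \<delta> g \<in> carrier KG"
  by simp

lemma KG_span: "lin_span K KG (\<delta> ` carrier G) = carrier KG"
  using free_mod_span[of "carrier G"] by (simp add: lin_span_cong[OF same_lin_KG(1)])

lemma \<delta>_sub_KG: "\<delta> ` carrier G \<subseteq> carrier KG" by auto

lemma KG_mult: "g \<in> carrier G \<Longrightarrow> h \<in> carrier G \<Longrightarrow> \<delta> g \<otimes>\<^sub>H \<delta> h = \<delta> (g \<cdot> h)"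
  by (simp add: monoid_algebra_single G.is_monoid)

lemma KG_one: "\<one>\<^sub>H = \<delta> \<one>\<^sub>G"
  by simp

lemma KG_mult_closed: "x \<in> carrier KG \<Longrightarrow> y \<in> carrier KG \<Longrightarrow> x \<otimes>\<^sub>H y \<in> carrier KG"
  using bilin_closed[OF k_algebra_mult_bilin[OF algebra_KG]] .

lemma comult_KG_eq: "comult KG = free_lift K (tensor K KG KG) (\<lambda>g. pt K KG KG (\<delta> g) (\<delta> g))"
  by (simp add: group_algebra_def[of K G, THEN arg_cong[of _ _ comult]] Let_def hopf.defs module.defs
    free_lift_def fun_eq_iff tensor_KG_monoid_algebra)

lemma lin_KG: "free_lift K Z \<phi> \<in> lin_map K KG Z" if "module K Z" "\<phi> \<in> carrier G \<rightarrow> carrier Z"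
  using free_lift_lin[OF that] by (simp add: lin_map_cong_record[OF same_lin_KG(1) same_lin_refl])

lemma comult_KG_lin: "comult KG \<in> lin_map K KG (tensor K KG KG)"
  unfolding comult_KG_eq by (intro lin_KG module_tensor module_KG) (auto intro!: pt_closed module_KG)

lemma comult_KG: "g \<in> carrier G \<Longrightarrow> comult KG (\<delta> g) = pt K KG KG (\<delta> g) (\<delta> g)"
  unfolding comult_KG_eq by (intro free_lift_single module_tensor pt_closed module_KG) auto

lemma counit_KG_eq: "f \<in> carrier KG \<Longrightarrow> counit KG f = free_lift K (ground K) (\<lambda>g. \<one>\<^bsub>K\<^esub>) f"
proof -
  assume f: "f \<in> carrier KG"
  have fs: "finsum K f (supp K f) = finsum (ground K) f (supp K f)"
    by (rule fun_cong[OF fun_cong[OF finsum_record_cong]]) simp_all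
  have "counit KG f = finsum K f (supp K f)"
    by (simp add: group_algebra_def Let_def hopf.defs module.defs)
  also have "\<dots> = (\<Oplus>\<^bsub>ground K\<^esub>g\<in>supp K f. f g \<odot>\<^bsub>ground K\<^esub> \<one>\<^bsub>K\<^esub>)"
    unfolding fs by (rule finsum_congI[OF module_ground]) (use f in \<open>auto simp: free_mod_carrier\<close>)
  finally show ?thesis by (simp add: free_lift_def)
qed

lemma counit_KG_lin: "counit KG \<in> lin_map K KG (ground K)"
  by (rule lin_map_cong[OF lin_KG[OF module_ground, of "\<lambda>g. \<one>\<^bsub>K\<^esub>"]]) (simp_all only: counit_KG_eq module_KG, simp)

lemma counit_KG: "g \<in> carrier G \<Longrightarrow> counit KG (\<delta> g) = \<one>\<^bsub>K\<^esub>"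
  using counit_KG_eq[of "\<delta> g"] free_lift_single[OF module_ground, of "\<lambda>g. \<one>\<^bsub>K\<^esub>"] by simp

lemma KG_eqI:
  assumes "module K Z" "(\<lambda>x. f x) \<in> lin_map K KG Z" "(\<lambda>x. g x) \<in> lin_map K KG Z"
    "\<And>u. u \<in> carrier G \<Longrightarrow> f (\<delta> u) = g (\<delta> u)" "x \<in> carrier KG"
  shows "f x = g x"
  by (rule lin_span_eqI[OF module_KG assms(1-3) \<delta>_sub_KG]) (use assms KG_span in auto)

lemma tlift_comult_KG:
  assumes "g \<in> carrier G" "module K Z" "\<phi> \<in> bilin K KG KG Z"
  shows "tlift K Z \<phi> (comult KG (\<delta> g)) = \<phi> (\<delta> g) (\<delta> g)"
  using assms by (simp only: comult_KG tlift_pt[OF module_KG module_KG] \<delta>_KG)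

lemmas KG_lins = lins lin_comp[OF comult_KG_lin] lin_comp[OF counit_KG_lin] lin_map_closed[OF comult_KG_lin]
  lin_map_closed[OF counit_KG_lin, simplified ground_simps] lin_scal

text \<open>Each \<delta> g is group-like, so on the basis every coalgebra law is an identity
  between pure tensors of copies of \<delta> g.\<close>

lemma coalgebra_KG: "k_coalgebra K KG"
proof (rule k_coalgebra.intro)
  note m = module_KG
  let ?TT = "tensor K KG (tensor K KG KG)"
  note mTT = module_tensor[OF m module_tensor[OF m m]]
  fix c assume c: "c \<in> carrier KG"
  have b1: "(\<lambda>x y. pt K KG (tensor K KG KG) x (comult KG y)) \<in> bilin K KG KG ?TT"
    by (rule KG_lins | assumption | rule m)+
  have b3: "(\<lambda>x1 x2. pt K KG (tensor K KG KG) x1 (pt K KG KG x2 y)) \<in> bilin K KG KG ?TT" if "y \<in> carrier KG" for y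
    using that by - (rule KG_lins | assumption | rule m)+
  have b2: "(\<lambda>x y. tlift K ?TT (\<lambda>x1 x2. pt K KG (tensor K KG KG) x1 (pt K KG KG x2 y)) (comult KG x)) \<in> bilin K KG KG ?TT"
    by (rule KG_lins | assumption | rule m)+
  show "tlift K ?TT (\<lambda>x y. pt K KG (tensor K KG KG) x (comult KG y)) (comult KG c) =
    tlift K ?TT (\<lambda>x y. tlift K ?TT (\<lambda>x1 x2. pt K KG (tensor K KG KG) x1 (pt K KG KG x2 y)) (comult KG x)) (comult KG c)"
    by (rule KG_eqI[OF mTT lin_comp[OF tlift_lin[OF m m mTT b1] comult_KG_lin] lin_comp[OF tlift_lin[OF m m mTT b2] comult_KG_lin] _ c])
      (simp only: tlift_comult_KG[OF _ mTT] b1 b2 b3 \<delta>_KG, simp only: comult_KG)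
  have b4: "(\<lambda>x y. counit KG x \<odot>\<^bsub>KG\<^esub> y) \<in> bilin K KG KG KG"
    by (rule KG_lins counit_KG_lin | assumption | rule m)+
  show "tlift K KG (\<lambda>x y. counit KG x \<odot>\<^bsub>KG\<^esub> y) (comult KG c) = c"
    by (rule KG_eqI[OF m lin_comp[OF tlift_lin[OF m m m b4] comult_KG_lin] lin_id _ c])
      (simp only: tlift_comult_KG[OF _ m b4] counit_KG module.smult_one[OF m] \<delta>_KG)
  have b5: "(\<lambda>x y. counit KG y \<odot>\<^bsub>KG\<^esub> x) \<in> bilin K KG KG KG"
    by (rule KG_lins counit_KG_lin | assumption | rule m)+
  show "tlift K KG (\<lambda>x y. counit KG y \<odot>\<^bsub>KG\<^esub> x) (comult KG c) = c"
    by (rule KG_eqI[OF m lin_comp[OF tlift_lin[OF m m m b5] comult_KG_lin] lin_id _ c])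
      (simp only: tlift_comult_KG[OF _ m b5] counit_KG module.smult_one[OF m] \<delta>_KG)
qed (simp_all only: field_K module_KG comult_KG_lin counit_KG_lin)

lemma antipode_KG: "is_antipode K KG (free_lift K KG (\<lambda>g. \<delta> (inv\<^sub>G g)))"
proof -
  note m = module_KG
  let ?S = "free_lift K KG (\<lambda>g. \<delta> (inv\<^sub>G g))"
  have S: "?S \<in> lin_map K KG KG" by (rule lin_KG[OF m]) auto
  have S\<delta>: "?S (\<delta> g) = \<delta> (inv\<^sub>G g)" if "g \<in> carrier G" for g
    using that by (intro free_lift_single[OF m]) auto
  have b: "(\<lambda>x y. ?S x \<otimes>\<^sub>H y) \<in> bilin K KG KG KG" "(\<lambda>x y. x \<otimes>\<^sub>H ?S y) \<in> bilin K KG KG KG"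
    by (rule KG_lins S algebra_KG lin_map_closed[OF S] | assumption | rule m)+
  have r: "(\<lambda>a. counit KG a \<odot>\<^bsub>KG\<^esub> \<one>\<^sub>H) \<in> lin_map K KG KG"
    by (rule lin_scal[OF m m counit_KG_lin]) simp
  have "tlift K KG (\<lambda>x y. ?S x \<otimes>\<^sub>H y) (comult KG a) = counit KG a \<odot>\<^bsub>KG\<^esub> \<one>\<^sub>H" if "a \<in> carrier KG" for a
    by (rule KG_eqI[OF m lin_comp[OF tlift_lin[OF m m m b(1)] comult_KG_lin] r _ that])
      (simp only: tlift_comult_KG[OF _ m b(1)] counit_KG module.smult_one[OF m] S\<delta> KG_mult G.inv_closed KG_one \<delta>_KG G.one_closed G.l_inv)
  moreover have "tlift K KG (\<lambda>x y. x \<otimes>\<^sub>H ?S y) (comult KG a) = counit KG a \<odot>\<^bsub>KG\<^esub> \<one>\<^sub>H" if "a \<in> carrier KG" for a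
    by (rule KG_eqI[OF m lin_comp[OF tlift_lin[OF m m m b(2)] comult_KG_lin] r _ that])
      (simp only: tlift_comult_KG[OF _ m b(2)] counit_KG module.smult_one[OF m] S\<delta> KG_mult G.inv_closed KG_one \<delta>_KG G.one_closed G.r_inv)
  ultimately show ?thesis using S by (simp only: is_antipode_def) blast
qed

lemma alg_hom_tensor_algI:
  assumes A: "k_algebra K A" and B: "k_algebra K B" and C: "k_algebra K C"
    and f: "f \<in> lin_map K A (tensor K B C)" and f1: "f \<one>\<^bsub>A\<^esub> = pt K B C \<one>\<^bsub>B\<^esub> \<one>\<^bsub>C\<^esub>"
    and S: "S \<subseteq> carrier A" "lin_span K A S = carrier A"
    and m: "\<And>x y. x \<in> S \<Longrightarrow> y \<in> S \<Longrightarrow> f (x \<otimes>\<^bsub>A\<^esub> y) = f x \<otimes>\<^bsub>tensor_alg K B C\<^esub> f y"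
  shows "f \<in> alg_hom K A (tensor_alg K B C)"
proof -
  note T = k_algebra_tensor_alg[OF B C]
  show ?thesis
    by (rule alg_homI_span[OF k_algebra.is_module[OF A] k_algebra.is_module[OF T] _ _
          k_algebra_mult_bilin[OF A] k_algebra_mult_bilin[OF T] S m])
      (use f f1 in \<open>simp_all add: lin_map_cong_record[OF same_lin_refl same_lin_tensor_alg(1)]\<close>)
qed

lemma k_algebra_ground: "k_algebra K (ground K)"
proof (rule k_algebra.intro[OF field_K module_ground])
  show "ring (ground K)"
    by (intro ringI abelian_group_module[OF module_ground] monoidI)
      (simp_all add: K.m_assoc K.l_distr K.r_distr)
qed (auto simp: K.m_ac)

lemma hopf_KG: "hopf_algebra K KG"
proof (rule hopf_algebra.intro[OF algebra_KG coalgebra_KG])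
  show "comult KG \<in> alg_hom K KG (tensor_alg K KG KG)"
    by (rule alg_hom_tensor_algI[OF algebra_KG algebra_KG algebra_KG comult_KG_lin _ \<delta>_sub_KG KG_span])
      (auto simp only: KG_one comult_KG G.one_closed KG_mult G.m_closed tensor_alg_mult_pt[OF algebra_KG algebra_KG] \<delta>_KG)
  show "counit KG \<in> alg_hom K KG (ground K)"
    by (rule alg_homI_span[OF module_KG module_ground counit_KG_lin _ k_algebra_mult_bilin[OF algebra_KG]
      k_algebra_mult_bilin[OF k_algebra_ground] \<delta>_sub_KG KG_span])
     (auto simp only: KG_one counit_KG G.one_closed KG_mult G.m_closed ground_simps K.one_closed K.l_one)
  show "\<exists>S. is_antipode K KG S" using antipode_KG by blast
qed

text \<open>On a finite group all functions have finite support, so functions and formal sums form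
  the same vector space and the delta functions are a basis of both.\<close>

lemma same_lin_FG: "same_lin FG (free_mod K (carrier G))"
  using finite_subset[OF _ finite_G] by (auto simp: same_lin_def free_mod_carrier image_subset_iff)

lemma FG_carrier: "f \<in> carrier FG \<longleftrightarrow> (\<forall>x. f x \<in> carrier K) \<and> (\<forall>x. x \<notin> carrier G \<longrightarrow> f x = \<zero>\<^bsub>K\<^esub>)"
  by (auto simp: supp_def)

lemma module_FG: "module K FG"
  using module_cong[OF _ module_free_mod, of "carrier G" FG] same_lin_FG by (simp add: same_lin_def)

lemma \<delta>_FG [simp]: "g \<in> carrier G \<Longrightarrow> \<delta> g \<in> carrier FG"
  using single_closed[of g "carrier G"] same_lin_FG by (simp add: same_lin_def)

lemma FG_span: "lin_span K FG (\<delta> ` carrier G) = carrier FG"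
  using free_mod_span[of "carrier G"] same_lin_FG lin_span_cong[OF same_lin_FG, of K] by (simp add: same_lin_def)

lemma algebra_FG: "k_algebra K FG"
proof (rule k_algebraI_span[OF field_K module_FG _ _ subset_refl lin_span_carrier[OF module_FG]])
  show "mult FG \<in> bilin K FG FG FG"
    by (intro bilinI lin_mapI)
      (auto simp: FG_carrier K.l_distr K.r_distr K.m_ac simp del: function_algebra_simps(1))
qed (auto simp: FG_carrier K.m_ac fun_eq_iff simp del: function_algebra_simps(1))

lemma eval_lin: "x \<in> carrier G \<Longrightarrow> (\<lambda>f. f x) \<in> lin_map K FG (ground K)"
  by (rule lin_mapI) (auto simp: FG_carrier simp del: function_algebra_simps(1))

lemma FG_sum:
  assumes f: "f \<in> carrier FG"
  shows "(\<Oplus>\<^bsub>FG\<^esub>u\<in>carrier G. f u \<odot>\<^sub>F \<delta> u) = f"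
proof
  fix x
  have cl: "f u \<odot>\<^sub>F \<delta> u \<in> carrier FG" if "u \<in> carrier G" for u
    using that f by (intro module_closures(3)[OF module_FG] \<delta>_FG) (auto simp: FG_carrier simp del: function_algebra_simps)
  have "(\<Oplus>\<^bsub>FG\<^esub>u\<in>carrier G. f u \<odot>\<^sub>F \<delta> u) x = (\<Oplus>\<^bsub>K\<^esub>u\<in>carrier G. (f u \<odot>\<^sub>F \<delta> u) x)"
    by (rule finsum_apply[OF cring_K _ _ module_FG _ finite_G cl]) auto
  also have "\<dots> = (\<Oplus>\<^bsub>K\<^esub>u\<in>carrier G. if x = u then f u else \<zero>\<^bsub>K\<^esub>)"
    by (rule K.finsum_cong') (use f in \<open>auto simp: FG_carrier single_def simp del: function_algebra_simps(1)\<close>)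
  also have "\<dots> = f x"
  proof (cases "x \<in> carrier G")
    case True
    then show ?thesis using f K.finsum_singleton[OF True finite_G, of f]
      by (auto simp: FG_carrier simp del: function_algebra_simps(1))
  next
    case False
    then have "(\<Oplus>\<^bsub>K\<^esub>u\<in>carrier G. if x = u then f u else \<zero>\<^bsub>K\<^esub>) = (\<Oplus>\<^bsub>K\<^esub>u\<in>carrier G. \<zero>\<^bsub>K\<^esub>)"
      by (intro K.finsum_cong') auto
    with False f show ?thesis by (simp add: FG_carrier del: function_algebra_simps(1))
  qed
  finally show "(\<Oplus>\<^bsub>FG\<^esub>u\<in>carrier G. f u \<odot>\<^sub>F \<delta> u) x = f x" .
qed

lemma right_transl_alg_hom: "a \<in> carrier G \<Longrightarrow> \<R> a \<in> alg_hom K FG FG"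
  by (intro alg_homI lin_mapI)
    (auto simp: FG_carrier right_transl_def fun_eq_iff simp del: function_algebra_simps(1))

lemma left_transl_alg_hom: "a \<in> carrier G \<Longrightarrow> left_transl K G a \<in> alg_hom K FG FG"
  by (intro alg_homI lin_mapI)
    (auto simp: FG_carrier left_transl_def fun_eq_iff simp del: function_algebra_simps(1))

lemmas right_transl_lin = alg_hom_lin[OF right_transl_alg_hom]
  and left_transl_lin = alg_hom_lin[OF left_transl_alg_hom]

lemmas right_transl_closed = lin_map_closed[OF right_transl_lin]
  and left_transl_closed = lin_map_closed[OF left_transl_lin]

lemma left_right_transl: "a \<in> carrier G \<Longrightarrow> b \<in> carrier G \<Longrightarrow>
    left_transl K G a (\<R> b f) = \<R> b (left_transl K G a f)"
  by (auto simp: left_transl_def right_transl_def fun_eq_iff G.m_assoc)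

lemma comult_FG_eq: "comult FG = (\<lambda>f. \<Oplus>\<^bsub>tensor K FG FG\<^esub>p\<in>carrier G \<times> carrier G.
      f (fst p \<cdot> snd p) \<odot>\<^bsub>tensor K FG FG\<^esub> pt K FG FG (\<delta> (fst p)) (\<delta> (snd p)))"
proof -
  have sl: "same_lin (fun_alg K G) FG" by (simp add: same_lin_def fun_alg_def)
  have "comult FG = (\<lambda>f. \<Oplus>\<^bsub>tensor K (fun_alg K G) (fun_alg K G)\<^esub>p\<in>carrier G \<times> carrier G.
      f (fst p \<cdot> snd p) \<odot>\<^bsub>tensor K (fun_alg K G) (fun_alg K G)\<^esub> pt K (fun_alg K G) (fun_alg K G) (\<delta> (fst p)) (\<delta> (snd p)))"
    by (simp add: function_algebra_def Let_def hopf.defs module.defs)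
  then show ?thesis by (simp only: tensor_cong[OF sl sl] pt_cong[OF sl sl])
qed

lemma comult_FG_lin: "comult FG \<in> lin_map K FG (tensor K FG FG)"
  unfolding comult_FG_eq
  by (intro lin_finsum lin_scal module_FG module_tensor finite_cartesian_product finite_G eval_lin pt_closed \<delta>_FG) auto

lemma counit_FG: "counit FG f = f \<one>\<^sub>G"
  by (simp add: function_algebra_def Let_def hopf.defs module.defs)

lemma counit_FG_lin: "counit FG \<in> lin_map K FG (ground K)"
  using eval_lin[OF G.one_closed] by (simp add: counit_FG[abs_def, symmetric] flip: counit_FG)

text \<open>Summing the double sum over one index reassembles a translate of f in delta functions.
  Later proofs use whichever of the two single sums has its delta function in the leg that
  collapses.\<close>

lemma tlift_comult_FG:
  assumes f: "f \<in> carrier FG" and Z: "module K Z" and \<phi>: "\<phi> \<in> bilin K FG FG Z"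
  shows tlift_comult_FG_right: "tlift K Z \<phi> (comult FG f) = (\<Oplus>\<^bsub>Z\<^esub>v\<in>carrier G. \<phi> (\<R> v f) (\<delta> v))"
    and tlift_comult_FG_left: "tlift K Z \<phi> (comult FG f) = (\<Oplus>\<^bsub>Z\<^esub>u\<in>carrier G. \<phi> (\<delta> u) (left_transl K G u f))"
proof -
  note m = module_FG
  note T = module_tensor[OF m m]
  have fK: "f x \<in> carrier K" for x using f by (simp add: FG_carrier del: function_algebra_simps)
  have \<phi>c: "\<phi> (\<delta> u) (\<delta> v) \<in> carrier Z" if "u \<in> carrier G" "v \<in> carrier G" for u v
    using bilin_closed[OF \<phi>] that by (simp del: function_algebra_simps)
  have tc: "f (u \<cdot> v) \<odot>\<^bsub>Z\<^esub> \<phi> (\<delta> u) (\<delta> v) \<in> carrier Z" if "u \<in> carrier G" "v \<in> carrier G" for u v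
    using that fK \<phi>c by (intro module_closures(3)[OF Z])
  have pc: "pt K FG FG (\<delta> u) (\<delta> v) \<in> carrier (tensor K FG FG)" if "u \<in> carrier G" "v \<in> carrier G" for u v
    by (intro pt_closed m \<delta>_FG that)
  have 1: "tlift K Z \<phi> (comult FG f) = (\<Oplus>\<^bsub>Z\<^esub>p\<in>carrier G \<times> carrier G.
      f (fst p \<cdot> snd p) \<odot>\<^bsub>Z\<^esub> \<phi> (\<delta> (fst p)) (\<delta> (snd p)))"
    unfolding comult_FG_eq
  proof (subst lin_map_finsum[OF tlift_lin[OF m m Z \<phi>] T Z])
    show "finite (carrier G \<times> carrier G)" using finite_G by simp
    show "f (fst a \<cdot> snd a) \<odot>\<^bsub>tensor K FG FG\<^esub> pt K FG FG (\<delta> (fst a)) (\<delta> (snd a)) \<in> carrier (tensor K FG FG)"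
      if "a \<in> carrier G \<times> carrier G" for a
      using that by (intro module_closures(3)[OF T] pc fK) auto
    show "(\<Oplus>\<^bsub>Z\<^esub>a\<in>carrier G \<times> carrier G. tlift K Z \<phi> (f (fst a \<cdot> snd a) \<odot>\<^bsub>tensor K FG FG\<^esub> pt K FG FG (\<delta> (fst a)) (\<delta> (snd a)))) =
      (\<Oplus>\<^bsub>Z\<^esub>p\<in>carrier G \<times> carrier G. f (fst p \<cdot> snd p) \<odot>\<^bsub>Z\<^esub> \<phi> (\<delta> (fst p)) (\<delta> (snd p)))"
    proof (rule finsum_congI[OF Z])
      fix p assume p: "p \<in> carrier G \<times> carrier G"
      then have pG: "fst p \<in> carrier G" "snd p \<in> carrier G" by auto
      show "f (fst p \<cdot> snd p) \<odot>\<^bsub>Z\<^esub> \<phi> (\<delta> (fst p)) (\<delta> (snd p)) \<in> carrier Z" by (rule tc[OF pG])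
      show "tlift K Z \<phi> (f (fst p \<cdot> snd p) \<odot>\<^bsub>tensor K FG FG\<^esub> pt K FG FG (\<delta> (fst p)) (\<delta> (snd p)))
          = f (fst p \<cdot> snd p) \<odot>\<^bsub>Z\<^esub> \<phi> (\<delta> (fst p)) (\<delta> (snd p))"
        by (simp only: lin_map_smult[OF tlift_lin[OF m m Z \<phi>] fK pc[OF pG]] tlift_pt[OF m m Z \<phi> \<delta>_FG \<delta>_FG] pG)
    qed
  qed
  have 2: "\<dots> = (\<Oplus>\<^bsub>Z\<^esub>u\<in>carrier G. \<Oplus>\<^bsub>Z\<^esub>v\<in>carrier G. f (u \<cdot> v) \<odot>\<^bsub>Z\<^esub> \<phi> (\<delta> u) (\<delta> v))"
    by (rule finsum_prod[OF Z finite_G finite_G tc])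
  have 3: "\<dots> = (\<Oplus>\<^bsub>Z\<^esub>v\<in>carrier G. \<Oplus>\<^bsub>Z\<^esub>u\<in>carrier G. f (u \<cdot> v) \<odot>\<^bsub>Z\<^esub> \<phi> (\<delta> u) (\<delta> v))"
    by (rule finsum_swap[OF Z finite_G finite_G tc])
  have fd: "f y \<odot>\<^sub>F \<delta> x \<in> carrier FG" if "x \<in> carrier G" for x y
    by (intro module_closures(3)[OF m] \<delta>_FG fK that)
  have R: "(\<Oplus>\<^bsub>Z\<^esub>u\<in>carrier G. f (u \<cdot> v) \<odot>\<^bsub>Z\<^esub> \<phi> (\<delta> u) (\<delta> v)) = \<phi> (\<R> v f) (\<delta> v)"
    if v: "v \<in> carrier G" for v
  proof -
    have e: "\<R> v f = (\<Oplus>\<^bsub>FG\<^esub>u\<in>carrier G. f (u \<cdot> v) \<odot>\<^sub>F \<delta> u)"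
      by (subst FG_sum[OF right_transl_closed[OF v f], symmetric], rule finsum_congI[OF m])
        (use fd in \<open>auto simp: right_transl_def simp del: function_algebra_simps\<close>)
    show ?thesis unfolding e
      by (subst lin_map_finsum[OF bilin_left[OF \<phi> \<delta>_FG[OF v]] m Z finite_G fd], simp, rule finsum_congI[OF Z])
        (use \<phi>c fK v in \<open>auto simp: lin_map_smult[OF bilin_left[OF \<phi> \<delta>_FG[OF v]]] \<delta>_FG simp del: function_algebra_simps
          intro!: module_closures(3)[OF Z] tc\<close>)
  qed
  have L: "(\<Oplus>\<^bsub>Z\<^esub>v\<in>carrier G. f (u \<cdot> v) \<odot>\<^bsub>Z\<^esub> \<phi> (\<delta> u) (\<delta> v)) = \<phi> (\<delta> u) (left_transl K G u f)"
    if u: "u \<in> carrier G" for u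
  proof -
    have e: "left_transl K G u f = (\<Oplus>\<^bsub>FG\<^esub>v\<in>carrier G. f (u \<cdot> v) \<odot>\<^sub>F \<delta> v)"
      by (subst FG_sum[OF left_transl_closed[OF u f], symmetric], rule finsum_congI[OF m])
        (use fd in \<open>auto simp: left_transl_def simp del: function_algebra_simps\<close>)
    show ?thesis unfolding e
      by (subst lin_map_finsum[OF bilin_right[OF \<phi> \<delta>_FG[OF u]] m Z finite_G fd], simp, rule finsum_congI[OF Z])
        (use \<phi>c fK u in \<open>auto simp: lin_map_smult[OF bilin_right[OF \<phi> \<delta>_FG[OF u]]] \<delta>_FG simp del: function_algebra_simps
          intro!: module_closures(3)[OF Z] tc\<close>)
  qed
  show "tlift K Z \<phi> (comult FG f) = (\<Oplus>\<^bsub>Z\<^esub>v\<in>carrier G. \<phi> (\<R> v f) (\<delta> v))"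
    unfolding 1 2 3 by (rule finsum_congI[OF Z _ R])
      (use bilin_closed[OF \<phi>] right_transl_closed f \<delta>_FG in \<open>auto simp del: function_algebra_simps\<close>)
  show "tlift K Z \<phi> (comult FG f) = (\<Oplus>\<^bsub>Z\<^esub>u\<in>carrier G. \<phi> (\<delta> u) (left_transl K G u f))"
    unfolding 1 2 by (rule finsum_congI[OF Z _ L])
      (use bilin_closed[OF \<phi>] left_transl_closed f \<delta>_FG in \<open>auto simp del: function_algebra_simps\<close>)
qed

lemmas comult_FG_closed = lin_map_closed[OF comult_FG_lin]

lemma comult_FG_right:
  assumes f: "f \<in> carrier FG"
  shows "comult FG f = (\<Oplus>\<^bsub>tensor K FG FG\<^esub>v\<in>carrier G. pt K FG FG (\<R> v f) (\<delta> v))"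
  using tlift_comult_FG_right[OF f module_tensor[OF module_FG module_FG] pt_bilin[OF module_FG module_FG]]
  by (simp only: tlift_pt_id[OF module_FG module_FG comult_FG_closed[OF f]])

lemma FG_one_apply: "\<one>\<^sub>F = (\<lambda>g. if g \<in> carrier G then \<one>\<^bsub>K\<^esub> else \<zero>\<^bsub>K\<^esub>)"
  by simp

lemma FG_mult_apply: "(f \<otimes>\<^sub>F g) x = f x \<otimes>\<^bsub>K\<^esub> g x"
  by simp

lemma FG_smult_apply: "(a \<odot>\<^sub>F g) x = a \<otimes>\<^bsub>K\<^esub> g x"
  by simp

lemma FG_zero_apply: "\<zero>\<^bsub>FG\<^esub> x = \<zero>\<^bsub>K\<^esub>"
  by simp

text \<open>From here on both algebras are used through named laws; unfolding their fields would
  turn products and sums into pointwise expressions.\<close>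

declare function_algebra_simps [simp del] group_algebra_simps [simp del]

lemma FG_closed: "f \<in> carrier FG \<Longrightarrow> f x \<in> carrier K"
  by (simp add: FG_carrier)

lemma FG_zero: "f \<in> carrier FG \<Longrightarrow> x \<notin> carrier G \<Longrightarrow> f x = \<zero>\<^bsub>K\<^esub>"
  by (simp add: FG_carrier)

lemma FG_mult_closed: "f \<in> carrier FG \<Longrightarrow> g \<in> carrier FG \<Longrightarrow> f \<otimes>\<^sub>F g \<in> carrier FG"
  using bilin_closed[OF k_algebra_mult_bilin[OF algebra_FG]] .

lemma FG_one_closed: "\<one>\<^sub>F \<in> carrier FG"
  by (simp add: FG_carrier FG_one_apply)

lemma mult_\<delta>: "g \<in> carrier FG \<Longrightarrow> v \<in> carrier G \<Longrightarrow> g \<otimes>\<^sub>F \<delta> v = g v \<odot>\<^sub>F \<delta> v"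
  by (auto simp: fun_eq_iff FG_mult_apply FG_smult_apply single_def FG_closed)

lemma \<delta>_mult: "g \<in> carrier FG \<Longrightarrow> v \<in> carrier G \<Longrightarrow> \<delta> v \<otimes>\<^sub>F g = g v \<odot>\<^sub>F \<delta> v"
  by (auto simp: fun_eq_iff FG_mult_apply FG_smult_apply single_def FG_closed)

lemma sum_const_\<delta>:
  assumes "c \<in> carrier K"
  shows "(\<Oplus>\<^bsub>FG\<^esub>u\<in>carrier G. c \<odot>\<^sub>F \<delta> u) = c \<odot>\<^sub>F \<one>\<^sub>F"
proof -
  have "c \<odot>\<^sub>F \<one>\<^sub>F \<in> carrier FG" by (intro module_closures(3)[OF module_FG] FG_one_closed assms)
  have "(\<Oplus>\<^bsub>FG\<^esub>u\<in>carrier G. c \<odot>\<^sub>F \<delta> u) = (\<Oplus>\<^bsub>FG\<^esub>u\<in>carrier G. (c \<odot>\<^sub>F \<one>\<^sub>F) u \<odot>\<^sub>F \<delta> u)"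
    by (rule finsum_congI[OF module_FG])
      (use assms in \<open>simp_all add: FG_smult_apply FG_one_apply module_closures(3)[OF module_FG] \<delta>_FG\<close>)
  also have "\<dots> = c \<odot>\<^sub>F \<one>\<^sub>F" by (rule FG_sum) fact
  finally show ?thesis .
qed

lemmas FG_lins = lins lin_comp[OF comult_FG_lin] comult_FG_closed lin_comp[OF counit_FG_lin] lin_scal
  algebra_FG module_FG

lemma left_transl_one: "f \<in> carrier FG \<Longrightarrow> left_transl K G \<one>\<^sub>G f = f"
  by (auto simp: left_transl_def fun_eq_iff FG_zero)

lemma right_transl_one: "f \<in> carrier FG \<Longrightarrow> \<R> \<one>\<^sub>G f = f"
  by (auto simp: right_transl_def fun_eq_iff FG_zero)

lemma coalgebra_FG: "k_coalgebra K FG"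
proof (rule k_coalgebra.intro)
  note m = module_FG
  let ?T = "tensor K FG FG" and ?TT = "tensor K FG (tensor K FG FG)"
  note mT = module_tensor[OF m m] and mTT = module_tensor[OF m module_tensor[OF m m]]
  fix f assume f: "f \<in> carrier FG"
  note R = right_transl_closed[OF _ f] and L = left_transl_closed[OF _ f]
  have b1: "(\<lambda>x y. pt K FG (tensor K FG FG) x (comult FG y)) \<in> bilin K FG FG ?TT"
    by (rule FG_lins | assumption)+
  have b3: "(\<lambda>x1 x2. pt K FG (tensor K FG FG) x1 (pt K FG FG x2 y)) \<in> bilin K FG FG ?TT" if "y \<in> carrier FG" for y
    using that by - (rule FG_lins | assumption)+
  have b2: "(\<lambda>x y. tlift K ?TT (\<lambda>x1 x2. pt K FG (tensor K FG FG) x1 (pt K FG FG x2 y)) (comult FG x)) \<in> bilin K FG FG ?TT"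
    by (rule FG_lins | assumption)+
  \<comment> \<open>The common value of the two iterated coproducts: expanding one on the left and
    the other on the right leaves the middle leg L_u R_v f, and left and right translations
    commute.\<close>
  let ?t = "\<lambda>u v. pt K FG ?T (\<delta> u) (pt K FG FG (left_transl K G u (\<R> v f)) (\<delta> v))"
  have tc: "?t u v \<in> carrier ?TT" if "u \<in> carrier G" "v \<in> carrier G" for u v
    by (intro pt_closed m mT \<delta>_FG left_transl_closed R that)
  have "tlift K ?TT (\<lambda>x y. pt K FG (tensor K FG FG) x (comult FG y)) (comult FG f) =
      (\<Oplus>\<^bsub>?TT\<^esub>u\<in>carrier G. pt K FG ?T (\<delta> u) (comult FG (left_transl K G u f)))"
    by (rule tlift_comult_FG_left[OF f mTT b1])
  also have "\<dots> = (\<Oplus>\<^bsub>?TT\<^esub>u\<in>carrier G. \<Oplus>\<^bsub>?TT\<^esub>v\<in>carrier G. ?t u v)"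
  proof (rule finsum_congI[OF mTT])
    fix u assume u: "u \<in> carrier G"
    show "(\<Oplus>\<^bsub>?TT\<^esub>v\<in>carrier G. ?t u v) \<in> carrier ?TT" by (intro finsum_closedI[OF mTT] tc u)
    show "pt K FG ?T (\<delta> u) (comult FG (left_transl K G u f)) = (\<Oplus>\<^bsub>?TT\<^esub>v\<in>carrier G. ?t u v)"
      by (subst comult_FG_right[OF L[OF u]], subst lin_map_finsum[OF bilin_right[OF pt_bilin[OF m mT] \<delta>_FG[OF u]] mT mTT finite_G])
        (simp add: pt_closed[OF m m] right_transl_closed L u, rule finsum_congI[OF mTT],
          simp_all add: left_right_transl u pt_closed[OF m mT] pt_closed[OF m m] right_transl_closed L)
  qed
  also have "\<dots> = (\<Oplus>\<^bsub>?TT\<^esub>v\<in>carrier G. \<Oplus>\<^bsub>?TT\<^esub>u\<in>carrier G. ?t u v)"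
    by (rule finsum_swap[OF mTT finite_G finite_G tc])
  also have "\<dots> = (\<Oplus>\<^bsub>?TT\<^esub>v\<in>carrier G. tlift K ?TT (\<lambda>x1 x2. pt K FG (tensor K FG FG) x1 (pt K FG FG x2 (\<delta> v))) (comult FG (\<R> v f)))"
    by (rule finsum_congI[OF mTT tlift_closed[OF comult_FG_closed m m mTT b3]])
      (simp_all add: R tlift_comult_FG_left[OF R mTT b3])
  also have "\<dots> = tlift K ?TT (\<lambda>x y. tlift K ?TT (\<lambda>x1 x2. pt K FG (tensor K FG FG) x1 (pt K FG FG x2 y)) (comult FG x)) (comult FG f)"
    by (rule tlift_comult_FG_right[OF f mTT b2, symmetric])
  finally show "tlift K ?TT (\<lambda>x y. pt K FG (tensor K FG FG) x (comult FG y)) (comult FG f) =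
    tlift K ?TT (\<lambda>x y. tlift K ?TT (\<lambda>x1 x2. pt K FG (tensor K FG FG) x1 (pt K FG FG x2 y)) (comult FG x)) (comult FG f)" .
  interpret m: module K FG by (rule m)
  have b4: "(\<lambda>x y. counit FG x \<odot>\<^sub>F y) \<in> bilin K FG FG FG"
    by (intro bilinI lin_scal lin_smult lin_id m counit_FG_lin lin_map_closed[OF counit_FG_lin, simplified ground_simps])
  show "tlift K FG (\<lambda>x y. counit FG x \<odot>\<^sub>F y) (comult FG f) = f"
    by (subst tlift_comult_FG_left[OF f m b4], subst finsum_only[OF m finite_G G.one_closed])
      (auto simp: counit_FG single_def left_transl_one f L m.smult_l_null)
  have b5: "(\<lambda>x y. counit FG y \<odot>\<^sub>F x) \<in> bilin K FG FG FG"
    by (intro bilinI lin_scal lin_smult lin_id m counit_FG_lin lin_map_closed[OF counit_FG_lin, simplified ground_simps])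
  show "tlift K FG (\<lambda>x y. counit FG y \<odot>\<^sub>F x) (comult FG f) = f"
    by (subst tlift_comult_FG_right[OF f m b5], subst finsum_only[OF m finite_G G.one_closed])
      (auto simp: counit_FG single_def right_transl_one f R m.smult_l_null)
qed (simp_all only: field_K module_FG comult_FG_lin counit_FG_lin)

lemma antipode_FG: "\<exists>S. is_antipode K FG S"
proof -
  note m = module_FG
  interpret m: module K FG by (rule m)
  define S where "S f = (\<lambda>g. if g \<in> carrier G then f (inv\<^sub>G g) else \<zero>\<^bsub>K\<^esub>)" for f :: "'g \<Rightarrow> 'k"
  have S: "S \<in> lin_map K FG FG"
    by (rule lin_mapI) (auto simp: S_def FG_carrier function_algebra_simps(2-))
  note Sc = lin_map_closed[OF S]
  have b: "(\<lambda>x y. S x \<otimes>\<^sub>F y) \<in> bilin K FG FG FG" "(\<lambda>x y. x \<otimes>\<^sub>F S y) \<in> bilin K FG FG FG"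
    by (rule FG_lins S Sc | assumption)+
  have "tlift K FG (\<lambda>x y. S x \<otimes>\<^sub>F y) (comult FG f) = counit FG f \<odot>\<^sub>F \<one>\<^sub>F"
    "tlift K FG (\<lambda>x y. x \<otimes>\<^sub>F S y) (comult FG f) = counit FG f \<odot>\<^sub>F \<one>\<^sub>F" if f: "f \<in> carrier FG" for f
  proof -
    \<comment> \<open>Multiplication by \<delta>_v evaluates the other factor at v, and S(R_v f)
      takes at v the value f(v^-1 v); likewise S(L_v f) takes the value f(v v^-1).\<close>
    have e: "S (\<R> v f) \<otimes>\<^sub>F \<delta> v = f \<one>\<^sub>G \<odot>\<^sub>F \<delta> v" "\<delta> v \<otimes>\<^sub>F S (left_transl K G v f) = f \<one>\<^sub>G \<odot>\<^sub>F \<delta> v"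
      if "v \<in> carrier G" for v
      using that f by (simp_all add: mult_\<delta> \<delta>_mult Sc right_transl_closed left_transl_closed)
        (simp_all add: S_def right_transl_def left_transl_def)
    have s: "(\<Oplus>\<^bsub>FG\<^esub>v\<in>carrier G. f \<one>\<^sub>G \<odot>\<^sub>F \<delta> v) = counit FG f \<odot>\<^sub>F \<one>\<^sub>F"
      by (simp add: sum_const_\<delta> FG_closed f counit_FG)
    show "tlift K FG (\<lambda>x y. S x \<otimes>\<^sub>F y) (comult FG f) = counit FG f \<odot>\<^sub>F \<one>\<^sub>F"
      by (subst tlift_comult_FG_right[OF f m b(1)], subst s[symmetric], rule finsum_congI[OF m])
        (simp_all add: e m.smult_closed FG_closed[OF f])
    show "tlift K FG (\<lambda>x y. x \<otimes>\<^sub>F S y) (comult FG f) = counit FG f \<odot>\<^sub>F \<one>\<^sub>F"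
      by (subst tlift_comult_FG_left[OF f m b(2)], subst s[symmetric], rule finsum_congI[OF m])
        (simp_all add: e m.smult_closed FG_closed[OF f])
  qed
  with S show ?thesis unfolding is_antipode_def by blast
qed

lemma \<delta>_\<delta>: "u \<noteq> v \<Longrightarrow> \<delta> u \<otimes>\<^sub>F \<delta> v = \<zero>\<^bsub>FG\<^esub>" "\<delta> u \<otimes>\<^sub>F \<delta> u = \<delta> u"
  by (auto simp: fun_eq_iff FG_mult_apply FG_zero_apply single_def)

lemma pt_zero_right:
  assumes "module K V" "module K W" "v \<in> carrier V"
  shows "pt K V W v \<zero>\<^bsub>W\<^esub> = \<zero>\<^bsub>tensor K V W\<^esub>"
  by (rule lin_map_zero[OF bilin_right[OF pt_bilin]]) (intro assms module_tensor)+

lemma pt_zero_left: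
  assumes "module K V" "module K W" "w \<in> carrier W"
  shows "pt K V W \<zero>\<^bsub>V\<^esub> w = \<zero>\<^bsub>tensor K V W\<^esub>"
  by (rule lin_map_zero[OF bilin_left[OF pt_bilin]]) (intro assms module_tensor)+

lemma hopf_FG: "hopf_algebra K FG"
proof (rule hopf_algebra.intro[OF algebra_FG coalgebra_FG _ _ antipode_FG])
  note m = module_FG
  let ?T = "tensor K FG FG"
  note mT = module_tensor[OF m m]
  note mb = tensor_alg_mult_bilin[OF algebra_FG algebra_FG] and mp = tensor_alg_mult_pt[OF algebra_FG algebra_FG]
  have pc: "pt K FG FG (\<R> v f) (\<delta> v) \<in> carrier ?T" if "v \<in> carrier G" "f \<in> carrier FG" for v f
    by (intro pt_closed m right_transl_closed \<delta>_FG that)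
  show "comult FG \<in> alg_hom K FG (tensor_alg K FG FG)"
  proof (rule alg_hom_tensor_algI[OF algebra_FG algebra_FG algebra_FG comult_FG_lin _ subset_refl lin_span_carrier[OF m]])
    have "\<R> v \<one>\<^sub>F = \<one>\<^sub>F" if "v \<in> carrier G" for v by (rule alg_hom_one[OF right_transl_alg_hom[OF that]])
    then have "comult FG \<one>\<^sub>F = (\<Oplus>\<^bsub>?T\<^esub>v\<in>carrier G. pt K FG FG \<one>\<^sub>F (\<delta> v))"
      unfolding comult_FG_right[OF FG_one_closed]
      by (intro finsum_congI[OF mT] pt_closed m FG_one_closed \<delta>_FG) auto
    also have "\<dots> = pt K FG FG \<one>\<^sub>F (\<Oplus>\<^bsub>FG\<^esub>v\<in>carrier G. \<delta> v)"
      by (rule lin_map_finsum[OF bilin_right[OF pt_bilin[OF m m] FG_one_closed] m mT finite_G, symmetric]) (rule \<delta>_FG)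
    also have "(\<Oplus>\<^bsub>FG\<^esub>v\<in>carrier G. \<delta> v) = \<one>\<^sub>F"
    proof -
      have "(\<Oplus>\<^bsub>FG\<^esub>v\<in>carrier G. \<delta> v) = (\<Oplus>\<^bsub>FG\<^esub>v\<in>carrier G. \<one>\<^bsub>K\<^esub> \<odot>\<^sub>F \<delta> v)"
        by (rule finsum_congI[OF m]) (simp_all add: module.smult_one[OF m])
      then show ?thesis using sum_const_\<delta>[OF K.one_closed] by (simp add: module.smult_one[OF m] FG_one_closed)
    qed
    finally show "comult FG \<one>\<^sub>F = pt K FG FG \<one>\<^sub>F \<one>\<^sub>F" .
  next
    fix f f' assume f: "f \<in> carrier FG" and f': "f' \<in> carrier FG"
    let ?p = "\<lambda>f v. pt K FG FG (\<R> v f) (\<delta> v)"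
    note cf = comult_FG_right[OF f] and cf' = comult_FG_right[OF f']
    \<comment> \<open>The second legs are delta functions, so terms with different indices
      annihilate each other and the diagonal ones multiply by multiplicativity of R_v.\<close>
    have e: "?p f v \<otimes>\<^bsub>tensor_alg K FG FG\<^esub> ?p f' v' = (if v' = v then ?p (f \<otimes>\<^sub>F f') v else \<zero>\<^bsub>?T\<^esub>)"
      if "v \<in> carrier G" "v' \<in> carrier G" for v v'
      using that f f' alg_hom_mult[OF right_transl_alg_hom[OF that(1)] f f']
      by (cases "v' = v") (simp_all add: mp right_transl_closed \<delta>_\<delta> not_sym FG_mult_closed pt_zero_right[OF m m])
    have 1: "?p f v \<otimes>\<^bsub>tensor_alg K FG FG\<^esub> comult FG f' = ?p (f \<otimes>\<^sub>F f') v" if v: "v \<in> carrier G" for v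
      unfolding cf' by (subst lin_map_finsum[OF bilin_right[OF mb pc[OF v f]] mT mT finite_G], erule pc[OF _ f'],
          subst finsum_only[OF mT finite_G v])
        (simp_all add: e v pc f f' FG_mult_closed)
    have "comult FG f \<otimes>\<^bsub>tensor_alg K FG FG\<^esub> comult FG f'
      = (\<Oplus>\<^bsub>?T\<^esub>v\<in>carrier G. ?p f v \<otimes>\<^bsub>tensor_alg K FG FG\<^esub> comult FG f')"
      by (subst (1) cf, rule lin_map_finsum[OF bilin_left[OF mb comult_FG_closed[OF f']] mT mT finite_G pc[OF _ f]])
    also have "\<dots> = comult FG (f \<otimes>\<^sub>F f')"
      unfolding comult_FG_right[OF FG_mult_closed[OF f f']]
      by (rule finsum_congI[OF mT]) (simp_all add: 1 pc FG_mult_closed f f')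
    finally show "comult FG (f \<otimes>\<^sub>F f') = comult FG f \<otimes>\<^bsub>tensor_alg K FG FG\<^esub> comult FG f'" by simp
  qed
  show "counit FG \<in> alg_hom K FG (ground K)"
    by (rule alg_homI[OF counit_FG_lin]) (simp_all add: counit_FG FG_one_apply FG_mult_apply)
qed

end

context kvect
begin

lemma tlift_fun_cong:
  assumes "t \<in> carrier (tensor K V W)" "module K V" "module K W" "module K Z"
    "\<phi> \<in> bilin K V W Z" "\<psi> \<in> bilin K V W Z"
    "\<And>v w. v \<in> carrier V \<Longrightarrow> w \<in> carrier W \<Longrightarrow> \<phi> v w = \<psi> v w"
  shows "tlift K Z \<phi> t = tlift K Z \<psi> t"
  by (rule tensor_lin_eqI[OF assms(1-4) tlift_lin[OF assms(2-5)] tlift_lin[OF assms(2-4,6)]])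
    (simp add: tlift_pt[OF assms(2-5)] tlift_pt[OF assms(2-4,6)] assms(7))

lemma lin_ground_mult1:
  assumes "f \<in> lin_map K V (ground K)" "c \<in> carrier K"
  shows "(\<lambda>x. f x \<otimes>\<^bsub>K\<^esub> c) \<in> lin_map K V (ground K)"
  using lin_map_closed[OF assms(1)] assms(2)
  by (intro lin_mapI) (auto simp: lin_map_add[OF assms(1)] lin_map_smult[OF assms(1)] K.l_distr K.m_assoc)

lemma lin_ground_mult2:
  assumes "f \<in> lin_map K V (ground K)" "c \<in> carrier K"
  shows "(\<lambda>x. c \<otimes>\<^bsub>K\<^esub> f x) \<in> lin_map K V (ground K)"
  using lin_map_closed[OF assms(1)] assms(2)
  by (intro lin_mapI) (auto simp: lin_map_add[OF assms(1)] lin_map_smult[OF assms(1)] K.r_distr K.m_lcomm)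

end

subsection \<open>Graded braided Hopf algebras over a finite group\<close>

text \<open>The group-theoretic form of an algebra in crossed modules: automorphisms \<sigma> and
  homogeneous families \<open>Hm\<close>. Taking \<open>Hm d\<close> as a set of chosen homogeneous
  elements makes products and conjugation plain membership statements; the coaction carries the same
  grading as a linear map.\<close>

locale crossed_algebra = kgroup K G
  for K :: "('k, 'm) ring_scheme" and G :: "('g, 'n) monoid_scheme" +
  fixes E :: "('k, 'e) hopf" and \<sigma> :: "'g \<Rightarrow> 'e \<Rightarrow> 'e" and Hm :: "'g \<Rightarrow> 'e set"
    and act :: "('g \<Rightarrow> 'k) \<Rightarrow> 'e \<Rightarrow> 'e" and co :: "'e \<Rightarrow> (('g \<Rightarrow> 'k) \<times> 'e \<Rightarrow> 'k) set"
  assumes algebra_E: "k_algebra K E"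
    and \<sigma>_hom: "g \<in> carrier G \<Longrightarrow> \<sigma> g \<in> alg_hom K E E"
    and \<sigma>_mult: "\<lbrakk>g \<in> carrier G; h \<in> carrier G; b \<in> carrier E\<rbrakk> \<Longrightarrow> \<sigma> (g \<cdot> h) b = \<sigma> g (\<sigma> h b)"
    and \<sigma>_one: "b \<in> carrier E \<Longrightarrow> \<sigma> \<one>\<^sub>G b = b"
    and Hm_sub: "d \<in> carrier G \<Longrightarrow> Hm d \<subseteq> carrier E"
    and Hm_span: "lin_span K E (\<Union>d\<in>carrier G. Hm d) = carrier E"
    and Hm_one: "\<one>\<^bsub>E\<^esub> \<in> Hm \<one>\<^sub>G"
    and Hm_mult: "\<lbrakk>d \<in> carrier G; d' \<in> carrier G; b \<in> Hm d; b' \<in> Hm d'\<rbrakk> \<Longrightarrow> b \<otimes>\<^bsub>E\<^esub> b' \<in> Hm (d \<cdot> d')"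
    and Hm_\<sigma>: "\<lbrakk>g \<in> carrier G; d \<in> carrier G; b \<in> Hm d\<rbrakk> \<Longrightarrow> \<sigma> g b \<in> Hm (g \<cdot> d \<cdot> inv\<^sub>G g)"
    and act_def: "act = (\<lambda>h v. \<Oplus>\<^bsub>E\<^esub>g\<in>carrier G. h g \<odot>\<^bsub>E\<^esub> \<sigma> g v)"
    and co_hom: "co \<in> alg_hom K E (tensor_alg K (group_algebra K G) E)"
    and co_Hm: "\<lbrakk>d \<in> carrier G; b \<in> Hm d\<rbrakk> \<Longrightarrow> co b = pt K (group_algebra K G) E (single K d) b"
begin

abbreviation Emult (infixl "\<star>" 70) where "x \<star> y \<equiv> x \<otimes>\<^bsub>E\<^esub> y"
abbreviation Esmult (infixr "\<odot>\<^sub>E" 75) where "k \<odot>\<^sub>E y \<equiv> k \<odot>\<^bsub>E\<^esub> y"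
abbreviation oneE ("\<one>\<^sub>E") where "\<one>\<^sub>E \<equiv> \<one>\<^bsub>E\<^esub>"
abbreviation "EE \<equiv> tensor K E E"
abbreviation "pE \<equiv> pt K E E"

lemmas module_E = k_algebra.is_module[OF algebra_E]

sublocale E: ring E by (rule k_algebra.is_ring[OF algebra_E])

lemma Hm_closed: "d \<in> carrier G \<Longrightarrow> b \<in> Hm d \<Longrightarrow> b \<in> carrier E"
  using Hm_sub by blast

lemmas \<sigma>_lin = alg_hom_lin[OF \<sigma>_hom]

lemmas \<sigma>_closed = lin_map_closed[OF \<sigma>_lin]

lemma co_lin: "co \<in> lin_map K E (tensor K KG E)"
  using alg_hom_lin[OF co_hom] by (simp add: lin_map_cong_record[OF same_lin_refl same_lin_tensor_alg(1)])

lemmas co_closed = lin_map_closed[OF co_lin]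

lemma KG_closed: "h \<in> carrier KG \<Longrightarrow> h g \<in> carrier K"
  by (simp add: group_algebra_simps free_mod_carrier)

lemma KG_eval: "g \<in> carrier G \<Longrightarrow> (\<lambda>h. h g) \<in> lin_map K KG (ground K)"
  by (rule lin_mapI) (auto simp: KG_closed group_algebra_simps)

lemma act_lin1: "v \<in> carrier E \<Longrightarrow> (\<lambda>h. act h v) \<in> lin_map K KG E"
  unfolding act_def by (intro lin_finsum lin_scal module_KG module_E finite_G KG_eval \<sigma>_closed)

lemma act_lin2: "h \<in> carrier KG \<Longrightarrow> (\<lambda>v. act h v) \<in> lin_map K E E"
  unfolding act_def by (intro lin_finsum lin_smult module_KG module_E finite_G KG_closed \<sigma>_lin)

lemma act_closed: "h \<in> carrier KG \<Longrightarrow> v \<in> carrier E \<Longrightarrow> act h v \<in> carrier E"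
  using lin_map_closed[OF act_lin1] .

lemma act_\<delta>: "g \<in> carrier G \<Longrightarrow> v \<in> carrier E \<Longrightarrow> act (\<delta> g) v = \<sigma> g v"
proof -
  assume g: "g \<in> carrier G" and v: "v \<in> carrier E"
  interpret m: module K E by (rule module_E)
  show ?thesis unfolding act_def
    by (subst finsum_only[OF module_E finite_G g]) (auto simp: single_def \<sigma>_closed g v)
qed

lemma E_eqI:
  assumes "module K Z" "(\<lambda>x. f x) \<in> lin_map K E Z" "(\<lambda>x. g x) \<in> lin_map K E Z"
    "\<And>d b. d \<in> carrier G \<Longrightarrow> b \<in> Hm d \<Longrightarrow> f b = g b" "x \<in> carrier E"
  shows "f x = g x"
  by (rule lin_span_eqI[OF module_E assms(1-3), of "\<Union>d\<in>carrier G. Hm d"])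
    (use assms Hm_span Hm_sub in blast)+

abbreviation "Dspan d \<equiv> {pE x y |x y d1 d2.
    d1 \<in> carrier G \<and> d2 \<in> carrier G \<and> x \<in> Hm d1 \<and> y \<in> Hm d2 \<and> d1 \<cdot> d2 = d}"

lemma Dspan_sub: "Dspan d \<subseteq> carrier EE"
  using pt_closed[OF module_E module_E] Hm_closed by blast

lemma EE_eqI:
  assumes "t \<in> carrier EE" "module K Z"
    "(\<lambda>x. f x) \<in> lin_map K EE Z" "(\<lambda>x. g x) \<in> lin_map K EE Z"
    "\<And>x y d1 d2. \<lbrakk>d1 \<in> carrier G; d2 \<in> carrier G; x \<in> Hm d1; y \<in> Hm d2; x \<in> carrier E; y \<in> carrier E\<rbrakk> \<Longrightarrow>
      f (pE x y) = g (pE x y)"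
  shows "f t = g t"
proof -
  let ?H = "\<Union>d\<in>carrier G. Hm d"
  have H: "?H \<subseteq> carrier E" using Hm_sub by auto
  note s = tensor_span[OF module_E module_E H Hm_span H Hm_span]
  have "{pE v w |v w. v \<in> ?H \<and> w \<in> ?H} \<subseteq> carrier EE"
    using H pt_closed[OF module_E module_E] by blast
  from lin_span_eqI[OF module_tensor[OF module_E module_E] assms(2-4) this, of t] show ?thesis
    using assms(1,5) s Hm_closed by blast
qed

lemmas CA_lins = KG_lins module_KG module_E algebra_KG algebra_E
  lin_comp[OF co_lin] lin_comp[OF \<sigma>_lin]
  lin_comp[OF act_lin1] lin_comp[OF act_lin2] co_closed \<sigma>_closed act_closed
  \<delta>_KG KG_mult_closed E.m_closed G.m_closed

lemma left_crossed: "left_crossed_module K KG E act co"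
proof (rule left_crossed_module.intro)
  note m = module_E and mK = module_KG
  let ?T = "tensor K KG E" and ?TT = "tensor K KG (tensor K KG E)"
  note mT = module_tensor[OF mK m] and mTT = module_tensor[OF mK module_tensor[OF mK m]]
  show "module K E" by (rule m)
  show "act h \<in> lin_map K E E" if "h \<in> carrier KG" for h by (rule act_lin2[OF that])
  show "(\<lambda>h. act h v) \<in> lin_map K KG E" if "v \<in> carrier E" for v by (rule act_lin1[OF that])
  show "act (h \<otimes>\<^sub>H h') v = act h (act h' v)" if "h \<in> carrier KG" "h' \<in> carrier KG" "v \<in> carrier E" for h h' v
  proof -
    have 1: "act (\<delta> g \<otimes>\<^sub>H h') v = act (\<delta> g) (act h' v)" if "g \<in> carrier G" for g
      by (rule KG_eqI[OF m _ _ _ \<open>h' \<in> _\<close>], insert that \<open>v \<in> _\<close>, (rule CA_lins | assumption)+)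
        (simp only: KG_mult act_\<delta> \<sigma>_mult G.m_closed \<sigma>_closed)
    show ?thesis
      by (rule KG_eqI[OF m _ _ _ \<open>h \<in> _\<close>], insert that, (rule CA_lins | assumption)+) (rule 1)
  qed
  show "act \<one>\<^sub>H v = v" if "v \<in> carrier E" for v
    using that by (simp add: group_algebra_simps act_\<delta> \<sigma>_one)
  show "co \<in> lin_map K E (tensor K KG E)" by (rule co_lin)
  have b1: "(\<lambda>h w. pt K KG (tensor K KG E) h (co w)) \<in> bilin K KG E ?TT"
    by (rule CA_lins | assumption)+
  have b3: "(\<lambda>h1 h2. pt K KG (tensor K KG E) h1 (pt K KG E h2 w)) \<in> bilin K KG KG ?TT" if "w \<in> carrier E" for w
    using that by - (rule CA_lins | assumption)+
  have b2: "(\<lambda>h w. tlift K ?TT (\<lambda>h1 h2. pt K KG (tensor K KG E) h1 (pt K KG E h2 w)) (comult KG h)) \<in> bilin K KG E ?TT"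
    by (rule CA_lins | assumption)+
  show "tlift K ?TT (\<lambda>h w. pt K KG (tensor K KG E) h (co w)) (co v) =
      tlift K ?TT (\<lambda>h w. tlift K ?TT (\<lambda>h1 h2. pt K KG (tensor K KG E) h1 (pt K KG E h2 w)) (comult KG h)) (co v)"
    if "v \<in> carrier E" for v
    by (rule E_eqI[OF mTT _ _ _ that], (rule CA_lins | assumption)+)
      (simp only: co_Hm tlift_pt[OF mK m mTT b1] tlift_pt[OF mK m mTT b2] tlift_comult_KG[OF _ mTT b3] \<delta>_KG Hm_closed)
  have b4: "(\<lambda>h w. counit KG h \<odot>\<^sub>E w) \<in> bilin K KG E E"
    by (rule CA_lins counit_KG_lin | assumption)+
  show "tlift K E (\<lambda>h w. counit KG h \<odot>\<^sub>E w) (co v) = v" if "v \<in> carrier E" for v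
    by (rule E_eqI[OF m _ _ _ that], (rule CA_lins counit_KG_lin | assumption)+)
      (simp only: co_Hm tlift_pt[OF mK m m b4] counit_KG module.smult_one[OF m] \<delta>_KG Hm_closed)
  let ?x = "\<lambda>h1 h2 x w. pt K KG E (h1 \<otimes>\<^sub>H x) (act h2 w)" and ?y = "\<lambda>h2 x w. pt K KG E (x \<otimes>\<^sub>H h2) w"
  show "tlift K ?T (\<lambda>h1 h2. tlift K ?T (?x h1 h2) (co v)) (comult KG h) =
      tlift K ?T (\<lambda>h1 h2. tlift K ?T (?y h2) (co (act h1 v))) (comult KG h)"
    if "h \<in> carrier KG" "v \<in> carrier E" for h v
  proof (rule KG_eqI[OF mT _ _ _ that(1)])
    let ?X = "\<lambda>h1 h2. tlift K ?T (?x h1 h2) (co v)" and ?Y = "\<lambda>h1 h2. tlift K ?T (?y h2) (co (act h1 v))"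
    have b: "?X \<in> bilin K KG KG ?T"
      "?Y \<in> bilin K KG KG ?T"
      using that(2) by - (rule CA_lins | assumption)+
    show "(\<lambda>h. tlift K ?T ?X (comult KG h)) \<in> lin_map K KG ?T"
      "(\<lambda>h. tlift K ?T ?Y (comult KG h)) \<in> lin_map K KG ?T"
      by (rule lin_tlift1[OF comult_KG_lin mK mK mT b(1)], rule lin_tlift1[OF comult_KG_lin mK mK mT b(2)])
    fix g assume g: "g \<in> carrier G"
    have b': "?x (\<delta> g) (\<delta> g) \<in> bilin K KG E ?T"
      "?y (\<delta> g) \<in> bilin K KG E ?T"
      using g by - (rule CA_lins | assumption)+
    have "tlift K ?T (?x (\<delta> g) (\<delta> g)) (co v) = tlift K ?T (?y (\<delta> g)) (co (act (\<delta> g) v))"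
    proof (rule E_eqI[OF mT _ _ _ that(2)])
      show "(\<lambda>v. tlift K ?T (?x (\<delta> g) (\<delta> g)) (co v)) \<in> lin_map K E ?T"
        "(\<lambda>v. tlift K ?T (?y (\<delta> g)) (co (act (\<delta> g) v))) \<in> lin_map K E ?T"
        using g by - (rule CA_lins | assumption)+
      fix d b assume d: "d \<in> carrier G" and b: "b \<in> Hm d"
      note bE = Hm_closed[OF d b]
      have d': "g \<cdot> d \<cdot> inv\<^sub>G g \<in> carrier G" using g d by simp
      \<comment> \<open>Both sides are \<delta>_{gd} \<otimes> g.b: on the right the degree g d g^-1
        of g.b is multiplied by g.\<close>
      show "tlift K ?T (?x (\<delta> g) (\<delta> g)) (co b) =
          tlift K ?T (?y (\<delta> g)) (co (act (\<delta> g) b))"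
        using g d bE
        by (simp add: co_Hm[OF d b] act_\<delta> co_Hm[OF d' Hm_\<sigma>[OF g d b]] tlift_pt[OF mK m mT b'(1)] tlift_pt[OF mK m mT b'(2)]
            d' \<sigma>_closed KG_mult G.m_assoc del: group_algebra_simps)
    qed
    then show "tlift K ?T ?X (comult KG (\<delta> g)) =
      tlift K ?T ?Y (comult KG (\<delta> g))"
      by (simp only: tlift_comult_KG[OF g mT b(1)] tlift_comult_KG[OF g mT b(2)])
  qed
qed

lemma left_braiding_bilin: "left_braiding K E act co \<in> bilin K E E EE"
  unfolding left_braiding_def[abs_def]
  by (rule CA_lins | assumption)+

lemma left_braiding_Hm:
  assumes "d \<in> carrier G" "v \<in> Hm d" "w \<in> carrier E"
  shows "left_braiding K E act co v w = pE (\<sigma> d w) v"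
proof -
  have b: "(\<lambda>x v'. pE (act x w) v') \<in> bilin K KG E EE"
    using assms(3) by - (rule CA_lins | assumption)+
  show ?thesis unfolding left_braiding_def
    using assms Hm_closed[OF assms(1,2)]
    by (simp add: co_Hm tlift_pt[OF module_KG module_E module_tensor[OF module_E module_E] b] act_\<delta>)
qed

abbreviation "BS \<equiv> braided_square K E (left_braiding K E act co)"

lemmas BS_bilin = braided_square_mult_bilin[OF algebra_E left_braiding_bilin]

lemma BS_mult:
  assumes "x \<in> carrier E" "d \<in> carrier G" "y \<in> Hm d" "x' \<in> carrier E" "y' \<in> carrier E"
  shows "pE x y \<otimes>\<^bsub>BS\<^esub> pE x' y' = pE (x \<star> \<sigma> d x') (y \<star> y')"
proof -
  note m = module_E
  have b: "(\<lambda>u v. pE (x \<star> u) (v \<star> y')) \<in> bilin K E E EE"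
    using assms by - (rule CA_lins | assumption)+
  show ?thesis
    using assms Hm_closed[OF assms(2,3)]
    by (simp add: braided_square_mult_pt[OF algebra_E left_braiding_bilin] left_braiding_Hm
      tlift_pt[OF m m module_tensor[OF m m] b] \<sigma>_closed)
qed

text \<open>A right leg of degree d meets the next left leg through the braiding and twists it by
  \<sigma> d; the grading makes these twists compose.\<close>

lemma BS_algebra: "k_algebra K BS"
proof (rule smash_k_algebra[OF algebra_E algebra_E, where R = "{(\<sigma> d, b) |d b. d \<in> carrier G \<and> b \<in> Hm d}"])
  have e: "snd ` {(\<sigma> d, b) |d b. d \<in> carrier G \<and> b \<in> Hm d} = (\<Union>d\<in>carrier G. Hm d)" by force
  show "lin_span K E (snd ` {(\<sigma> d, b) |d b. d \<in> carrier G \<and> b \<in> Hm d}) = carrier E"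
    unfolding e by (rule Hm_span)
  show "mult BS \<in> bilin K EE EE EE" by (rule BS_bilin)
  show "\<exists>s. (s, \<one>\<^sub>E) \<in> {(\<sigma> d, b) |d b. d \<in> carrier G \<and> b \<in> Hm d} \<and> (\<forall>v\<in>carrier E. s v = v)"
    using Hm_one \<sigma>_one by (intro exI[of _ "\<sigma> \<one>\<^sub>G"]) auto
  show "\<exists>s''. (s'', b \<star> b') \<in> {(\<sigma> d, b) |d b. d \<in> carrier G \<and> b \<in> Hm d} \<and> (\<forall>v\<in>carrier E. s'' v = s (s' v))"
    if sb: "(s, b) \<in> {(\<sigma> d, b) |d b. d \<in> carrier G \<and> b \<in> Hm d}" "(s', b') \<in> {(\<sigma> d, b) |d b. d \<in> carrier G \<and> b \<in> Hm d}" for s b s' b'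
  proof -
    from sb obtain d d' where *: "d \<in> carrier G" "d' \<in> carrier G" "s = \<sigma> d" "b \<in> Hm d" "s' = \<sigma> d'" "b' \<in> Hm d'" by auto
    then show ?thesis by (intro exI[of _ "\<sigma> (d \<cdot> d')"]) (use Hm_mult \<sigma>_mult in auto)
  qed
qed (auto simp: same_lin_tensor_alg BS_mult \<sigma>_hom Hm_closed)

definition sig2 where "sig2 g = tlift K EE (\<lambda>x y. pE (\<sigma> g x) (\<sigma> g y))"

lemma sig2_bilin: "g \<in> carrier G \<Longrightarrow> (\<lambda>x y. pE (\<sigma> g x) (\<sigma> g y)) \<in> bilin K E E EE"
  by (rule CA_lins \<sigma>_lin | assumption)+

lemmas module_EE = module_tensor[OF module_E module_E]

lemma sig2_lin: "g \<in> carrier G \<Longrightarrow> sig2 g \<in> lin_map K EE EE"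
  unfolding sig2_def by (rule tlift_lin[OF module_E module_E module_EE sig2_bilin])

lemma sig2: "g \<in> carrier G \<Longrightarrow> x \<in> carrier E \<Longrightarrow> y \<in> carrier E \<Longrightarrow> sig2 g (pE x y) = pE (\<sigma> g x) (\<sigma> g y)"
  unfolding sig2_def by (rule tlift_pt[OF module_E module_E module_EE sig2_bilin])

text \<open>The braided opposite of \<open>E\<close>, in which the antipode of a braided Hopf algebra is multiplicative.\<close>

definition "braided_op = E\<lparr>mult := \<lambda>a b. tlift K E (\<lambda>x y. x \<star> y) (left_braiding K E act co a b)\<rparr>"

lemma braided_op_simps:
  "carrier braided_op = carrier E" "add braided_op = add E" "zero braided_op = zero E"
  "smult braided_op = smult E" "one braided_op = one E"
  "mult braided_op = (\<lambda>a b. tlift K E (\<lambda>x y. x \<star> y) (left_braiding K E act co a b))"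
  by (simp_all add: braided_op_def)

lemma same_lin_braided_op: "same_lin braided_op E"
  by (simp add: same_lin_def braided_op_simps)

lemma braided_op_mult:
  assumes "d \<in> carrier G" "a \<in> Hm d" "b \<in> carrier E"
  shows "a \<otimes>\<^bsub>braided_op\<^esub> b = \<sigma> d b \<star> a"
  using assms Hm_closed[OF assms(1,2)]
  by (simp add: braided_op_simps left_braiding_Hm[OF assms] tlift_pt[OF module_E module_E module_E k_algebra_mult_bilin[OF algebra_E]] \<sigma>_closed)

lemma braided_op_algebra: "k_algebra K braided_op"
proof (rule k_algebraI_span[OF field_K, where S = "\<Union>d\<in>carrier G. Hm d"])
  show "module K braided_op"
    using module_cong[of E braided_op] module_E same_lin_braided_op by (simp add: same_lin_def)
  have b: "(\<lambda>x y. x \<star> y) \<in> bilin K E E E" by (rule k_algebra_mult_bilin[OF algebra_E])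
  have "(\<lambda>a b. tlift K E (\<lambda>x y. x \<star> y) (left_braiding K E act co a b)) \<in> bilin K E E E"
    by (intro bilinI lin_tlift1[OF _ module_E module_E module_E b] bilin_left[OF left_braiding_bilin] bilin_right[OF left_braiding_bilin])
  then show "mult braided_op \<in> bilin K braided_op braided_op braided_op"
    by (simp add: bilin_def lin_map_cong_record[OF same_lin_braided_op same_lin_braided_op] braided_op_simps)
  show "lin_span K braided_op (\<Union>d\<in>carrier G. Hm d) = carrier braided_op"
    using Hm_span by (simp add: lin_span_cong[OF same_lin_braided_op] braided_op_simps)
next
  fix x y z assume "x \<in> (\<Union>d\<in>carrier G. Hm d)" "y \<in> (\<Union>d\<in>carrier G. Hm d)" "z \<in> (\<Union>d\<in>carrier G. Hm d)"
  then obtain d e f where *: "d \<in> carrier G" "x \<in> Hm d" "e \<in> carrier G" "y \<in> Hm e" "f \<in> carrier G" "z \<in> Hm f" by blast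
  note xE = Hm_closed[OF *(1,2)] and yE = Hm_closed[OF *(3,4)] and zE = Hm_closed[OF *(5,6)]
  \<comment> \<open>The braided product (d.y) x has degree d e d^-1 d = d e, the degree of the
    ordinary product. Hence both bracketings become (de.z)(d.y)x.\<close>
  have 1: "\<sigma> d y \<star> x \<in> Hm (d \<cdot> e \<cdot> inv\<^sub>G d \<cdot> d)"
    by (rule Hm_mult[OF _ _ Hm_\<sigma>[OF *(1,3,4)] *(2)]) (use * in auto)
  have 2: "d \<cdot> e \<cdot> inv\<^sub>G d \<cdot> d = d \<cdot> e" using * by (simp add: G.m_assoc)
  have de: "d \<cdot> e \<in> carrier G" using * by simp
  show "x \<otimes>\<^bsub>braided_op\<^esub> y \<otimes>\<^bsub>braided_op\<^esub> z = x \<otimes>\<^bsub>braided_op\<^esub> (y \<otimes>\<^bsub>braided_op\<^esub> z)"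
    using * xE yE zE
    by (simp add: braided_op_mult[OF *(1,2)] braided_op_mult[OF *(3,4)] braided_op_mult[OF de 1[unfolded 2]] \<sigma>_closed
      alg_hom_mult[OF \<sigma>_hom[OF *(1)]] \<sigma>_mult E.m_assoc)
next
  fix x assume "x \<in> (\<Union>d\<in>carrier G. Hm d)"
  then obtain d where *: "d \<in> carrier G" "x \<in> Hm d" by blast
  then show "\<one>\<^bsub>braided_op\<^esub> \<otimes>\<^bsub>braided_op\<^esub> x = x" "x \<otimes>\<^bsub>braided_op\<^esub> \<one>\<^bsub>braided_op\<^esub> = x"
    using Hm_closed[OF *] by (simp_all add: braided_op_simps(5) braided_op_mult[OF *] braided_op_mult[OF G.one_closed Hm_one] \<sigma>_one alg_hom_one[OF \<sigma>_hom])
qed (use Hm_sub in \<open>auto simp: braided_op_simps\<close>)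

end

text \<open>The data from which both bosonisations are built, phrased by group elements and degrees.
  The antipode preserves degree only up to span, since it sends a generator to its negative while
  \<open>Hm\<close> consists of chosen elements.\<close>

locale braided_hopf = crossed_algebra +
  assumes coalgebra_E: "k_coalgebra K E"
    and comult_\<sigma>: "\<lbrakk>g \<in> carrier G; b \<in> carrier E\<rbrakk> \<Longrightarrow>
      comult E (\<sigma> g b) = tlift K EE (\<lambda>x y. pE (\<sigma> g x) (\<sigma> g y)) (comult E b)"
    and counit_\<sigma>: "\<lbrakk>g \<in> carrier G; b \<in> carrier E\<rbrakk> \<Longrightarrow> counit E (\<sigma> g b) = counit E b"
    and comult_Hm: "\<lbrakk>d \<in> carrier G; b \<in> Hm d\<rbrakk> \<Longrightarrow> comult E b \<in> lin_span K EE
      {pE x y |x y d1 d2. d1 \<in> carrier G \<and> d2 \<in> carrier G \<and> x \<in> Hm d1 \<and> y \<in> Hm d2 \<and> d1 \<cdot> d2 = d}"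
    and counit_Hm: "\<lbrakk>d \<in> carrier G; b \<in> Hm d; d \<noteq> \<one>\<^sub>G\<rbrakk> \<Longrightarrow> counit E b = \<zero>\<^bsub>K\<^esub>"
    and comult_hom_left: "comult E \<in> alg_hom K E (braided_square K E (left_braiding K E act co))"
    and counit_hom: "counit E \<in> alg_hom K E (ground K)"
    and antipode: "\<exists>S. is_antipode K E S \<and> (\<forall>g\<in>carrier G. \<forall>b\<in>carrier E. S (\<sigma> g b) = \<sigma> g (S b)) \<and>
      (\<forall>d\<in>carrier G. \<forall>b\<in>Hm d. S b \<in> lin_span K E (Hm d))"
begin

lemmas comult_E_lin = k_coalgebra.comult_linear[OF coalgebra_E]
  and counit_E_lin = k_coalgebra.counit_linear[OF coalgebra_E]

lemmas comult_E_closed = lin_map_closed[OF comult_E_lin]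
  and counit_E_closed = lin_map_closed[OF counit_E_lin, unfolded ground_simps]

text \<open>The coproduct of a homogeneous b lies in the span of tensors whose degrees multiply to
  d. Comparing linear maps on these only makes d = d1 d2 available, which \<open>EE_eqI\<close> does
  not supply.\<close>

lemma comult_E_eqI:
  assumes "d \<in> carrier G" "b \<in> Hm d"
    "module K Z" "(\<lambda>x. f x) \<in> lin_map K EE Z" "(\<lambda>x. g x) \<in> lin_map K EE Z"
    "\<And>x y d1 d2. \<lbrakk>d1 \<in> carrier G; d2 \<in> carrier G; x \<in> Hm d1; y \<in> Hm d2; x \<in> carrier E; y \<in> carrier E; d = d1 \<cdot> d2\<rbrakk> \<Longrightarrow>
      f (pE x y) = g (pE x y)"
  shows "f (comult E b) = g (comult E b)"
  by (rule lin_span_eqI[OF module_tensor[OF module_E module_E] assms(3-5) Dspan_sub _ comult_Hm[OF assms(1,2)]])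
    (use assms(6) Hm_closed in blast)

lemmas E_lins = CA_lins lin_comp[OF comult_E_lin] lin_comp[OF counit_E_lin] comult_E_closed counit_E_closed

end

section \<open>The braided group in left crossed modules over the group algebra\<close>

context braided_hopf
begin

lemmas gr_lins = E_lins lin_ground_mult1 lin_ground_mult2 counit_KG_lin counit_E_lin module_ground

lemma comult_mult: "\<lbrakk>x \<in> carrier E; y \<in> carrier E\<rbrakk> \<Longrightarrow> comult E (x \<star> y) = comult E x \<otimes>\<^bsub>BS\<^esub> comult E y"
  by (rule alg_hom_mult[OF comult_hom_left])

lemma comult_one: "comult E \<one>\<^sub>E = pE \<one>\<^sub>E \<one>\<^sub>E"
  using alg_hom_one[OF comult_hom_left] by simp

lemma counit_one: "counit E \<one>\<^sub>E = \<one>\<^bsub>K\<^esub>"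
  using alg_hom_one[OF counit_hom] by simp

lemma counit_mult: "\<lbrakk>x \<in> carrier E; y \<in> carrier E\<rbrakk> \<Longrightarrow> counit E (x \<star> y) = counit E x \<otimes>\<^bsub>K\<^esub> counit E y"
  using alg_hom_mult[OF counit_hom] by simp

text \<open>Needed at the antipode of a homogeneous element, which lies in the span of its
  degree.\<close>

lemma co_Hm_span:
  assumes "d \<in> carrier G" "b \<in> lin_span K E (Hm d)"
  shows "co b = pt K KG E (\<delta> d) b"
  by (rule lin_span_eqI[OF module_E module_tensor[OF module_KG module_E] co_lin _ Hm_sub[OF assms(1)] _ assms(2)])
    (insert assms(1), (rule E_lins | assumption)+, rule co_Hm)

lemma left_braided: "left_braided_group K KG E act co"
proof (rule left_braided_group.intro[OF hopf_KG left_crossed algebra_E coalgebra_E])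
  note m = module_E and mK = module_KG and mT = module_tensor[OF module_E module_E]
  note mX = module_tensor[OF module_KG module_tensor[OF module_E module_E]]
  note mg = module_ground
  interpret E: module K E by (rule m)
  show "act h (b \<star> c) = tlift K E (\<lambda>h1 h2. act h1 b \<star> act h2 c) (comult KG h)"
    if h: "h \<in> carrier KG" and "b \<in> carrier E" "c \<in> carrier E" for h b c
  proof (rule KG_eqI[OF m _ _ _ h])
    have b: "(\<lambda>h1 h2. act h1 b \<star> act h2 c) \<in> bilin K KG KG E"
      using that by - (rule E_lins | assumption)+
    show "act (\<delta> g) (b \<star> c) = tlift K E (\<lambda>h1 h2. act h1 b \<star> act h2 c) (comult KG (\<delta> g))" if "g \<in> carrier G" for g
      using that \<open>b \<in> _\<close> \<open>c \<in> _\<close> by (simp add: tlift_comult_KG[OF _ m b] act_\<delta> alg_hom_mult[OF \<sigma>_hom])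
  qed (insert that, (rule E_lins | assumption)+)
  show "act h \<one>\<^sub>E = counit KG h \<odot>\<^sub>E \<one>\<^sub>E" if h: "h \<in> carrier KG" for h
    by (rule KG_eqI[OF m act_lin1[OF E.one_closed] lin_scal[OF mK m counit_KG_lin E.one_closed] _ h])
      (simp add: act_\<delta> counit_KG alg_hom_one[OF \<sigma>_hom])
  show "co \<in> alg_hom K E (tensor_alg K KG E)" by (rule co_hom)
  show "comult E (act h b) = tlift K EE (\<lambda>h1 h2.
        tlift K EE (\<lambda>b1 b2. pE (act h1 b1) (act h2 b2)) (comult E b)) (comult KG h)"
    if h: "h \<in> carrier KG" and bE: "b \<in> carrier E" for h b
  proof (rule KG_eqI[OF mT _ _ _ h])
    have b: "(\<lambda>h1 h2. tlift K EE (\<lambda>b1 b2. pE (act h1 b1) (act h2 b2)) (comult E b)) \<in> bilin K KG KG EE"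
      using that by - (rule E_lins | assumption)+
    fix g assume g: "g \<in> carrier G"
    have "comult E (\<sigma> g b) = tlift K EE (\<lambda>b1 b2. pE (act (\<delta> g) b1) (act (\<delta> g) b2)) (comult E b)"
      unfolding comult_\<sigma>[OF g bE]
      by (rule tlift_fun_cong[OF comult_E_closed[OF bE] m m mT], insert g, (rule E_lins | assumption)+) (simp add: act_\<delta>)
    then show "comult E (act (\<delta> g) b) = tlift K EE (\<lambda>h1 h2.
        tlift K EE (\<lambda>b1 b2. pE (act h1 b1) (act h2 b2)) (comult E b)) (comult KG (\<delta> g))"
      using g bE by (simp add: tlift_comult_KG[OF _ mT b] act_\<delta>)
  qed (insert that, (rule E_lins | assumption)+)
  show "counit E (act h b) = counit KG h \<otimes>\<^bsub>K\<^esub> counit E b" if h: "h \<in> carrier KG" and bE: "b \<in> carrier E" for h b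
    by (rule KG_eqI[OF mg _ _ _ h], insert bE, (rule gr_lins | assumption)+)
      (simp add: act_\<delta> counit_\<sigma> counit_KG counit_E_closed)
  let ?Z = "tensor K KG EE"
  let ?C = "\<lambda>x c. pt K KG EE x (comult E c)" and ?u = "\<lambda>x1 c1 x2 c2. pt K KG EE (x1 \<otimes>\<^sub>H x2) (pE c1 c2)"
  let ?w = "\<lambda>b2 x1 c1. tlift K ?Z (?u x1 c1) (co b2)"
  let ?D = "\<lambda>b1 b2. tlift K ?Z (?w b2) (co b1)"
  have b1: "?C \<in> bilin K KG E ?Z"
    by (rule E_lins | assumption)+
  have b3: "?u x1 c1 \<in> bilin K KG E ?Z"
    if "x1 \<in> carrier KG" "c1 \<in> carrier E" for x1 c1
    using that by - (rule E_lins | assumption)+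
  have b2: "?w b2 \<in> bilin K KG E ?Z"
    if "b2 \<in> carrier E" for b2
    using that by - (rule E_lins | assumption)+
  have b4: "?D \<in> bilin K E E ?Z"
    by (rule E_lins | assumption)+
  show "tlift K ?Z ?C (co b) = tlift K ?Z ?D
        (comult E b)" if bE: "b \<in> carrier E" for b
  proof (rule E_eqI[OF mX _ _ _ bE])
    fix d b assume d: "d \<in> carrier G" and b: "b \<in> Hm d"
    have "tlift K ?Z ?C (co b) = pt K KG EE (\<delta> d) (comult E b)"
      by (simp add: co_Hm[OF d b] tlift_pt[OF mK m mX b1] d Hm_closed[OF d b])
    also have "\<dots> = tlift K ?Z ?D
        (comult E b)"
    \<comment> \<open>The right side carries the group element d1 d2 and the left side the degree d
      of b; the tensors in the coproduct of b satisfy d = d1 d2.\<close>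
    proof (rule comult_E_eqI[OF d b mX])
      fix x y d1 d2 assume *: "d1 \<in> carrier G" "d2 \<in> carrier G" "x \<in> Hm d1" "y \<in> Hm d2" "x \<in> carrier E" "y \<in> carrier E"
          "d = d1 \<cdot> d2"
      have b2': "(\<lambda>x1 c1. tlift K ?Z (?u x1 c1) (pt K KG E (\<delta> d2) y)) \<in> bilin K KG E ?Z"
        using * by - (rule E_lins | assumption)+
      from * show "pt K KG EE (\<delta> d) (pE x y) = tlift K ?Z ?D (pE x y)"
        by (simp add: tlift_pt[OF m m mX b4] co_Hm[of d1 x] co_Hm[of d2 y] tlift_pt[OF mK m mX b2'] tlift_pt[OF mK m mX b3] KG_mult)
    qed (insert d, (rule E_lins | assumption)+)
    finally show "tlift K ?Z ?C (co b) = \<dots>" .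
  qed (rule E_lins | assumption)+
  have b5: "(\<lambda>x c. counit E c \<odot>\<^bsub>KG\<^esub> x) \<in> bilin K KG E KG"
    by (rule gr_lins | assumption)+
  interpret Km: module K KG by (rule mK)
  show "tlift K KG (\<lambda>x c. counit E c \<odot>\<^bsub>KG\<^esub> x) (co b) = counit E b \<odot>\<^bsub>KG\<^esub> \<one>\<^sub>H" if bE: "b \<in> carrier E" for b
  proof (rule E_eqI[OF mK _ _ _ bE])
    fix d b assume d: "d \<in> carrier G" and b: "b \<in> Hm d"
    \<comment> \<open>In degree 1 the group leg is the unit; in any other degree the counit vanishes
      and both sides are zero.\<close>
    show "tlift K KG (\<lambda>x c. counit E c \<odot>\<^bsub>KG\<^esub> x) (co b) = counit E b \<odot>\<^bsub>KG\<^esub> \<one>\<^sub>H"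
      using d Hm_closed[OF d b] counit_Hm[OF d b]
      by (cases "d = \<one>\<^sub>G") (simp_all add: co_Hm[OF d b] tlift_pt[OF mK m mK b5] KG_one)
  next
    have "\<one>\<^sub>H \<in> carrier KG" by (simp add: KG_one)
    then show "(\<lambda>x. counit E x \<odot>\<^bsub>KG\<^esub> \<one>\<^sub>H) \<in> lin_map K E KG" by (intro lin_scal m mK counit_E_lin)
  qed (rule gr_lins b5 | assumption)+
  show "comult E \<in> alg_hom K E BS" by (rule comult_hom_left)
  show "counit E \<in> alg_hom K E (ground K)" by (rule counit_hom)
  obtain S where S: "is_antipode K E S" "\<And>g b. g \<in> carrier G \<Longrightarrow> b \<in> carrier E \<Longrightarrow> S (\<sigma> g b) = \<sigma> g (S b)"
      "\<And>d b. d \<in> carrier G \<Longrightarrow> b \<in> Hm d \<Longrightarrow> S b \<in> lin_span K E (Hm d)" using antipode by blast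
  have Sl: "S \<in> lin_map K E E" using S(1) by (simp add: is_antipode_def)
  note Sr = lin_comp[OF Sl] lin_map_closed[OF Sl]
  have "S (act h b) = act h (S b)" if h: "h \<in> carrier KG" and bE: "b \<in> carrier E" for h b
    by (rule KG_eqI[OF m _ _ _ h], insert bE, (rule E_lins Sr | assumption)+)
      (simp add: act_\<delta> S(2) lin_map_closed[OF Sl])
  moreover have b6: "(\<lambda>x c. pt K KG E x (S c)) \<in> bilin K KG E (tensor K KG E)"
    by (rule E_lins Sr Sl | assumption)+
  have "co (S b) = tlift K (tensor K KG E) (\<lambda>x c. pt K KG E x (S c)) (co b)" if bE: "b \<in> carrier E" for b
    by (rule E_eqI[OF module_tensor[OF mK m] _ _ _ bE], (rule E_lins Sr b6 Sl | assumption)+)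
      (simp add: co_Hm co_Hm_span[OF _ S(3)] tlift_pt[OF mK m module_tensor[OF mK m] b6] Hm_closed)
  ultimately show "\<exists>S. is_antipode K E S \<and> (\<forall>h\<in>carrier KG. \<forall>b\<in>carrier E. S (act h b) = act h (S b)) \<and>
      (\<forall>b\<in>carrier E. co (S b) = tlift K (tensor K KG E) (\<lambda>x c. pt K KG E x (S c)) (co b))"
    using S(1) by blast
qed

end

subsection \<open>Left bosonisation\<close>

context braided_hopf
begin

abbreviation "LT \<equiv> tensor K E KG"
abbreviation "LTT \<equiv> tensor K LT LT"
abbreviation "LA \<equiv> left_biproduct K KG E act co"
abbreviation LAmult (infixl "\<otimes>\<^sub>L" 70) where "x \<otimes>\<^sub>L y \<equiv> x \<otimes>\<^bsub>LA\<^esub> y"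
abbreviation "lp \<equiv> pt K E KG"
abbreviation "lpp \<equiv> pt K LT LT"

lemma module_LT: "module K LT" "module K LTT"
  by (intro module_tensor module_E module_KG)+

lemma LA_lin: "carrier LA = carrier LT" "add LA = add LT" "zero LA = zero LT" "smult LA = smult LT"
  "one LA = lp \<one>\<^sub>E \<one>\<^sub>H"
  by (simp_all add: left_biproduct_def Let_def module.defs hopf.defs)

lemma same_lin_LA: "same_lin LA LT"
  by (simp add: same_lin_def LA_lin)

lemmas LA_eq = tensor_cong[OF same_lin_LA same_lin_LA, of K] tensor_cong[OF same_lin_LA same_lin_refl, of K]
  tensor_cong[OF same_lin_refl same_lin_LA, of K] pt_cong[OF same_lin_refl same_lin_LA, of K]
  pt_cong[OF same_lin_LA same_lin_LA, of K] pt_cong[OF same_lin_LA same_lin_refl, of K]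
  tlift_cong[OF same_lin_LA, of K]
  lin_map_cong_record[OF same_lin_LA same_lin_LA, of K]
  lin_map_cong_record[OF same_lin_LA same_lin_refl, of K]
  lin_map_cong_record[OF same_lin_refl same_lin_LA, of K]
  lin_span_cong[OF same_lin_LA, of K] LA_lin(1-4)

definition LA_X where
  "LA_X b h c g = tlift K LT (\<lambda>h1 h2. lp (b \<star> act h1 c) (h2 \<otimes>\<^sub>H g)) (comult KG h)"

lemma LA_mult_eq: "mult LA = (\<lambda>s t. tlift K LT (\<lambda>b h. tlift K LT (\<lambda>c g. LA_X b h c g) t) s)"
  by (simp add: left_biproduct_def Let_def module.defs hopf.defs LA_X_def)

lemma LA_X_bilin:
  shows "\<And>b h. b \<in> carrier E \<Longrightarrow> h \<in> carrier KG \<Longrightarrow> LA_X b h \<in> bilin K E KG LT"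
    and "\<And>c g. c \<in> carrier E \<Longrightarrow> g \<in> carrier KG \<Longrightarrow> (\<lambda>b h. LA_X b h c g) \<in> bilin K E KG LT"
  unfolding LA_X_def by - (rule E_lins | assumption)+

lemma LA_mult_bilin: "mult LA \<in> bilin K LT LT LT"
  unfolding LA_mult_eq
  by (rule tlift2_bilin[OF module_E module_KG module_E module_KG module_LT(1) LA_X_bilin])

lemma LA_mult:
  assumes "b \<in> carrier E" "g \<in> carrier G" "c \<in> carrier E" "h \<in> carrier KG"
  shows "lp b (\<delta> g) \<otimes>\<^sub>L lp c h = lp (b \<star> \<sigma> g c) (\<delta> g \<otimes>\<^sub>H h)"
proof -
  have b: "(\<lambda>h1 h2. lp (b \<star> act h1 c) (h2 \<otimes>\<^sub>H h)) \<in> bilin K KG KG LT"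
    using assms by - (rule E_lins | assumption)+
  have "lp b (\<delta> g) \<otimes>\<^sub>L lp c h = LA_X b (\<delta> g) c h"
    unfolding LA_mult_eq
    by (rule tlift2_pt[OF module_E module_KG module_E module_KG module_LT(1) LA_X_bilin]) (use assms in auto)
  then show ?thesis using assms by (simp add: LA_X_def tlift_comult_KG[OF _ module_LT(1) b] act_\<delta>)
qed

lemma LA_mult_\<delta>:
  assumes "b \<in> carrier E" "g \<in> carrier G" "c \<in> carrier E" "h \<in> carrier G"
  shows "lp b (\<delta> g) \<otimes>\<^sub>L lp c (\<delta> h) = lp (b \<star> \<sigma> g c) (\<delta> (g \<cdot> h))"
  using assms by (simp add: LA_mult KG_mult)

lemma LA_algebra: "k_algebra K LA"
proof (rule smash_k_algebra[OF algebra_E algebra_KG, where R = "{(\<sigma> g, \<delta> g) |g. g \<in> carrier G}"])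
  have e: "snd ` {(\<sigma> g, \<delta> g) |g. g \<in> carrier G} = \<delta> ` carrier G" by force
  show "lin_span K KG (snd ` {(\<sigma> g, \<delta> g) |g. g \<in> carrier G}) = carrier KG" unfolding e by (rule KG_span)
  show "mult LA \<in> bilin K LT LT LT" by (rule LA_mult_bilin)
  show "\<exists>s. (s, \<one>\<^sub>H) \<in> {(\<sigma> g, \<delta> g) |g. g \<in> carrier G} \<and> (\<forall>v\<in>carrier E. s v = v)"
    using \<sigma>_one KG_one by (intro exI[of _ "\<sigma> \<one>\<^sub>G"]) auto
  show "\<exists>s''. (s'', b \<otimes>\<^sub>H b') \<in> {(\<sigma> g, \<delta> g) |g. g \<in> carrier G} \<and> (\<forall>v\<in>carrier E. s'' v = s (s' v))"
    if "(s, b) \<in> {(\<sigma> g, \<delta> g) |g. g \<in> carrier G}" "(s', b') \<in> {(\<sigma> g, \<delta> g) |g. g \<in> carrier G}" for s b s' b'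
  proof -
    from that obtain g h where gh: "g \<in> carrier G" "h \<in> carrier G" "s = \<sigma> g" "b = \<delta> g" "s' = \<sigma> h" "b' = \<delta> h" by auto
    then show ?thesis by (intro exI[of _ "\<sigma> (g \<cdot> h)"]) (auto simp: KG_mult \<sigma>_mult)
  qed
qed (auto simp: same_lin_LA LA_lin LA_mult \<sigma>_hom)

lemma LT_eqI:
  assumes "t \<in> carrier LT" "module K Z" "(\<lambda>x. f x) \<in> lin_map K LT Z" "(\<lambda>x. g x) \<in> lin_map K LT Z"
    "\<And>d b u. \<lbrakk>d \<in> carrier G; b \<in> Hm d; b \<in> carrier E; u \<in> carrier G\<rbrakk> \<Longrightarrow> f (lp b (\<delta> u)) = g (lp b (\<delta> u))"
  shows "f t = g t"
proof -
  let ?H = "\<Union>d\<in>carrier G. Hm d"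
  have H: "?H \<subseteq> carrier E" using Hm_sub by auto
  note s = tensor_span[OF module_E module_KG H Hm_span \<delta>_sub_KG KG_span]
  have "{lp v w |v w. v \<in> ?H \<and> w \<in> \<delta> ` carrier G} \<subseteq> carrier LT"
    using H pt_closed[OF module_E module_KG] \<delta>_KG by blast
  from lin_span_eqI[OF module_LT(1) assms(2-4) this, of t] show ?thesis
    using assms(1,5) s Hm_closed by blast
qed

lemma LT_span: "{lp b (\<delta> u) |b u. b \<in> carrier E \<and> u \<in> carrier G} \<subseteq> carrier LT"
    "lin_span K LT {lp b (\<delta> u) |b u. b \<in> carrier E \<and> u \<in> carrier G} = carrier LT"
proof -
  have e: "{lp b (\<delta> u) |b u. b \<in> carrier E \<and> u \<in> carrier G} = {lp v w |v w. v \<in> carrier E \<and> w \<in> \<delta> ` carrier G}" by auto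
  show "{lp b (\<delta> u) |b u. b \<in> carrier E \<and> u \<in> carrier G} \<subseteq> carrier LT"
    using pt_closed[OF module_E module_KG] \<delta>_KG by blast
  show "lin_span K LT {lp b (\<delta> u) |b u. b \<in> carrier E \<and> u \<in> carrier G} = carrier LT"
    unfolding e by (rule tensor_span[OF module_E module_KG subset_refl lin_span_carrier[OF module_E] \<delta>_sub_KG KG_span])
qed

definition LA_Phi where
  "LA_Phi b h = tlift K LTT (\<lambda>b1 b2. tlift K LTT (\<lambda>x c. tlift K LTT (\<lambda>h1 h2.
          lpp (lp b1 (x \<otimes>\<^sub>H h1)) (lp c h2)) (comult KG h)) (co b2)) (comult E b)"

lemma LA_Phi_bilin: "LA_Phi \<in> bilin K E KG LTT"
  unfolding LA_Phi_def[abs_def] by (rule E_lins | assumption)+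

lemma LA_comult_eq: "comult LA = tlift K LTT LA_Phi"
  by (simp add: left_biproduct_def Let_def module.defs hopf.defs LA_Phi_def[abs_def])

lemma LA_counit_eq: "counit LA = tlift K (ground K) (\<lambda>b h. counit E b \<otimes>\<^bsub>K\<^esub> counit KG h)"
  by (simp add: left_biproduct_def Let_def module.defs hopf.defs)

lemma LA_comult_lin: "comult LA \<in> lin_map K LT LTT"
  unfolding LA_comult_eq by (rule tlift_lin[OF module_E module_KG module_LT(2) LA_Phi_bilin])

lemma LA_counit_bilin: "(\<lambda>b h. counit E b \<otimes>\<^bsub>K\<^esub> counit KG h) \<in> bilin K E KG (ground K)"
  by (rule gr_lins | assumption)+

lemma LA_counit_lin: "counit LA \<in> lin_map K LT (ground K)"
  unfolding LA_counit_eq by (rule tlift_lin[OF module_E module_KG module_ground LA_counit_bilin])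

lemma LA_counit: "b \<in> carrier E \<Longrightarrow> g \<in> carrier G \<Longrightarrow> counit LA (lp b (\<delta> g)) = counit E b"
  unfolding LA_counit_eq by (simp add: tlift_pt[OF module_E module_KG module_ground LA_counit_bilin] counit_KG counit_E_closed)

text \<open>The cross coproduct at a group-like second leg. For y of degree d it sends x \<otimes> y
  to (x \<otimes> dg) \<otimes> (y \<otimes> g), so the coproduct of b \<otimes> g is this map
  applied to that of b, and laws on E can be transported.\<close>

definition PhiL where
  "PhiL g = tlift K LTT (\<lambda>b1 b2. tlift K LTT (\<lambda>x c. lpp (lp b1 (x \<otimes>\<^sub>H \<delta> g)) (lp c (\<delta> g))) (co b2))"

lemma PhiL_bilin: "g \<in> carrier G \<Longrightarrow> (\<lambda>b1 b2. tlift K LTT (\<lambda>x c. lpp (lp b1 (x \<otimes>\<^sub>H \<delta> g)) (lp c (\<delta> g))) (co b2)) \<in> bilin K E E LTT"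
  by - (rule E_lins | assumption)+

lemma PhiL_lin: "g \<in> carrier G \<Longrightarrow> PhiL g \<in> lin_map K EE LTT"
  unfolding PhiL_def by (rule tlift_lin[OF module_E module_E module_LT(2) PhiL_bilin])

lemma PhiL:
  assumes "g \<in> carrier G" "x \<in> carrier E" "d \<in> carrier G" "y \<in> Hm d"
  shows "PhiL g (pE x y) = lpp (lp x (\<delta> (d \<cdot> g))) (lp y (\<delta> g))"
proof -
  have b: "(\<lambda>z c. lpp (lp x (z \<otimes>\<^sub>H \<delta> g)) (lp c (\<delta> g))) \<in> bilin K KG E LTT"
    using assms by - (rule E_lins | assumption)+
  show ?thesis unfolding PhiL_def using assms Hm_closed[OF assms(3,4)]
    by (simp add: tlift_pt[OF module_E module_E module_LT(2) PhiL_bilin] co_Hm tlift_pt[OF module_KG module_E module_LT(2) b] KG_mult)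
qed

lemma LA_comult:
  assumes g: "g \<in> carrier G" and bE: "b \<in> carrier E"
  shows "comult LA (lp b (\<delta> g)) = PhiL g (comult E b)"
proof -
  have b1: "(\<lambda>b1 b2. tlift K LTT (\<lambda>x c. tlift K LTT (\<lambda>h1 h2.
          lpp (lp b1 (x \<otimes>\<^sub>H h1)) (lp c h2)) (comult KG (\<delta> g))) (co b2)) \<in> bilin K E E LTT"
    using g by - (rule E_lins | assumption)+
  have "comult LA (lp b (\<delta> g)) = LA_Phi b (\<delta> g)"
    unfolding LA_comult_eq by (rule tlift_pt[OF module_E module_KG module_LT(2) LA_Phi_bilin bE \<delta>_KG[OF g]])
  also have "\<dots> = PhiL g (comult E b)"
    unfolding LA_Phi_def PhiL_def
  proof (rule tlift_fun_cong[OF comult_E_closed[OF bE] module_E module_E module_LT(2) b1 PhiL_bilin[OF g]])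
    fix v w assume v: "v \<in> carrier E" and w: "w \<in> carrier E"
    have b2: "(\<lambda>h1 h2. lpp (lp v (x \<otimes>\<^sub>H h1)) (lp c h2)) \<in> bilin K KG KG LTT" if "x \<in> carrier KG" "c \<in> carrier E" for x c
      using that v w by - (rule E_lins | assumption)+
    show "tlift K LTT (\<lambda>x c. tlift K LTT (\<lambda>h1 h2. lpp (lp v (x \<otimes>\<^sub>H h1)) (lp c h2)) (comult KG (\<delta> g))) (co w) =
       tlift K LTT (\<lambda>x c. lpp (lp v (x \<otimes>\<^sub>H \<delta> g)) (lp c (\<delta> g))) (co w)"
      by (rule tlift_fun_cong[OF co_closed[OF w] module_KG module_E module_LT(2)], insert v g, (rule E_lins | assumption)+)
        (simp add: tlift_comult_KG[OF _ module_LT(2) b2])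
  qed
  finally show ?thesis .
qed

lemmas LA_ma = tensor_alg_mult_pt[OF LA_algebra LA_algebra, unfolded LA_eq]
lemmas LA_mb = tensor_alg_mult_bilin[OF LA_algebra LA_algebra, unfolded LA_eq]

lemma LA_m_closed: "s \<in> carrier LT \<Longrightarrow> t \<in> carrier LT \<Longrightarrow> s \<otimes>\<^sub>L t \<in> carrier LT"
  using bilin_closed[OF LA_mult_bilin] .

lemma lp_closed: "b \<in> carrier E \<Longrightarrow> g \<in> carrier G \<Longrightarrow> lp b (\<delta> g) \<in> carrier LT"
  by (intro pt_closed module_E module_KG \<delta>_KG)

text \<open>Moving g past the second tensor acts diagonally on it, and what remains is the product
  of the braided square. The group elements match because d'(g e' g^-1)(g h) = (d' g)(e' h). Stated
  for all tensors, it turns multiplicativity of the coproduct of E into that of the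
  bosonisation.\<close>

lemma PhiL_mult:
  assumes g: "g \<in> carrier G" and h: "h \<in> carrier G"
    and s: "s \<in> carrier EE" and t: "t \<in> carrier EE"
  shows "PhiL g s \<otimes>\<^bsub>tensor_alg K LA LA\<^esub> PhiL h t = PhiL (g \<cdot> h) (s \<otimes>\<^bsub>BS\<^esub> sig2 g t)"
proof -
  have gh: "g \<cdot> h \<in> carrier G" using g h by simp
  note lr = lin_comp[OF PhiL_lin] lin_comp[OF sig2_lin] lin_comp[OF bilin_left[OF LA_mb]] lin_comp[OF bilin_right[OF LA_mb]]
    lin_comp[OF bilin_left[OF BS_bilin]] lin_comp[OF bilin_right[OF BS_bilin]] lin_map_closed[OF PhiL_lin] lin_map_closed[OF sig2_lin]
    bilin_closed[OF BS_bilin] bilin_closed[OF LA_mb]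
  show ?thesis
  proof (rule EE_eqI[OF s module_LT(2)])
    fix x y d d' assume xy: "d \<in> carrier G" "d' \<in> carrier G" "x \<in> Hm d" "y \<in> Hm d'" "x \<in> carrier E" "y \<in> carrier E"
    show "PhiL g (pE x y) \<otimes>\<^bsub>tensor_alg K LA LA\<^esub> PhiL h t = PhiL (g \<cdot> h) (pE x y \<otimes>\<^bsub>BS\<^esub> sig2 g t)"
    proof (rule EE_eqI[OF t module_LT(2)])
      fix x' y' e e' assume xy': "e \<in> carrier G" "e' \<in> carrier G" "x' \<in> Hm e" "y' \<in> Hm e'" "x' \<in> carrier E" "y' \<in> carrier E"
      have y1: "\<sigma> g y' \<in> Hm (g \<cdot> e' \<cdot> inv\<^sub>G g)" by (rule Hm_\<sigma>[OF g xy'(2,4)])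
      have y2: "y \<star> \<sigma> g y' \<in> Hm (d' \<cdot> (g \<cdot> e' \<cdot> inv\<^sub>G g))"
        by (rule Hm_mult[OF xy(2) _ xy(4) y1]) (use g xy' in simp)
      have "PhiL g (pE x y) \<otimes>\<^bsub>tensor_alg K LA LA\<^esub> PhiL h (pE x' y')
        = lpp (lp (x \<star> \<sigma> (d' \<cdot> g) x') (\<delta> (d' \<cdot> g \<cdot> (e' \<cdot> h)))) (lp (y \<star> \<sigma> g y') (\<delta> (g \<cdot> h)))"
        using g h xy xy' by (simp add: PhiL[OF g xy(5,2,4)] PhiL[OF h xy'(5,2,4)] LA_ma lp_closed LA_mult_\<delta>)
      moreover have "PhiL (g \<cdot> h) (pE x y \<otimes>\<^bsub>BS\<^esub> sig2 g (pE x' y'))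
        = lpp (lp (x \<star> \<sigma> d' (\<sigma> g x')) (\<delta> (d' \<cdot> (g \<cdot> e' \<cdot> inv\<^sub>G g) \<cdot> (g \<cdot> h)))) (lp (y \<star> \<sigma> g y') (\<delta> (g \<cdot> h)))"
        using g h xy xy' by (simp add: sig2 BS_mult[OF xy(5,2,4)] \<sigma>_closed PhiL[OF gh _ _ y2])
      moreover have "d' \<cdot> (g \<cdot> e' \<cdot> inv\<^sub>G g) \<cdot> (g \<cdot> h) = d' \<cdot> g \<cdot> (e' \<cdot> h)"
      proof -
        have "inv\<^sub>G g \<cdot> (g \<cdot> h) = h" using g h by (simp add: G.m_assoc[symmetric])
        then show ?thesis using g h xy xy' by (simp add: G.m_assoc)
      qed
      ultimately show "PhiL g (pE x y) \<otimes>\<^bsub>tensor_alg K LA LA\<^esub> PhiL h (pE x' y') = PhiL (g \<cdot> h) (pE x y \<otimes>\<^bsub>BS\<^esub> sig2 g (pE x' y'))"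
        using g xy xy' by (simp add: \<sigma>_mult)
    qed (insert g h gh xy, (rule E_lins lr PhiL_lin sig2_lin | assumption)+)
  qed (insert g h gh t, (rule E_lins lr PhiL_lin sig2_lin | assumption)+)
qed

lemma LA_comult_hom: "comult LA \<in> alg_hom K LA (tensor_alg K LA LA)"
proof (rule alg_hom_tensor_algI[OF LA_algebra LA_algebra LA_algebra, unfolded LA_eq, OF LA_comult_lin _ LT_span])
  show "comult LA \<one>\<^bsub>LA\<^esub> = lpp \<one>\<^bsub>LA\<^esub> \<one>\<^bsub>LA\<^esub>"
    by (simp add: LA_lin KG_one LA_comult comult_one PhiL[OF _ _ _ Hm_one])
  fix x y assume "x \<in> {lp b (\<delta> u) |b u. b \<in> carrier E \<and> u \<in> carrier G}" "y \<in> {lp b (\<delta> u) |b u. b \<in> carrier E \<and> u \<in> carrier G}"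
  then obtain b g c h where *: "x = lp b (\<delta> g)" "y = lp c (\<delta> h)" "b \<in> carrier E" "c \<in> carrier E" "g \<in> carrier G" "h \<in> carrier G" by auto
  then show "comult LA (x \<otimes>\<^sub>L y) = comult LA x \<otimes>\<^bsub>tensor_alg K LA LA\<^esub> comult LA y"
    by (simp add: LA_mult_\<delta> LA_comult \<sigma>_closed PhiL_mult comult_E_closed comult_mult comult_\<sigma>[folded sig2_def])
qed

lemma LA_counit_hom: "counit LA \<in> alg_hom K LA (ground K)"
  by (rule alg_homI_span[OF k_algebra.is_module[OF LA_algebra] module_ground _ _ k_algebra_mult_bilin[OF LA_algebra]
        k_algebra_mult_bilin[OF k_algebra_ground], unfolded LA_eq, OF LA_counit_lin _ LT_span])
    (auto simp: LA_lin KG_one LA_counit counit_one LA_mult_\<delta> \<sigma>_closed counit_mult counit_\<sigma>)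

end

section \<open>Coassociativity, counit and antipode of the left bosonisation\<close>

context braided_hopf
begin

abbreviation "EEE \<equiv> tensor K E EE"
abbreviation "LTTT \<equiv> tensor K LT LTT"

lemma module_EEE: "module K EEE" "module K LTTT"
  by (intro module_tensor module_E module_KG)+

definition XiL_aux where
  "XiL_aux g b1 = (\<lambda>b2 b3. tlift K LTTT (\<lambda>x' c'. tlift K LTTT (\<lambda>x1 x2. tlift K LTTT (\<lambda>x c.
      pt K LT LTT (lp b1 (x \<otimes>\<^sub>H (x1 \<otimes>\<^sub>H \<delta> g))) (lpp (lp c (x2 \<otimes>\<^sub>H \<delta> g)) (lp c' (\<delta> g))))
      (co b2)) (comult KG x')) (co b3))"

text \<open>The threefold analogue of \<open>PhiL\<close>: for y of degree d and z of degree e, x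
  \<otimes> y \<otimes> z goes to (x \<otimes> deg) \<otimes> (y \<otimes> eg) \<otimes> (z
  \<otimes> g), where deg is the product of d, e and g.\<close>

definition XiL where
  "XiL g = tlift K LTTT (\<lambda>b1 s. tlift K LTTT (XiL_aux g b1) s)"

lemma XiL_aux_bilin: "g \<in> carrier G \<Longrightarrow> b1 \<in> carrier E \<Longrightarrow> XiL_aux g b1 \<in> bilin K E E LTTT"
  unfolding XiL_aux_def by - (rule E_lins | assumption)+

lemma XiL_bilin: "g \<in> carrier G \<Longrightarrow> (\<lambda>b1 s. tlift K LTTT (XiL_aux g b1) s) \<in> bilin K E EE LTTT"
  unfolding XiL_aux_def by - (rule E_lins | assumption)+

lemma XiL_lin: "g \<in> carrier G \<Longrightarrow> XiL g \<in> lin_map K EEE LTTT"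
  unfolding XiL_def by (rule tlift_lin[OF module_E module_EE module_EEE(2) XiL_bilin])

lemma XiL:
  assumes g: "g \<in> carrier G" and x: "x \<in> carrier E" and d: "d \<in> carrier G" and y: "y \<in> Hm d"
    and e: "e \<in> carrier G" and z: "z \<in> Hm e"
  shows "XiL g (pt K E EE x (pE y z)) =
    pt K LT LTT (lp x (\<delta> (d \<cdot> (e \<cdot> g)))) (lpp (lp y (\<delta> (e \<cdot> g))) (lp z (\<delta> g)))"
proof -
  note yE = Hm_closed[OF d y] and zE = Hm_closed[OF e z]
  have b1: "(\<lambda>x' c'. tlift K LTTT (\<lambda>x1 x2. tlift K LTTT (\<lambda>w c.
      pt K LT LTT (lp x (w \<otimes>\<^sub>H (x1 \<otimes>\<^sub>H \<delta> g))) (lpp (lp c (x2 \<otimes>\<^sub>H \<delta> g)) (lp c' (\<delta> g))))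
      (pt K KG E (\<delta> d) y)) (comult KG x')) \<in> bilin K KG E LTTT"
    using g x d yE by - (rule E_lins | assumption)+
  have b2: "(\<lambda>x1 x2. tlift K LTTT (\<lambda>w c.
      pt K LT LTT (lp x (w \<otimes>\<^sub>H (x1 \<otimes>\<^sub>H \<delta> g))) (lpp (lp c (x2 \<otimes>\<^sub>H \<delta> g)) (lp z (\<delta> g))))
      (pt K KG E (\<delta> d) y)) \<in> bilin K KG KG LTTT"
    using g x d yE zE by - (rule E_lins | assumption)+
  have b3: "(\<lambda>w c. pt K LT LTT (lp x (w \<otimes>\<^sub>H (\<delta> e \<otimes>\<^sub>H \<delta> g))) (lpp (lp c (\<delta> e \<otimes>\<^sub>H \<delta> g)) (lp z (\<delta> g))))
      \<in> bilin K KG E LTTT"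
    using g x e zE by - (rule E_lins | assumption)+
  have "XiL g (pt K E EE x (pE y z)) = XiL_aux g x y z"
    unfolding XiL_def
    by (simp add: tlift_pt[OF module_E module_EE module_EEE(2) XiL_bilin[OF g]] x yE zE pt_closed[OF module_E module_E]
      tlift_pt[OF module_E module_E module_EEE(2) XiL_aux_bilin[OF g x]])
  also have "\<dots> = pt K LT LTT (lp x (\<delta> d \<otimes>\<^sub>H (\<delta> e \<otimes>\<^sub>H \<delta> g))) (lpp (lp y (\<delta> e \<otimes>\<^sub>H \<delta> g)) (lp z (\<delta> g)))"
    unfolding XiL_aux_def co_Hm[OF d y] co_Hm[OF e z]
    by (simp only: tlift_pt[OF module_KG module_E module_EEE(2) b1 \<delta>_KG[OF e] zE]
        tlift_comult_KG[OF e module_EEE(2) b2]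
        tlift_pt[OF module_KG module_E module_EEE(2) b3 \<delta>_KG[OF d] yE])
  finally show ?thesis using g d e by (simp add: KG_mult)
qed

lemmas LA_lins = E_lins lin_comp[OF LA_comult_lin] lin_map_closed[OF LA_comult_lin] lin_comp[OF PhiL_lin] lin_map_closed[OF PhiL_lin]
  lin_comp[OF XiL_lin] lin_map_closed[OF XiL_lin] PhiL_lin LA_comult_lin
  lin_comp[OF LA_counit_lin] LA_counit_lin lin_map_closed[OF LA_counit_lin, unfolded ground_simps]

text \<open>Each iterated coproduct of b \<otimes> g is \<open>XiL g\<close> applied to the matching
  iterated coproduct of b, so coassociativity of E finishes the proof.\<close>

lemma LA_coassoc:
  assumes a: "a \<in> carrier LT"
  shows "tlift K LTTT (\<lambda>x y. pt K LT LTT x (comult LA y)) (comult LA a) =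
      tlift K LTTT (\<lambda>x y. tlift K LTTT (\<lambda>x1 x2. pt K LT LTT x1 (lpp x2 y)) (comult LA x)) (comult LA a)"
proof -
  note mE = module_E and mEEE = module_EEE(1) and m3 = module_EEE(2)
    and m1 = module_LT(1)
  let ?b = "\<lambda>y x1 x2. pt K LT LTT x1 (lpp x2 y)" and ?e = "\<lambda>y x1 x2. pt K E EE x1 (pE x2 y)"
  let ?B = "\<lambda>x y. tlift K LTTT (?b y) (comult LA x)" and ?C = "\<lambda>x y. pt K LT LTT x (comult LA y)"
  let ?d = "\<lambda>x y. tlift K EEE (?e y) (comult E x)" and ?c = "\<lambda>x y. pt K E EE x (comult E y)"
  have p1: "?C \<in> bilin K LT LT LTTT"
    by (rule LA_lins | assumption)+
  have p2': "?b y \<in> bilin K LT LT LTTT" if "y \<in> carrier LT" for y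
    using that by - (rule LA_lins | assumption)+
  have p2: "?B \<in> bilin K LT LT LTTT"
    by (rule LA_lins | assumption)+
  have q1: "?c \<in> bilin K E E EEE"
    by (rule LA_lins comult_E_lin | assumption)+
  have q2': "?e y \<in> bilin K E E EEE" if "y \<in> carrier E" for y
    using that by - (rule LA_lins | assumption)+
  have q2: "?d \<in> bilin K E E EEE"
    by (rule LA_lins comult_E_lin | assumption)+
  have c1: "tlift K LTTT ?C (PhiL g t) =
      XiL g (tlift K EEE ?c t)"
    if g: "g \<in> carrier G" and t: "t \<in> carrier EE" for g t
  proof (rule EE_eqI[OF t m3])
    fix x y d' d assume xy: "d' \<in> carrier G" "d \<in> carrier G" "x \<in> Hm d'" "y \<in> Hm d" "x \<in> carrier E" "y \<in> carrier E"
    have dg: "d \<cdot> g \<in> carrier G" using xy g by simp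
    have "tlift K LTTT ?C (PhiL g (pE x y)) =
        pt K LT LTT (lp x (\<delta> (d \<cdot> g))) (PhiL g (comult E y))"
      using xy g by (simp add: PhiL[OF g xy(5,2,4)] tlift_pt[OF m1 m1 m3 p1] lp_closed LA_comult)
    also have "\<dots> = XiL g (pt K E EE x (comult E y))"
    \<comment> \<open>The left side remembers the degree d of y, while \<open>XiL\<close> sees only
      the degrees of the two legs of its coproduct. They agree because d = d1 d2; the other iterated
      coproduct raises no such condition.\<close>
    proof (rule comult_E_eqI[OF xy(2,4) m3])
      fix y1 y2 d1 d2 assume y: "d1 \<in> carrier G" "d2 \<in> carrier G" "y1 \<in> Hm d1" "y2 \<in> Hm d2" "y1 \<in> carrier E" "y2 \<in> carrier E" "d = d1 \<cdot> d2"
      then show "pt K LT LTT (lp x (\<delta> (d \<cdot> g))) (PhiL g (pE y1 y2)) = XiL g (pt K E EE x (pE y1 y2))"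
        using g by (simp add: PhiL[OF g y(5,2,4)] XiL[OF g xy(5) y(1,3,2,4)] G.m_assoc)
    qed (insert g xy dg, (rule LA_lins | assumption)+)
    finally show "tlift K LTTT ?C (PhiL g (pE x y)) =
      XiL g (tlift K EEE ?c (pE x y))"
      by (simp add: tlift_pt[OF mE mE mEEE q1] xy)
  qed (insert g, (rule LA_lins p1 q1 | assumption)+)
  have c2: "tlift K LTTT ?B (PhiL g t) =
      XiL g (tlift K EEE ?d t)"
    if g: "g \<in> carrier G" and t: "t \<in> carrier EE" for g t
  proof (rule EE_eqI[OF t m3])
    fix x y d' d assume xy: "d' \<in> carrier G" "d \<in> carrier G" "x \<in> Hm d'" "y \<in> Hm d" "x \<in> carrier E" "y \<in> carrier E"
    have dg: "d \<cdot> g \<in> carrier G" using xy g by simp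
    have yc: "lp y (\<delta> g) \<in> carrier LT" by (rule lp_closed[OF xy(6) g])
    have "tlift K LTTT ?B (PhiL g (pE x y)) =
        tlift K LTTT (?b (lp y (\<delta> g))) (PhiL (d \<cdot> g) (comult E x))"
      using xy g by (simp add: PhiL[OF g xy(5,2,4)] tlift_pt[OF m1 m1 m3 p2] lp_closed LA_comult)
    also have "\<dots> = XiL g (tlift K EEE (?e y) (comult E x))"
    proof (rule EE_eqI[OF comult_E_closed[OF xy(5)] m3])
      fix x1 x2 d1 d2 assume x: "d1 \<in> carrier G" "d2 \<in> carrier G" "x1 \<in> Hm d1" "x2 \<in> Hm d2" "x1 \<in> carrier E" "x2 \<in> carrier E"
      show "tlift K LTTT (?b (lp y (\<delta> g))) (PhiL (d \<cdot> g) (pE x1 x2)) =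
          XiL g (tlift K EEE (?e y) (pE x1 x2))"
        using x g dg xy yc by (simp add: PhiL[OF dg x(5,2,4)] tlift_pt[OF m1 m1 m3 p2'] lp_closed tlift_pt[OF mE mE mEEE q2'] XiL[OF g x(5,2,4) xy(2,4)])
    qed (insert g xy dg yc p2'[OF yc] q2'[OF xy(6)], (rule LA_lins | assumption)+)
    finally show "tlift K LTTT ?B (PhiL g (pE x y)) =
      XiL g (tlift K EEE ?d (pE x y))"
      by (simp add: tlift_pt[OF mE mE mEEE q2] xy)
  qed (insert g, (rule LA_lins p2 q2 comult_E_lin | assumption)+)
  show ?thesis
  proof (rule LT_eqI[OF a m3])
    fix d b u assume *: "d \<in> carrier G" "b \<in> Hm d" "b \<in> carrier E" "u \<in> carrier G"
    show "tlift K LTTT ?C (comult LA (lp b (\<delta> u))) =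
      tlift K LTTT ?B (comult LA (lp b (\<delta> u)))"
      using * by (simp add: LA_comult c1 c2 comult_E_closed k_coalgebra.coassoc[OF coalgebra_E])
  qed (rule LA_lins p1 p2 | assumption)+
qed

lemma LA_coalgebra: "k_coalgebra K LA"
proof (rule k_coalgebra.intro, unfold LA_eq)
  note m1 = module_LT(1)
  interpret m: module K LT by (rule m1)
  interpret mE: module K E by (rule module_E)
  show "field K" by (rule field_K)
  show "module K LA" by (rule k_algebra.is_module[OF LA_algebra])
  show "comult LA \<in> lin_map K LT LTT" by (rule LA_comult_lin)
  show "counit LA \<in> lin_map K LT (ground K)" by (rule LA_counit_lin)
  fix a assume a: "a \<in> carrier LT"
  show "tlift K LTTT (\<lambda>x y. pt K LT LTT x (comult LA y)) (comult LA a) =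
      tlift K LTTT (\<lambda>x y. tlift K LTTT (\<lambda>x1 x2. pt K LT LTT x1 (lpp x2 y)) (comult LA x)) (comult LA a)"
    by (rule LA_coassoc[OF a])
  let ?l = "\<lambda>x y. counit LA x \<odot>\<^bsub>LT\<^esub> y" and ?r = "\<lambda>x y. counit LA y \<odot>\<^bsub>LT\<^esub> x"
  let ?s = "\<lambda>x y. counit E x \<odot>\<^sub>E y" and ?t = "\<lambda>x y. counit E y \<odot>\<^sub>E x"
  have p1: "?l \<in> bilin K LT LT LT" "?r \<in> bilin K LT LT LT"
    by (rule LA_lins | assumption)+
  have q1: "?s \<in> bilin K E E E" "?t \<in> bilin K E E E"
    by (rule LA_lins counit_E_lin | assumption)+
  have c1: "tlift K LT ?l (PhiL g t) = lp (tlift K E ?s t) (\<delta> g)"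
    if g: "g \<in> carrier G" and t: "t \<in> carrier EE" for g t
  proof (rule EE_eqI[OF t m1])
    fix x y d' d assume xy: "d' \<in> carrier G" "d \<in> carrier G" "x \<in> Hm d'" "y \<in> Hm d" "x \<in> carrier E" "y \<in> carrier E"
    then show "tlift K LT ?l (PhiL g (pE x y)) = lp (tlift K E ?s (pE x y)) (\<delta> g)"
      using g by (simp add: PhiL[OF g xy(5,2,4)] tlift_pt[OF m1 m1 m1 p1(1)] lp_closed LA_counit tlift_pt[OF module_E module_E module_E q1(1)]
        pt_smult_left[OF module_E module_KG] counit_E_closed)
  qed (insert g, (rule LA_lins p1 q1 | assumption)+)
  have c2: "tlift K LT ?r (PhiL g t) = lp (tlift K E ?t t) (\<delta> g)"
    if g: "g \<in> carrier G" and t: "t \<in> carrier EE" for g t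
  proof (rule EE_eqI[OF t m1])
    fix x y d' d assume xy: "d' \<in> carrier G" "d \<in> carrier G" "x \<in> Hm d'" "y \<in> Hm d" "x \<in> carrier E" "y \<in> carrier E"
    \<comment> \<open>The surviving leg is x \<otimes> dg instead of x \<otimes> g. The counit of y
      repairs this, since it vanishes unless d = 1.\<close>
    then show "tlift K LT ?r (PhiL g (pE x y)) = lp (tlift K E ?t (pE x y)) (\<delta> g)"
      using g counit_Hm[OF xy(2,4)]
      by (cases "d = \<one>\<^sub>G")
       (simp_all add: PhiL[OF g xy(5,2,4)] tlift_pt[OF m1 m1 m1 p1(2)] lp_closed LA_counit tlift_pt[OF module_E module_E module_E q1(2)]
        pt_smult_left[OF module_E module_KG] counit_E_closed pt_zero_left[OF module_E module_KG])
  qed (insert g, (rule LA_lins p1 q1 | assumption)+)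
  show "tlift K LT ?l (comult LA a) = a"
    by (rule LT_eqI[OF a m1], (rule LA_lins p1 | assumption)+)
      (simp add: LA_comult c1 comult_E_closed k_coalgebra.counit_left[OF coalgebra_E])
  show "tlift K LT ?r (comult LA a) = a"
    by (rule LT_eqI[OF a m1], (rule LA_lins p1 | assumption)+)
      (simp add: LA_comult c2 comult_E_closed k_coalgebra.counit_right[OF coalgebra_E])
qed

lemma LA_antipode: "\<exists>S. is_antipode K LA S"
proof -
  note m1 = module_LT(1)
  interpret m: module K LT by (rule m1)
  interpret mE: module K E by (rule module_E)
  obtain S where S: "is_antipode K E S" "\<And>g b. g \<in> carrier G \<Longrightarrow> b \<in> carrier E \<Longrightarrow> S (\<sigma> g b) = \<sigma> g (S b)"
      "\<And>d b. d \<in> carrier G \<Longrightarrow> b \<in> Hm d \<Longrightarrow> S b \<in> lin_span K E (Hm d)" using antipode by blast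
  have Sl: "S \<in> lin_map K E E" using S(1) by (simp add: is_antipode_def)
  note Sr = lin_comp[OF Sl] lin_map_closed[OF Sl]
  define SK where "SK = free_lift K KG (\<lambda>g. \<delta> (inv\<^sub>G g))"
  have SK: "SK \<in> lin_map K KG KG" unfolding SK_def by (rule lin_KG[OF module_KG]) auto
  have SK\<delta>: "SK (\<delta> g) = \<delta> (inv\<^sub>G g)" if "g \<in> carrier G" for g
    unfolding SK_def using that by (intro free_lift_single[OF module_KG]) auto
  note mult_rs = lin_comp[OF bilin_left[OF LA_mult_bilin]] lin_comp[OF bilin_right[OF LA_mult_bilin]] LA_m_closed
  note rs = LA_lins Sr Sl lin_comp[OF SK] lin_map_closed[OF SK] mult_rs
  have oneK: "\<one>\<^sub>H \<in> carrier KG" by (simp add: KG_one)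
  \<comment> \<open>The standard antipode of a biproduct: S(b \<otimes> h) = (1 \<otimes> S(b^1 h))
    (S(b^0) \<otimes> 1), where b^1 \<otimes> b^0 is the coaction of b.\<close>
  define SA where "SA = tlift K LT (\<lambda>b h. tlift K LT (\<lambda>x c. lp \<one>\<^sub>E (SK (x \<otimes>\<^sub>H h)) \<otimes>\<^sub>L lp (S c) \<one>\<^sub>H) (co b))"
  have b1: "(\<lambda>b h. tlift K LT (\<lambda>x c. lp \<one>\<^sub>E (SK (x \<otimes>\<^sub>H h)) \<otimes>\<^sub>L lp (S c) \<one>\<^sub>H) (co b)) \<in> bilin K E KG LT"
    by (rule rs oneK E.one_closed | assumption)+
  have SAl: "SA \<in> lin_map K LT LT" unfolding SA_def by (rule tlift_lin[OF module_E module_KG m1 b1])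
  have SA: "SA (lp b (\<delta> g)) = lp (\<sigma> (inv\<^sub>G (d \<cdot> g)) (S b)) (\<delta> (inv\<^sub>G (d \<cdot> g)))"
    if d: "d \<in> carrier G" and b: "b \<in> Hm d" and g: "g \<in> carrier G" for d b g
  proof -
    note bE = Hm_closed[OF d b]
    have b2: "(\<lambda>x c. lp \<one>\<^sub>E (SK (x \<otimes>\<^sub>H \<delta> g)) \<otimes>\<^sub>L lp (S c) \<one>\<^sub>H) \<in> bilin K KG E LT"
      using g by - (rule rs oneK E.one_closed | assumption)+
    show ?thesis unfolding SA_def using d g bE lin_map_closed[OF Sl bE] oneK
      by (simp add: tlift_pt[OF module_E module_KG m1 b1] co_Hm[OF d b] tlift_pt[OF module_KG module_E m1 b2] KG_mult SK\<delta> LA_mult \<sigma>_closed)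
        (simp add: KG_one KG_mult)
  qed
  have oneA: "\<one>\<^bsub>LA\<^esub> \<in> carrier LT" by (simp add: LA_lin KG_one lp_closed)
  let ?l = "\<lambda>x y. SA x \<otimes>\<^sub>L y" and ?r = "\<lambda>x y. x \<otimes>\<^sub>L SA y"
  let ?s = "\<lambda>x y. S x \<star> y" and ?t = "\<lambda>x y. x \<star> S y"
  have p: "?l \<in> bilin K LT LT LT" "?r \<in> bilin K LT LT LT"
    by (rule rs lin_comp[OF SAl] lin_map_closed[OF SAl] SAl | assumption)+
  have q: "?s \<in> bilin K E E E" "?t \<in> bilin K E E E"
    by (rule rs | assumption)+
  have 1: "tlift K LT ?l (comult LA (lp b (\<delta> g))) = counit LA (lp b (\<delta> g)) \<odot>\<^bsub>LT\<^esub> \<one>\<^bsub>LA\<^esub>"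
    "tlift K LT ?r (comult LA (lp b (\<delta> g))) = counit LA (lp b (\<delta> g)) \<odot>\<^bsub>LT\<^esub> \<one>\<^bsub>LA\<^esub>"
    if d: "d \<in> carrier G" and b: "b \<in> Hm d" and bE: "b \<in> carrier E" and g: "g \<in> carrier G" for d b g
  proof -
    let ?u = "inv\<^sub>G (d \<cdot> g)"
    have u: "?u \<in> carrier G" "?u \<cdot> g \<in> carrier G" using d g by auto
    have "tlift K LT ?l (PhiL g (comult E b)) =
      lp (\<sigma> ?u (tlift K E ?s (comult E b))) (\<delta> (?u \<cdot> g))"
    \<comment> \<open>The antipode of x \<otimes> (d2 g) involves the inverse of d1 d2 g. As d1 d2 =
      d for all terms of the coproduct of b, the same group element u twists every term and can be
      taken out.\<close>
    proof (rule comult_E_eqI[OF d b m1])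
      fix x y d1 d2 assume xy: "d1 \<in> carrier G" "d2 \<in> carrier G" "x \<in> Hm d1" "y \<in> Hm d2" "x \<in> carrier E" "y \<in> carrier E" "d = d1 \<cdot> d2"
      have d2g: "d2 \<cdot> g \<in> carrier G" using xy g by simp
      have "tlift K LT ?l (PhiL g (pE x y)) = lp (\<sigma> ?u (S x)) (\<delta> ?u) \<otimes>\<^sub>L lp y (\<delta> g)"
        using xy g by (simp add: PhiL[OF g xy(5,2,4)] tlift_pt[OF m1 m1 m1 p(1)] lp_closed SA[OF xy(1,3) d2g] G.m_assoc)
      also have "\<dots> = lp (\<sigma> ?u (S x \<star> y)) (\<delta> (?u \<cdot> g))"
        using xy(1-6) g u Sr(2) by (simp add: LA_mult_\<delta> \<sigma>_closed alg_hom_mult[OF \<sigma>_hom[OF u(1)]])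
      finally show "tlift K LT ?l (PhiL g (pE x y)) =
          lp (\<sigma> ?u (tlift K E ?s (pE x y))) (\<delta> (?u \<cdot> g))"
        using xy by (simp add: tlift_pt[OF module_E module_E module_E q(1)])
    qed (insert g u, (rule rs p q | assumption)+)
    also have "tlift K E ?s (comult E b) = counit E b \<odot>\<^sub>E \<one>\<^sub>E"
      using S(1) bE by (simp add: is_antipode_def)
    also have "\<sigma> ?u (counit E b \<odot>\<^sub>E \<one>\<^sub>E) = counit E b \<odot>\<^sub>E \<one>\<^sub>E"
      using bE u by (simp add: lin_map_smult[OF \<sigma>_lin[OF u(1)]] alg_hom_one[OF \<sigma>_hom] counit_E_closed)
    \<comment> \<open>For d = 1 the element u g is 1; for any other d the counit of b is
      zero.\<close>
    also have "lp (counit E b \<odot>\<^sub>E \<one>\<^sub>E) (\<delta> (?u \<cdot> g)) = counit E b \<odot>\<^bsub>LT\<^esub> \<one>\<^bsub>LA\<^esub>"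
      using u g d bE counit_Hm[OF d b] oneA
      by (cases "d = \<one>\<^sub>G") (simp_all add: counit_E_closed LA_lin KG_one
          pt_smult_left[OF module_E module_KG] pt_zero_left[OF module_E module_KG])
    finally show "tlift K LT ?l (comult LA (lp b (\<delta> g))) = counit LA (lp b (\<delta> g)) \<odot>\<^bsub>LT\<^esub> \<one>\<^bsub>LA\<^esub>"
      using g bE by (simp add: LA_comult LA_counit)
    \<comment> \<open>Here the group elements cancel term by term, since d2 g acts on what its own
      inverse has twisted. The identity therefore holds for arbitrary tensors.\<close>
    have "tlift K LT ?r (PhiL g t) =
      lp (tlift K E ?t t) (\<delta> \<one>\<^sub>G)" if t: "t \<in> carrier EE" for t
    proof (rule EE_eqI[OF t m1])
      fix x y d1 d2 assume xy: "d1 \<in> carrier G" "d2 \<in> carrier G" "x \<in> Hm d1" "y \<in> Hm d2" "x \<in> carrier E" "y \<in> carrier E"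
      let ?v = "inv\<^sub>G (d2 \<cdot> g)"
      have v: "d2 \<cdot> g \<in> carrier G" "?v \<in> carrier G" using xy g by auto
      have "\<sigma> (d2 \<cdot> g) (\<sigma> ?v (S y)) = S y"
        using \<sigma>_mult[OF v Sr(2)[OF xy(6)]] \<sigma>_one Sr(2) xy v by simp
      then show "tlift K LT ?r (PhiL g (pE x y)) =
          lp (tlift K E ?t (pE x y)) (\<delta> \<one>\<^sub>G)"
        using xy g v Sr(2) by (simp add: PhiL[OF g xy(5,2,4)] tlift_pt[OF m1 m1 m1 p(2)] lp_closed SA[OF xy(2,4) g]
            tlift_pt[OF module_E module_E module_E q(2)] LA_mult_\<delta> \<sigma>_closed)
    qed (insert g, (rule rs p q G.one_closed | assumption)+)
    then show "tlift K LT ?r (comult LA (lp b (\<delta> g))) = counit LA (lp b (\<delta> g)) \<odot>\<^bsub>LT\<^esub> \<one>\<^bsub>LA\<^esub>"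
      using g bE S(1) by (simp add: LA_comult LA_counit comult_E_closed is_antipode_def LA_lin KG_one
          pt_smult_left[OF module_E module_KG] counit_E_closed)
  qed
  have r: "(\<lambda>a. counit LA a \<odot>\<^bsub>LT\<^esub> \<one>\<^bsub>LA\<^esub>) \<in> lin_map K LT LT" by (intro lin_scal m1 LA_counit_lin oneA)
  have "is_antipode K LA SA"
    unfolding is_antipode_def LA_eq
  proof (intro conjI ballI SAl)
    fix a assume a: "a \<in> carrier LT"
    show "tlift K LT ?l (comult LA a) = counit LA a \<odot>\<^bsub>LT\<^esub> \<one>\<^bsub>LA\<^esub>"
      by (rule LT_eqI[OF a m1 lin_comp[OF tlift_lin[OF m1 m1 m1 p(1)] LA_comult_lin] r 1(1)])
    show "tlift K LT ?r (comult LA a) = counit LA a \<odot>\<^bsub>LT\<^esub> \<one>\<^bsub>LA\<^esub>"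
      by (rule LT_eqI[OF a m1 lin_comp[OF tlift_lin[OF m1 m1 m1 p(2)] LA_comult_lin] r 1(2)])
  qed
  then show ?thesis by blast
qed

lemma LA_hopf: "hopf_algebra K LA"
  by (rule hopf_algebra.intro[OF LA_algebra LA_coalgebra LA_comult_hom LA_counit_hom LA_antipode])

end

section \<open>Factorisation of a biproduct into its two embedded factors\<close>

context kvect
begin

lemma tlift_id:
  assumes V: "module K V" and W: "module K W" and t: "t \<in> carrier (tensor K V W)"
    and Z: "same_lin Z (tensor K V W)"
    and \<phi>: "\<And>v w. v \<in> carrier V \<Longrightarrow> w \<in> carrier W \<Longrightarrow> \<phi> v w = pt K V W v w"
  shows "tlift K Z \<phi> t = t"
proof -
  note T = module_tensor[OF V W]
  have b: "\<phi> \<in> bilin K V W (tensor K V W)"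
  proof (rule bilinI)
    fix w assume "w \<in> carrier W"
    then show "(\<lambda>v. \<phi> v w) \<in> lin_map K V (tensor K V W)"
      by (intro lin_map_cong[OF bilin_left[OF pt_bilin[OF V W]] _ V]) (auto simp: \<phi>)
  next
    fix v assume "v \<in> carrier V"
    then show "(\<lambda>w. \<phi> v w) \<in> lin_map K W (tensor K V W)"
      by (intro lin_map_cong[OF bilin_right[OF pt_bilin[OF V W]] _ W]) (auto simp: \<phi>)
  qed
  have "tlift K (tensor K V W) \<phi> t = tlift K (tensor K V W) (pt K V W) t"
    by (rule tlift_fun_cong[OF t V W T b pt_bilin[OF V W] \<phi>])
  then show ?thesis by (simp add: tlift_cong[OF Z] tlift_pt_id[OF V W t])
qed

text \<open>A subalgebra that contains X contains every pure tensor, and these span.\<close>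

lemma alg_span_eq_carrier:
  assumes A: "k_algebra K A" and sl: "same_lin A (tensor K V W)" and V: "module K V" and W: "module K W"
    and X: "X \<subseteq> carrier A"
    and gen: "\<And>v w. v \<in> carrier V \<Longrightarrow> w \<in> carrier W \<Longrightarrow> \<exists>x\<in>X. \<exists>y\<in>X. pt K V W v w = x \<otimes>\<^bsub>A\<^esub> y"
  shows "alg_span K A X = carrier A"
proof
  note mA = k_algebra.is_module[OF A] and rA = k_algebra.is_ring[OF A]
  have "submodule (carrier A) K A" by (rule module.carrier_is_submodule[OF mA])
  then show "alg_span K A X \<subseteq> carrier A"
    unfolding alg_span_def using ring.carrier_is_subring[OF rA] X by blast
  show "carrier A \<subseteq> alg_span K A X"
    unfolding alg_span_def
  proof (intro Inter_greatest, clarify)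
    fix U a assume U: "subring U A" "submodule U K A" "X \<subseteq> U" and a: "a \<in> carrier A"
    have s: "submodule U K (tensor K V W)"
      using U(2) sl by (simp add: same_lin_def submodule_def submodule_axioms_def subgroup_def m_inv_def)
    have "lin_span K (tensor K V W) {pt K V W v w |v w. v \<in> carrier V \<and> w \<in> carrier W} \<subseteq> U"
    proof (rule lin_span_least[OF s], clarify)
      fix v w assume "v \<in> carrier V" "w \<in> carrier W"
      with gen obtain x y where "x \<in> X" "y \<in> X" "pt K V W v w = x \<otimes>\<^bsub>A\<^esub> y" by blast
      with subringE(6)[OF U(1), of x y] subsetD[OF U(3)] show "pt K V W v w \<in> U" by simp
    qed
    with a sl show "a \<in> U" by (auto simp: tensor_span_all[OF V W] same_lin_def)
  qed
qed

text \<open>Contracting the second leg with a functional that takes the value 1 at w is a left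
  inverse. Below the functional is the counit.\<close>

lemma inj_on_pt_left:
  assumes V: "module K V" and W: "module K W" and w: "w \<in> carrier W"
    and e: "e \<in> lin_map K W (ground K)" "e w = \<one>\<^bsub>K\<^esub>"
  shows "inj_on (\<lambda>v. pt K V W v w) (carrier V)"
proof (rule inj_onI)
  fix v v' assume v: "v \<in> carrier V" "v' \<in> carrier V" "pt K V W v w = pt K V W v' w"
  interpret V: module K V by (rule V)
  have b: "(\<lambda>v w. e w \<odot>\<^bsub>V\<^esub> v) \<in> bilin K V W V"
    by (intro bilinI lin_scal lin_smult lin_id V W e lin_map_closed[OF e(1), unfolded ground_simps])
  have "tlift K V (\<lambda>v w. e w \<odot>\<^bsub>V\<^esub> v) (pt K V W v w) = tlift K V (\<lambda>v w. e w \<odot>\<^bsub>V\<^esub> v) (pt K V W v' w)"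
    using v(3) by simp
  then show "v = v'" using v(1,2) w e(2) by (simp add: tlift_pt[OF V W V b])
qed

lemma inj_on_pt_right:
  assumes V: "module K V" and W: "module K W" and v: "v \<in> carrier V"
    and e: "e \<in> lin_map K V (ground K)" "e v = \<one>\<^bsub>K\<^esub>"
  shows "inj_on (\<lambda>w. pt K V W v w) (carrier W)"
proof (rule inj_onI)
  fix w w' assume w: "w \<in> carrier W" "w' \<in> carrier W" "pt K V W v w = pt K V W v w'"
  interpret W: module K W by (rule W)
  have b: "(\<lambda>v w. e v \<odot>\<^bsub>W\<^esub> w) \<in> bilin K V W W"
    by (intro bilinI lin_scal lin_smult lin_id V W e lin_map_closed[OF e(1), unfolded ground_simps])
  have "tlift K W (\<lambda>v w. e v \<odot>\<^bsub>W\<^esub> w) (pt K V W v w) = tlift K W (\<lambda>v w. e v \<odot>\<^bsub>W\<^esub> w) (pt K V W v w')"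
    using w(3) by simp
  then show "w = w'" using w(1,2) v e(2) by (simp add: tlift_pt[OF V W W b])
qed

lemma bij_betw_id:
  assumes "\<And>t. t \<in> S \<Longrightarrow> f t = t" "S = T"
  shows "bij_betw f S T"
  using assms by (auto simp: bij_betw_def inj_on_def image_iff)

end

context braided_hopf
begin

lemma KG_one_closed: "\<one>\<^sub>H \<in> carrier KG" by (simp add: KG_one)

lemma left_iota_E: "(\<lambda>b. lp b \<one>\<^sub>H) \<in> alg_hom K E LA"
proof (rule alg_homI)
  show "(\<lambda>b. lp b \<one>\<^sub>H) \<in> lin_map K E LA"
    unfolding LA_eq by (rule bilin_left[OF pt_bilin[OF module_E module_KG] KG_one_closed])
qed (auto simp: LA_lin KG_one LA_mult_\<delta> \<sigma>_one)

lemma left_iota_H_alg: "(\<lambda>h. lp \<one>\<^sub>E h) \<in> alg_hom K KG LA"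
proof (rule alg_homI_span[OF module_KG k_algebra.is_module[OF LA_algebra] _ _ k_algebra_mult_bilin[OF algebra_KG]
      k_algebra_mult_bilin[OF LA_algebra] \<delta>_sub_KG KG_span])
  show "(\<lambda>h. lp \<one>\<^sub>E h) \<in> lin_map K KG LA"
    unfolding LA_eq by (rule bilin_right[OF pt_bilin[OF module_E module_KG] E.one_closed])
qed (auto simp: LA_lin LA_mult_\<delta> KG_mult alg_hom_one[OF \<sigma>_hom])

lemma left_iota_H: "(\<lambda>h. lp \<one>\<^sub>E h) \<in> hopf_hom K KG LA"
  unfolding hopf_hom_def LA_eq
proof (intro CollectI conjI ballI left_iota_H_alg)
  fix h assume h: "h \<in> carrier KG"
  have b: "(\<lambda>x y. lpp (lp \<one>\<^sub>E x) (lp \<one>\<^sub>E y)) \<in> bilin K KG KG LTT"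
    by (rule LA_lins E.one_closed | assumption)+
  show "comult LA (lp \<one>\<^sub>E h) = tlift K LTT (\<lambda>x y. lpp (lp \<one>\<^sub>E x) (lp \<one>\<^sub>E y)) (comult KG h)"
    by (rule KG_eqI[OF module_LT(2) _ _ _ h], (rule LA_lins E.one_closed | assumption)+)
      (simp add: LA_comult comult_one PhiL[OF _ _ _ Hm_one] tlift_comult_KG[OF _ module_LT(2) b])
  show "counit LA (lp \<one>\<^sub>E h) = counit KG h"
    by (rule KG_eqI[OF module_ground _ _ _ h], (rule LA_lins E.one_closed counit_KG_lin | assumption)+)
      (simp add: LA_counit counit_one counit_KG)
qed

lemma left_factor: "b \<in> carrier E \<Longrightarrow> h \<in> carrier KG \<Longrightarrow> lp b \<one>\<^sub>H \<otimes>\<^sub>L lp \<one>\<^sub>E h = lp b h"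
  using k_algebra.is_ring[OF algebra_KG] ring.ring_simprules(12)[of KG h]
  by (simp add: KG_one LA_mult \<sigma>_one)

text \<open>The product of the images of b and h is the pure tensor b \<otimes> h, so the
  multiplication map is the identity on the shared carrier; linearity and bijectivity are immediate
  from that. The counits provide injectivity of the embeddings.\<close>

lemma left_conclusion:
  shows "left_braided_group K KG E act co \<and> hopf_algebra K LA \<and>
     (\<lambda>b. lp b \<one>\<^sub>H) \<in> alg_hom K E LA \<and> inj_on (\<lambda>b. lp b \<one>\<^sub>H) (carrier E) \<and>
     (\<lambda>h. lp \<one>\<^sub>E h) \<in> hopf_hom K KG LA \<and> inj_on (\<lambda>h. lp \<one>\<^sub>E h) (carrier KG) \<and>
     alg_span K LA ((\<lambda>b. lp b \<one>\<^sub>H) ` carrier E \<union> (\<lambda>h. lp \<one>\<^sub>E h) ` carrier KG) = carrier LA \<and>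
     tlift K LA (\<lambda>b h. lp b \<one>\<^sub>H \<otimes>\<^sub>L lp \<one>\<^sub>E h) \<in> lin_map K LT LA \<and>
     bij_betw (tlift K LA (\<lambda>b h. lp b \<one>\<^sub>H \<otimes>\<^sub>L lp \<one>\<^sub>E h)) (carrier LT) (carrier LA)"
proof (intro conjI left_braided LA_hopf left_iota_E left_iota_H)
  show "inj_on (\<lambda>b. lp b \<one>\<^sub>H) (carrier E)"
    by (rule inj_on_pt_left[OF module_E module_KG KG_one_closed counit_KG_lin]) (simp add: KG_one counit_KG)
  show "inj_on (\<lambda>h. lp \<one>\<^sub>E h) (carrier KG)"
    by (rule inj_on_pt_right[OF module_E module_KG E.one_closed counit_E_lin counit_one])
  show "alg_span K LA ((\<lambda>b. lp b \<one>\<^sub>H) ` carrier E \<union> (\<lambda>h. lp \<one>\<^sub>E h) ` carrier KG) = carrier LA"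
  proof (rule alg_span_eq_carrier[OF LA_algebra same_lin_LA module_E module_KG])
    show "(\<lambda>b. lp b \<one>\<^sub>H) ` carrier E \<union> (\<lambda>h. lp \<one>\<^sub>E h) ` carrier KG \<subseteq> carrier LA"
      using alg_hom_closed[OF left_iota_E] alg_hom_closed[OF left_iota_H_alg] by auto
  qed (use left_factor[symmetric] in blast)
  have id: "tlift K LA (\<lambda>b h. lp b \<one>\<^sub>H \<otimes>\<^sub>L lp \<one>\<^sub>E h) t = t" if "t \<in> carrier LT" for t
    by (rule tlift_id[OF module_E module_KG that same_lin_LA left_factor])
  then show "bij_betw (tlift K LA (\<lambda>b h. lp b \<one>\<^sub>H \<otimes>\<^sub>L lp \<one>\<^sub>E h)) (carrier LT) (carrier LA)"
    by (intro bij_betw_id) (auto simp: LA_lin)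
  show "tlift K LA (\<lambda>b h. lp b \<one>\<^sub>H \<otimes>\<^sub>L lp \<one>\<^sub>E h) \<in> lin_map K LT LA"
    by (rule lin_map_cong[OF _ id[symmetric] module_LT(1)]) (simp_all add: LA_eq lin_id)
qed

lemma left_relation: "g \<in> carrier G \<Longrightarrow> b \<in> carrier E \<Longrightarrow>
    lp \<one>\<^sub>E (\<delta> g) \<otimes>\<^sub>L lp b \<one>\<^sub>H = lp (\<sigma> g b) \<one>\<^sub>H \<otimes>\<^sub>L lp \<one>\<^sub>E (\<delta> g)"
  by (simp add: KG_one LA_mult_\<delta> \<sigma>_one \<sigma>_closed)

lemma left_comult_primitive:
  assumes d: "d \<in> carrier G" "b \<in> Hm d"
    and p: "comult E b = pE b \<one>\<^sub>E \<oplus>\<^bsub>EE\<^esub> pE \<one>\<^sub>E b"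
  shows "comult LA (lp b \<one>\<^sub>H) =
    pt K LA LA (lp b \<one>\<^sub>H) \<one>\<^bsub>LA\<^esub> \<oplus>\<^bsub>tensor K LA LA\<^esub> pt K LA LA (lp \<one>\<^sub>E (\<delta> d)) (lp b \<one>\<^sub>H)"
  using d Hm_closed[OF d]
  by (simp add: LA_eq KG_one LA_comult p lin_map_add[OF PhiL_lin] pt_closed[OF module_E module_E]
      PhiL[OF _ _ G.one_closed Hm_one] PhiL[OF _ _ d] LA_lin)

lemma left_counit: "b \<in> carrier E \<Longrightarrow> counit LA (lp b \<one>\<^sub>H) = counit E b"
  by (simp add: KG_one LA_counit)

subsection \<open>The right crossed module\<close>

abbreviation "ract \<equiv> dual_act K G E co"
abbreviation "rco \<equiv> dual_coact K G E act"

lemma ground_finsum: "finsum (ground K) = finsum K"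
  by (rule finsum_record_cong) simp_all

lemma pairing_bilin: "(\<lambda>f x. \<Oplus>\<^bsub>K\<^esub>g\<in>carrier G. f g \<otimes>\<^bsub>K\<^esub> x g) \<in> bilin K FG KG (ground K)"
  unfolding ground_finsum[symmetric]
  by (intro bilinI lin_finsum lin_ground_mult1 lin_ground_mult2 module_FG module_KG module_ground finite_G eval_lin KG_eval KG_closed FG_closed)

lemma pairing_\<delta>:
  assumes f: "f \<in> carrier FG" and d: "d \<in> carrier G"
  shows "(\<Oplus>\<^bsub>K\<^esub>g\<in>carrier G. f g \<otimes>\<^bsub>K\<^esub> \<delta> d g) = f d"
  unfolding ground_finsum[symmetric]
  by (subst finsum_only[OF module_ground finite_G d]) (auto simp: single_def FG_closed[OF f])

lemma FG_one_at: "d \<in> carrier G \<Longrightarrow> \<one>\<^sub>F d = \<one>\<^bsub>K\<^esub>"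
  by (simp add: FG_one_apply)

lemma ract_aux_bilin: "f \<in> carrier FG \<Longrightarrow> (\<lambda>x w. (\<Oplus>\<^bsub>K\<^esub>g\<in>carrier G. f g \<otimes>\<^bsub>K\<^esub> x g) \<odot>\<^sub>E w) \<in> bilin K KG E E"
  by (intro bilinI lin_scal lin_smult lin_id module_KG module_E bilin_right[OF pairing_bilin] bilin_closed[OF pairing_bilin, unfolded ground_simps])

lemma ract_lin1: "f \<in> carrier FG \<Longrightarrow> (\<lambda>v. ract v f) \<in> lin_map K E E"
  unfolding dual_act_def by (rule lin_tlift1[OF co_lin module_KG module_E module_E ract_aux_bilin])

lemma ract_lin2: "v \<in> carrier E \<Longrightarrow> (\<lambda>f. ract v f) \<in> lin_map K FG E"
  unfolding dual_act_def
  by (intro lin_tlift2[OF co_closed module_KG module_E module_E module_FG] ract_aux_bilin lin_scal module_FG module_E bilin_left[OF pairing_bilin])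

lemma ract_closed: "v \<in> carrier E \<Longrightarrow> f \<in> carrier FG \<Longrightarrow> ract v f \<in> carrier E"
  using lin_map_closed[OF ract_lin2] .

lemma ract_Hm:
  assumes "d \<in> carrier G" "v \<in> Hm d" "f \<in> carrier FG"
  shows "ract v f = f d \<odot>\<^sub>E v"
  unfolding dual_act_def using assms Hm_closed[OF assms(1,2)]
  by (simp add: co_Hm tlift_pt[OF module_KG module_E module_E ract_aux_bilin] pairing_\<delta>)

abbreviation "RT \<equiv> tensor K E FG"

lemma module_RT: "module K RT" by (intro module_tensor module_E module_FG)

lemma rco_eq: "v \<in> carrier E \<Longrightarrow> rco v = (\<Oplus>\<^bsub>RT\<^esub>g\<in>carrier G. pt K E FG (\<sigma> g v) (\<delta> g))"
  unfolding dual_coact_def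
  by (rule finsum_congI[OF module_RT]) (auto simp: act_\<delta> intro!: pt_closed module_E module_FG \<sigma>_closed \<delta>_FG)

lemma rco_lin: "rco \<in> lin_map K E RT"
  unfolding dual_coact_def[abs_def]
  by (intro lin_finsum lin_pt1 act_lin2 module_E module_FG module_RT finite_G \<delta>_FG \<delta>_KG)

lemmas rco_closed = lin_map_closed[OF rco_lin]

text \<open>The coaction dual to the action is a sum over the group, so Sweedler expressions in it
  become sums whose second leg is a delta function.\<close>

lemma tlift_rco:
  assumes v: "v \<in> carrier E" and Z: "module K Z" and \<phi>: "\<phi> \<in> bilin K E FG Z"
  shows "tlift K Z \<phi> (rco v) = (\<Oplus>\<^bsub>Z\<^esub>g\<in>carrier G. \<phi> (\<sigma> g v) (\<delta> g))"
proof -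
  have c: "pt K E FG (\<sigma> g v) (\<delta> g) \<in> carrier RT" if "g \<in> carrier G" for g
    by (intro pt_closed module_E module_FG \<sigma>_closed \<delta>_FG that v)
  show ?thesis unfolding rco_eq[OF v]
    by (subst lin_map_finsum[OF tlift_lin[OF module_E module_FG Z \<phi>] module_RT Z finite_G c], assumption, rule finsum_congI[OF Z])
      (use v bilin_closed[OF \<phi>] in \<open>auto simp: tlift_pt[OF module_E module_FG Z \<phi>] \<sigma>_closed \<delta>_FG\<close>)
qed

lemmas R_lins = gr_lins FG_lins lin_comp[OF rco_lin] rco_closed lin_comp[OF ract_lin1] lin_comp[OF ract_lin2] ract_closed
  counit_FG_lin \<delta>_FG FG_mult_closed lin_comp[OF right_transl_lin] lin_comp[OF left_transl_lin] right_transl_closed left_transl_closed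
  finite_G lin_map_closed[OF counit_FG_lin, unfolded ground_simps]

lemma right_transl_\<delta>: "u \<in> carrier G \<Longrightarrow> g \<in> carrier G \<Longrightarrow> \<R> u (\<delta> g) = \<delta> (g \<cdot> inv\<^sub>G u)"
  by (auto simp: right_transl_def single_def fun_eq_iff G.m_assoc)

lemma bij_mult_right: "u \<in> carrier G \<Longrightarrow> bij_betw (\<lambda>g. g \<cdot> u) (carrier G) (carrier G)"
  by (rule bij_betwI[where g = "\<lambda>g. g \<cdot> inv\<^sub>G u"]) (auto simp: G.m_assoc)

lemma right_crossed: "right_crossed_module K FG E ract rco"
proof (rule right_crossed_module.intro)
  note m = module_E and mF = module_FG and mT = module_RT
  interpret m: module K E by (rule m)
  show "module K E" by (rule m)
  show "(\<lambda>v. ract v h) \<in> lin_map K E E" if "h \<in> carrier FG" for h by (rule ract_lin1[OF that])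
  show "ract v \<in> lin_map K FG E" if "v \<in> carrier E" for v by (rule ract_lin2[OF that])
  show "ract v (h \<otimes>\<^sub>F h') = ract (ract v h) h'" if "h \<in> carrier FG" "h' \<in> carrier FG" "v \<in> carrier E" for h h' v
  proof (rule E_eqI[OF m _ _ _ that(3)])
    fix d b assume d: "d \<in> carrier G" "b \<in> Hm d"
    then show "ract b (h \<otimes>\<^sub>F h') = ract (ract b h) h'"
      using that Hm_closed[OF d] K.m_comm[of "h d" "h' d"] m.smult_assoc1[of "h d" "h' d" b]
      by (simp add: ract_Hm[OF d] FG_mult_closed FG_mult_apply lin_map_smult[OF ract_lin1] FG_closed)
  qed (insert that, (rule R_lins ract_lin1 | assumption)+)
  show "ract v \<one>\<^sub>F = v" if "v \<in> carrier E" for v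
    by (rule E_eqI[OF m _ lin_id _ that], (rule R_lins ract_lin1 FG_one_closed | assumption)+)
      (simp add: ract_Hm FG_one_closed FG_one_at Hm_closed)
  show "rco \<in> lin_map K E RT" by (rule rco_lin)
  show "tlift K (tensor K RT FG) (\<lambda>w h. pt K RT FG (rco w) h) (rco v) =
      tlift K (tensor K RT FG) (\<lambda>w h. tlift K (tensor K RT FG) (\<lambda>h1 h2. pt K RT FG (pt K E FG w h1) h2) (comult FG h)) (rco v)"
    if v: "v \<in> carrier E" for v
  proof -
    let ?Z = "tensor K RT FG" and ?b = "\<lambda>w h1 h2. pt K RT FG (pt K E FG w h1) h2"
    \<comment> \<open>The common double sum. Coacting twice gives h.u.v \<otimes> \<delta>_h
      \<otimes> \<delta>_u, and g = hu turns it into the coproduct of \<delta>_g, whose terms are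
      \<delta>_{gu^-1} \<otimes> \<delta>_u.\<close>
    let ?F = "\<lambda>g u. pt K RT FG (pt K E FG (\<sigma> g v) (\<delta> (g \<cdot> inv\<^sub>G u))) (\<delta> u)"
    have mZ: "module K ?Z" by (intro module_tensor module_E module_FG)
    have b1: "(\<lambda>w h. pt K RT FG (rco w) h) \<in> bilin K E FG ?Z"
      by (rule R_lins rco_lin | assumption)+
    have b3: "?b w \<in> bilin K FG FG ?Z" if "w \<in> carrier E" for w
      using that by - (rule R_lins rco_lin | assumption)+
    have b2: "(\<lambda>w h. tlift K ?Z (?b w) (comult FG h)) \<in> bilin K E FG ?Z"
      by (rule R_lins rco_lin comult_FG_lin | assumption)+
    have F: "?F g u \<in> carrier ?Z" if "g \<in> carrier G" "u \<in> carrier G" for g u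
      using that v by (intro pt_closed m mT mF \<sigma>_closed \<delta>_FG) auto
    have "tlift K ?Z (\<lambda>w h. pt K RT FG (rco w) h) (rco v) = (\<Oplus>\<^bsub>?Z\<^esub>u\<in>carrier G. pt K RT FG (rco (\<sigma> u v)) (\<delta> u))"
      by (rule tlift_rco[OF v mZ b1])
    also have "\<dots> = (\<Oplus>\<^bsub>?Z\<^esub>u\<in>carrier G. \<Oplus>\<^bsub>?Z\<^esub>g\<in>carrier G. ?F g u)"
    proof (rule finsum_congI[OF mZ finsum_closedI[OF mZ F]])
      fix u assume u: "u \<in> carrier G"
      have "pt K RT FG (rco (\<sigma> u v)) (\<delta> u) = (\<Oplus>\<^bsub>?Z\<^esub>h\<in>carrier G. pt K RT FG (pt K E FG (\<sigma> h (\<sigma> u v)) (\<delta> h)) (\<delta> u))"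
        unfolding rco_eq[OF \<sigma>_closed[OF u v]]
        by (rule lin_map_finsum[OF bilin_left[OF pt_bilin[OF mT mF] \<delta>_FG[OF u]] mT mZ finite_G]) (intro pt_closed m mF \<delta>_FG \<sigma>_closed u v)
      also have "\<dots> = (\<Oplus>\<^bsub>?Z\<^esub>h\<in>carrier G. ?F (h \<cdot> u) u)"
        by (rule finsum_congI[OF mZ F[OF _ u]]) (use u v in \<open>simp_all add: \<sigma>_mult G.m_assoc\<close>)
      also have "\<dots> = (\<Oplus>\<^bsub>?Z\<^esub>g\<in>carrier G. ?F g u)"
        by (rule finsum_reindex_bij[OF mZ bij_mult_right[OF u] F[OF _ u], symmetric])
      finally show "pt K RT FG (rco (\<sigma> u v)) (\<delta> u) = (\<Oplus>\<^bsub>?Z\<^esub>g\<in>carrier G. ?F g u)" .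
    qed
    also have "\<dots> = (\<Oplus>\<^bsub>?Z\<^esub>g\<in>carrier G. \<Oplus>\<^bsub>?Z\<^esub>u\<in>carrier G. ?F g u)"
      by (rule finsum_swap[OF mZ finite_G finite_G F])
    also have "\<dots> = (\<Oplus>\<^bsub>?Z\<^esub>g\<in>carrier G. tlift K ?Z (?b (\<sigma> g v)) (comult FG (\<delta> g)))"
    proof (rule finsum_congI[OF mZ])
      fix g assume g: "g \<in> carrier G"
      show "tlift K ?Z (?b (\<sigma> g v)) (comult FG (\<delta> g)) \<in> carrier ?Z"
        by (rule tlift_closed[OF comult_FG_closed[OF \<delta>_FG[OF g]] mF mF mZ b3[OF \<sigma>_closed[OF g v]]])
      show "(\<Oplus>\<^bsub>?Z\<^esub>u\<in>carrier G. ?F g u) = tlift K ?Z (?b (\<sigma> g v)) (comult FG (\<delta> g))"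
        unfolding tlift_comult_FG_right[OF \<delta>_FG[OF g] mZ b3[OF \<sigma>_closed[OF g v]]]
        by (rule finsum_congI[OF mZ]) (use g v F in \<open>simp_all add: right_transl_\<delta>\<close>)
    qed
    also have "\<dots> = tlift K ?Z (\<lambda>w h. tlift K ?Z (?b w) (comult FG h)) (rco v)"
      by (rule tlift_rco[OF v mZ b2, symmetric])
    finally show ?thesis .
  qed
  have b4: "(\<lambda>w h. counit FG h \<odot>\<^sub>E w) \<in> bilin K E FG E"
    by (rule R_lins | assumption)+
  show "tlift K E (\<lambda>w h. counit FG h \<odot>\<^sub>E w) (rco v) = v" if v: "v \<in> carrier E" for v
    unfolding tlift_rco[OF v m b4]
    by (subst finsum_only[OF m finite_G G.one_closed]) (use v in \<open>auto simp: counit_FG single_def \<sigma>_one \<sigma>_closed\<close>)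
  let ?x = "\<lambda>h1 h2 w x. pt K E FG (ract w h1) (x \<otimes>\<^sub>F h2)" and ?y = "\<lambda>h1 w x. pt K E FG w (h1 \<otimes>\<^sub>F x)"
  show "tlift K RT (\<lambda>h1 h2. tlift K RT (?x h1 h2) (rco v)) (comult FG h) =
      tlift K RT (\<lambda>h1 h2. tlift K RT (?y h1) (rco (ract v h2))) (comult FG h)"
    if h: "h \<in> carrier FG" and v: "v \<in> carrier E" for h v
  proof (rule E_eqI[OF mT _ _ _ v])
    fix d b assume d: "d \<in> carrier G" and b: "b \<in> Hm d"
    note bE = Hm_closed[OF d b]
    have b1: "(\<lambda>h1 h2. tlift K RT (?x h1 h2) (rco b)) \<in> bilin K FG FG RT"
      using bE by - (rule R_lins | assumption)+
    have b2: "(\<lambda>h1 h2. tlift K RT (?y h1) (rco (ract b h2))) \<in> bilin K FG FG RT"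
      using bE by - (rule R_lins | assumption)+
    have b3: "?x h1 h2 \<in> bilin K E FG RT" if "h1 \<in> carrier FG" "h2 \<in> carrier FG" for h1 h2
      using that by - (rule R_lins ract_lin1 | assumption)+
    have b4: "?y h1 \<in> bilin K E FG RT" if "h1 \<in> carrier FG" for h1
      using that by - (rule R_lins | assumption)+
    \<comment> \<open>Both sides are the sum over c of h(cd) times c.b \<otimes> \<delta>_c. On one
      side R_c h is evaluated at the degree c d c^-1 of c.b, on the other L_c h at the degree d of
      b.\<close>
    let ?r = "\<lambda>c. h (c \<cdot> d) \<odot>\<^bsub>RT\<^esub> pt K E FG (\<sigma> c b) (\<delta> c)"
    have rc: "?r c \<in> carrier RT" if "c \<in> carrier G" for c
      using that d bE by (intro module_closures(3)[OF mT] pt_closed m mF \<sigma>_closed \<delta>_FG FG_closed[OF h])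
    have "tlift K RT (?x (\<R> c h) (\<delta> c)) (rco b) = ?r c" if c: "c \<in> carrier G" for c
    proof -
      have cd: "c \<cdot> d \<cdot> inv\<^sub>G c \<in> carrier G" using c d by simp
      have e: "\<R> c h (c \<cdot> d \<cdot> inv\<^sub>G c) = h (c \<cdot> d)" using c d by (simp add: right_transl_def G.m_assoc)
      show ?thesis
        unfolding tlift_rco[OF bE mT b3[OF right_transl_closed[OF c h] \<delta>_FG[OF c]]]
        by (subst finsum_only[OF mT finite_G c])
          (use c d bE h in \<open>auto simp: \<delta>_\<delta> pt_zero_right[OF m mF] ract_closed \<sigma>_closed right_transl_closed pt_closed[OF m mF]
            ract_Hm[OF cd Hm_\<sigma>[OF c d b]] e module_closures(3)[OF mT] pt_smult_left[OF m mF] FG_closed\<close>)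
    qed
    then have 1: "tlift K RT (\<lambda>h1 h2. tlift K RT (?x h1 h2) (rco b)) (comult FG h) = (\<Oplus>\<^bsub>RT\<^esub>c\<in>carrier G. ?r c)"
      unfolding tlift_comult_FG_right[OF h mT b1] by (intro finsum_congI[OF mT] rc)
    have "tlift K RT (?y (\<delta> u)) (rco (ract b (left_transl K G u h))) = ?r u" if u: "u \<in> carrier G" for u
    proof -
      have e: "left_transl K G u h d = h (u \<cdot> d)" using d by (simp add: left_transl_def)
      show ?thesis
        unfolding tlift_rco[OF ract_closed[OF bE left_transl_closed[OF u h]] mT b4[OF \<delta>_FG[OF u]]]
        by (subst finsum_only[OF mT finite_G u])
          (use u d bE h in \<open>auto simp: \<delta>_\<delta> pt_zero_right[OF m mF] ract_closed \<sigma>_closed left_transl_closed pt_closed[OF m mF]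
            ract_Hm[OF d b] e module_closures(3)[OF mT] pt_smult_left[OF m mF] FG_closed lin_map_smult[OF \<sigma>_lin]\<close>)
    qed
    then have 2: "tlift K RT (\<lambda>h1 h2. tlift K RT (?y h1) (rco (ract b h2))) (comult FG h) = (\<Oplus>\<^bsub>RT\<^esub>c\<in>carrier G. ?r c)"
      unfolding tlift_comult_FG_left[OF h mT b2] by (intro finsum_congI[OF mT] rc)
    show "tlift K RT (\<lambda>h1 h2. tlift K RT (?x h1 h2) (rco b)) (comult FG h) =
        tlift K RT (\<lambda>h1 h2. tlift K RT (?y h1) (rco (ract b h2))) (comult FG h)"
      unfolding 1 2 ..
  qed (insert h, (rule R_lins | assumption)+)
qed

end

section \<open>The braided group in right crossed modules over the function algebra\<close>

context braided_hopf
begin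

lemma right_braiding_bilin: "right_braiding K E ract rco \<in> bilin K E E EE"
  unfolding right_braiding_def[abs_def]
  by (rule R_lins ract_lin1 ract_lin2 | assumption)+

text \<open>For v of degree d the right braiding is the sum over g of g.w \<otimes> v.\<delta>_g,
  and v.\<delta>_g = \<delta>_g(d) v leaves the term d.w \<otimes> v. Thus the equivalence of
  categories keeps the braiding.\<close>

lemma right_braiding_eq:
  assumes v: "v \<in> carrier E" and w: "w \<in> carrier E"
  shows "right_braiding K E ract rco v w = left_braiding K E act co v w"
proof (rule E_eqI[OF module_EE bilin_left[OF right_braiding_bilin w] bilin_left[OF left_braiding_bilin w] _ v])
  fix d v assume d: "d \<in> carrier G" and v: "v \<in> Hm d"
  note vE = Hm_closed[OF d v]
  interpret m: module K E by (rule module_E)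
  have b: "(\<lambda>w' x. pE w' (ract v x)) \<in> bilin K E FG EE"
    using vE by - (rule R_lins ract_lin2 | assumption)+
  show "right_braiding K E ract rco v w = left_braiding K E act co v w"
    unfolding right_braiding_def left_braiding_Hm[OF d v w] tlift_rco[OF w module_EE b]
    by (subst finsum_only[OF module_EE finite_G d])
      (use d v w vE in \<open>auto simp: ract_Hm[OF d v] single_def[of K] \<delta>_FG[unfolded single_def] pt_zero_right[OF module_E module_E] \<sigma>_closed pt_closed[OF module_E module_E]\<close>)
qed

text \<open>The braidings agree on the carrier, hence so do the products of the two braided squares,
  and multiplicativity of the coproduct transfers.\<close>

lemma comult_hom_right: "comult E \<in> alg_hom K E (braided_square K E (right_braiding K E ract rco))"
proof (rule alg_homI)
  let ?BR = "braided_square K E (right_braiding K E ract rco)"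
  note m = module_E
  note bR = braided_square_mult_bilin[OF algebra_E right_braiding_bilin]
  show "comult E \<in> lin_map K E ?BR"
    using comult_E_lin by (simp add: lin_map_cong_record[OF same_lin_refl same_lin_tensor_alg(2)])
  show "comult E \<one>\<^sub>E = \<one>\<^bsub>?BR\<^esub>" by (simp add: comult_one)
  fix x y assume xy: "x \<in> carrier E" "y \<in> carrier E"
  let ?S = "{pE v w |v w. v \<in> carrier E \<and> w \<in> carrier E}"
  have S: "?S \<subseteq> carrier EE" using pt_closed[OF m m] by blast
  have "s \<otimes>\<^bsub>?BR\<^esub> t = s \<otimes>\<^bsub>BS\<^esub> t" if "s \<in> carrier EE" "t \<in> carrier EE" for s t
    by (rule bilin_eq_on_span[OF module_EE module_EE module_EE bR BS_bilin S tensor_span_all[OF m m] S tensor_span_all[OF m m] _ that])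
      (auto simp: braided_square_mult_pt[OF algebra_E right_braiding_bilin] braided_square_mult_pt[OF algebra_E left_braiding_bilin] right_braiding_eq)
  then show "comult E (x \<star> y) = comult E x \<otimes>\<^bsub>?BR\<^esub> comult E y"
    using xy by (simp add: comult_mult comult_E_closed)
qed

lemma sum_\<delta>: "(\<Oplus>\<^bsub>FG\<^esub>u\<in>carrier G. \<delta> u) = \<one>\<^sub>F"
proof -
  interpret m: module K FG by (rule module_FG)
  have "(\<Oplus>\<^bsub>FG\<^esub>u\<in>carrier G. \<delta> u) = (\<Oplus>\<^bsub>FG\<^esub>u\<in>carrier G. \<one>\<^bsub>K\<^esub> \<odot>\<^sub>F \<delta> u)"
    by (rule finsum_congI[OF module_FG]) (simp_all add: \<delta>_FG)
  then show ?thesis using sum_const_\<delta>[OF K.one_closed] by (simp add: FG_one_closed)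
qed

lemma \<delta>_at: "\<delta> u d = (if d = u then \<one>\<^bsub>K\<^esub> else \<zero>\<^bsub>K\<^esub>)" by (simp add: single_def)

lemma left_transl_at: "d \<in> carrier G \<Longrightarrow> left_transl K G u h d = h (u \<cdot> d)"
  by (simp add: left_transl_def)

lemma right_transl_at: "d \<in> carrier G \<Longrightarrow> \<R> u h d = h (d \<cdot> u)"
  by (simp add: right_transl_def)

lemma right_braided: "right_braided_group K FG E ract rco"
proof (rule right_braided_group.intro[OF hopf_FG right_crossed algebra_E coalgebra_E])
  let ?TA = "tensor_alg K E FG"
  note m = module_E and mF = module_FG and mT = module_RT and mEE = module_EE and mg = module_ground
  interpret m: module K E by (rule m)
  interpret mEE: module K "EE" by (rule mEE)
  show "ract (b \<star> c) h = tlift K E (\<lambda>h1 h2. ract b h1 \<star> ract c h2) (comult FG h)"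
    if h: "h \<in> carrier FG" and bE: "b \<in> carrier E" and cE: "c \<in> carrier E" for h b c
  proof (rule E_eqI[OF m _ _ _ bE])
    fix d b assume d: "d \<in> carrier G" and b: "b \<in> Hm d"
    note bE = Hm_closed[OF d b]
    show "ract (b \<star> c) h = tlift K E (\<lambda>h1 h2. ract b h1 \<star> ract c h2) (comult FG h)"
    proof (rule E_eqI[OF m _ _ _ cE])
      fix d' c assume d': "d' \<in> carrier G" and c: "c \<in> Hm d'"
      note cE = Hm_closed[OF d' c]
      have dd: "d \<cdot> d' \<in> carrier G" using d d' by simp
      have b1: "(\<lambda>h1 h2. ract b h1 \<star> ract c h2) \<in> bilin K FG FG E"
        using bE cE by - (rule R_lins ract_lin2 | assumption)+
      show "ract (b \<star> c) h = tlift K E (\<lambda>h1 h2. ract b h1 \<star> ract c h2) (comult FG h)"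
        \<comment> \<open>With the delta function on the side of b only the index d survives, and
          the other factor contributes (L_d h)(d') = h(d d'), the value at the degree of b
          c.\<close>
        unfolding tlift_comult_FG_left[OF h m b1]
        by (subst finsum_only[OF m finite_G d])
         (use d d' bE cE h in \<open>auto simp: ract_Hm[OF dd Hm_mult[OF d d' b c]] ract_Hm[OF d b] ract_Hm[OF d' c] \<delta>_FG \<delta>_at
            left_transl_closed FG_closed k_algebra.smult_mult_right[OF algebra_E] left_transl_at\<close>)
    qed (insert h bE, (rule R_lins ract_lin1 ract_lin2 | assumption)+)
  qed (insert h cE, (rule R_lins ract_lin1 ract_lin2 | assumption)+)
  show "ract \<one>\<^sub>E h = counit FG h \<odot>\<^sub>E \<one>\<^sub>E" if "h \<in> carrier FG" for h
    by (simp add: ract_Hm[OF G.one_closed Hm_one that] counit_FG)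
  have p: "pt K E FG (\<sigma> g w) (\<delta> g) \<in> carrier RT" if "g \<in> carrier G" "w \<in> carrier E" for g w
    by (intro pt_closed m mF \<sigma>_closed \<delta>_FG that)
  note tb = tensor_alg_mult_bilin[OF algebra_E algebra_FG] and tp = tensor_alg_mult_pt[OF algebra_E algebra_FG]
  show "rco \<in> alg_hom K E (?TA)"
  proof (rule alg_homI)
    show "rco \<in> lin_map K E (?TA)"
      using rco_lin by (simp add: lin_map_cong_record[OF same_lin_refl same_lin_tensor_alg(1)])
    have "rco \<one>\<^sub>E = (\<Oplus>\<^bsub>RT\<^esub>g\<in>carrier G. pt K E FG \<one>\<^sub>E (\<delta> g))"
      unfolding rco_eq[OF E.one_closed]
      by (rule finsum_congI[OF mT]) (auto simp: alg_hom_one[OF \<sigma>_hom] intro!: pt_closed m mF \<delta>_FG)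
    also have "\<dots> = pt K E FG \<one>\<^sub>E (\<Oplus>\<^bsub>FG\<^esub>g\<in>carrier G. \<delta> g)"
      by (rule lin_map_finsum[OF bilin_right[OF pt_bilin[OF m mF] E.one_closed] mF mT finite_G, symmetric]) (rule \<delta>_FG)
    finally show "rco \<one>\<^sub>E = \<one>\<^bsub>?TA\<^esub>" by (simp add: sum_\<delta>)
    fix x y assume x: "x \<in> carrier E" and y: "y \<in> carrier E"
    let ?p = "\<lambda>w g. pt K E FG (\<sigma> g w) (\<delta> g)"
    have e: "?p x v \<otimes>\<^bsub>?TA\<^esub> ?p y v' = (if v' = v then ?p (x \<star> y) v else \<zero>\<^bsub>RT\<^esub>)"
      if "v \<in> carrier G" "v' \<in> carrier G" for v v'
      using that x y
      by (cases "v' = v") (simp_all add: tp \<sigma>_closed alg_hom_mult[OF \<sigma>_hom] \<delta>_FG \<delta>_\<delta> not_sym pt_zero_right[OF m mF])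
    have 1: "?p x v \<otimes>\<^bsub>?TA\<^esub> rco y = ?p (x \<star> y) v" if v: "v \<in> carrier G" for v
    proof -
      have "?p x v \<otimes>\<^bsub>?TA\<^esub> rco y = (\<Oplus>\<^bsub>RT\<^esub>v'\<in>carrier G. ?p x v \<otimes>\<^bsub>?TA\<^esub> ?p y v')"
        unfolding rco_eq[OF y] by (rule lin_map_finsum[OF bilin_right[OF tb p[OF v x]] mT mT finite_G p[OF _ y]])
      also have "\<dots> = ?p (x \<star> y) v"
        by (subst finsum_only[OF mT finite_G v]) (simp_all add: e v p x y)
      finally show ?thesis .
    qed
    have "rco x \<otimes>\<^bsub>?TA\<^esub> rco y = (\<Oplus>\<^bsub>RT\<^esub>v\<in>carrier G. ?p x v \<otimes>\<^bsub>?TA\<^esub> rco y)"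
      by (subst (1) rco_eq[OF x], rule lin_map_finsum[OF bilin_left[OF tb rco_closed[OF y]] mT mT finite_G p[OF _ x]])
    also have "\<dots> = rco (x \<star> y)"
      unfolding rco_eq[OF E.m_closed[OF x y]] by (rule finsum_congI[OF mT]) (simp_all add: 1 p x y)
    finally show "rco (x \<star> y) = rco x \<otimes>\<^bsub>?TA\<^esub> rco y" by simp
  qed
  let ?q = "\<lambda>h1 h2. tlift K EE (\<lambda>b1 b2. pE (ract b1 h1) (ract b2 h2))"
  show "comult E (ract b h) = tlift K EE (\<lambda>h1 h2. ?q h1 h2 (comult E b)) (comult FG h)"
    if h: "h \<in> carrier FG" and bE: "b \<in> carrier E" for h b
  proof (rule E_eqI[OF mEE _ _ _ bE])
    fix d b assume d: "d \<in> carrier G" and b: "b \<in> Hm d"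
    note bE = Hm_closed[OF d b]
    \<comment> \<open>Acting on b multiplies it by h(d). The coproduct of h, acting on the two legs,
      multiplies by h(d1 d2), which is the same number on the tensors of total degree d.\<close>
    have "h d \<odot>\<^bsub>EE\<^esub> comult E b = tlift K EE (\<lambda>h1 h2. ?q h1 h2 (comult E b)) (comult FG h)"
    proof (rule comult_E_eqI[OF d b mEE])
      fix x y d1 d2 assume xy: "d1 \<in> carrier G" "d2 \<in> carrier G" "x \<in> Hm d1" "y \<in> Hm d2" "x \<in> carrier E" "y \<in> carrier E" "d = d1 \<cdot> d2"
      have b1: "(\<lambda>h1 h2. ?q h1 h2 (pE x y)) \<in> bilin K FG FG EE"
        using xy by - (rule R_lins ract_lin1 ract_lin2 | assumption)+
      have b2: "(\<lambda>b1 b2. pE (ract b1 h1) (ract b2 h2)) \<in> bilin K E E EE" if "h1 \<in> carrier FG" "h2 \<in> carrier FG" for h1 h2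
        using that by - (rule R_lins ract_lin1 ract_lin2 | assumption)+
      show "h d \<odot>\<^bsub>EE\<^esub> pE x y = tlift K EE (\<lambda>h1 h2. ?q h1 h2 (pE x y)) (comult FG h)"
        unfolding tlift_comult_FG_left[OF h mEE b1]
        by (subst finsum_only[OF mEE finite_G xy(1)])
          (use xy h in \<open>auto simp: tlift_pt[OF m m mEE b2] \<delta>_FG left_transl_closed ract_Hm[OF xy(1,3)] ract_Hm[OF xy(2,4)] \<delta>_at
            pt_zero_left[OF m m] FG_closed pt_smult_right[OF m m] left_transl_at pt_closed[OF m m]\<close>)
    qed (insert h d, (rule R_lins ract_lin1 ract_lin2 FG_closed | assumption)+)
    then show "comult E (ract b h) = tlift K EE (\<lambda>h1 h2. ?q h1 h2 (comult E b)) (comult FG h)"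
      using h by (simp add: ract_Hm[OF d b] lin_map_smult[OF comult_E_lin] FG_closed bE)
  qed (insert h, (rule R_lins ract_lin1 ract_lin2 | assumption)+)
  show "counit E (ract b h) = counit E b \<otimes>\<^bsub>K\<^esub> counit FG h" if h: "h \<in> carrier FG" and bE: "b \<in> carrier E" for h b
  proof (rule E_eqI[OF mg _ _ _ bE])
    fix d b assume d: "d \<in> carrier G" and b: "b \<in> Hm d"
    show "counit E (ract b h) = counit E b \<otimes>\<^bsub>K\<^esub> counit FG h"
      using d h Hm_closed[OF d b] counit_Hm[OF d b] FG_closed[OF h]
      by (cases "d = \<one>\<^sub>G") (simp_all add: ract_Hm[OF d b] lin_map_smult[OF counit_E_lin] counit_FG counit_E_closed K.m_comm)
  qed (insert h, (rule R_lins ract_lin1 ract_lin2 | assumption)+)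
  let ?Z = "tensor K EE FG"
  let ?C = "\<lambda>c x. pt K EE FG (comult E c) x" and ?u = "\<lambda>c1 x1 c2 x2. pt K EE FG (pE c1 c2) (x1 \<otimes>\<^sub>F x2)"
  let ?w = "\<lambda>b2 c1 x1. tlift K ?Z (?u c1 x1) (rco b2)"
  let ?D = "\<lambda>b1 b2. tlift K ?Z (?w b2) (rco b1)" and ?z = "\<lambda>g t. pt K EE FG (sig2 g t) (\<delta> g)"
  have mZ: "module K ?Z" by (intro module_tensor m mF)
  have b1: "?C \<in> bilin K E FG ?Z"
    by (rule R_lins comult_E_lin | assumption)+
  have b4: "?D \<in> bilin K E E ?Z"
    by (rule R_lins | assumption)+
  have b3: "?w b2 \<in> bilin K E FG ?Z" if "b2 \<in> carrier E" for b2
    using that by - (rule R_lins | assumption)+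
  have b2: "?u c1 x1 \<in> bilin K E FG ?Z" if "c1 \<in> carrier E" "x1 \<in> carrier FG" for c1 x1
    using that by - (rule R_lins | assumption)+
  show "tlift K ?Z ?C (rco b) =
      tlift K ?Z ?D (comult E b)" if bE: "b \<in> carrier E" for b
  proof -
    have zc: "?z g t \<in> carrier ?Z" if "g \<in> carrier G" "t \<in> carrier EE" for g t
      by (intro pt_closed mEE mF \<delta>_FG lin_map_closed[OF sig2_lin] that)
    have "tlift K ?Z ?C (rco b) =
        (\<Oplus>\<^bsub>?Z\<^esub>g\<in>carrier G. ?z g (comult E b))"
      unfolding tlift_rco[OF bE mZ b1]
      by (rule finsum_congI[OF mZ]) (simp_all add: zc comult_E_closed bE comult_\<sigma>[folded sig2_def])
    also have "\<dots> = tlift K ?Z ?D (comult E b)"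
    \<comment> \<open>Coacting on both legs multiplies two delta functions, so only equal indices
      remain and the double sum becomes the sum of the diagonal actions.\<close>
    proof (rule EE_eqI[OF comult_E_closed[OF bE] mZ])
      fix x y assume x: "x \<in> carrier E" and y: "y \<in> carrier E"
      have "tlift K ?Z ?D (pE x y)
        = (\<Oplus>\<^bsub>?Z\<^esub>g\<in>carrier G. tlift K ?Z (\<lambda>c2 x2. pt K EE FG (pE (\<sigma> g x) c2) (\<delta> g \<otimes>\<^sub>F x2)) (rco y))"
        by (simp only: tlift_pt[OF m m mZ b4 x y] tlift_rco[OF x mZ b3[OF y]])
      also have "\<dots> = (\<Oplus>\<^bsub>?Z\<^esub>g\<in>carrier G. ?z g (pE x y))"
      proof (rule finsum_congI[OF mZ])
        fix g assume g: "g \<in> carrier G"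
        show "?z g (pE x y) \<in> carrier ?Z" by (intro zc g pt_closed m x y)
        show "tlift K ?Z (\<lambda>c2 x2. pt K EE FG (pE (\<sigma> g x) c2) (\<delta> g \<otimes>\<^sub>F x2)) (rco y) = ?z g (pE x y)"
          unfolding tlift_rco[OF y mZ b2[OF \<sigma>_closed[OF g x] \<delta>_FG[OF g]]]
          by (subst finsum_only[OF mZ finite_G g])
            (use g x y in \<open>auto simp: \<delta>_\<delta> pt_zero_right[OF mEE mF] pt_closed[OF m m] \<sigma>_closed pt_closed[OF mEE mF] \<delta>_FG sig2\<close>)
      qed
      finally show "(\<Oplus>\<^bsub>?Z\<^esub>g\<in>carrier G. ?z g (pE x y)) = tlift K ?Z ?D (pE x y)" by simp
    qed (rule R_lins b4 sig2_lin | assumption)+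
    finally show ?thesis .
  qed
  have b5: "(\<lambda>c x. counit E c \<odot>\<^sub>F x) \<in> bilin K E FG FG"
    by (rule R_lins | assumption)+
  show "tlift K FG (\<lambda>c x. counit E c \<odot>\<^sub>F x) (rco b) = counit E b \<odot>\<^sub>F \<one>\<^sub>F" if bE: "b \<in> carrier E" for b
    unfolding tlift_rco[OF bE mF b5] sum_const_\<delta>[OF counit_E_closed[OF bE], symmetric]
    by (rule finsum_congI[OF mF]) (simp_all add: counit_\<sigma> bE module_closures(3)[OF mF] counit_E_closed \<delta>_FG)
  show "comult E \<in> alg_hom K E (braided_square K E (right_braiding K E ract rco))" by (rule comult_hom_right)
  show "counit E \<in> alg_hom K E (ground K)" by (rule counit_hom)
  obtain S where S: "is_antipode K E S" "\<And>g b. g \<in> carrier G \<Longrightarrow> b \<in> carrier E \<Longrightarrow> S (\<sigma> g b) = \<sigma> g (S b)"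
      "\<And>d b. d \<in> carrier G \<Longrightarrow> b \<in> Hm d \<Longrightarrow> S b \<in> lin_span K E (Hm d)" using antipode by blast
  have Sl: "S \<in> lin_map K E E" using S(1) by (simp add: is_antipode_def)
  note Sr = lin_comp[OF Sl] lin_map_closed[OF Sl]
  have "S (ract b h) = ract (S b) h" if h: "h \<in> carrier FG" and bE: "b \<in> carrier E" for h b
  proof (rule E_eqI[OF m _ _ _ bE])
    fix d b assume d: "d \<in> carrier G" and b: "b \<in> Hm d"
    \<comment> \<open>Acting by h is multiplication by h(d) on the whole span of
      \<open>Hm d\<close>, which is where the antipode of b lies.\<close>
    have "ract s h = h d \<odot>\<^sub>E s" if "s \<in> lin_span K E (Hm d)" for s
      by (rule lin_span_eqI[OF m m ract_lin1[OF h] lin_smult[OF m m FG_closed[OF h] lin_id] Hm_sub[OF d] _ that])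
        (rule ract_Hm[OF d _ h])
    from this[OF S(3)[OF d b]] show "S (ract b h) = ract (S b) h"
      using h by (simp add: ract_Hm[OF d b] lin_map_smult[OF Sl] FG_closed Hm_closed[OF d b])
  qed (insert h, (rule R_lins ract_lin1 Sl Sr | assumption)+)
  moreover have b6: "(\<lambda>c x. pt K E FG (S c) x) \<in> bilin K E FG RT"
    by (rule R_lins Sl Sr | assumption)+
  have "rco (S b) = tlift K RT (\<lambda>c x. pt K E FG (S c) x) (rco b)" if bE: "b \<in> carrier E" for b
    unfolding rco_eq[OF Sr(2)[OF bE]] tlift_rco[OF bE mT b6]
    by (rule finsum_congI[OF mT]) (auto simp: S(2) bE intro!: pt_closed m mF \<sigma>_closed \<delta>_FG Sr(2))
  ultimately show "\<exists>S. is_antipode K E S \<and> (\<forall>h\<in>carrier FG. \<forall>b\<in>carrier E. S (ract b h) = ract (S b) h) \<and>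
      (\<forall>b\<in>carrier E. rco (S b) = tlift K RT (\<lambda>c x. pt K E FG (S c) x) (rco b))"
    using S(1) by blast
qed

end

subsection \<open>Right bosonisation\<close>

context braided_hopf
begin

abbreviation "RL \<equiv> tensor K FG E"
abbreviation "RLL \<equiv> tensor K RL RL"
abbreviation "RLLL \<equiv> tensor K RL RLL"
abbreviation "RA \<equiv> right_biproduct K FG E ract rco"
abbreviation RAmult (infixl "\<otimes>\<^sub>R" 70) where "x \<otimes>\<^sub>R y \<equiv> x \<otimes>\<^bsub>RA\<^esub> y"
abbreviation RLsmult (infixr "\<odot>\<^sub>R" 75) where "x \<odot>\<^sub>R y \<equiv> x \<odot>\<^bsub>RL\<^esub> y"
abbreviation RAtmult (infixl "\<otimes>\<^sub>R\<^sub>R" 70) where "x \<otimes>\<^sub>R\<^sub>R y \<equiv> x \<otimes>\<^bsub>tensor_alg K RA RA\<^esub> y"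
abbreviation "rp \<equiv> pt K FG E"
abbreviation "rpp \<equiv> pt K RL RL"

lemma module_RL: "module K RL" "module K RLL" "module K RLLL"
  by (intro module_tensor module_E module_FG)+

lemma RA_lin: "carrier RA = carrier RL" "add RA = add RL" "zero RA = zero RL" "smult RA = smult RL"
  "one RA = rp \<one>\<^sub>F \<one>\<^sub>E"
  by (simp_all add: right_biproduct_def Let_def module.defs hopf.defs)

lemma same_lin_RA: "same_lin RA RL"
  by (simp add: same_lin_def RA_lin)

lemmas RA_eq = tensor_cong[OF same_lin_RA same_lin_RA, of K] tensor_cong[OF same_lin_RA same_lin_refl, of K]
  tensor_cong[OF same_lin_refl same_lin_RA, of K] pt_cong[OF same_lin_refl same_lin_RA, of K]
  pt_cong[OF same_lin_RA same_lin_RA, of K] pt_cong[OF same_lin_RA same_lin_refl, of K]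
  tlift_cong[OF same_lin_RA, of K]
  lin_map_cong_record[OF same_lin_RA same_lin_RA, of K]
  lin_map_cong_record[OF same_lin_RA same_lin_refl, of K]
  lin_map_cong_record[OF same_lin_refl same_lin_RA, of K]
  lin_span_cong[OF same_lin_RA, of K] RA_lin(1-4)

definition RA_X where
  "RA_X h b g c = tlift K RL (\<lambda>g1 g2. rp (h \<otimes>\<^sub>F g1) (ract b g2 \<star> c)) (comult FG g)"

lemma RA_mult_eq: "mult RA = (\<lambda>s t. tlift K RL (\<lambda>h b. tlift K RL (\<lambda>g c. RA_X h b g c) t) s)"
  by (simp add: right_biproduct_def Let_def module.defs hopf.defs RA_X_def)

lemma RA_X_bilin:
  shows "\<And>h b. h \<in> carrier FG \<Longrightarrow> b \<in> carrier E \<Longrightarrow> RA_X h b \<in> bilin K FG E RL"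
    and "\<And>g c. g \<in> carrier FG \<Longrightarrow> c \<in> carrier E \<Longrightarrow> (\<lambda>h b. RA_X h b g c) \<in> bilin K FG E RL"
  unfolding RA_X_def by - (rule R_lins | assumption)+

lemma RA_mult_bilin: "mult RA \<in> bilin K RL RL RL"
  unfolding RA_mult_eq
  by (rule tlift2_bilin[OF module_FG module_E module_FG module_E module_RL(1) RA_X_bilin])

text \<open>In the sum over v of h (R_v g) \<otimes> (b.\<delta>_v) c only v = d contributes,
  because b.\<delta>_v = \<delta>_v(d) b. Moving a function past b is thus translation by the degree
  of b.\<close>

lemma RA_mult:
  assumes h: "h \<in> carrier FG" and d: "d \<in> carrier G" and b: "b \<in> Hm d" and g: "g \<in> carrier FG" and c: "c \<in> carrier E"
  shows "rp h b \<otimes>\<^sub>R rp g c = rp (h \<otimes>\<^sub>F \<R> d g) (b \<star> c)"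
proof -
  note bE = Hm_closed[OF d b]
  interpret m: module K E by (rule module_E)
  have p: "(\<lambda>g1 g2. rp (h \<otimes>\<^sub>F g1) (ract b g2 \<star> c)) \<in> bilin K FG FG RL"
    using h bE c by - (rule R_lins ract_lin2 | assumption)+
  have "rp h b \<otimes>\<^sub>R rp g c = RA_X h b g c"
    unfolding RA_mult_eq
    by (rule tlift2_pt[OF module_FG module_E module_FG module_E module_RL(1) RA_X_bilin]) (use h bE g c in auto)
  also have "\<dots> = rp (h \<otimes>\<^sub>F \<R> d g) (b \<star> c)"
    unfolding RA_X_def tlift_comult_FG_right[OF g module_RL(1) p]
    by (subst finsum_only[OF module_RL(1) finite_G d])
      (use d bE c h g in \<open>auto simp: ract_Hm[OF d b] \<delta>_FG \<delta>_at pt_zero_right[OF module_FG module_E] FG_mult_closed right_transl_closed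
        pt_closed[OF module_FG module_E]\<close>)
  finally show ?thesis .
qed

text \<open>The antipode computation multiplies by S b, which is homogeneous only up to span; both
  sides are linear in b.\<close>

lemma RA_mult_span:
  assumes h: "h \<in> carrier FG" and d: "d \<in> carrier G" and b: "b \<in> lin_span K E (Hm d)" and g: "g \<in> carrier FG" and c: "c \<in> carrier E"
  shows "rp h b \<otimes>\<^sub>R rp g c = rp (h \<otimes>\<^sub>F \<R> d g) (b \<star> c)"
proof (rule lin_span_eqI[OF module_E module_RL(1) _ _ Hm_sub[OF d] _ b])
  have "rp g c \<in> carrier RL" "h \<otimes>\<^sub>F \<R> d g \<in> carrier FG"
    using g c h d by (auto intro!: pt_closed module_FG module_E FG_mult_closed right_transl_closed)
  then show "(\<lambda>b. rp h b \<otimes>\<^sub>R rp g c) \<in> lin_map K E RL" "(\<lambda>b. rp (h \<otimes>\<^sub>F \<R> d g) (b \<star> c)) \<in> lin_map K E RL"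
    using h c g d by - (rule R_lins lin_comp[OF bilin_left[OF RA_mult_bilin]] | assumption)+
qed (rule RA_mult[OF h d _ g c])

lemma right_transl_mult: "a \<in> carrier G \<Longrightarrow> b \<in> carrier G \<Longrightarrow>
    \<R> (a \<cdot> b) f = \<R> a (\<R> b f)"
  by (auto simp: right_transl_def fun_eq_iff G.m_assoc)

text \<open>The twists are now the translations R_d, algebra automorphisms of the functions that
  compose along products of degrees.\<close>

lemma RA_algebra: "k_algebra K RA"
proof (rule smash_k_algebra[OF algebra_FG algebra_E, where R = "{(\<R> d, b) |d b. d \<in> carrier G \<and> b \<in> Hm d}"])
  have e: "snd ` {(\<R> d, b) |d b. d \<in> carrier G \<and> b \<in> Hm d} = (\<Union>d\<in>carrier G. Hm d)" by force
  show "lin_span K E (snd ` {(\<R> d, b) |d b. d \<in> carrier G \<and> b \<in> Hm d}) = carrier E"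
    unfolding e by (rule Hm_span)
  show "mult RA \<in> bilin K RL RL RL" by (rule RA_mult_bilin)
  show "\<exists>s. (s, \<one>\<^sub>E) \<in> {(\<R> d, b) |d b. d \<in> carrier G \<and> b \<in> Hm d} \<and> (\<forall>v\<in>carrier FG. s v = v)"
    using Hm_one right_transl_one by (intro exI[of _ "\<R> \<one>\<^sub>G"]) auto
  show "\<exists>s''. (s'', b \<star> b') \<in> {(\<R> d, b) |d b. d \<in> carrier G \<and> b \<in> Hm d} \<and> (\<forall>v\<in>carrier FG. s'' v = s (s' v))"
    if sb: "(s, b) \<in> {(\<R> d, b) |d b. d \<in> carrier G \<and> b \<in> Hm d}" "(s', b') \<in> {(\<R> d, b) |d b. d \<in> carrier G \<and> b \<in> Hm d}" for s b s' b'
  proof -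
    from sb obtain d d' where *: "d \<in> carrier G" "d' \<in> carrier G" "s = \<R> d" "b \<in> Hm d" "s' = \<R> d'" "b' \<in> Hm d'" by auto
    then show ?thesis by (intro exI[of _ "\<R> (d \<cdot> d')"]) (use Hm_mult right_transl_mult in auto)
  qed
qed (auto simp: same_lin_RA RA_lin RA_mult right_transl_alg_hom Hm_closed)

lemma RL_eqI:
  assumes "t \<in> carrier RL" "module K Z" "(\<lambda>x. f x) \<in> lin_map K RL Z" "(\<lambda>x. g x) \<in> lin_map K RL Z"
    "\<And>h d b. \<lbrakk>h \<in> carrier FG; d \<in> carrier G; b \<in> Hm d; b \<in> carrier E\<rbrakk> \<Longrightarrow> f (rp h b) = g (rp h b)"
  shows "f t = g t"
proof -
  let ?H = "\<Union>d\<in>carrier G. Hm d"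
  have H: "?H \<subseteq> carrier E" using Hm_sub by auto
  note s = tensor_span[OF module_FG module_E subset_refl lin_span_carrier[OF module_FG] H Hm_span]
  have "{rp v w |v w. v \<in> carrier FG \<and> w \<in> ?H} \<subseteq> carrier RL"
    using H pt_closed[OF module_FG module_E] by blast
  from lin_span_eqI[OF module_RL(1) assms(2-4) this, of t] show ?thesis
    using assms(1,5) s Hm_closed by blast
qed

abbreviation "RSp \<equiv> {rp h b |h b. h \<in> carrier FG \<and> (\<exists>d\<in>carrier G. b \<in> Hm d)}"

lemma RL_span: "RSp \<subseteq> carrier RL" "lin_span K RL RSp = carrier RL"
proof -
  let ?H = "\<Union>d\<in>carrier G. Hm d"
  have H: "?H \<subseteq> carrier E" using Hm_sub by auto
  have e: "RSp = {rp v w |v w. v \<in> carrier FG \<and> w \<in> ?H}" by auto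
  show "RSp \<subseteq> carrier RL" using H pt_closed[OF module_FG module_E] unfolding e by blast
  show "lin_span K RL RSp = carrier RL"
    unfolding e by (rule tensor_span[OF module_FG module_E subset_refl lin_span_carrier[OF module_FG] H Hm_span])
qed

definition RA_Phi where
  "RA_Phi h b = tlift K RLL (\<lambda>b1 b2. tlift K RLL (\<lambda>c x. tlift K RLL (\<lambda>h1 h2.
          rpp (rp h1 c) (rp (h2 \<otimes>\<^sub>F x) b2)) (comult FG h)) (rco b1)) (comult E b)"

lemma RA_Phi_bilin: "RA_Phi \<in> bilin K FG E RLL"
  unfolding RA_Phi_def[abs_def] by (rule R_lins comult_FG_lin | assumption)+

lemma RA_comult_eq: "comult RA = tlift K RLL RA_Phi"
  by (simp add: right_biproduct_def Let_def module.defs hopf.defs RA_Phi_def[abs_def])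

lemma RA_counit_eq: "counit RA = tlift K (ground K) (\<lambda>h b. counit FG h \<otimes>\<^bsub>K\<^esub> counit E b)"
  by (simp add: right_biproduct_def Let_def module.defs hopf.defs)

lemma RA_comult_lin: "comult RA \<in> lin_map K RL RLL"
  unfolding RA_comult_eq by (rule tlift_lin[OF module_FG module_E module_RL(2) RA_Phi_bilin])

lemma RA_counit_bilin: "(\<lambda>h b. counit FG h \<otimes>\<^bsub>K\<^esub> counit E b) \<in> bilin K FG E (ground K)"
  by (rule R_lins | assumption)+

lemma RA_counit_lin: "counit RA \<in> lin_map K RL (ground K)"
  unfolding RA_counit_eq by (rule tlift_lin[OF module_FG module_E module_ground RA_counit_bilin])

lemma RA_counit: "h \<in> carrier FG \<Longrightarrow> b \<in> carrier E \<Longrightarrow> counit RA (rp h b) = h \<one>\<^sub>G \<otimes>\<^bsub>K\<^esub> counit E b"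
  unfolding RA_counit_eq by (subst tlift_pt[OF module_FG module_E module_ground RA_counit_bilin]) (simp_all add: counit_FG)

text \<open>What the cross coproduct becomes once the delta function from the coproduct of h has met
  the one from the coaction of b1: of the two sums over the group one is left. It plays the role of
  \<open>PhiL\<close>.\<close>

definition PhiR where
  "PhiR h b1 b2 = (\<Oplus>\<^bsub>RLL\<^esub>v\<in>carrier G. rpp (rp (\<R> v h) (\<sigma> v b1)) (rp (\<delta> v) b2))"

definition PR where "PR h = tlift K RLL (PhiR h)"

lemma PhiR_bilin: "h \<in> carrier FG \<Longrightarrow> PhiR h \<in> bilin K E E RLL"
  unfolding PhiR_def[abs_def] by - (rule R_lins \<sigma>_lin | assumption)+

lemma PR_lin: "h \<in> carrier FG \<Longrightarrow> PR h \<in> lin_map K EE RLL"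
  unfolding PR_def by (rule tlift_lin[OF module_E module_E module_RL(2) PhiR_bilin])

lemma PR: "h \<in> carrier FG \<Longrightarrow> x \<in> carrier E \<Longrightarrow> y \<in> carrier E \<Longrightarrow>
    PR h (pE x y) = (\<Oplus>\<^bsub>RLL\<^esub>v\<in>carrier G. rpp (rp (\<R> v h) (\<sigma> v x)) (rp (\<delta> v) y))"
  unfolding PR_def by (simp add: tlift_pt[OF module_E module_E module_RL(2) PhiR_bilin]) (simp add: PhiR_def)

lemma rp_closed: "h \<in> carrier FG \<Longrightarrow> b \<in> carrier E \<Longrightarrow> rp h b \<in> carrier RL"
  by (intro pt_closed module_FG module_E)

lemma rpp_closed: "s \<in> carrier RL \<Longrightarrow> t \<in> carrier RL \<Longrightarrow> rpp s t \<in> carrier RLL"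
  by (intro pt_closed module_RL)

lemma RA_comult:
  assumes h: "h \<in> carrier FG" and b: "b \<in> carrier E"
  shows "comult RA (rp h b) = PR h (comult E b)"
proof -
  note mR = module_RL(2)
  have b1: "(\<lambda>b1 b2. tlift K RLL (\<lambda>c x. tlift K RLL (\<lambda>h1 h2.
          rpp (rp h1 c) (rp (h2 \<otimes>\<^sub>F x) b2)) (comult FG h)) (rco b1)) \<in> bilin K E E RLL"
    using h by - (rule R_lins comult_FG_lin | assumption)+
  have "comult RA (rp h b) = RA_Phi h b"
    unfolding RA_comult_eq by (rule tlift_pt[OF module_FG module_E mR RA_Phi_bilin h b])
  also have "\<dots> = PR h (comult E b)"
    unfolding RA_Phi_def PR_def
  proof (rule tlift_fun_cong[OF comult_E_closed[OF b] module_E module_E mR b1 PhiR_bilin[OF h]])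
    fix x y assume x: "x \<in> carrier E" and y: "y \<in> carrier E"
    have b2: "(\<lambda>c z. tlift K RLL (\<lambda>h1 h2. rpp (rp h1 c) (rp (h2 \<otimes>\<^sub>F z) y)) (comult FG h)) \<in> bilin K E FG RLL"
      using h y by - (rule R_lins comult_FG_lin | assumption)+
    have b3: "(\<lambda>h1 h2. rpp (rp h1 c) (rp (h2 \<otimes>\<^sub>F z) y)) \<in> bilin K FG FG RLL" if "c \<in> carrier E" "z \<in> carrier FG" for c z
      using that y by - (rule R_lins comult_FG_lin | assumption)+
    show "tlift K RLL (\<lambda>c z. tlift K RLL (\<lambda>h1 h2. rpp (rp h1 c) (rp (h2 \<otimes>\<^sub>F z) y)) (comult FG h)) (rco x) = PhiR h x y"
      unfolding tlift_rco[OF x mR b2] PhiR_def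
    proof (rule finsum_congI[OF mR])
      fix v assume v: "v \<in> carrier G"
      show "rpp (rp (\<R> v h) (\<sigma> v x)) (rp (\<delta> v) y) \<in> carrier RLL"
        by (intro rpp_closed rp_closed right_transl_closed \<sigma>_closed \<delta>_FG v h x y)
      show "tlift K RLL (\<lambda>h1 h2. rpp (rp h1 (\<sigma> v x)) (rp (h2 \<otimes>\<^sub>F \<delta> v) y)) (comult FG h) = rpp (rp (\<R> v h) (\<sigma> v x)) (rp (\<delta> v) y)"
        unfolding tlift_comult_FG_right[OF h mR b3[OF \<sigma>_closed[OF v x] \<delta>_FG[OF v]]]
        by (subst finsum_only[OF mR finite_G v])
          (use v h x y in \<open>auto simp: \<delta>_\<delta> pt_zero_left[OF module_FG module_E] pt_zero_right[OF module_RL(1) module_RL(1)]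
            rp_closed rpp_closed right_transl_closed \<sigma>_closed \<delta>_FG\<close>)
    qed
  qed
  finally show ?thesis .
qed

lemmas RA_ma = tensor_alg_mult_pt[OF RA_algebra RA_algebra, unfolded RA_eq]
lemmas RA_mb = tensor_alg_mult_bilin[OF RA_algebra RA_algebra, unfolded RA_eq]

lemma RA_m_closed: "s \<in> carrier RL \<Longrightarrow> t \<in> carrier RL \<Longrightarrow> s \<otimes>\<^sub>R t \<in> carrier RL"
  using bilin_closed[OF RA_mult_bilin] .

text \<open>The translation of h' depends on the two degrees only through d1 d2. On the coproduct of
  a homogeneous element it is therefore constant, which is what allows the passage to
  \<open>PR_mult\<close>.\<close>

lemma PR_mult_pt:
  assumes h: "h \<in> carrier FG" and h': "h' \<in> carrier FG"
    and x: "d1 \<in> carrier G" "x \<in> Hm d1" and y: "d2 \<in> carrier G" "y \<in> Hm d2" and x': "x' \<in> carrier E" and y': "y' \<in> carrier E"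
  shows "PR h (pE x y) \<otimes>\<^sub>R\<^sub>R PR h' (pE x' y') =
    PR (h \<otimes>\<^sub>F \<R> (d1 \<cdot> d2) h') (pE (x \<star> \<sigma> d2 x') (y \<star> y'))"
proof -
  note xE = Hm_closed[OF x] and yE = Hm_closed[OF y] and mR = module_RL(2)
  let ?p = "\<lambda>h x y v. rpp (rp (\<R> v h) (\<sigma> v x)) (rp (\<delta> v) y)"
  let ?h = "h \<otimes>\<^sub>F \<R> (d1 \<cdot> d2) h'"
  have hh: "?h \<in> carrier FG" using h h' x y by (intro FG_mult_closed right_transl_closed) auto
  have pc: "?p h x y v \<in> carrier RLL" if "h \<in> carrier FG" "x \<in> carrier E" "y \<in> carrier E" "v \<in> carrier G" for h x y v
    using that by (intro rpp_closed rp_closed right_transl_closed \<sigma>_closed \<delta>_FG)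
  have yy: "y \<star> y' \<in> carrier E" "x \<star> \<sigma> d2 x' \<in> carrier E" using xE yE x' y' y by (auto simp: \<sigma>_closed)
  have 1: "?p h x y v \<otimes>\<^sub>R\<^sub>R PR h' (pE x' y') = ?p ?h (x \<star> \<sigma> d2 x') (y \<star> y') v" if v: "v \<in> carrier G" for v
  proof -
    let ?c = "v \<cdot> d1 \<cdot> inv\<^sub>G v"
    have c: "?c \<in> carrier G" using v x by simp
    have vd: "v \<cdot> d2 \<in> carrier G" using v y by simp
    have e: "?p h x y v \<otimes>\<^sub>R\<^sub>R ?p h' x' y' w =
        rpp (rp (\<R> v h \<otimes>\<^sub>F \<R> ?c (\<R> w h')) (\<sigma> v x \<star> \<sigma> w x'))
          (rp (\<delta> v \<otimes>\<^sub>F \<delta> (w \<cdot> inv\<^sub>G d2)) (y \<star> y'))" if w: "w \<in> carrier G" for w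
      using v w c h h' xE yE x' y' y
      by (simp add: RA_ma rp_closed right_transl_closed \<sigma>_closed \<delta>_FG RA_mult[OF _ c Hm_\<sigma>[OF v x]] RA_mult[OF _ y] right_transl_\<delta>)
    have "?p h x y v \<otimes>\<^sub>R\<^sub>R PR h' (pE x' y') =
      (\<Oplus>\<^bsub>RLL\<^esub>w\<in>carrier G. ?p h x y v \<otimes>\<^sub>R\<^sub>R ?p h' x' y' w)"
      unfolding PR[OF h' x' y'] by (rule lin_map_finsum[OF bilin_right[OF RA_mb pc[OF h xE yE v]] mR mR finite_G pc[OF h' x' y']])
    \<comment> \<open>The second legs carry the product of \<delta>_v and \<delta>_{w d2^-1}, which
      is nonzero only for w = v d2.\<close>
    also have "\<dots> = ?p h x y v \<otimes>\<^sub>R\<^sub>R ?p h' x' y' (v \<cdot> d2)"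
    proof (rule finsum_only[OF mR finite_G vd])
      show "?p h x y v \<otimes>\<^sub>R\<^sub>R ?p h' x' y' (v \<cdot> d2) \<in> carrier RLL"
        by (rule bilin_closed[OF RA_mb pc[OF h xE yE v] pc[OF h' x' y' vd]])
      fix w assume w: "w \<in> carrier G" "w \<noteq> v \<cdot> d2"
      then have "v \<noteq> w \<cdot> inv\<^sub>G d2" using v y by (auto simp: G.m_assoc)
      then show "?p h x y v \<otimes>\<^sub>R\<^sub>R ?p h' x' y' w = \<zero>\<^bsub>RLL\<^esub>"
        unfolding e[OF w(1)] using v w c h h' xE yE x' y' yy
        by (simp add: \<delta>_\<delta> pt_zero_left[OF module_FG module_E] pt_zero_right[OF module_RL(1) module_RL(1)] rp_closed FG_mult_closed right_transl_closed \<sigma>_closed)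
    qed
    also have "\<dots> = ?p ?h (x \<star> \<sigma> d2 x') (y \<star> y') v"
    proof -
      have a: "v \<cdot> d2 \<cdot> inv\<^sub>G d2 = v" using v y by (simp add: G.m_assoc)
      \<comment> \<open>The degree v d1 v^-1 of v.x, followed by v d2, gives v d1 d2, so the two
        translations of h' combine into R_v after R_{d1 d2}.\<close>
      have "?c \<cdot> (v \<cdot> d2) = v \<cdot> (d1 \<cdot> d2)"
      proof -
        have "inv\<^sub>G v \<cdot> (v \<cdot> d2) = d2" using v y by (simp add: G.m_assoc[symmetric])
        then show ?thesis using v x y by (simp add: G.m_assoc)
      qed
      then have b: "\<R> ?c (\<R> (v \<cdot> d2) h') = \<R> v (\<R> (d1 \<cdot> d2) h')"
        using right_transl_mult[OF c vd, of h'] right_transl_mult[OF v, of "d1 \<cdot> d2" h'] x y by simp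
      show ?thesis unfolding e[OF vd] a b
        using v x y xE x' h h' by (simp add: \<delta>_\<delta> alg_hom_mult[OF right_transl_alg_hom[OF v]] right_transl_closed alg_hom_mult[OF \<sigma>_hom[OF v]] \<sigma>_closed \<sigma>_mult)
    qed
    finally show ?thesis .
  qed
  have pc': "PR h' (pE x' y') \<in> carrier RLL" by (intro lin_map_closed[OF PR_lin[OF h']] pt_closed module_E x' y')
  have "PR h (pE x y) \<otimes>\<^sub>R\<^sub>R PR h' (pE x' y') =
      (\<Oplus>\<^bsub>RLL\<^esub>v\<in>carrier G. ?p h x y v \<otimes>\<^sub>R\<^sub>R PR h' (pE x' y'))"
    unfolding PR[OF h xE yE] by (rule lin_map_finsum[OF bilin_left[OF RA_mb pc'] mR mR finite_G pc[OF h xE yE]])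
  also have "\<dots> = PR ?h (pE (x \<star> \<sigma> d2 x') (y \<star> y'))"
    unfolding PR[OF hh yy(2,1)] by (rule finsum_congI[OF mR pc[OF hh yy(2,1)] 1])
  finally show ?thesis .
qed

text \<open>One tensor must be the coproduct of a homogeneous b, so that the translation of h' is by
  d for all its terms; the other tensor is arbitrary.\<close>

lemma PR_mult:
  assumes h: "h \<in> carrier FG" and h': "h' \<in> carrier FG" and d: "d \<in> carrier G" and b: "b \<in> Hm d" and t: "t \<in> carrier EE"
  shows "PR h (comult E b) \<otimes>\<^sub>R\<^sub>R PR h' t = PR (h \<otimes>\<^sub>F \<R> d h') (comult E b \<otimes>\<^bsub>BS\<^esub> t)"
proof -
  have hh: "h \<otimes>\<^sub>F \<R> d h' \<in> carrier FG" using h h' d by (intro FG_mult_closed right_transl_closed) auto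
  note lr = lin_comp[OF PR_lin] lin_comp[OF bilin_left[OF RA_mb]] lin_comp[OF bilin_right[OF RA_mb]]
    lin_comp[OF bilin_left[OF BS_bilin]] lin_comp[OF bilin_right[OF BS_bilin]] lin_map_closed[OF PR_lin]
    bilin_closed[OF BS_bilin] bilin_closed[OF RA_mb]
  show ?thesis
  proof (rule comult_E_eqI[OF d b module_RL(2)])
    fix x y d1 d2 assume xy: "d1 \<in> carrier G" "d2 \<in> carrier G" "x \<in> Hm d1" "y \<in> Hm d2" "x \<in> carrier E" "y \<in> carrier E" "d = d1 \<cdot> d2"
    show "PR h (pE x y) \<otimes>\<^sub>R\<^sub>R PR h' t = PR (h \<otimes>\<^sub>F \<R> d h') (pE x y \<otimes>\<^bsub>BS\<^esub> t)"
    proof (rule EE_eqI[OF t module_RL(2)])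
      fix x' y' assume "x' \<in> carrier E" "y' \<in> carrier E"
      then show "PR h (pE x y) \<otimes>\<^sub>R\<^sub>R PR h' (pE x' y') = PR (h \<otimes>\<^sub>F \<R> d h') (pE x y \<otimes>\<^bsub>BS\<^esub> pE x' y')"
        using xy by (simp add: PR_mult_pt[OF h h' xy(1,3,2,4)] BS_mult[OF xy(5,2,4)])
    qed (insert h h' hh xy, (rule E_lins lr PR_lin | assumption)+)
  qed (insert h h' hh t, (rule E_lins lr PR_lin | assumption)+)
qed

text \<open>Translates of 1 and images of 1 under the group are 1, so the summation index occurs
  only in \<delta>_v, and the delta functions add up to 1.\<close>

lemma PR_one: "PR \<one>\<^sub>F (pE \<one>\<^sub>E b) = rpp (rp \<one>\<^sub>F \<one>\<^sub>E) (rp \<one>\<^sub>F b)" if b: "b \<in> carrier E"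
proof -
  have c: "rpp (rp \<one>\<^sub>F \<one>\<^sub>E) (rp (\<delta> v) b) \<in> carrier RLL" if "v \<in> carrier G" for v
    by (intro rpp_closed rp_closed FG_one_closed E.one_closed \<delta>_FG that b)
  have o: "rp \<one>\<^sub>F \<one>\<^sub>E \<in> carrier RL" by (intro rp_closed FG_one_closed E.one_closed)
  have "PR \<one>\<^sub>F (pE \<one>\<^sub>E b) = (\<Oplus>\<^bsub>RLL\<^esub>v\<in>carrier G. rpp (rp \<one>\<^sub>F \<one>\<^sub>E) (rp (\<delta> v) b))"
    unfolding PR[OF FG_one_closed E.one_closed b]
    by (rule finsum_congI[OF module_RL(2) c]) (simp_all add: alg_hom_one[OF right_transl_alg_hom] alg_hom_one[OF \<sigma>_hom])
  also have "\<dots> = rpp (rp \<one>\<^sub>F \<one>\<^sub>E) (\<Oplus>\<^bsub>RL\<^esub>v\<in>carrier G. rp (\<delta> v) b)"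
    by (rule lin_map_finsum[OF bilin_right[OF pt_bilin[OF module_RL(1) module_RL(1)] o] module_RL(1) module_RL(2) finite_G, symmetric])
      (intro rp_closed \<delta>_FG b)
  also have "(\<Oplus>\<^bsub>RL\<^esub>v\<in>carrier G. rp (\<delta> v) b) = rp (\<Oplus>\<^bsub>FG\<^esub>v\<in>carrier G. \<delta> v) b"
    by (rule lin_map_finsum[OF bilin_left[OF pt_bilin[OF module_FG module_E] b] module_FG module_RL(1) finite_G, symmetric]) (rule \<delta>_FG)
  finally show ?thesis by (simp add: sum_\<delta>)
qed

lemma RA_comult_hom: "comult RA \<in> alg_hom K RA (tensor_alg K RA RA)"
proof (rule alg_hom_tensor_algI[OF RA_algebra RA_algebra RA_algebra, unfolded RA_eq, OF RA_comult_lin _ RL_span])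
  show "comult RA \<one>\<^bsub>RA\<^esub> = rpp \<one>\<^bsub>RA\<^esub> \<one>\<^bsub>RA\<^esub>"
    by (simp add: RA_lin RA_comult FG_one_closed comult_one PR_one)
  fix x y assume "x \<in> RSp" "y \<in> RSp"
  then obtain h b d h' b' d' where *: "x = rp h b" "h \<in> carrier FG" "d \<in> carrier G" "b \<in> Hm d"
    "y = rp h' b'" "h' \<in> carrier FG" "d' \<in> carrier G" "b' \<in> Hm d'" by blast
  have bE: "b \<in> carrier E" "b' \<in> carrier E" using Hm_closed * by auto
  have hh: "h \<otimes>\<^sub>F \<R> d h' \<in> carrier FG" using * by (intro FG_mult_closed right_transl_closed) auto
  show "comult RA (x \<otimes>\<^sub>R y) = comult RA x \<otimes>\<^sub>R\<^sub>R comult RA y"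
    using * bE hh by (simp add: RA_mult[OF *(2,3,4,6) bE(2)] RA_comult PR_mult[OF *(2,6,3,4)] comult_E_closed comult_mult)
qed

lemma RA_counit_hom: "counit RA \<in> alg_hom K RA (ground K)"
proof (rule alg_homI_span[OF k_algebra.is_module[OF RA_algebra] module_ground _ _ k_algebra_mult_bilin[OF RA_algebra]
        k_algebra_mult_bilin[OF k_algebra_ground], unfolded RA_eq, OF RA_counit_lin _ RL_span])
  show "counit RA \<one>\<^bsub>RA\<^esub> = \<one>\<^bsub>ground K\<^esub>"
    by (simp add: RA_lin RA_counit FG_one_closed FG_one_at counit_one)
  fix x y assume "x \<in> RSp" "y \<in> RSp"
  then obtain h b d h' b' d' where *: "x = rp h b" "h \<in> carrier FG" "d \<in> carrier G" "b \<in> Hm d"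
    "y = rp h' b'" "h' \<in> carrier FG" "d' \<in> carrier G" "b' \<in> Hm d'" by blast
  have bE: "b \<in> carrier E" "b' \<in> carrier E" using Hm_closed * by auto
  have hh: "h \<otimes>\<^sub>F \<R> d h' \<in> carrier FG" using * by (intro FG_mult_closed right_transl_closed) auto
  have k: "counit E b \<in> carrier K" "counit E b' \<in> carrier K" "h \<one>\<^sub>G \<in> carrier K" "h' \<one>\<^sub>G \<in> carrier K" "h' d \<in> carrier K"
    using bE counit_E_closed FG_closed * by auto
  \<comment> \<open>Translation by d replaces h'(1) by h'(d). This is harmless because the counit of
    b vanishes unless d = 1.\<close>
  show "counit RA (x \<otimes>\<^sub>R y) = counit RA x \<otimes>\<^bsub>ground K\<^esub> counit RA y"
    using *(1-3,5-6) bE hh k counit_Hm[OF *(3,4)]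
    by (cases "d = \<one>\<^sub>G") (simp_all add: RA_mult[OF *(2,3,4,6) bE(2)] RA_counit counit_mult FG_mult_apply right_transl_at K.m_ac)
qed

end

section \<open>Coassociativity and counit of the right bosonisation\<close>

context braided_hopf
begin

lemma tlift_PR:
  assumes Z: "module K Z" and p: "p \<in> bilin K RL RL Z" and k: "k \<in> carrier G" and xy: "x \<in> carrier E" "y \<in> carrier E"
  shows "tlift K Z p (PR (\<delta> k) (pE x y)) =
    (\<Oplus>\<^bsub>Z\<^esub>v\<in>carrier G. p (rp (\<delta> (k \<cdot> inv\<^sub>G v)) (\<sigma> v x)) (rp (\<delta> v) y))"
proof -
  note m = module_RL(1)
  have c: "rp (\<delta> (k \<cdot> inv\<^sub>G v)) (\<sigma> v x) \<in> carrier RL" "rp (\<delta> v) y \<in> carrier RL" if "v \<in> carrier G" for v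
    using that k xy by (simp_all add: rp_closed \<sigma>_closed \<delta>_FG)
  have "tlift K Z p (PR (\<delta> k) (pE x y)) =
    (\<Oplus>\<^bsub>Z\<^esub>v\<in>carrier G. tlift K Z p (rpp (rp (\<R> v (\<delta> k)) (\<sigma> v x)) (rp (\<delta> v) y)))"
    unfolding PR[OF \<delta>_FG[OF k] xy]
    by (rule lin_map_finsum[OF tlift_lin[OF m m Z p] module_RL(2) Z finite_G])
      (use k c in \<open>simp add: rpp_closed right_transl_\<delta>\<close>)
  also have "\<dots> = (\<Oplus>\<^bsub>Z\<^esub>v\<in>carrier G. p (rp (\<delta> (k \<cdot> inv\<^sub>G v)) (\<sigma> v x)) (rp (\<delta> v) y))"
    by (rule finsum_congI[OF Z]) (use k bilin_closed[OF p c] in \<open>simp_all add: tlift_pt[OF m m Z p c] right_transl_\<delta>\<close>)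
  finally show ?thesis .
qed

text \<open>On delta functions translation stays explicit: R_v sends \<delta>_k to \<delta>_{k
  v^-1}. Functions thereby turn into group elements and the remaining laws into reindexing of
  sums.\<close>

lemma RL_\<delta>_eqI:
  assumes "t \<in> carrier RL" "module K Z" "(\<lambda>x. f x) \<in> lin_map K RL Z" "(\<lambda>x. g x) \<in> lin_map K RL Z"
    "\<And>k d b. \<lbrakk>k \<in> carrier G; d \<in> carrier G; b \<in> Hm d; b \<in> carrier E\<rbrakk> \<Longrightarrow> f (rp (\<delta> k) b) = g (rp (\<delta> k) b)"
  shows "f t = g t"
proof (rule RL_eqI[OF assms(1-4)])
  fix h d b assume h: "h \<in> carrier FG" and b: "d \<in> carrier G" "b \<in> Hm d" "b \<in> carrier E"
  show "f (rp h b) = g (rp h b)"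
    by (rule lin_span_eqI[OF module_FG assms(2) _ _ _ _ h[folded FG_span]])
      (use assms(3-5) b \<delta>_FG in \<open>auto intro: lin_comp bilin_left[OF pt_bilin[OF module_FG module_E]]\<close>)
qed

definition XiR_aux where
  "XiR_aux k x = (\<lambda>y z. \<Oplus>\<^bsub>RLLL\<^esub>w\<in>carrier G. \<Oplus>\<^bsub>RLLL\<^esub>v\<in>carrier G. pt K RL RLL (rp (\<delta> (k \<cdot> inv\<^sub>G v)) (\<sigma> v x))
      (rpp (rp (\<delta> (v \<cdot> inv\<^sub>G w)) (\<sigma> w y)) (rp (\<delta> w) z)))"

text \<open>The counterpart of \<open>XiL\<close>: it takes x \<otimes> y \<otimes> z to the sum
  over v and w of (\<delta>_{k v^-1} \<otimes> v.x) \<otimes> (\<delta>_{v w^-1} \<otimes> w.y)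
  \<otimes> (\<delta>_w \<otimes> z). Each coefficient is determined by the group elements acting on
  its neighbours.\<close>

definition XiR where
  "XiR k = tlift K RLLL (\<lambda>x s. tlift K RLLL (XiR_aux k x) s)"

lemma XiR_aux_bilin: "k \<in> carrier G \<Longrightarrow> x \<in> carrier E \<Longrightarrow> XiR_aux k x \<in> bilin K E E RLLL"
  unfolding XiR_aux_def by - (rule R_lins \<sigma>_lin G.inv_closed | assumption)+

lemma XiR_bilin: "k \<in> carrier G \<Longrightarrow> (\<lambda>x s. tlift K RLLL (XiR_aux k x) s) \<in> bilin K E EE RLLL"
  unfolding XiR_aux_def by - (rule R_lins \<sigma>_lin G.inv_closed | assumption)+

lemma XiR_lin: "k \<in> carrier G \<Longrightarrow> XiR k \<in> lin_map K EEE RLLL"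
  unfolding XiR_def by (rule tlift_lin[OF module_E module_EE module_RL(3) XiR_bilin])

lemma XiR:
  assumes "k \<in> carrier G" "x \<in> carrier E" "y \<in> carrier E" "z \<in> carrier E"
  shows "XiR k (pt K E EE x (pE y z)) = XiR_aux k x y z"
  unfolding XiR_def using assms
  by (simp add: tlift_pt[OF module_E module_EE module_RL(3) XiR_bilin] pt_closed[OF module_E module_E]
      tlift_pt[OF module_E module_E module_RL(3) XiR_aux_bilin])

lemmas RA_lins = R_lins lin_comp[OF RA_comult_lin] lin_map_closed[OF RA_comult_lin] lin_comp[OF PR_lin] lin_map_closed[OF PR_lin]
  lin_comp[OF XiR_lin] lin_map_closed[OF XiR_lin] PR_lin RA_comult_lin
  lin_comp[OF RA_counit_lin] RA_counit_lin lin_map_closed[OF RA_counit_lin, unfolded ground_simps]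

text \<open>As on the left, both iterated coproducts factor through \<open>XiR\<close>; one needs an
  exchange of summations, the other a substitution.\<close>

lemma RA_coassoc:
  assumes a: "a \<in> carrier RL"
  shows "tlift K RLLL (\<lambda>x y. pt K RL RLL x (comult RA y)) (comult RA a) =
      tlift K RLLL (\<lambda>x y. tlift K RLLL (\<lambda>x1 x2. pt K RL RLL x1 (rpp x2 y)) (comult RA x)) (comult RA a)"
    (is "?f (comult RA a) = ?g (comult RA a)")
proof -
  note mE = module_E and mEEE = module_EEE(1) and m1 = module_RL(1) and m2 = module_RL(2) and m3 = module_RL(3)
  let ?b = "\<lambda>y x1 x2. pt K RL RLL x1 (rpp x2 y)" and ?e = "\<lambda>y x1 x2. pt K E EE x1 (pE x2 y)"
  let ?B = "\<lambda>x y. tlift K RLLL (?b y) (comult RA x)" and ?C = "\<lambda>x y. pt K RL RLL x (comult RA y)"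
  let ?d = "\<lambda>x y. tlift K EEE (?e y) (comult E x)" and ?c = "\<lambda>x y. pt K E EE x (comult E y)"
  have p1: "?C \<in> bilin K RL RL RLLL"
    by (rule RA_lins | assumption)+
  have p2': "?b y \<in> bilin K RL RL RLLL" if "y \<in> carrier RL" for y
    using that by - (rule RA_lins | assumption)+
  have p2: "?B \<in> bilin K RL RL RLLL"
    by (rule RA_lins | assumption)+
  have q1: "?c \<in> bilin K E E EEE"
    by (rule RA_lins comult_E_lin | assumption)+
  have q2': "?e y \<in> bilin K E E EEE" if "y \<in> carrier E" for y
    using that by - (rule RA_lins | assumption)+
  have q2: "?d \<in> bilin K E E EEE"
    by (rule RA_lins comult_E_lin | assumption)+
  let ?L = "\<lambda>k x v. rp (\<delta> (k \<cdot> inv\<^sub>G v)) (\<sigma> v x)"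
  have Lc: "?L k x v \<in> carrier RL" "rp (\<delta> v) x \<in> carrier RL" if "k \<in> carrier G" "x \<in> carrier E" "v \<in> carrier G" for k x v
    using that by (simp_all add: rp_closed \<sigma>_closed \<delta>_FG)
  let ?t = "\<lambda>k x y z v w. pt K RL RLL (?L k x v) (rpp (?L v y w) (rp (\<delta> w) z))"
  have tc: "?t k x y z v w \<in> carrier RLLL"
    if "k \<in> carrier G" "x \<in> carrier E" "y \<in> carrier E" "z \<in> carrier E" "v \<in> carrier G" "w \<in> carrier G" for k x y z v w
    using that by (intro pt_closed m1 m2 Lc)
  have c1: "?f (PR (\<delta> k) t) = XiR k (tlift K EEE ?c t)"
    if k: "k \<in> carrier G" and t: "t \<in> carrier EE" for k t
  proof (rule EE_eqI[OF t m3])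
    fix x y assume x: "x \<in> carrier E" and y: "y \<in> carrier E"
    have "(\<Oplus>\<^bsub>RLLL\<^esub>v\<in>carrier G. pt K RL RLL (?L k x v) (comult RA (rp (\<delta> v) y))) =
        (\<Oplus>\<^bsub>RLLL\<^esub>v\<in>carrier G. pt K RL RLL (?L k x v) (PR (\<delta> v) (comult E y)))"
      by (rule finsum_congI[OF m3]) (use k x y in \<open>simp_all add: RA_comult \<delta>_FG pt_closed[OF m1 m2] Lc lin_map_closed[OF PR_lin] comult_E_closed\<close>)
    also have "\<dots> = XiR k (pt K E EE x (comult E y))"
    proof (rule EE_eqI[OF comult_E_closed[OF y] m3])
      fix y1 y2 assume y12: "y1 \<in> carrier E" "y2 \<in> carrier E"
      have "(\<Oplus>\<^bsub>RLLL\<^esub>v\<in>carrier G. pt K RL RLL (?L k x v) (PR (\<delta> v) (pE y1 y2))) =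
        (\<Oplus>\<^bsub>RLLL\<^esub>v\<in>carrier G. \<Oplus>\<^bsub>RLLL\<^esub>w\<in>carrier G. ?t k x y1 y2 v w)"
      proof (rule finsum_congI[OF m3 finsum_closedI[OF m3 tc[OF k x y12]]])
        fix v assume v: "v \<in> carrier G"
        note b = bilin_right[OF pt_bilin[OF m1 m2] Lc(1)[OF k x v]]
        show "pt K RL RLL (?L k x v) (PR (\<delta> v) (pE y1 y2)) = (\<Oplus>\<^bsub>RLLL\<^esub>w\<in>carrier G. ?t k x y1 y2 v w)"
          using tlift_PR[OF m2 pt_bilin[OF m1 m1] v y12] tlift_pt_id[OF m1 m1 lin_map_closed[OF PR_lin[OF \<delta>_FG[OF v]] pt_closed[OF mE mE y12]]]
            lin_map_finsum[OF b m2 m3 finite_G rpp_closed[OF Lc(1)[OF v y12(1)] Lc(2)[OF v y12(2)]]]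
          by simp
      qed
      also have "\<dots> = (\<Oplus>\<^bsub>RLLL\<^esub>w\<in>carrier G. \<Oplus>\<^bsub>RLLL\<^esub>v\<in>carrier G. ?t k x y1 y2 v w)"
        by (rule finsum_swap[OF m3 finite_G finite_G tc[OF k x y12]])
      finally show "(\<Oplus>\<^bsub>RLLL\<^esub>v\<in>carrier G. pt K RL RLL (?L k x v) (PR (\<delta> v) (pE y1 y2))) = XiR k (pt K E EE x (pE y1 y2))"
        by (simp add: XiR[OF k x y12] XiR_aux_def)
    qed (insert k x, (rule RA_lins G.inv_closed | assumption)+)
    finally show "?f (PR (\<delta> k) (pE x y)) = XiR k (tlift K EEE ?c (pE x y))"
      by (simp add: tlift_PR[OF m3 p1 k x y] tlift_pt[OF mE mE mEEE q1] x y)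
  qed (insert k, (rule RA_lins p1 q1 | assumption)+)
  have c2: "?g (PR (\<delta> k) t) = XiR k (tlift K EEE ?d t)"
    if k: "k \<in> carrier G" and t: "t \<in> carrier EE" for k t
  proof (rule EE_eqI[OF t m3])
    fix x y assume x: "x \<in> carrier E" and y: "y \<in> carrier E"
    let ?h = "\<lambda>w. tlift K RLLL (?b (rp (\<delta> w) y))"
    have h: "?h w \<in> lin_map K RLL RLLL" if "w \<in> carrier G" for w
      by (rule tlift_lin[OF m1 m1 m3 p2'[OF Lc(2)[OF that y that]]])
    \<comment> \<open>The first leg has been moved by w before its coproduct is taken. Equivariance
      of the coproduct turns this into the diagonal action \<open>sig2 w\<close>.\<close>
    have "(\<Oplus>\<^bsub>RLLL\<^esub>w\<in>carrier G. ?h w (comult RA (?L k x w))) = (\<Oplus>\<^bsub>RLLL\<^esub>w\<in>carrier G. ?h w (PR (\<delta> (k \<cdot> inv\<^sub>G w)) (sig2 w (comult E x))))"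
      by (rule finsum_congI[OF m3])
        (use k x in \<open>simp_all add: RA_comult \<delta>_FG \<sigma>_closed comult_\<sigma> sig2_def[symmetric] lin_map_closed[OF h] lin_map_closed[OF PR_lin] lin_map_closed[OF sig2_lin] comult_E_closed\<close>)
    also have "\<dots> = XiR k (tlift K EEE (?e y) (comult E x))"
    proof (rule EE_eqI[OF comult_E_closed[OF x] m3])
      fix x1 x2 assume x12: "x1 \<in> carrier E" "x2 \<in> carrier E"
      have "(\<Oplus>\<^bsub>RLLL\<^esub>w\<in>carrier G. ?h w (PR (\<delta> (k \<cdot> inv\<^sub>G w)) (sig2 w (pE x1 x2)))) = XiR_aux k x1 x2 y"
        unfolding XiR_aux_def
      proof (rule finsum_congI[OF m3 finsum_closedI[OF m3]])
        fix w v assume "w \<in> carrier G" "v \<in> carrier G"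
        then show "?t k x1 x2 y v w \<in> carrier RLLL" by (intro tc k x12 y)
      next
        fix w assume w: "w \<in> carrier G"
        have kw: "k \<cdot> inv\<^sub>G w \<in> carrier G" using k w by simp
        \<comment> \<open>Since (k w^-1) u^-1 = k (u w)^-1 and u.(w.x) = (u w).x, the index u enters
          through u w; the next step substitutes v = u w.\<close>
        have "?h w (PR (\<delta> (k \<cdot> inv\<^sub>G w)) (sig2 w (pE x1 x2))) =
            (\<Oplus>\<^bsub>RLLL\<^esub>u\<in>carrier G. ?t k x1 x2 y (u \<cdot> w) w)"
          unfolding sig2[OF w x12] tlift_PR[OF m3 p2'[OF Lc(2)[OF w y w]] kw \<sigma>_closed[OF w x12(1)] \<sigma>_closed[OF w x12(2)]]
          by (rule finsum_congI[OF m3 tc[OF k x12 y _ w]])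
            (use k w x12 in \<open>simp_all add: \<sigma>_mult[symmetric] G.inv_mult_group G.m_assoc\<close>)
        also have "\<dots> = (\<Oplus>\<^bsub>RLLL\<^esub>v\<in>carrier G. ?t k x1 x2 y v w)"
          by (rule finsum_reindex_bij[OF m3 bij_mult_right[OF w] tc[OF k x12 y _ w], symmetric])
        finally show "?h w (PR (\<delta> (k \<cdot> inv\<^sub>G w)) (sig2 w (pE x1 x2))) = (\<Oplus>\<^bsub>RLLL\<^esub>v\<in>carrier G. ?t k x1 x2 y v w)" .
      qed
      then show "(\<Oplus>\<^bsub>RLLL\<^esub>w\<in>carrier G. ?h w (PR (\<delta> (k \<cdot> inv\<^sub>G w)) (sig2 w (pE x1 x2)))) = XiR k (tlift K EEE (?e y) (pE x1 x2))"
        by (simp add: tlift_pt[OF mE mE mEEE q2'[OF y]] x12 XiR[OF k x12 y])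
    next
      show "(\<lambda>t. \<Oplus>\<^bsub>RLLL\<^esub>w\<in>carrier G. ?h w (PR (\<delta> (k \<cdot> inv\<^sub>G w)) (sig2 w t))) \<in> lin_map K EE RLLL"
        by (intro lin_finsum module_EE m3 finite_G lin_comp[OF h] lin_comp[OF PR_lin] sig2_lin \<delta>_FG G.m_closed G.inv_closed k)
    qed (insert k y q2'[OF y], (rule RA_lins | assumption)+)
    finally show "?g (PR (\<delta> k) (pE x y)) = XiR k (tlift K EEE ?d (pE x y))"
      by (simp add: tlift_PR[OF m3 p2 k x y] tlift_pt[OF mE mE mEEE q2] x y)
  qed (insert k, (rule RA_lins p2 q2 comult_E_lin | assumption)+)
  show ?thesis
    by (rule RL_\<delta>_eqI[OF a m3], (rule RA_lins p1 p2 | assumption)+)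
      (simp add: RA_comult \<delta>_FG c1 c2 comult_E_closed k_coalgebra.coassoc[OF coalgebra_E])
qed

lemma rp_sum:
  assumes "b \<in> carrier E" "\<And>v. v \<in> carrier G \<Longrightarrow> f v \<in> carrier FG"
  shows "(\<Oplus>\<^bsub>RL\<^esub>v\<in>carrier G. rp (f v) b) = rp (\<Oplus>\<^bsub>FG\<^esub>v\<in>carrier G. f v) b"
  by (rule lin_map_finsum[OF bilin_left[OF pt_bilin[OF module_FG module_E] assms(1)] module_FG module_RL(1) finite_G assms(2), symmetric])

lemma RA_coalgebra: "k_coalgebra K RA"
proof (rule k_coalgebra.intro, unfold RA_eq)
  note m1 = module_RL(1) and mE = module_E
  interpret m: module K RL by (rule m1)
  interpret mE: module K E by (rule mE)
  show "field K" by (rule field_K)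
  show "module K RA" by (rule k_algebra.is_module[OF RA_algebra])
  show "comult RA \<in> lin_map K RL RLL" by (rule RA_comult_lin)
  show "counit RA \<in> lin_map K RL (ground K)" by (rule RA_counit_lin)
  fix a assume a: "a \<in> carrier RL"
  show "tlift K RLLL (\<lambda>x y. pt K RL RLL x (comult RA y)) (comult RA a) =
      tlift K RLLL (\<lambda>x y. tlift K RLLL (\<lambda>x1 x2. pt K RL RLL x1 (rpp x2 y)) (comult RA x)) (comult RA a)"
    by (rule RA_coassoc[OF a])
  let ?l = "\<lambda>x y. counit RA x \<odot>\<^sub>R y" and ?r = "\<lambda>x y. counit RA y \<odot>\<^sub>R x"
  let ?s = "\<lambda>x y. counit E x \<odot>\<^sub>E y" and ?t = "\<lambda>x y. counit E y \<odot>\<^sub>E x"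
  have p: "?l \<in> bilin K RL RL RL" "?r \<in> bilin K RL RL RL"
    by (rule RA_lins | assumption)+
  have q: "?s \<in> bilin K E E E" "?t \<in> bilin K E E E"
    by (rule RA_lins | assumption)+
  have c1: "tlift K RL ?l (PR (\<delta> k) t) = rp (\<delta> k) (tlift K E ?s t)"
    and c2: "tlift K RL ?r (PR (\<delta> k) t) = rp (\<delta> k) (tlift K E ?t t)"
    if k: "k \<in> carrier G" and t: "t \<in> carrier EE" for k t
  proof -
    note s = RA_counit \<delta>_FG \<delta>_at \<sigma>_closed counit_\<sigma> counit_E_closed rp_closed pt_smult_right[OF module_FG mE] k
    show "tlift K RL ?l (PR (\<delta> k) t) = rp (\<delta> k) (tlift K E ?s t)"
    proof (rule EE_eqI[OF t m1])
      fix x y assume xy: "x \<in> carrier E" "y \<in> carrier E"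
      \<comment> \<open>The left counit evaluates \<delta>_{k v^-1} at 1 and so selects v = k. The
        right counit, further below, evaluates \<delta>_v at 1 and selects v = 1.\<close>
      have e: "\<one>\<^sub>G = k \<cdot> inv\<^sub>G v \<longleftrightarrow> v = k" if "v \<in> carrier G" for v
        using that k G.inv_solve_right[of "\<one>\<^sub>G" k v] by auto
      show "tlift K RL ?l (PR (\<delta> k) (pE x y)) = rp (\<delta> k) (tlift K E ?s (pE x y))"
        unfolding tlift_PR[OF m1 p(1) k xy] tlift_pt[OF mE mE mE q(1) xy]
        by (subst finsum_only[OF m1 finite_G k]) (use xy in \<open>auto simp: s e\<close>)
    qed (insert k, (rule RA_lins p q | assumption)+)
    show "tlift K RL ?r (PR (\<delta> k) t) = rp (\<delta> k) (tlift K E ?t t)"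
    proof (rule EE_eqI[OF t m1])
      fix x y assume xy: "x \<in> carrier E" "y \<in> carrier E"
      show "tlift K RL ?r (PR (\<delta> k) (pE x y)) = rp (\<delta> k) (tlift K E ?t (pE x y))"
        unfolding tlift_PR[OF m1 p(2) k xy] tlift_pt[OF mE mE mE q(2) xy]
        by (subst finsum_only[OF m1 finite_G G.one_closed]) (use xy in \<open>auto simp: s \<sigma>_one\<close>)
    qed (insert k, (rule RA_lins p q | assumption)+)
  qed
  show "tlift K RL ?l (comult RA a) = a"
    by (rule RL_\<delta>_eqI[OF a m1], (rule RA_lins p | assumption)+)
      (simp add: RA_comult \<delta>_FG c1 comult_E_closed k_coalgebra.counit_left[OF coalgebra_E])
  show "tlift K RL ?r (comult RA a) = a"
    by (rule RL_\<delta>_eqI[OF a m1], (rule RA_lins p | assumption)+)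
      (simp add: RA_comult \<delta>_FG c2 comult_E_closed k_coalgebra.counit_right[OF coalgebra_E])
qed

end

section \<open>Antipode of the right bosonisation, its two embedded factors and its
  relations\<close>

context braided_hopf
begin

text \<open>The delta functions sum to 1 in whatever order a bijection of the group lists them. Both
  antipode laws end in such a sum.\<close>

lemma right_transl_lift: "b \<in> carrier E \<Longrightarrow> bij_betw p (carrier G) (carrier G) \<Longrightarrow>
    (\<Oplus>\<^bsub>RL\<^esub>v\<in>carrier G. rp (\<delta> (p v)) b) = rp \<one>\<^sub>F b"
  using finsum_reindex_bij[OF module_RL(1), of p "carrier G" "carrier G" "\<lambda>v. rp (\<delta> v) b"]
  by (simp add: rp_sum sum_\<delta> rp_closed \<delta>_FG)

lemma RA_antipode: "\<exists>S. is_antipode K RA S"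
proof -
  note m1 = module_RL(1) and mE = module_E
  interpret m: module K RL by (rule m1)
  interpret mE: module K E by (rule mE)
  obtain S where S: "is_antipode K E S" "\<And>g b. g \<in> carrier G \<Longrightarrow> b \<in> carrier E \<Longrightarrow> S (\<sigma> g b) = \<sigma> g (S b)"
      "\<And>d b. d \<in> carrier G \<Longrightarrow> b \<in> Hm d \<Longrightarrow> S b \<in> lin_span K E (Hm d)" using antipode by blast
  have Sl: "S \<in> lin_map K E E" using S(1) by (simp add: is_antipode_def)
  note Sc = lin_map_closed[OF Sl]
  note rs = RA_lins lin_comp[OF Sl] Sc Sl lin_comp[OF bilin_left[OF RA_mult_bilin]] lin_comp[OF bilin_right[OF RA_mult_bilin]] RA_m_closed
  \<comment> \<open>The standard formula S(h \<otimes> b) = (1 \<otimes> S(b^0)) (S(h b^1) \<otimes>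
    1). The coaction has terms g.b \<otimes> \<delta>_g, the product h \<delta>_g is h(g)
    \<delta>_g, and the antipode of functions sends \<delta>_g to \<delta>_{g^-1}.\<close>
  define SA where "SA = tlift K RL (\<lambda>h b. \<Oplus>\<^bsub>RL\<^esub>g\<in>carrier G. h g \<odot>\<^sub>R (rp \<one>\<^sub>F (S (\<sigma> g b)) \<otimes>\<^sub>R rp (\<delta> (inv\<^sub>G g)) \<one>\<^sub>E))"
  have b1: "(\<lambda>h b. \<Oplus>\<^bsub>RL\<^esub>g\<in>carrier G. h g \<odot>\<^sub>R (rp \<one>\<^sub>F (S (\<sigma> g b)) \<otimes>\<^sub>R rp (\<delta> (inv\<^sub>G g)) \<one>\<^sub>E)) \<in> bilin K FG E RL"
    by (rule rs \<sigma>_lin eval_lin FG_one_closed E.one_closed G.inv_closed FG_closed | assumption)+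
  have SAl: "SA \<in> lin_map K RL RL" unfolding SA_def by (rule tlift_lin[OF module_FG mE m1 b1])
  have mult: "rp (\<delta> g) b \<otimes>\<^sub>R rp (\<delta> k) c = (if g = k \<cdot> inv\<^sub>G d then rp (\<delta> g) (b \<star> c) else \<zero>\<^bsub>RL\<^esub>)"
    if "g \<in> carrier G" "d \<in> carrier G" "b \<in> lin_span K E (Hm d)" "k \<in> carrier G" "b \<in> carrier E" "c \<in> carrier E" for g d b k c
    using that by (simp add: RA_mult_span[OF \<delta>_FG that(2,3) \<delta>_FG] right_transl_\<delta> \<delta>_\<delta> pt_zero_left[OF module_FG mE])
  have SA: "SA (rp (\<delta> g) b) = rp (\<delta> (inv\<^sub>G (g \<cdot> d))) (\<sigma> g (S b))"
    if g: "g \<in> carrier G" and d: "d \<in> carrier G" and b: "b \<in> Hm d" for d b g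
  proof -
    note bE = Hm_closed[OF d b]
    let ?c = "g \<cdot> d \<cdot> inv\<^sub>G g"
    have c: "?c \<in> carrier G" using g d by simp
    have e: "inv\<^sub>G g \<cdot> inv\<^sub>G ?c = inv\<^sub>G (g \<cdot> d)"
      using g d by (simp add: G.inv_mult_group G.m_assoc[symmetric])
    have s: "\<sigma> g (S b) \<in> lin_span K E (Hm ?c)" using S(3)[OF c Hm_\<sigma>[OF g d b]] S(2)[OF g bE] by simp
    have "rp \<one>\<^sub>F (S (\<sigma> g b)) \<otimes>\<^sub>R rp (\<delta> (inv\<^sub>G g)) \<one>\<^sub>E = rp (\<delta> (inv\<^sub>G (g \<cdot> d))) (\<sigma> g (S b))"
      using g d bE by (simp add: RA_mult_span[OF FG_one_closed c s] \<delta>_FG right_transl_\<delta>[OF c] e \<sigma>_closed Sc S(2)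
          ring.ring_simprules(12)[OF k_algebra.is_ring[OF algebra_FG]])
    then show ?thesis unfolding SA_def tlift_pt[OF module_FG mE m1 b1 \<delta>_FG[OF g] bE]
      by (subst finsum_only[OF m1 finite_G g])
        (use g d bE in \<open>auto simp: \<delta>_at rp_closed \<delta>_FG \<sigma>_closed Sc RA_m_closed FG_one_closed\<close>)
  qed
  let ?l = "\<lambda>x y. SA x \<otimes>\<^sub>R y" and ?r = "\<lambda>x y. x \<otimes>\<^sub>R SA y"
  let ?s = "\<lambda>x y. S x \<star> y" and ?t = "\<lambda>x y. x \<star> S y"
  have p: "?l \<in> bilin K RL RL RL" "?r \<in> bilin K RL RL RL"
    by (rule rs lin_comp[OF SAl] lin_map_closed[OF SAl] SAl | assumption)+
  have q: "?s \<in> bilin K E E E" "?t \<in> bilin K E E E"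
    by (rule rs | assumption)+
  have 1: "tlift K RL ?l (PR (\<delta> k) t) = \<delta> k \<one>\<^sub>G \<odot>\<^sub>R rp \<one>\<^sub>F (tlift K E ?s t)"
    if k: "k \<in> carrier G" and t: "t \<in> carrier EE" for k t
  proof (rule EE_eqI[OF t m1])
    fix x y d1 d2 assume xy: "d1 \<in> carrier G" "d2 \<in> carrier G" "x \<in> Hm d1" "y \<in> Hm d2" "x \<in> carrier E" "y \<in> carrier E"
    let ?c = "k \<cdot> d1 \<cdot> inv\<^sub>G k"
    have c: "?c \<in> carrier G" using k xy by simp
    have Sx: "\<sigma> k (S x) \<in> lin_span K E (Hm ?c)" "\<sigma> k (S x) \<in> carrier E"
      using S(3)[OF c Hm_\<sigma>[OF k xy(1,3)]] S(2)[OF k xy(5)] k xy Sc \<sigma>_closed by auto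
    \<comment> \<open>The two delta functions that meet in this product agree exactly when k = 1,
      for every v. In that case the sum over v lists all delta functions once, shifted by the
      inverse of d1.\<close>
    have s: "SA (rp (\<delta> (k \<cdot> inv\<^sub>G v)) (\<sigma> v x)) \<otimes>\<^sub>R rp (\<delta> v) y =
        (if k = \<one>\<^sub>G then rp (\<delta> (v \<cdot> inv\<^sub>G d1)) (S x \<star> y) else \<zero>\<^bsub>RL\<^esub>)" if v: "v \<in> carrier G" for v
    proof -
      let ?g = "v \<cdot> inv\<^sub>G d1 \<cdot> inv\<^sub>G k"
      have g: "?g \<in> carrier G" using v k xy by simp
      have e1: "inv\<^sub>G (k \<cdot> inv\<^sub>G v \<cdot> (v \<cdot> d1 \<cdot> inv\<^sub>G v)) = ?g"
        using v k xy by (simp add: G.inv_mult_group G.m_assoc)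
      have e2: "\<sigma> (k \<cdot> inv\<^sub>G v) (\<sigma> v (S x)) = \<sigma> k (S x)"
        using v k xy Sc by (simp add: \<sigma>_mult[symmetric] G.m_assoc)
      let ?u = "inv\<^sub>G d1 \<cdot> inv\<^sub>G k"
      have "?g = v \<cdot> ?u" "v \<cdot> inv\<^sub>G ?c = v \<cdot> (k \<cdot> ?u)"
        using v k xy by (simp_all add: G.inv_mult_group G.m_assoc)
      then have e3: "?g = v \<cdot> inv\<^sub>G ?c \<longleftrightarrow> k = \<one>\<^sub>G" using v k xy by simp
      have "SA (rp (\<delta> (k \<cdot> inv\<^sub>G v)) (\<sigma> v x)) = rp (\<delta> ?g) (\<sigma> k (S x))"
        using SA[of "k \<cdot> inv\<^sub>G v" "v \<cdot> d1 \<cdot> inv\<^sub>G v" "\<sigma> v x"] v k xy Hm_\<sigma>[OF v xy(1,3)] by (simp only: e1 e2 S(2) G.m_closed G.inv_closed)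
      then show ?thesis using mult[OF g c Sx(1) v Sx(2) xy(6)] v xy Sc unfolding e3 by (simp add: \<sigma>_one)
    qed
    have sc: "S x \<star> y \<in> carrier E" using xy Sc by simp
    have "tlift K RL ?l (PR (\<delta> k) (pE x y)) =
      (\<Oplus>\<^bsub>RL\<^esub>v\<in>carrier G. if k = \<one>\<^sub>G then rp (\<delta> (v \<cdot> inv\<^sub>G d1)) (S x \<star> y) else \<zero>\<^bsub>RL\<^esub>)"
      unfolding tlift_PR[OF m1 p(1) k xy(5,6)]
      by (rule finsum_congI[OF m1 _ s]) (use xy sc in \<open>auto intro!: rp_closed \<delta>_FG\<close>)
    also have "\<dots> = \<delta> k \<one>\<^sub>G \<odot>\<^sub>R rp \<one>\<^sub>F (S x \<star> y)"
      using right_transl_lift[OF sc bij_mult_right[OF G.inv_closed[OF xy(1)]]] sc by (simp add: \<delta>_at rp_closed FG_one_closed)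
    finally show "tlift K RL ?l (PR (\<delta> k) (pE x y)) =
        \<delta> k \<one>\<^sub>G \<odot>\<^sub>R rp \<one>\<^sub>F (tlift K E ?s (pE x y))"
      by (simp add: tlift_pt[OF mE mE mE q(1)] xy)
  qed (insert k, (rule rs p q FG_one_closed FG_closed \<delta>_FG | assumption)+)
  have 2: "tlift K RL ?r (PR (\<delta> k) (comult E b)) = (\<delta> k \<one>\<^sub>G \<otimes>\<^bsub>K\<^esub> counit E b) \<odot>\<^sub>R rp \<one>\<^sub>F \<one>\<^sub>E"
    if k: "k \<in> carrier G" and d: "d \<in> carrier G" and b: "b \<in> Hm d" for k d b
  proof -
    note bE = Hm_closed[OF d b] and eb = counit_E_closed[OF Hm_closed[OF d b]]
    \<comment> \<open>The delta functions match exactly when k is the inverse of d1 d2. Fixing this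
      product to be d makes the condition independent of the tensor, so that \<open>?f\<close> is
      linear and can be compared on the coproduct of b.\<close>
    let ?f = "\<lambda>t. \<Oplus>\<^bsub>RL\<^esub>v\<in>carrier G. if k = inv\<^sub>G d then rp (\<delta> (k \<cdot> inv\<^sub>G v)) (\<sigma> v (tlift K E ?t t)) else \<zero>\<^bsub>RL\<^esub>"
    have "tlift K RL ?r (PR (\<delta> k) (comult E b)) = ?f (comult E b)"
    proof (rule comult_E_eqI[OF d b m1])
      fix x y d1 d2 assume xy: "d1 \<in> carrier G" "d2 \<in> carrier G" "x \<in> Hm d1" "y \<in> Hm d2" "x \<in> carrier E" "y \<in> carrier E" "d = d1 \<cdot> d2"
      show "tlift K RL ?r (PR (\<delta> k) (pE x y)) = ?f (pE x y)"
        unfolding tlift_PR[OF m1 p(2) k xy(5,6)] tlift_pt[OF mE mE mE q(2) xy(5,6)]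
      proof (rule finsum_congI[OF m1])
        fix v assume v: "v \<in> carrier G"
        show "(if k = inv\<^sub>G d then rp (\<delta> (k \<cdot> inv\<^sub>G v)) (\<sigma> v (x \<star> S y)) else \<zero>\<^bsub>RL\<^esub>) \<in> carrier RL"
          using v k xy Sc by (auto intro!: rp_closed \<delta>_FG \<sigma>_closed)
        let ?c = "v \<cdot> d1 \<cdot> inv\<^sub>G v"
        have c: "?c \<in> carrier G" using v xy by simp
        have "inv\<^sub>G v \<cdot> inv\<^sub>G ?c = inv\<^sub>G d1 \<cdot> inv\<^sub>G v"
          using v xy by (simp add: G.inv_mult_group G.m_assoc[symmetric])
        then have e: "inv\<^sub>G (v \<cdot> d2) \<cdot> inv\<^sub>G ?c = inv\<^sub>G d \<cdot> inv\<^sub>G v"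
          using v xy c by (simp add: G.inv_mult_group G.m_assoc)
        have "k \<cdot> inv\<^sub>G v = inv\<^sub>G (v \<cdot> d2) \<cdot> inv\<^sub>G ?c \<longleftrightarrow> k = inv\<^sub>G d"
          unfolding e using v k d by simp
        then show "rp (\<delta> (k \<cdot> inv\<^sub>G v)) (\<sigma> v x) \<otimes>\<^sub>R SA (rp (\<delta> v) y) =
            (if k = inv\<^sub>G d then rp (\<delta> (k \<cdot> inv\<^sub>G v)) (\<sigma> v (x \<star> S y)) else \<zero>\<^bsub>RL\<^esub>)"
          unfolding SA[OF v xy(2,4)]
          using mult[OF _ c lin_span_base[OF Hm_\<sigma>[OF v xy(1,3)]], of "k \<cdot> inv\<^sub>G v" "inv\<^sub>G (v \<cdot> d2)" "\<sigma> v (S y)"] v k xy Sc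
          by (simp add: \<sigma>_closed alg_hom_mult[OF \<sigma>_hom])
      qed
    next
      show "?f \<in> lin_map K EE RL"
        using k by (cases "k = inv\<^sub>G d") (auto intro!: lin_finsum lin_zero lin_pt2 lin_comp[OF \<sigma>_lin] tlift_lin q module_EE m1 finite_G module_FG mE \<delta>_FG)
    qed (insert k, (rule rs p q \<delta>_FG | assumption)+)
    also have "\<dots> = (if k = inv\<^sub>G d then rp \<one>\<^sub>F (counit E b \<odot>\<^sub>E \<one>\<^sub>E) else \<zero>\<^bsub>RL\<^esub>)"
    proof -
      have kk: "k \<cdot> (inv\<^sub>G k \<cdot> y) = y" if "y \<in> carrier G" for y
        using k that by (simp add: G.m_assoc[symmetric])
      have "bij_betw (\<lambda>v. k \<cdot> inv\<^sub>G v) (carrier G) (carrier G)"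
        by (rule bij_betwI[where g = "\<lambda>g. inv\<^sub>G g \<cdot> k"]) (use k kk in \<open>auto simp: G.m_assoc G.inv_mult_group\<close>)
      note r = right_transl_lift[OF _ this, of "counit E b \<odot>\<^sub>E \<one>\<^sub>E"]
      have "\<sigma> v (tlift K E ?t (comult E b)) = counit E b \<odot>\<^sub>E \<one>\<^sub>E" if "v \<in> carrier G" for v
        using S(1) bE eb that by (simp add: is_antipode_def lin_map_smult[OF \<sigma>_lin] alg_hom_one[OF \<sigma>_hom])
      then have "?f (comult E b) = (\<Oplus>\<^bsub>RL\<^esub>v\<in>carrier G. if k = inv\<^sub>G d then rp (\<delta> (k \<cdot> inv\<^sub>G v)) (counit E b \<odot>\<^sub>E \<one>\<^sub>E) else \<zero>\<^bsub>RL\<^esub>)"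
        by (intro finsum_congI[OF m1]) (use k eb in \<open>auto intro!: rp_closed \<delta>_FG\<close>)
      then show ?thesis using r eb by (cases "k = inv\<^sub>G d") auto
    qed
    \<comment> \<open>The condition reads k = d^-1, whereas the counit asks for k = 1. For d = 1
      they coincide; for any other d the counit of b is zero.\<close>
    also have "\<dots> = (\<delta> k \<one>\<^sub>G \<otimes>\<^bsub>K\<^esub> counit E b) \<odot>\<^sub>R rp \<one>\<^sub>F \<one>\<^sub>E"
      using counit_Hm[OF d b] eb k
      by (cases "d = \<one>\<^sub>G") (auto simp: \<delta>_at pt_smult_right[OF module_FG mE] pt_zero_right[OF module_FG mE] FG_one_closed rp_closed)
    finally show ?thesis .
  qed
  have r: "(\<lambda>a. counit RA a \<odot>\<^sub>R \<one>\<^bsub>RA\<^esub>) \<in> lin_map K RL RL"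
    by (intro lin_scal m1 RA_counit_lin) (simp add: RA_lin rp_closed FG_one_closed)
  have "is_antipode K RA SA"
    unfolding is_antipode_def RA_eq
  proof (intro conjI ballI SAl)
    fix a assume a: "a \<in> carrier RL"
    have "tlift K E ?s (comult E b) = counit E b \<odot>\<^sub>E \<one>\<^sub>E" if "b \<in> carrier E" for b
      using S(1) that by (simp add: is_antipode_def)
    then show "tlift K RL ?l (comult RA a) = counit RA a \<odot>\<^sub>R \<one>\<^bsub>RA\<^esub>"
      by (intro RL_\<delta>_eqI[OF a m1 lin_comp[OF tlift_lin[OF m1 m1 m1 p(1)] RA_comult_lin] r])
        (simp add: RA_comult \<delta>_FG 1 comult_E_closed RA_counit RA_lin pt_smult_right[OF module_FG mE] counit_E_closed FG_one_closed
            m.smult_assoc1 FG_closed rp_closed)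
    show "tlift K RL ?r (comult RA a) = counit RA a \<odot>\<^sub>R \<one>\<^bsub>RA\<^esub>"
      by (rule RL_\<delta>_eqI[OF a m1 lin_comp[OF tlift_lin[OF m1 m1 m1 p(2)] RA_comult_lin] r])
        (simp add: RA_comult \<delta>_FG 2 RA_counit RA_lin)
  qed
  then show ?thesis by blast
qed
lemma RA_hopf: "hopf_algebra K RA"
  by (rule hopf_algebra.intro[OF RA_algebra RA_coalgebra RA_comult_hom RA_counit_hom RA_antipode])

lemma FG_l_one: "f \<in> carrier FG \<Longrightarrow> \<one>\<^sub>F \<otimes>\<^sub>F f = f" "f \<in> carrier FG \<Longrightarrow> f \<otimes>\<^sub>F \<one>\<^sub>F = f"
  using ring.ring_simprules(12)[OF k_algebra.is_ring[OF algebra_FG]] ring.is_monoid[OF k_algebra.is_ring[OF algebra_FG]]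
  by (auto simp: monoid.r_one)

lemma RA_mult_one: "h \<in> carrier FG \<Longrightarrow> g \<in> carrier FG \<Longrightarrow> c \<in> carrier E \<Longrightarrow> rp h \<one>\<^sub>E \<otimes>\<^sub>R rp g c = rp (h \<otimes>\<^sub>F g) c"
  using RA_mult[OF _ G.one_closed Hm_one] by (simp add: right_transl_one)

lemma right_iota_E: "(\<lambda>b. rp \<one>\<^sub>F b) \<in> alg_hom K E RA"
proof (rule alg_homI_span[OF module_E k_algebra.is_module[OF RA_algebra] _ _ k_algebra_mult_bilin[OF algebra_E]
      k_algebra_mult_bilin[OF RA_algebra] _ Hm_span])
  show "(\<lambda>b. rp \<one>\<^sub>F b) \<in> lin_map K E RA"
    unfolding RA_eq by (rule bilin_right[OF pt_bilin[OF module_FG module_E] FG_one_closed])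
  fix x y assume "x \<in> (\<Union>d\<in>carrier G. Hm d)" "y \<in> (\<Union>d\<in>carrier G. Hm d)"
  then obtain d d' where *: "d \<in> carrier G" "x \<in> Hm d" "d' \<in> carrier G" "y \<in> Hm d'" by blast
  then show "rp \<one>\<^sub>F (x \<star> y) = rp \<one>\<^sub>F x \<otimes>\<^sub>R rp \<one>\<^sub>F y"
    by (simp add: RA_mult[OF FG_one_closed *(1,2) FG_one_closed] Hm_closed alg_hom_one[OF right_transl_alg_hom] FG_l_one FG_one_closed)
qed (use Hm_sub in \<open>auto simp: RA_lin\<close>)

lemma right_iota_H_alg: "(\<lambda>h. rp h \<one>\<^sub>E) \<in> alg_hom K FG RA"
proof (rule alg_homI)
  show "(\<lambda>h. rp h \<one>\<^sub>E) \<in> lin_map K FG RA"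
    unfolding RA_eq by (rule bilin_left[OF pt_bilin[OF module_FG module_E] E.one_closed])
qed (auto simp: RA_lin RA_mult_one)

lemma right_iota_H: "(\<lambda>h. rp h \<one>\<^sub>E) \<in> hopf_hom K FG RA"
  unfolding hopf_hom_def RA_eq
proof (intro CollectI conjI ballI right_iota_H_alg)
  fix h assume h: "h \<in> carrier FG"
  have b: "(\<lambda>x y. rpp (rp x \<one>\<^sub>E) (rp y \<one>\<^sub>E)) \<in> bilin K FG FG RLL"
    by (rule RA_lins E.one_closed | assumption)+
  show "comult RA (rp h \<one>\<^sub>E) = tlift K RLL (\<lambda>x y. rpp (rp x \<one>\<^sub>E) (rp y \<one>\<^sub>E)) (comult FG h)"
    unfolding tlift_comult_FG_right[OF h module_RL(2) b] RA_comult[OF h E.one_closed] comult_one PR[OF h E.one_closed E.one_closed]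
    by (rule finsum_congI[OF module_RL(2)])
      (auto simp: alg_hom_one[OF \<sigma>_hom] h intro!: rpp_closed rp_closed right_transl_closed \<delta>_FG)
  show "counit RA (rp h \<one>\<^sub>E) = counit FG h"
    using h by (simp add: RA_counit counit_one counit_FG FG_closed)
qed

lemma right_factor: "h \<in> carrier FG \<Longrightarrow> b \<in> carrier E \<Longrightarrow> rp h \<one>\<^sub>E \<otimes>\<^sub>R rp \<one>\<^sub>F b = rp h b"
  by (simp add: RA_mult_one FG_one_closed FG_l_one)

lemma right_conclusion:
  shows "right_braided_group K FG E ract rco \<and> hopf_algebra K RA \<and>
     (\<lambda>b. rp \<one>\<^sub>F b) \<in> alg_hom K E RA \<and> inj_on (\<lambda>b. rp \<one>\<^sub>F b) (carrier E) \<and>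
     (\<lambda>h. rp h \<one>\<^sub>E) \<in> hopf_hom K FG RA \<and> inj_on (\<lambda>h. rp h \<one>\<^sub>E) (carrier FG) \<and>
     alg_span K RA ((\<lambda>h. rp h \<one>\<^sub>E) ` carrier FG \<union> (\<lambda>b. rp \<one>\<^sub>F b) ` carrier E) = carrier RA \<and>
     tlift K RA (\<lambda>h b. rp h \<one>\<^sub>E \<otimes>\<^sub>R rp \<one>\<^sub>F b) \<in> lin_map K RL RA \<and>
     bij_betw (tlift K RA (\<lambda>h b. rp h \<one>\<^sub>E \<otimes>\<^sub>R rp \<one>\<^sub>F b)) (carrier RL) (carrier RA)"
proof (intro conjI right_braided RA_hopf right_iota_E right_iota_H)
  show "inj_on (\<lambda>b. rp \<one>\<^sub>F b) (carrier E)"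
    by (rule inj_on_pt_right[OF module_FG module_E FG_one_closed counit_FG_lin]) (simp add: counit_FG FG_one_at)
  show "inj_on (\<lambda>h. rp h \<one>\<^sub>E) (carrier FG)"
    by (rule inj_on_pt_left[OF module_FG module_E E.one_closed counit_E_lin counit_one])
  show "alg_span K RA ((\<lambda>h. rp h \<one>\<^sub>E) ` carrier FG \<union> (\<lambda>b. rp \<one>\<^sub>F b) ` carrier E) = carrier RA"
  proof (rule alg_span_eq_carrier[OF RA_algebra same_lin_RA module_FG module_E])
    show "(\<lambda>h. rp h \<one>\<^sub>E) ` carrier FG \<union> (\<lambda>b. rp \<one>\<^sub>F b) ` carrier E \<subseteq> carrier RA"
      using alg_hom_closed[OF right_iota_E] alg_hom_closed[OF right_iota_H_alg] by auto
  qed (use right_factor[symmetric] in blast)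
  have id: "tlift K RA (\<lambda>h b. rp h \<one>\<^sub>E \<otimes>\<^sub>R rp \<one>\<^sub>F b) t = t" if "t \<in> carrier RL" for t
    by (rule tlift_id[OF module_FG module_E that same_lin_RA right_factor])
  then show "bij_betw (tlift K RA (\<lambda>h b. rp h \<one>\<^sub>E \<otimes>\<^sub>R rp \<one>\<^sub>F b)) (carrier RL) (carrier RA)"
    by (intro bij_betw_id) (auto simp: RA_lin)
  show "tlift K RA (\<lambda>h b. rp h \<one>\<^sub>E \<otimes>\<^sub>R rp \<one>\<^sub>F b) \<in> lin_map K RL RA"
    by (rule lin_map_cong[OF _ id[symmetric] module_RL(1)]) (simp_all add: RA_eq lin_id)
qed

lemma right_relation: "d \<in> carrier G \<Longrightarrow> b \<in> Hm d \<Longrightarrow> f \<in> carrier FG \<Longrightarrow>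
    rp \<one>\<^sub>F b \<otimes>\<^sub>R rp f \<one>\<^sub>E = rp (\<R> d f) \<one>\<^sub>E \<otimes>\<^sub>R rp \<one>\<^sub>F b"
  by (simp add: RA_mult[OF FG_one_closed] right_factor right_transl_closed Hm_closed FG_l_one)

text \<open>The term b \<otimes> 1 keeps its sum over the group, as both legs depend on the index;
  in the term 1 \<otimes> b the index occurs only in delta functions and sums to 1.\<close>

lemma right_comult_primitive:
  assumes b: "b \<in> carrier E"
    and p: "comult E b = pE b \<one>\<^sub>E \<oplus>\<^bsub>EE\<^esub> pE \<one>\<^sub>E b"
  shows "comult RA (rp \<one>\<^sub>F b) =
    (\<Oplus>\<^bsub>tensor K RA RA\<^esub>g\<in>carrier G. pt K RA RA (rp \<one>\<^sub>F (\<sigma> g b)) (rp (\<delta> g) \<one>\<^sub>E)) \<oplus>\<^bsub>tensor K RA RA\<^esub>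
    pt K RA RA \<one>\<^bsub>RA\<^esub> (rp \<one>\<^sub>F b)"
proof -
  have "PR \<one>\<^sub>F (pE b \<one>\<^sub>E) = (\<Oplus>\<^bsub>RLL\<^esub>g\<in>carrier G. rpp (rp \<one>\<^sub>F (\<sigma> g b)) (rp (\<delta> g) \<one>\<^sub>E))"
    unfolding PR[OF FG_one_closed b E.one_closed]
    by (rule finsum_congI[OF module_RL(2)]) (auto simp: alg_hom_one[OF right_transl_alg_hom] intro!: rpp_closed rp_closed FG_one_closed \<sigma>_closed \<delta>_FG b)
  then show ?thesis unfolding RA_eq
    using b by (simp add: RA_comult FG_one_closed p lin_map_add[OF PR_lin] pt_closed[OF module_E module_E] PR_one RA_lin)
qed

lemma right_counit: "b \<in> carrier E \<Longrightarrow> counit RA (rp \<one>\<^sub>F b) = counit E b"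
  by (simp add: RA_counit FG_one_closed FG_one_at counit_E_closed)

end

subsection \<open>The Fomin--Kirillov algebra\<close>

text \<open>The defining relations read in an arbitrary algebra: the condition on prescribed values
  under which \<open>fk_hom\<close> denotes an algebra map.\<close>

definition fk_sat where
  "fk_sat N B \<phi> \<longleftrightarrow>
    (\<forall>i\<in>{1..N}. \<forall>j\<in>{1..N}. i \<noteq> j \<longrightarrow> \<phi> i j \<in> carrier B \<and> \<phi> i j \<oplus>\<^bsub>B\<^esub> \<phi> j i = \<zero>\<^bsub>B\<^esub> \<and> \<phi> i j \<otimes>\<^bsub>B\<^esub> \<phi> i j = \<zero>\<^bsub>B\<^esub>) \<and>
    (\<forall>i\<in>{1..N}. \<forall>j\<in>{1..N}. \<forall>l\<in>{1..N}. \<forall>m\<in>{1..N}. distinct [i, j, l, m] \<longrightarrow>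
      \<phi> i j \<otimes>\<^bsub>B\<^esub> \<phi> l m = \<phi> l m \<otimes>\<^bsub>B\<^esub> \<phi> i j) \<and>
    (\<forall>i\<in>{1..N}. \<forall>j\<in>{1..N}. \<forall>l\<in>{1..N}. distinct [i, j, l] \<longrightarrow>
      \<phi> i j \<otimes>\<^bsub>B\<^esub> \<phi> j l \<oplus>\<^bsub>B\<^esub> \<phi> j l \<otimes>\<^bsub>B\<^esub> \<phi> l i \<oplus>\<^bsub>B\<^esub> \<phi> l i \<otimes>\<^bsub>B\<^esub> \<phi> i j = \<zero>\<^bsub>B\<^esub>)"

lemma fk_simps:
  "carrier (fk K N) = carrier (fk_alg K N)" "add (fk K N) = add (fk_alg K N)"
  "zero (fk K N) = zero (fk_alg K N)" "smult (fk K N) = smult (fk_alg K N)"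
  "mult (fk K N) = mult (fk_alg K N)" "one (fk K N) = one (fk_alg K N)"
  "comult (fk K N) = fk_comult K N" "counit (fk K N) = fk_hom K N (ground K) (\<lambda>i j. \<zero>\<^bsub>K\<^esub>)"
  by (simp_all add: fk_def module.defs hopf.defs)

locale fomin_kirillov = kvect K for K :: "('k, 'm) ring_scheme" +
  fixes N :: nat
begin

abbreviation "P \<equiv> fk_pairs N"
abbreviation "W \<equiv> \<lparr>carrier = lists P, mult = (@), one = []\<rparr>"
abbreviation "F \<equiv> free_alg K P"
abbreviation "I \<equiv> genideal F (fk_rels K N)"
abbreviation "A \<equiv> fk K N"
abbreviation "gen \<equiv> fk_gen K N"

lemma monoid_W: "monoid W"
  by (rule monoidI) auto

lemma algebra_F: "k_algebra K F"
  unfolding free_alg_def by (rule k_algebra_monoid_algebra[OF monoid_W])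

lemma F_single: "w \<in> lists P \<Longrightarrow> single K w \<in> carrier F"
  by (simp add: free_alg_def)

lemma F_mult: "v \<in> lists P \<Longrightarrow> w \<in> lists P \<Longrightarrow> single K v \<otimes>\<^bsub>F\<^esub> single K w = single K (v @ w)"
  unfolding free_alg_def by (subst monoid_algebra_single[OF monoid_W]) auto

lemma F_one: "\<one>\<^bsub>F\<^esub> = single K []"
  by (simp add: free_alg_def)

lemma pair_iff: "(i, j) \<in> P \<longleftrightarrow> i \<in> {1..N} \<and> j \<in> {1..N} \<and> i \<noteq> j"
  by (auto simp: fk_pairs_def)

lemma fk_rels_cases:
  assumes "r \<in> fk_rels K N"
  obtains i j where "(i, j) \<in> P" "r = single K [(i, j)] \<oplus>\<^bsub>F\<^esub> single K [(j, i)]"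
  | i j where "(i, j) \<in> P" "r = single K [(i, j)] \<otimes>\<^bsub>F\<^esub> single K [(i, j)]"
  | i j l m where "{i, j, l, m} \<subseteq> {1..N}" "distinct [i, j, l, m]"
      "r = single K [(i, j)] \<otimes>\<^bsub>F\<^esub> single K [(l, m)] \<ominus>\<^bsub>F\<^esub> single K [(l, m)] \<otimes>\<^bsub>F\<^esub> single K [(i, j)]"
  | i j l where "{i, j, l} \<subseteq> {1..N}" "distinct [i, j, l]"
      "r = single K [(i, j)] \<otimes>\<^bsub>F\<^esub> single K [(j, l)] \<oplus>\<^bsub>F\<^esub> single K [(j, l)] \<otimes>\<^bsub>F\<^esub> single K [(l, i)] \<oplus>\<^bsub>F\<^esub> single K [(l, i)] \<otimes>\<^bsub>F\<^esub> single K [(i, j)]"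
  using assms unfolding fk_rels_def Let_def Un_iff mem_Collect_eq
  by (elim disjE exE conjE)
    ((rule that(1)[unfolded pair_iff]; (intro conjI)?; assumption) | (rule that(2)[unfolded pair_iff]; (intro conjI)?; assumption) |
      (rule that(3); assumption) | (rule that(4); assumption))+

lemma fk_relsI:
  "(i, j) \<in> P \<Longrightarrow> single K [(i, j)] \<oplus>\<^bsub>F\<^esub> single K [(j, i)] \<in> fk_rels K N"
  "(i, j) \<in> P \<Longrightarrow> single K [(i, j)] \<otimes>\<^bsub>F\<^esub> single K [(i, j)] \<in> fk_rels K N"
  "{i, j, l, m} \<subseteq> {1..N} \<Longrightarrow> distinct [i, j, l, m] \<Longrightarrow>
      single K [(i, j)] \<otimes>\<^bsub>F\<^esub> single K [(l, m)] \<ominus>\<^bsub>F\<^esub> single K [(l, m)] \<otimes>\<^bsub>F\<^esub> single K [(i, j)] \<in> fk_rels K N"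
  "{i, j, l} \<subseteq> {1..N} \<Longrightarrow> distinct [i, j, l] \<Longrightarrow>
      single K [(i, j)] \<otimes>\<^bsub>F\<^esub> single K [(j, l)] \<oplus>\<^bsub>F\<^esub> single K [(j, l)] \<otimes>\<^bsub>F\<^esub> single K [(l, i)] \<oplus>\<^bsub>F\<^esub> single K [(l, i)] \<otimes>\<^bsub>F\<^esub> single K [(i, j)] \<in> fk_rels K N"
  unfolding fk_rels_def Let_def pair_iff Un_iff mem_Collect_eq by metis+

sublocale FF: ring F
  by (rule k_algebra.is_ring[OF algebra_F])

lemmas module_F = k_algebra.is_module[OF algebra_F]

lemma gen_single: "(i, j) \<in> P \<Longrightarrow> single K [(i, j)] \<in> carrier F"
  by (rule F_single) simp

lemma fk_rels_closed: "fk_rels K N \<subseteq> carrier F"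
proof
  fix r assume "r \<in> fk_rels K N"
  then show "r \<in> carrier F"
    by (cases rule: fk_rels_cases) (auto simp: gen_single pair_iff)
qed

lemma ideal_I: "ideal I F"
  by (rule FF.genideal_ideal[OF fk_rels_closed])

lemma fk_alg_eq: "fk_alg K N = quot F I"
  by (simp add: fk_alg_def Let_def)

text \<open>The action, coaction and coproduct are defined over \<open>fk_alg\<close>, while the
  Hopf statements speak of the record \<open>fk\<close>. The two share all algebra fields, and
  everything is moved to \<open>fk\<close>.\<close>

lemma same_lin_fk: "same_lin (fk_alg K N) A"
  by (simp add: same_lin_def fk_simps)

lemma algebra_A: "k_algebra K A"
  by (rule k_algebra_cong[OF k_algebra_quot(1)[OF algebra_F ideal_I], folded fk_alg_eq]) (simp_all add: fk_simps)

sublocale AA: ring A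
  by (rule k_algebra.is_ring[OF algebra_A])

lemmas module_A = k_algebra.is_module[OF algebra_A]

lemma alg_hom_fk: "alg_hom K (fk_alg K N) B = alg_hom K A B" "alg_hom K B (fk_alg K N) = alg_hom K B A"
  by (auto simp: alg_hom_def ring_hom_def lin_map_def fk_simps)

lemma proj_hom: "(\<lambda>x. I +>\<^bsub>F\<^esub> x) \<in> alg_hom K F A"
  using quot_proj_alg_hom[OF algebra_F ideal_I] by (simp only: fk_alg_eq[symmetric] alg_hom_fk)

lemma proj_zero: "r \<in> fk_rels K N \<Longrightarrow> I +>\<^bsub>F\<^esub> r = \<zero>\<^bsub>A\<^esub>"
proof -
  assume r: "r \<in> fk_rels K N"
  interpret Q: quot_space K F I by (intro quot_space.intro module_F ideal_submodule algebra_F ideal_I)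
  have "r \<in> I" using FF.genideal_self[OF fk_rels_closed] r by auto
  then have "I +>\<^bsub>F\<^esub> r = I +>\<^bsub>F\<^esub> \<zero>\<^bsub>F\<^esub>"
    using Q.quot_eq[of r "\<zero>\<^bsub>F\<^esub>"] fk_rels_closed r by (auto simp: a_minus_def)
  then show ?thesis by (simp add: Q.quot_zero[symmetric] fk_simps fk_alg_eq quot_simps)
qed

lemma gen_eq: "gen i j = I +>\<^bsub>F\<^esub> single K [(i, j)]"
  by (simp add: fk_gen_def Let_def)

lemma gen_closed: "(i, j) \<in> P \<Longrightarrow> gen i j \<in> carrier A"
  unfolding gen_eq by (rule alg_hom_closed[OF proj_hom gen_single])

lemma A_cancel: "x \<in> carrier A \<Longrightarrow> y \<in> carrier A \<Longrightarrow> x \<ominus>\<^bsub>A\<^esub> y = \<zero>\<^bsub>A\<^esub> \<Longrightarrow> x = y"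
  by (rule module_diff_zero[OF module_A])

lemma proj_gen_mult:
  "(i, j) \<in> P \<Longrightarrow> (l, m) \<in> P \<Longrightarrow> I +>\<^bsub>F\<^esub> (single K [(i, j)] \<otimes>\<^bsub>F\<^esub> single K [(l, m)]) = gen i j \<otimes>\<^bsub>A\<^esub> gen l m"
  unfolding gen_eq by (rule alg_hom_mult[OF proj_hom gen_single gen_single])

lemma gen_sat: "fk_sat N A gen"
proof -
  note hl = alg_hom_lin[OF proj_hom]
  note add = lin_map_add[OF hl] and diff = lin_map_diff[OF hl module_F module_A]
  have p: "(i, j) \<in> P" if "i \<in> {1..N}" "j \<in> {1..N}" "i \<noteq> j" for i j
    using that by (simp add: pair_iff)
  have c: "single K [(i, j)] \<otimes>\<^bsub>F\<^esub> single K [(l, m)] \<in> carrier F" if "(i, j) \<in> P" "(l, m) \<in> P" for i j l m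
    using that by (intro FF.m_closed gen_single)
  show ?thesis
    unfolding fk_sat_def
  proof (intro conjI ballI impI)
    fix i j assume ij: "i \<in> {1..N}" "j \<in> {1..N}" "i \<noteq> j"
    note q = p[OF ij] p[OF ij(2,1) not_sym[OF ij(3)]]
    show "gen i j \<in> carrier A" by (rule gen_closed[OF q(1)])
    show "gen i j \<oplus>\<^bsub>A\<^esub> gen j i = \<zero>\<^bsub>A\<^esub>"
      using proj_zero[OF fk_relsI(1)[OF q(1)]] unfolding add[OF q[THEN gen_single]] gen_eq .
    show "gen i j \<otimes>\<^bsub>A\<^esub> gen i j = \<zero>\<^bsub>A\<^esub>"
      using proj_zero[OF fk_relsI(2)[OF q(1)]] unfolding proj_gen_mult[OF q(1) q(1)] .
  next
    fix i j l m assume *: "i \<in> {1..N}" "j \<in> {1..N}" "l \<in> {1..N}" "m \<in> {1..N}" "distinct [i, j, l, m]"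
    then have s: "{i, j, l, m} \<subseteq> {1..N}" by blast
    have "i \<noteq> j" "l \<noteq> m" using *(5) by auto
    note q = p[OF *(1,2) this(1)] p[OF *(3,4) this(2)]
    have "gen i j \<otimes>\<^bsub>A\<^esub> gen l m \<ominus>\<^bsub>A\<^esub> gen l m \<otimes>\<^bsub>A\<^esub> gen i j = \<zero>\<^bsub>A\<^esub>"
      using proj_zero[OF fk_relsI(3)[OF s *(5)]]
      unfolding diff[OF c[OF q] c[OF q(2,1)]] proj_gen_mult[OF q] proj_gen_mult[OF q(2,1)] .
    from A_cancel[OF AA.m_closed[OF q[THEN gen_closed]] AA.m_closed[OF q(2,1)[THEN gen_closed]] this]
    show "gen i j \<otimes>\<^bsub>A\<^esub> gen l m = gen l m \<otimes>\<^bsub>A\<^esub> gen i j" .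
  next
    fix i j l assume *: "i \<in> {1..N}" "j \<in> {1..N}" "l \<in> {1..N}" "distinct [i, j, l]"
    then have s: "{i, j, l} \<subseteq> {1..N}" by blast
    have "i \<noteq> j" "j \<noteq> l" "l \<noteq> i" using *(4) by auto
    note q = p[OF *(1,2) this(1)] p[OF *(2,3) this(2)] p[OF *(3,1) this(3)]
    note cs = c[OF q(1,2)] c[OF q(2,3)] c[OF q(3,1)]
    show "gen i j \<otimes>\<^bsub>A\<^esub> gen j l \<oplus>\<^bsub>A\<^esub> gen j l \<otimes>\<^bsub>A\<^esub> gen l i \<oplus>\<^bsub>A\<^esub> gen l i \<otimes>\<^bsub>A\<^esub> gen i j = \<zero>\<^bsub>A\<^esub>"
      using proj_zero[OF fk_relsI(4)[OF s *(4)]]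
      unfolding add[OF FF.a_closed[OF cs(1,2)] cs(3)] add[OF cs(1,2)]
        proj_gen_mult[OF q(1,2)] proj_gen_mult[OF q(2,3)] proj_gen_mult[OF q(3,1)] .
  qed
qed

definition mon where "mon w = I +>\<^bsub>F\<^esub> single K w"

lemma mon_Nil: "mon [] = \<one>\<^bsub>A\<^esub>"
  using alg_hom_one[OF proj_hom] by (simp add: mon_def F_one)

lemma mon_append: "v \<in> lists P \<Longrightarrow> w \<in> lists P \<Longrightarrow> mon (v @ w) = mon v \<otimes>\<^bsub>A\<^esub> mon w"
  unfolding mon_def by (simp add: F_mult[symmetric] alg_hom_mult[OF proj_hom] F_single)

lemma mon_Cons: "(i, j) \<in> P \<Longrightarrow> w \<in> lists P \<Longrightarrow> mon ((i, j) # w) = gen i j \<otimes>\<^bsub>A\<^esub> mon w"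
  using mon_append[of "[(i, j)]" w] by (simp add: gen_eq mon_def)

lemma mon_closed: "w \<in> lists P \<Longrightarrow> mon w \<in> carrier A"
  unfolding mon_def by (rule alg_hom_closed[OF proj_hom F_single])

lemma mon_span: "lin_span K A (mon ` lists P) = carrier A"
proof -
  interpret Q: quot_space K F I by (intro quot_space.intro module_F ideal_submodule algebra_F ideal_I)
  have sl: "same_lin F (free_mod K (lists P))"
    unfolding free_alg_def using same_lin_monoid_algebra[of W] by simp
  have "lin_span K F (single K ` lists P) = carrier F"
    using free_mod_span[of "lists P"] by (simp add: lin_span_cong[OF sl]) (simp add: free_alg_def)
  then have "lin_span K A ((\<lambda>x. I +>\<^bsub>F\<^esub> x) ` (single K ` lists P)) = carrier A"
    using F_single by (intro lin_span_image[OF module_F module_A alg_hom_lin[OF proj_hom]])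
      (auto simp: fk_simps fk_alg_eq Q.quot_carrier)
  then show ?thesis by (simp add: image_image mon_def)
qed

lemma mon_induct [consumes 1, case_names Nil Cons]:
  assumes "w \<in> lists P" "Q []" "\<And>i j w. (i, j) \<in> P \<Longrightarrow> w \<in> lists P \<Longrightarrow> Q w \<Longrightarrow> Q ((i, j) # w)"
  shows "Q w"
  using assms(1)
proof (induction w)
  case (Cons p w)
  then show ?case using assms(3)[of "fst p" "snd p" w] by simp
qed (rule assms(2))

lemma alg_hom_ext:
  assumes B: "module K B" and f: "f \<in> alg_hom K A B" and g: "g \<in> alg_hom K A B"
    and eq: "\<And>i j. (i, j) \<in> P \<Longrightarrow> f (gen i j) = g (gen i j)" and x: "x \<in> carrier A"
  shows "f x = g x"
proof (rule lin_span_eqI[OF module_A B alg_hom_lin[OF f] alg_hom_lin[OF g]])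
  show "mon ` lists P \<subseteq> carrier A" using mon_closed by auto
  show "x \<in> lin_span K A (mon ` lists P)" using x mon_span by simp
  fix s assume "s \<in> mon ` lists P"
  then obtain w where w: "w \<in> lists P" "s = mon w" by auto
  have "f (mon w) = g (mon w)" using w(1)
    by (induction w rule: mon_induct)
      (simp_all add: mon_Nil alg_hom_one[OF f] alg_hom_one[OF g] mon_Cons alg_hom_mult[OF f] alg_hom_mult[OF g] gen_closed mon_closed eq)
  with w show "f s = g s" by simp
qed

text \<open>Words are sent to products of the prescribed values. The linear extension is an algebra
  map on the free algebra that kills the four families of relations, so it descends.\<close>

lemma fk_univ_exists:
  assumes B: "k_algebra K B" and sat: "fk_sat N B \<phi>"
  obtains f where "f \<in> alg_hom K A B" "\<And>i j. (i, j) \<in> P \<Longrightarrow> f (gen i j) = \<phi> i j"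
proof -
  interpret B: k_algebra K B by fact
  interpret Br: ring B by (rule B.is_ring)
  let ?w = "\<lambda>w. foldr (\<lambda>p b. \<phi> (fst p) (snd p) \<otimes>\<^bsub>B\<^esub> b) w \<one>\<^bsub>B\<^esub>"
  have \<phi>c: "\<phi> i j \<in> carrier B" if "(i, j) \<in> P" for i j
    using sat that by (auto simp: fk_sat_def pair_iff)
  have wc: "?w w \<in> carrier B" if "w \<in> lists P" for w
    using that by (induction w) (auto simp: \<phi>c)
  have wm: "?w (v @ w) = ?w v \<otimes>\<^bsub>B\<^esub> ?w w" if "v \<in> lists P" "w \<in> lists P" for v w
    using that(1) by (induction v) (use wc that(2) \<phi>c in \<open>auto simp: Br.m_assoc\<close>)
  let ?f = "free_lift K B ?w"
  have f: "?f \<in> alg_hom K F B"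
    unfolding free_alg_def by (rule free_lift_alg_hom[OF monoid_W B]) (use wc wm in auto)
  have fs: "?f (single K [(i, j)]) = \<phi> i j" if "(i, j) \<in> P" for i j
    using free_lift_single[OF B.is_module, of ?w "[(i, j)]"] wc[of "[(i, j)]"] that \<phi>c by simp
  note fl = alg_hom_lin[OF f]
  have "?f r = \<zero>\<^bsub>B\<^esub>" if "r \<in> fk_rels K N" for r
    using that
  proof (cases rule: fk_rels_cases)
    case (1 i j)
    then have "(j, i) \<in> P" by (auto simp: pair_iff)
    with 1 sat show ?thesis by (simp add: lin_map_add[OF fl] gen_single fs) (simp add: fk_sat_def pair_iff)
  next
    case (2 i j)
    with sat show ?thesis by (simp add: alg_hom_mult[OF f] gen_single fs) (simp add: fk_sat_def pair_iff)
  next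
    case (3 i j l m)
    have "i \<noteq> j" "l \<noteq> m" using 3(2) by auto
    then have p: "(i, j) \<in> P" "(l, m) \<in> P" using 3(1) unfolding pair_iff by blast+
    have "\<phi> i j \<otimes>\<^bsub>B\<^esub> \<phi> l m = \<phi> l m \<otimes>\<^bsub>B\<^esub> \<phi> i j" using sat 3(1,2) unfolding fk_sat_def by blast
    with 3(3) p \<phi>c show ?thesis
      by (simp add: lin_map_diff[OF fl module_F B.is_module] alg_hom_mult[OF f] gen_single fs)
  next
    case (4 i j l)
    have "i \<noteq> j" "j \<noteq> l" "l \<noteq> i" using 4(2) by auto
    then have p: "(i, j) \<in> P" "(j, l) \<in> P" "(l, i) \<in> P" using 4(1) unfolding pair_iff by blast+
    have "\<phi> i j \<otimes>\<^bsub>B\<^esub> \<phi> j l \<oplus>\<^bsub>B\<^esub> \<phi> j l \<otimes>\<^bsub>B\<^esub> \<phi> l i \<oplus>\<^bsub>B\<^esub> \<phi> l i \<otimes>\<^bsub>B\<^esub> \<phi> i j = \<zero>\<^bsub>B\<^esub>"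
      using sat 4(1,2) unfolding fk_sat_def by blast
    with 4(3) p show ?thesis by (simp add: lin_map_add[OF fl] alg_hom_mult[OF f] gen_single fs)
  qed
  then obtain g where "g \<in> alg_hom K (quot F I) B" "\<And>x. x \<in> carrier F \<Longrightarrow> g (I +>\<^bsub>F\<^esub> x) = ?f x"
    using quot_alg_lift[OF algebra_F B f fk_rels_closed] by (metis (no_types, lifting))
  then have g: "g \<in> alg_hom K A B" "\<And>x. x \<in> carrier F \<Longrightarrow> g (I +>\<^bsub>F\<^esub> x) = ?f x"
    by (simp_all only: fk_alg_eq[symmetric] alg_hom_fk)
  have "g (gen i j) = \<phi> i j" if "(i, j) \<in> P" for i j
    unfolding gen_eq g(2)[OF gen_single[OF that]] by (rule fs[OF that])
  from that[OF g(1) this] show ?thesis .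
qed

lemma fk_univ:
  assumes B: "k_algebra K B" and sat: "fk_sat N B \<phi>"
  shows fk_hom: "fk_hom K N B \<phi> \<in> alg_hom K A B"
    and fk_hom_gen: "\<And>i j. (i, j) \<in> P \<Longrightarrow> fk_hom K N B \<phi> (gen i j) = \<phi> i j"
proof -
  note mB = k_algebra.is_module[OF B]
  let ?Q = "\<lambda>f. f \<in> extensional (carrier (fk_alg K N)) \<and> f \<in> alg_hom K (fk_alg K N) B \<and> (\<forall>(i, j)\<in>P. f (gen i j) = \<phi> i j)"
  obtain f where f: "f \<in> alg_hom K A B" "\<And>i j. (i, j) \<in> P \<Longrightarrow> f (gen i j) = \<phi> i j"
    using fk_univ_exists[OF assms] by blast
  \<comment> \<open>The definite description in \<open>fk_hom\<close> ranges over extensional maps,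
    so the witness is cut off outside the carrier; only then is it unique.\<close>
  let ?g = "restrict f (carrier A)"
  have gh: "?g \<in> alg_hom K A B"
    by (rule alg_homI[OF lin_map_cong[OF alg_hom_lin[OF f(1)] _ module_A]])
      (auto simp: alg_hom_one[OF f(1)] alg_hom_mult[OF f(1)])
  have g: "?Q ?g"
  proof (intro conjI)
    show "?g \<in> extensional (carrier (fk_alg K N))" by (simp add: fk_simps)
    show "?g \<in> alg_hom K (fk_alg K N) B" using gh by (simp only: alg_hom_fk)
  qed (use f(2) gen_closed in auto)
  have "h = ?g" if h: "?Q h" for h
  proof (rule extensionalityI)
    show "h \<in> extensional (carrier A)" using h by (simp add: fk_simps)
    show "?g \<in> extensional (carrier A)" by simp
    have hh: "h \<in> alg_hom K A B" using h by (simp only: alg_hom_fk)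
    fix x assume x: "x \<in> carrier A"
    have e: "h (gen i j) = ?g (gen i j)" if "(i, j) \<in> P" for i j
      using bspec[OF conjunct2[OF conjunct2[OF h]] that] bspec[OF conjunct2[OF conjunct2[OF g]] that] unfolding prod.case by simp
    show "h x = ?g x" by (rule alg_hom_ext[OF mB hh gh e x])
  qed
  then have "?Q (fk_hom K N B \<phi>)" unfolding fk_hom_def using g by (intro theI[of ?Q ?g]) blast+
  then show "fk_hom K N B \<phi> \<in> alg_hom K A B" "\<And>i j. (i, j) \<in> P \<Longrightarrow> fk_hom K N B \<phi> (gen i j) = \<phi> i j"
    unfolding alg_hom_fk by blast+
qed

lemma fk_hom_fk_alg: "fk_hom K N (fk_alg K N) \<phi> = fk_hom K N A \<phi>"
  unfolding fk_hom_def by (simp add: alg_hom_fk)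

subsection \<open>Action and grading\<close>

abbreviation "G \<equiv> sym_group N"

lemma G_carrier: "g \<in> carrier G \<longleftrightarrow> g permutes {1..N}" by (rule sym_group_carrier)

sublocale kgroup K "sym_group N"
proof (intro kgroup.intro kgroup_axioms.intro kvect_axioms)
  show "group (sym_group N)" by (rule sym_group_is_group)
  have "carrier (sym_group N) = {p. p permutes {1..N}}" by (auto simp: sym_group_carrier)
  then show "finite (carrier (sym_group N))" by (simp add: finite_permutations)
qed

text \<open>Inverses stay in the language of the abstract group, where the laws of the general
  development apply to them.\<close>

declare sym_group_inv_equality [simp del]

definition \<sigma> where "\<sigma> g = fk_hom K N A (\<lambda>i j. gen (g i) (g j))"

lemma perm_pair: "g \<in> carrier G \<Longrightarrow> (i, j) \<in> P \<Longrightarrow> (g i, g j) \<in> P"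
  using permutes_in_image[of g "{1..N}"] permutes_inj[of g "{1..N}"] by (auto simp: G_carrier pair_iff inj_eq)

text \<open>The relations are indexed by distinct points of {1..N}, and a permutation preserves
  distinctness, so relabelling permutes the relations within each family.\<close>

lemma perm_sat: "g \<in> carrier G \<Longrightarrow> fk_sat N B \<phi> \<Longrightarrow> fk_sat N B (\<lambda>i j. \<phi> (g i) (g j))"
proof -
  assume g: "g \<in> carrier G" and s: "fk_sat N B \<phi>"
  have m: "g i \<in> {1..N}" if "i \<in> {1..N}" for i using g permutes_in_image[of g "{1..N}" i] that by (simp add: G_carrier)
  have i: "g i = g j \<longleftrightarrow> i = j" for i j using g permutes_inj[of g "{1..N}"] by (simp add: G_carrier inj_eq)
  show ?thesis using s m unfolding fk_sat_def by (simp add: i)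
qed

lemma \<sigma>_hom: "g \<in> carrier G \<Longrightarrow> \<sigma> g \<in> alg_hom K A A"
  unfolding \<sigma>_def by (rule fk_hom[OF algebra_A perm_sat[OF _ gen_sat]])

lemma \<sigma>_gen: "g \<in> carrier G \<Longrightarrow> (i, j) \<in> P \<Longrightarrow> \<sigma> g (gen i j) = gen (g i) (g j)"
  unfolding \<sigma>_def by (rule fk_hom_gen[OF algebra_A perm_sat[OF _ gen_sat]])

lemma G_mult: "g \<otimes>\<^bsub>G\<^esub> h = g \<circ> h" by (simp add: sym_group_mult)

lemma G_one: "\<one>\<^bsub>G\<^esub> = id" by (rule sym_group_one)

lemma \<sigma>_mult: "g \<in> carrier G \<Longrightarrow> h \<in> carrier G \<Longrightarrow> b \<in> carrier A \<Longrightarrow> \<sigma> (g \<otimes>\<^bsub>G\<^esub> h) b = \<sigma> g (\<sigma> h b)"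
  by (rule alg_hom_ext[OF module_A \<sigma>_hom alg_hom_comp[OF \<sigma>_hom \<sigma>_hom]])
    (simp_all add: \<sigma>_gen perm_pair, simp add: G_mult)

lemma \<sigma>_one: "b \<in> carrier A \<Longrightarrow> \<sigma> \<one>\<^bsub>G\<^esub> b = b"
  by (rule alg_hom_ext[OF module_A \<sigma>_hom alg_hom_id]) (simp_all add: \<sigma>_gen, simp add: G_one)

text \<open>The degree is attached to the word. Its class need not determine it: the word with twice
  the same letter and the word with four times that letter are both zero, and so is a word of
  another degree with a repeated letter.\<close>

definition deg where "deg w = foldr (\<lambda>p g. transpose (fst p) (snd p) \<circ> g) w id"

lemma transpose_G: "(i, j) \<in> P \<Longrightarrow> transpose i j \<in> carrier G"
  by (auto simp: G_carrier pair_iff intro: permutes_swap_id)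

lemma deg_Nil: "deg [] = \<one>\<^bsub>G\<^esub>" by (simp add: deg_def G_one)

lemma deg_Cons: "deg ((i, j) # w) = transpose i j \<otimes>\<^bsub>G\<^esub> deg w" by (simp add: deg_def G_mult)

lemma deg_closed: "w \<in> lists P \<Longrightarrow> deg w \<in> carrier G"
  by (induction w rule: mon_induct) (simp_all add: deg_Nil deg_Cons transpose_G)

lemma deg_append: "v \<in> lists P \<Longrightarrow> w \<in> lists P \<Longrightarrow> deg (v @ w) = deg v \<otimes>\<^bsub>G\<^esub> deg w"
  by (induction v rule: mon_induct) (simp_all add: deg_Nil deg_Cons transpose_G deg_closed G.m_assoc)

definition Hm where "Hm d = {mon w |w. w \<in> lists P \<and> deg w = d}"

lemma gen_Hm: "(i, j) \<in> P \<Longrightarrow> gen i j \<in> Hm (transpose i j)"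
  unfolding Hm_def using transpose_G[of i j]
  by (intro CollectI exI[of _ "[(i, j)]"]) (simp add: deg_Cons deg_Nil mon_Cons mon_Nil gen_closed)

lemma transpose_conj: "g \<in> carrier G \<Longrightarrow> transpose (g i) (g j) \<otimes>\<^bsub>G\<^esub> g = g \<otimes>\<^bsub>G\<^esub> transpose i j"
  using permutes_inj[of g "{1..N}"] by (auto simp: G_carrier G_mult fun_eq_iff transpose_def inj_eq)

lemma \<sigma>_mon: "g \<in> carrier G \<Longrightarrow> w \<in> lists P \<Longrightarrow> \<sigma> g (mon w) \<in> Hm (g \<otimes>\<^bsub>G\<^esub> deg w \<otimes>\<^bsub>G\<^esub> inv\<^sub>G g)"
proof -
  assume g: "g \<in> carrier G" and w: "w \<in> lists P"
  from w have "\<exists>v\<in>lists P. \<sigma> g (mon w) = mon v \<and> deg v = g \<otimes>\<^bsub>G\<^esub> deg w \<otimes>\<^bsub>G\<^esub> inv\<^sub>G g"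
  proof (induction w rule: mon_induct)
    case Nil
    show ?case by (rule bexI[of _ "[]"]) (use g in \<open>simp_all add: mon_Nil deg_Nil alg_hom_one[OF \<sigma>_hom]\<close>)
  next
    case (Cons i j w)
    then obtain v where v: "v \<in> lists P" "\<sigma> g (mon w) = mon v" "deg v = g \<otimes>\<^bsub>G\<^esub> deg w \<otimes>\<^bsub>G\<^esub> inv\<^sub>G g" by blast
    have "transpose (g i) (g j) \<otimes>\<^bsub>G\<^esub> (g \<otimes>\<^bsub>G\<^esub> deg w \<otimes>\<^bsub>G\<^esub> inv\<^sub>G g) = (transpose (g i) (g j) \<otimes>\<^bsub>G\<^esub> g) \<otimes>\<^bsub>G\<^esub> deg w \<otimes>\<^bsub>G\<^esub> inv\<^sub>G g"
      using g Cons(1,2) transpose_G[OF perm_pair[OF g Cons(1)]] by (simp add: G.m_assoc deg_closed)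
    also have "\<dots> = g \<otimes>\<^bsub>G\<^esub> (transpose i j \<otimes>\<^bsub>G\<^esub> deg w) \<otimes>\<^bsub>G\<^esub> inv\<^sub>G g"
      unfolding transpose_conj[OF g] using g Cons(1,2) transpose_G by (simp add: G.m_assoc deg_closed)
    finally show ?case
      using Cons(1,2) v g perm_pair[OF g Cons(1)]
      by (intro bexI[of _ "(g i, g j) # v"]) (simp_all add: mon_Cons deg_Cons alg_hom_mult[OF \<sigma>_hom] gen_closed mon_closed \<sigma>_gen)
  qed
  then show ?thesis by (auto simp: Hm_def)
qed

abbreviation "co \<equiv> fk_coact K N"

lemma tensor_fk:
  "tensor K V (fk_alg K N) = tensor K V A" "tensor K (fk_alg K N) V = tensor K A V"
  "pt K V (fk_alg K N) = pt K V A" "pt K (fk_alg K N) V = pt K A V" "tlift K (fk_alg K N) = tlift K A"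
  by (rule tensor_cong pt_cong tlift_cong same_lin_fk same_lin_refl)+

lemma tensor_alg_fk: "tensor_alg K B (fk_alg K N) = tensor_alg K B A"
  by (simp add: tensor_alg_def tensor_fk fk_simps)

lemma co_eq: "co = fk_hom K N (tensor_alg K KG A) (\<lambda>i j. pt K KG A (\<delta> (transpose i j)) (gen i j))"
  by (simp add: fk_coact_def Let_def tensor_alg_fk tensor_fk)

lemma tensor_KA_zero: "x \<in> carrier KG \<Longrightarrow> pt K KG A x \<zero>\<^bsub>A\<^esub> = \<zero>\<^bsub>tensor K KG A\<^esub>"
  by (rule pt_zero_right[OF module_KG module_A])

lemma co_sat: "fk_sat N (tensor_alg K KG A) (\<lambda>i j. pt K KG A (\<delta> (transpose i j)) (gen i j))"
proof -
  note m = tensor_alg_mult_pt[OF algebra_KG algebra_A]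
  have t: "transpose i j \<in> carrier G" "gen i j \<in> carrier A" "(i, j) \<in> P" if "i \<in> {1..N}" "j \<in> {1..N}" "i \<noteq> j" for i j
    using that transpose_G gen_closed by (simp_all add: pair_iff)
  show ?thesis unfolding fk_sat_def
  proof (intro conjI ballI impI)
    fix i j assume ij: "i \<in> {1..N}" "j \<in> {1..N}" "i \<noteq> j"
    have s: "gen i j \<oplus>\<^bsub>A\<^esub> gen j i = \<zero>\<^bsub>A\<^esub>" "gen i j \<otimes>\<^bsub>A\<^esub> gen i j = \<zero>\<^bsub>A\<^esub>" using gen_sat ij by (auto simp: fk_sat_def)
    show "pt K KG A (\<delta> (transpose i j)) (gen i j) \<in> carrier (tensor_alg K KG A)"
      using t[OF ij] by (simp add: pt_closed[OF module_KG module_A])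
    show "pt K KG A (\<delta> (transpose i j)) (gen i j) \<oplus>\<^bsub>tensor_alg K KG A\<^esub> pt K KG A (\<delta> (transpose j i)) (gen j i) = \<zero>\<^bsub>tensor_alg K KG A\<^esub>"
      using t[OF ij] t[of j i] ij by (simp add: transpose_commute[of j i] pt_add_right[OF module_KG module_A, symmetric] s tensor_KA_zero)
    show "pt K KG A (\<delta> (transpose i j)) (gen i j) \<otimes>\<^bsub>tensor_alg K KG A\<^esub> pt K KG A (\<delta> (transpose i j)) (gen i j) = \<zero>\<^bsub>tensor_alg K KG A\<^esub>"
      using t[OF ij] by (simp add: m s KG_mult tensor_KA_zero)
  next
    fix i j l n assume *: "i \<in> {1..N}" "j \<in> {1..N}" "l \<in> {1..N}" "n \<in> {1..N}" "distinct [i, j, l, n]"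
    have s: "gen i j \<otimes>\<^bsub>A\<^esub> gen l n = gen l n \<otimes>\<^bsub>A\<^esub> gen i j" using gen_sat * unfolding fk_sat_def by blast
    \<comment> \<open>Disjoint transpositions commute, so the degree is the same on both sides of
      the commutation relation.\<close>
    have e: "transpose i j \<otimes>\<^bsub>G\<^esub> transpose l n = transpose l n \<otimes>\<^bsub>G\<^esub> transpose i j"
      unfolding G_mult fun_eq_iff o_apply
    proof
      fix x
      show "transpose i j (transpose l n x) = transpose l n (transpose i j x)"
        using *(5) by (cases "x = i"; cases "x = j"; cases "x = l"; cases "x = n") (simp_all add: transpose_def)
    qed
    show "pt K KG A (\<delta> (transpose i j)) (gen i j) \<otimes>\<^bsub>tensor_alg K KG A\<^esub> pt K KG A (\<delta> (transpose l n)) (gen l n) =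
        pt K KG A (\<delta> (transpose l n)) (gen l n) \<otimes>\<^bsub>tensor_alg K KG A\<^esub> pt K KG A (\<delta> (transpose i j)) (gen i j)"
      using *(5) t(1,2)[OF *(1,2)] t(1,2)[OF *(3,4)] by (simp add: m KG_mult) (simp only: s e)
  next
    fix i j l assume *: "i \<in> {1..N}" "j \<in> {1..N}" "l \<in> {1..N}" "distinct [i, j, l]"
    have s: "gen i j \<otimes>\<^bsub>A\<^esub> gen j l \<oplus>\<^bsub>A\<^esub> gen j l \<otimes>\<^bsub>A\<^esub> gen l i \<oplus>\<^bsub>A\<^esub> gen l i \<otimes>\<^bsub>A\<^esub> gen i j = \<zero>\<^bsub>A\<^esub>"
      using gen_sat * unfolding fk_sat_def by blast
    \<comment> \<open>The three products of transpositions in the cyclic relation are one and the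
      same 3-cycle. Its delta function factors out, leaving the relation in the second leg.\<close>
    have e: "transpose j l \<otimes>\<^bsub>G\<^esub> transpose l i = transpose i j \<otimes>\<^bsub>G\<^esub> transpose j l"
      "transpose l i \<otimes>\<^bsub>G\<^esub> transpose i j = transpose i j \<otimes>\<^bsub>G\<^esub> transpose j l"
      using *(4) by (auto simp: G_mult fun_eq_iff transpose_def)
    show "pt K KG A (\<delta> (transpose i j)) (gen i j) \<otimes>\<^bsub>tensor_alg K KG A\<^esub> pt K KG A (\<delta> (transpose j l)) (gen j l) \<oplus>\<^bsub>tensor_alg K KG A\<^esub>
        pt K KG A (\<delta> (transpose j l)) (gen j l) \<otimes>\<^bsub>tensor_alg K KG A\<^esub> pt K KG A (\<delta> (transpose l i)) (gen l i) \<oplus>\<^bsub>tensor_alg K KG A\<^esub>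
        pt K KG A (\<delta> (transpose l i)) (gen l i) \<otimes>\<^bsub>tensor_alg K KG A\<^esub> pt K KG A (\<delta> (transpose i j)) (gen i j) = \<zero>\<^bsub>tensor_alg K KG A\<^esub>"
      using t[OF *(1,2)] t[OF *(2,3)] t[OF *(3,1)] *(4) not_sym
      by (simp add: m e KG_mult pt_add_right[OF module_KG module_A, symmetric] s tensor_KA_zero)
  qed
qed

lemma co_hom: "co \<in> alg_hom K A (tensor_alg K KG A)"
  unfolding co_eq by (rule fk_hom[OF k_algebra_tensor_alg[OF algebra_KG algebra_A] co_sat])

lemma co_mon: "w \<in> lists P \<Longrightarrow> co (mon w) = pt K KG A (\<delta> (deg w)) (mon w)"
proof (induction w rule: mon_induct)
  case Nil
  then show ?case using alg_hom_one[OF co_hom] by (simp add: mon_Nil deg_Nil KG_one)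
next
  case (Cons i j w)
  have "co (gen i j) = pt K KG A (\<delta> (transpose i j)) (gen i j)"
    unfolding co_eq by (rule fk_hom_gen[OF k_algebra_tensor_alg[OF algebra_KG algebra_A] co_sat Cons(1)])
  then show ?case using Cons
    by (simp add: mon_Cons deg_Cons alg_hom_mult[OF co_hom] gen_closed mon_closed tensor_alg_mult_pt[OF algebra_KG algebra_A]
        transpose_G deg_closed KG_mult)
qed

lemma fk_crossed_algebra: "crossed_algebra K (sym_group N) A \<sigma> Hm (fk_act K N) co"
proof (intro crossed_algebra.intro crossed_algebra_axioms.intro kgroup_axioms)
  show "k_algebra K A" by (rule algebra_A)
  show "\<sigma> g \<in> alg_hom K A A" if "g \<in> carrier G" for g by (rule \<sigma>_hom[OF that])
  show "\<sigma> (g \<otimes>\<^bsub>G\<^esub> h) b = \<sigma> g (\<sigma> h b)" if "g \<in> carrier G" "h \<in> carrier G" "b \<in> carrier A" for g h b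
    by (rule \<sigma>_mult[OF that])
  show "\<sigma> \<one>\<^bsub>G\<^esub> b = b" if "b \<in> carrier A" for b by (rule \<sigma>_one[OF that])
  show "Hm d \<subseteq> carrier A" for d unfolding Hm_def using mon_closed by blast
  have "(\<Union>d\<in>carrier G. Hm d) = mon ` lists P" unfolding Hm_def using deg_closed by blast
  then show "lin_span K A (\<Union>d\<in>carrier G. Hm d) = carrier A" using mon_span by simp
  show "\<one>\<^bsub>A\<^esub> \<in> Hm \<one>\<^bsub>G\<^esub>" unfolding Hm_def by (intro CollectI exI[of _ "[]"]) (simp add: mon_Nil deg_Nil)
  show "b \<otimes>\<^bsub>A\<^esub> b' \<in> Hm (d \<otimes>\<^bsub>G\<^esub> d')" if bb: "b \<in> Hm d" "b' \<in> Hm d'" for b b' d d'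
  proof -
    from bb obtain v w where *: "v \<in> lists P" "w \<in> lists P" "deg v = d" "deg w = d'" "b = mon v" "b' = mon w" by (auto simp: Hm_def)
    then show ?thesis unfolding Hm_def by (intro CollectI exI[of _ "v @ w"]) (simp add: mon_append deg_append)
  qed
  show "\<sigma> g b \<in> Hm (g \<otimes>\<^bsub>G\<^esub> d \<otimes>\<^bsub>G\<^esub> inv\<^sub>G g)" if "g \<in> carrier G" "b \<in> Hm d" for g b d
    using that \<sigma>_mon by (auto simp: Hm_def)
  have "finsum (fk_alg K N) = (finsum A :: ((nat \<Rightarrow> nat) \<Rightarrow> _) \<Rightarrow> _)" by (rule finsum_record_cong) (simp_all add: fk_simps)
  then show "fk_act K N = (\<lambda>h v. \<Oplus>\<^bsub>A\<^esub>g\<in>carrier G. h g \<odot>\<^bsub>A\<^esub> \<sigma> g v)"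
    by (intro ext) (simp only: fk_act_def \<sigma>_def fk_hom_fk_alg fk_simps)
  show "co \<in> alg_hom K A (tensor_alg K KG A)" by (rule co_hom)
  show "co b = pt K KG A (\<delta> d) b" if "b \<in> Hm d" for b d using that co_mon unfolding Hm_def by blast
qed

end

subsection \<open>Primitively generated braided Hopf algebras\<close>

text \<open>X consists of generators paired with their degrees, and it is stable under the group.
  The rule \<open>Hm_induct\<close> is induction on words: homogeneous elements arise from 1 by left
  multiplication with generators. The map required in \<open>antihom\<close> will be the antipode;
  its existence is a matter of relations, so it is supplied by the concrete algebra.\<close>

locale primitively_generated = crossed_algebra K G E \<sigma> Hm act co
  for K :: "('k, 'm) ring_scheme" and G :: "('g, 'n) monoid_scheme" and E :: "('k, 'e) hopf"
    and \<sigma> Hm act co +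
  fixes X :: "('g \<times> 'e) set"
  assumes X_deg: "(t, x) \<in> X \<Longrightarrow> t \<in> carrier G"
    and X_Hm: "(t, x) \<in> X \<Longrightarrow> x \<in> Hm t"
    and X_\<sigma>: "g \<in> carrier G \<Longrightarrow> (t, x) \<in> X \<Longrightarrow> (g \<cdot> t \<cdot> inv\<^sub>G g, \<sigma> g x) \<in> X"
    and Hm_induct [consumes 1, case_names one mult]: "\<lbrakk>b \<in> Hm d; Q \<one>\<^sub>G \<one>\<^sub>E;
      \<And>t x e c. \<lbrakk>(t, x) \<in> X; e \<in> carrier G; c \<in> Hm e; Q e c\<rbrakk> \<Longrightarrow> Q (t \<cdot> e) (x \<star> c)\<rbrakk> \<Longrightarrow> Q d b"
    and comult_hom: "comult E \<in> alg_hom K E (braided_square K E (left_braiding K E act co))"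
    and comult_X: "(t, x) \<in> X \<Longrightarrow> comult E x = pE x \<one>\<^sub>E \<oplus>\<^bsub>EE\<^esub> pE \<one>\<^sub>E x"
    and counit_hom: "counit E \<in> alg_hom K E (ground K)"
    and counit_X: "(t, x) \<in> X \<Longrightarrow> counit E x = \<zero>\<^bsub>K\<^esub>"
    and antihom: "\<exists>S \<in> alg_hom K E braided_op. \<forall>(t, x)\<in>X. S x = \<ominus>\<^bsub>E\<^esub> x"
begin

abbreviation "TT \<equiv> tensor K E EE"

lemma X_closed: "(t, x) \<in> X \<Longrightarrow> x \<in> carrier E"
  using Hm_closed[OF X_deg X_Hm] .

lemmas module_TT = module_tensor[OF module_E module_EE]

lemma comult_lin: "comult E \<in> lin_map K E EE"
  using alg_hom_lin[OF comult_hom] by (simp add: lin_map_cong_record[OF same_lin_refl same_lin_tensor_alg(2)])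

lemma counit_lin: "counit E \<in> lin_map K E (ground K)"
  by (rule alg_hom_lin[OF counit_hom])

lemmas comult_closed = lin_map_closed[OF comult_lin]

lemma counit_closed: "b \<in> carrier E \<Longrightarrow> counit E b \<in> carrier K"
  using lin_map_closed[OF counit_lin] by simp

lemma pE_closed: "\<And>x y. x \<in> carrier E \<Longrightarrow> y \<in> carrier E \<Longrightarrow> pE x y \<in> carrier EE"
  by (rule pt_closed[OF module_E module_E])

definition Lop where
  "Lop t x = tlift K EE (\<lambda>a b. pE (x \<star> a) b \<oplus>\<^bsub>EE\<^esub> pE (\<sigma> t a) (x \<star> b))"

lemmas P_lins = CA_lins lin_add[OF _ module_EE] lin_add[OF _ module_E] lin_add[OF _ module_TT]
  lin_comp[OF comult_lin] lin_comp[OF counit_lin] comult_closed counit_closed module_EE module_TT \<sigma>_lin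
  module_closures(2)[OF module_EE] module_closures(2)[OF module_TT] pE_closed pt_closed lin_scal

lemma Lop_bilin:
  "t \<in> carrier G \<Longrightarrow> x \<in> carrier E \<Longrightarrow>
    (\<lambda>a b. pE (x \<star> a) b \<oplus>\<^bsub>EE\<^esub> pE (\<sigma> t a) (x \<star> b)) \<in> bilin K E E EE"
  by (rule P_lins | assumption)+

lemma Lop_lin: "t \<in> carrier G \<Longrightarrow> x \<in> carrier E \<Longrightarrow> Lop t x \<in> lin_map K EE EE"
  unfolding Lop_def by (rule tlift_lin[OF module_E module_E module_EE Lop_bilin])

lemma Lop: "t \<in> carrier G \<Longrightarrow> x \<in> carrier E \<Longrightarrow> a \<in> carrier E \<Longrightarrow> b \<in> carrier E \<Longrightarrow>
    Lop t x (pE a b) = pE (x \<star> a) b \<oplus>\<^bsub>EE\<^esub> pE (\<sigma> t a) (x \<star> b)"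
  unfolding Lop_def by (rule tlift_pt[OF module_E module_E module_EE Lop_bilin])

lemma BS_sub: "carrier BS = carrier EE" "add BS = add EE"
  by simp_all

text \<open>In the braided square (x \<otimes> 1)(a \<otimes> b) = xa \<otimes> b and (1 \<otimes>
  x)(a \<otimes> b) = t.a \<otimes> xb, because x moves past a by its degree.\<close>

lemma comult_X_mult:
  assumes tx: "(t, x) \<in> X" and c: "c \<in> carrier E"
  shows "comult E (x \<star> c) = Lop t x (comult E c)"
proof -
  note t = X_deg[OF tx] and x = X_closed[OF tx]
  interpret BS: ring BS by (rule k_algebra.is_ring[OF BS_algebra])
  have "comult E x \<otimes>\<^bsub>BS\<^esub> s = Lop t x s" if "s \<in> carrier EE" for s
  proof (rule EE_eqI[OF that module_EE bilin_right[OF BS_bilin comult_closed[OF x]] Lop_lin[OF t x]])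
    fix a b d1 d2 assume ab: "d1 \<in> carrier G" "d2 \<in> carrier G" "a \<in> Hm d1" "b \<in> Hm d2" "a \<in> carrier E" "b \<in> carrier E"
    have "(pE x \<one>\<^sub>E \<oplus>\<^bsub>BS\<^esub> pE \<one>\<^sub>E x) \<otimes>\<^bsub>BS\<^esub> pE a b =
        pE x \<one>\<^sub>E \<otimes>\<^bsub>BS\<^esub> pE a b \<oplus>\<^bsub>BS\<^esub> pE \<one>\<^sub>E x \<otimes>\<^bsub>BS\<^esub> pE a b"
      by (rule BS.l_distr) (use x ab in \<open>simp_all add: BS_sub pE_closed\<close>)
    then show "comult E x \<otimes>\<^bsub>BS\<^esub> pE a b = Lop t x (pE a b)"
      using x ab t
      by (simp add: comult_X[OF tx] Lop BS_sub BS_mult[OF _ G.one_closed Hm_one] BS_mult[OF _ t X_Hm[OF tx]] \<sigma>_one \<sigma>_closed)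
  qed
  with c x show ?thesis by (simp add: alg_hom_mult[OF comult_hom] comult_closed)
qed

lemma comult_one: "comult E \<one>\<^sub>E = pE \<one>\<^sub>E \<one>\<^sub>E"
  using alg_hom_one[OF comult_hom] by simp

lemma counit_one: "counit E \<one>\<^sub>E = \<one>\<^bsub>K\<^esub>"
  using alg_hom_one[OF counit_hom] by simp

lemma counit_X_mult: "(t, x) \<in> X \<Longrightarrow> c \<in> carrier E \<Longrightarrow> counit E (x \<star> c) = \<zero>\<^bsub>K\<^esub>"
  using alg_hom_mult[OF counit_hom, of x c] by (simp add: X_closed counit_X counit_closed)

text \<open>Induction on words for linear identities: the unit and one left multiplication by a
  generator decide.\<close>

lemma lin_eq_Hm:
  assumes Z: "module K Z" and f: "(\<lambda>x. f x) \<in> lin_map K E Z" and g: "(\<lambda>x. g x) \<in> lin_map K E Z"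
    and one: "f \<one>\<^sub>E = g \<one>\<^sub>E"
    and mult: "\<And>t x c. (t, x) \<in> X \<Longrightarrow> c \<in> carrier E \<Longrightarrow> f c = g c \<Longrightarrow> f (x \<star> c) = g (x \<star> c)"
    and b: "b \<in> carrier E"
  shows "f b = g b"
proof (rule E_eqI[OF Z f g _ b])
  fix d b assume "d \<in> carrier G" "b \<in> Hm d"
  from this(2) show "f b = g b"
    by (induction rule: Hm_induct) (auto intro: one mult Hm_closed)
qed

lemma comult_\<sigma>:
  assumes g: "g \<in> carrier G" and b: "b \<in> carrier E"
  shows "comult E (\<sigma> g b) = sig2 g (comult E b)"
proof (rule lin_eq_Hm[OF module_EE _ _ _ _ b])
  show "(\<lambda>b. comult E (\<sigma> g b)) \<in> lin_map K E EE" "(\<lambda>b. sig2 g (comult E b)) \<in> lin_map K E EE"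
    by (rule lin_comp[OF comult_lin \<sigma>_lin[OF g]], rule lin_comp[OF sig2_lin[OF g] comult_lin])
  show "comult E (\<sigma> g \<one>\<^sub>E) = sig2 g (comult E \<one>\<^sub>E)"
    by (simp add: alg_hom_one[OF \<sigma>_hom[OF g]] comult_one sig2[OF g])
  fix t x c assume tx: "(t, x) \<in> X" and c: "c \<in> carrier E" and IH: "comult E (\<sigma> g c) = sig2 g (comult E c)"
  note t = X_deg[OF tx] and x = X_closed[OF tx] and tx' = X_\<sigma>[OF g tx]
  note t' = X_deg[OF tx'] and x' = X_closed[OF tx']
  have "Lop (g \<cdot> t \<cdot> inv\<^sub>G g) (\<sigma> g x) (sig2 g s) = sig2 g (Lop t x s)" if "s \<in> carrier EE" for s
  proof (rule EE_eqI[OF that module_EE lin_comp[OF Lop_lin[OF t' x'] sig2_lin[OF g]] lin_comp[OF sig2_lin[OF g] Lop_lin[OF t x]]])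
    fix a b assume ab: "a \<in> carrier E" "b \<in> carrier E"
    \<comment> \<open>The image g.x has degree g t g^-1, and (g t g^-1) g = g t; this is why the
      operators for x and g.x are intertwined by the diagonal action.\<close>
    have "\<sigma> (g \<cdot> t \<cdot> inv\<^sub>G g) (\<sigma> g a) = \<sigma> g (\<sigma> t a)"
      using g t ab by (simp add: \<sigma>_mult[symmetric] G.m_assoc)
    then show "Lop (g \<cdot> t \<cdot> inv\<^sub>G g) (\<sigma> g x) (sig2 g (pE a b)) = sig2 g (Lop t x (pE a b))"
      using g t x ab by (simp add: sig2 Lop[OF t'] Lop lin_map_add[OF sig2_lin] \<sigma>_closed pE_closed alg_hom_mult[OF \<sigma>_hom])
  qed
  then show "comult E (\<sigma> g (x \<star> c)) = sig2 g (comult E (x \<star> c))"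
    using g x c by (simp add: alg_hom_mult[OF \<sigma>_hom] comult_X_mult[OF tx'] comult_X_mult[OF tx] \<sigma>_closed IH comult_closed)
qed

text \<open>Both terms of \<open>Lop t x\<close> raise the total degree from e to te: the first by
  putting x in front, the second because (t d1 t^-1)(t d2) = t d1 d2.\<close>

lemma comult_Hm:
  assumes "b \<in> Hm d"
  shows "comult E b \<in> lin_span K EE (Dspan d)"
  using assms
proof (induction rule: Hm_induct)
  case one
  show ?case unfolding comult_one by (rule lin_span_base) (use Hm_one in force)
next
  case (mult t x e c)
  note t = X_deg[OF mult(1)] and x = X_closed[OF mult(1)] and xt = X_Hm[OF mult(1)]
  note U = submodule_lin_span[OF module_EE Dspan_sub[of "t \<cdot> e"]]
  have "Lop t x (comult E c) \<in> lin_span K EE (Dspan (t \<cdot> e))"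
  proof (rule lin_map_lin_span[OF module_EE module_EE Lop_lin[OF t x] Dspan_sub U _ mult(4)])
    fix s assume "s \<in> Dspan e"
    then obtain a b d1 d2 where s: "s = pE a b" "d1 \<in> carrier G" "d2 \<in> carrier G" "a \<in> Hm d1" "b \<in> Hm d2"
      "d1 \<cdot> d2 = e" by blast
    note ab = Hm_closed[OF s(2,4)] Hm_closed[OF s(3,5)]
    have "pE (x \<star> a) b \<in> Dspan (t \<cdot> e)"
      using Hm_mult[OF t s(2) xt s(4)] s(3,5) G.m_assoc[OF t s(2,3)] s(6) G.m_closed[OF t s(2)] by blast
    moreover have "pE (\<sigma> t a) (x \<star> b) \<in> Dspan (t \<cdot> e)"
    proof -
      have "inv\<^sub>G t \<cdot> (t \<cdot> d2) = d2" using t s(3) by (simp add: G.m_assoc[symmetric])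
      then have "t \<cdot> d1 \<cdot> inv\<^sub>G t \<cdot> (t \<cdot> d2) = t \<cdot> e"
        using t s(2,3) s(6)[symmetric] by (simp add: G.m_assoc)
      then show ?thesis
        using Hm_\<sigma>[OF t s(2,4)] Hm_mult[OF t s(3) xt s(5)] G.m_closed[OF t s(3)] G.m_closed[OF G.m_closed[OF t s(2)] G.inv_closed[OF t]]
        by blast
    qed
    ultimately show "Lop t x s \<in> lin_span K EE (Dspan (t \<cdot> e))"
      unfolding s(1) Lop[OF t x ab] by (intro submoduleD(3)[OF module_EE U] lin_span_base)
  qed
  then show ?case by (simp add: comult_X_mult[OF mult(1)] Hm_closed[OF mult(2,3)])
qed

lemma counit_\<sigma>:
  assumes g: "g \<in> carrier G" and b: "b \<in> carrier E"
  shows "counit E (\<sigma> g b) = counit E b"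
  by (rule lin_eq_Hm[OF module_ground lin_comp[OF counit_lin \<sigma>_lin[OF g]] counit_lin _ _ b])
    (use g in \<open>simp_all add: alg_hom_one[OF \<sigma>_hom] alg_hom_mult[OF \<sigma>_hom] X_closed counit_X_mult[OF X_\<sigma>[OF g]] counit_X_mult \<sigma>_closed\<close>)

lemma a_inv_braided_op: "\<ominus>\<^bsub>braided_op\<^esub> x = \<ominus>\<^bsub>E\<^esub> x"
  by (simp add: a_inv_def m_inv_def braided_op_simps)

abbreviation "rot y \<equiv> tlift K TT (\<lambda>x1 x2. pt K E EE x1 (pE x2 y))"

lemma rot_bilin: "y \<in> carrier E \<Longrightarrow> (\<lambda>x1 x2. pt K E EE x1 (pE x2 y)) \<in> bilin K E E TT"
  by (rule P_lins | assumption)+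

lemma coassoc_bilin:
  "(\<lambda>x y. pt K E EE x (comult E y)) \<in> bilin K E E TT"
  "(\<lambda>x y. rot y (comult E x)) \<in> bilin K E E TT"
  by (rule P_lins | assumption)+

lemma coassoc:
  assumes c: "c \<in> carrier E"
  shows "tlift K TT (\<lambda>x y. pt K E EE x (comult E y)) (comult E c) = tlift K TT (\<lambda>x y. rot y (comult E x)) (comult E c)"
    (is "?L (comult E c) = ?R (comult E c)")
proof (rule lin_eq_Hm[OF module_TT _ _ _ _ c])
  note m = module_E
  note L = tlift_pt[OF m m module_TT coassoc_bilin(1)] and R = tlift_pt[OF m m module_TT coassoc_bilin(2)]
    and rot = tlift_pt[OF m m module_TT rot_bilin]
  note Ll = tlift_lin[OF m m module_TT coassoc_bilin(1)] and Rl = tlift_lin[OF m m module_TT coassoc_bilin(2)]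
    and rotl = tlift_lin[OF m m module_TT rot_bilin]
  show "(\<lambda>c. ?L (comult E c)) \<in> lin_map K E TT" "(\<lambda>c. ?R (comult E c)) \<in> lin_map K E TT"
    by (rule lin_comp[OF Ll comult_lin], rule lin_comp[OF Rl comult_lin])
  show "?L (comult E \<one>\<^sub>E) = ?R (comult E \<one>\<^sub>E)"
    by (simp add: comult_one L R rot)
  fix t x c assume tx: "(t, x) \<in> X" and c: "c \<in> carrier E" and IH: "?L (comult E c) = ?R (comult E c)"
  note t = X_deg[OF tx] and x = X_closed[OF tx]
  \<comment> \<open>The threefold version of \<open>Lop t x\<close>: x enters the first leg, or the
    first leg is moved by t and x acts on the other two through \<open>Lop\<close>. Both iterated
    coproducts turn \<open>Lop t x\<close> into this operator, so the induction closes.\<close>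
  let ?M = "tlift K TT (\<lambda>a s. pt K E EE (x \<star> a) s \<oplus>\<^bsub>TT\<^esub> pt K E EE (\<sigma> t a) (Lop t x s))"
  have Mb: "(\<lambda>a s. pt K E EE (x \<star> a) s \<oplus>\<^bsub>TT\<^esub> pt K E EE (\<sigma> t a) (Lop t x s)) \<in> bilin K E EE TT"
    using t x by - (rule P_lins lin_comp[OF Lop_lin] lin_map_closed[OF Lop_lin] | assumption)+
  note M = tlift_pt[OF m module_EE module_TT Mb] and Ml = tlift_lin[OF m module_EE module_TT Mb]
  interpret TT: module K TT by (rule module_TT)
  have p: "pt K E EE a s \<in> carrier TT" if "a \<in> carrier E" "s \<in> carrier EE" for a s
    by (rule pt_closed[OF m module_EE that])
  have 1: "?L (Lop t x s) = ?M (?L s)" if "s \<in> carrier EE" for s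
    by (rule EE_eqI[OF that module_TT lin_comp[OF Ll Lop_lin[OF t x]] lin_comp[OF Ml Ll]])
      (use t x in \<open>simp add: Lop L M lin_map_add[OF Ll] pE_closed comult_X_mult[OF tx] \<sigma>_closed comult_closed\<close>)
  \<comment> \<open>Written out on x1 \<otimes> x2 \<otimes> b, both sides have the three terms in
    which x is put into one leg and every leg to its left is moved by t. When x goes into b, both
    other legs move, whence \<open>sig2 t\<close>.\<close>
  have 2: "rot b (Lop t x s) \<oplus>\<^bsub>TT\<^esub> rot (x \<star> b) (sig2 t s) = ?M (rot b s)" if b: "b \<in> carrier E" and s: "s \<in> carrier EE" for s b
    by (rule EE_eqI[OF s module_TT lin_add[OF module_EE module_TT lin_comp[OF rotl[OF b] Lop_lin[OF t x]]
            lin_comp[OF rotl[OF E.m_closed[OF x b]] sig2_lin[OF t]]] lin_comp[OF Ml rotl[OF b]]])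
      (use t x b in \<open>simp add: Lop sig2 rot M lin_map_add[OF rotl] pE_closed \<sigma>_closed p TT.a_assoc
        pt_add_right[OF m module_EE] module_closures(2)[OF module_EE]\<close>)
  have 3: "?R (Lop t x s) = ?M (?R s)" if "s \<in> carrier EE" for s
    by (rule EE_eqI[OF that module_TT lin_comp[OF Rl Lop_lin[OF t x]] lin_comp[OF Ml Rl]])
      (use t x in \<open>simp add: Lop R lin_map_add[OF Rl] pE_closed comult_X_mult[OF tx] \<sigma>_closed comult_closed comult_\<sigma> 2\<close>)
  show "?L (comult E (x \<star> c)) = ?R (comult E (x \<star> c))"
    unfolding comult_X_mult[OF tx c] 1[OF comult_closed[OF c]] 3[OF comult_closed[OF c]] IH ..
qed

text \<open>Applying the counit to one leg of \<open>Lop t x\<close> kills the term with x in that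
  leg, and the counit ignores the action of t. What remains is left multiplication by x, so the laws
  pass from c to xc.\<close>

lemma counit_laws:
  assumes c: "c \<in> carrier E"
  shows "tlift K E (\<lambda>x y. counit E x \<odot>\<^sub>E y) (comult E c) = c"
    and "tlift K E (\<lambda>x y. counit E y \<odot>\<^sub>E x) (comult E c) = c"
proof -
  note m = module_E
  interpret Em: module K E by (rule m)
  let ?s = "\<lambda>x y. counit E x \<odot>\<^sub>E y" and ?t = "\<lambda>x y. counit E y \<odot>\<^sub>E x"
  have b1: "?s \<in> bilin K E E E" and b2: "?t \<in> bilin K E E E"
    by (rule P_lins counit_lin lin_smult[OF m m] | assumption)+
  note q1 = tlift_pt[OF m m m b1] and q2 = tlift_pt[OF m m m b2] and l1 = tlift_lin[OF m m m b1] and l2 = tlift_lin[OF m m m b2]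
  have cs: "counit E (\<sigma> g a) = counit E a" if "g \<in> carrier G" "a \<in> carrier E" for g a
    using counit_\<sigma>[OF that] .
  have 1: "tlift K E ?s (Lop t x s) = x \<star> tlift K E ?s s"
    "tlift K E ?t (Lop t x s) = x \<star> tlift K E ?t s"
    if tx: "(t, x) \<in> X" and s: "s \<in> carrier EE" for t x s
  proof -
    note t = X_deg[OF tx] and x = X_closed[OF tx]
    show "tlift K E ?s (Lop t x s) = x \<star> tlift K E ?s s"
      by (rule EE_eqI[OF s m lin_comp[OF l1 Lop_lin[OF t x]] lin_mult2[OF algebra_E x l1]])
        (use t x in \<open>simp add: Lop q1 lin_map_add[OF l1] pE_closed counit_X_mult[OF tx] \<sigma>_closed cs counit_closed
          k_algebra.smult_mult_right[OF algebra_E]\<close>)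
    show "tlift K E ?t (Lop t x s) = x \<star> tlift K E ?t s"
      by (rule EE_eqI[OF s m lin_comp[OF l2 Lop_lin[OF t x]] lin_mult2[OF algebra_E x l2]])
        (use t x in \<open>simp add: Lop q2 lin_map_add[OF l2] pE_closed counit_X_mult[OF tx] \<sigma>_closed counit_closed
          k_algebra.smult_mult_right[OF algebra_E]\<close>)
  qed
  show "tlift K E ?s (comult E c) = c"
    by (rule lin_eq_Hm[OF m lin_comp[OF l1 comult_lin] lin_id _ _ c])
      (simp_all add: comult_one q1 counit_one comult_X_mult 1 comult_closed)
  show "tlift K E ?t (comult E c) = c"
    by (rule lin_eq_Hm[OF m lin_comp[OF l2 comult_lin] lin_id _ _ c])
      (simp_all add: comult_one q2 counit_one comult_X_mult 1 comult_closed)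
qed

lemma antipode:
  "\<exists>S. is_antipode K E S \<and> (\<forall>g\<in>carrier G. \<forall>b\<in>carrier E. S (\<sigma> g b) = \<sigma> g (S b)) \<and>
      (\<forall>d\<in>carrier G. \<forall>b\<in>Hm d. S b \<in> lin_span K E (Hm d))"
proof -
  note m = module_E
  interpret Em: module K E by (rule m)
  interpret O: ring braided_op by (rule k_algebra.is_ring[OF braided_op_algebra])
  obtain S where S: "S \<in> alg_hom K E braided_op" and Sx: "\<And>t x. (t, x) \<in> X \<Longrightarrow> S x = \<ominus>\<^bsub>E\<^esub> x"
    using antihom by fast
  have Sl: "S \<in> lin_map K E E"
    using alg_hom_lin[OF S] by (simp add: lin_map_cong_record[OF same_lin_refl same_lin_braided_op])
  note Sc = lin_map_closed[OF Sl]
  have S1: "S \<one>\<^sub>E = \<one>\<^sub>E" using alg_hom_one[OF S] by (simp add: braided_op_simps)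
  \<comment> \<open>S x = -x, and a product in the braided opposite whose first factor has degree t
    places that factor last, after acting by t on the other one.\<close>
  have SX: "S (x \<star> c) = \<ominus>\<^bsub>E\<^esub> (\<sigma> t (S c) \<star> x)" if tx: "(t, x) \<in> X" and c: "c \<in> carrier E" for t x c
  proof -
    note t = X_deg[OF tx] and x = X_closed[OF tx] and b = k_algebra_mult_bilin[OF braided_op_algebra]
    have "S (x \<star> c) = \<ominus>\<^bsub>E\<^esub> x \<otimes>\<^bsub>braided_op\<^esub> S c"
      using alg_hom_mult[OF S x c] Sx[OF tx] by simp
    also have "\<dots> = \<ominus>\<^bsub>braided_op\<^esub> (x \<otimes>\<^bsub>braided_op\<^esub> S c)"
      using O.l_minus[of x "S c"] x Sc[OF c] by (simp add: braided_op_simps(1) a_inv_braided_op)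
    also have "\<dots> = \<ominus>\<^bsub>E\<^esub> (\<sigma> t (S c) \<star> x)"
      by (simp add: braided_op_mult[OF t X_Hm[OF tx] Sc[OF c]] a_inv_braided_op)
    finally show ?thesis .
  qed
  have S\<sigma>: "S (\<sigma> g b) = \<sigma> g (S b)" if g: "g \<in> carrier G" and b: "b \<in> carrier E" for g b
  proof (rule lin_eq_Hm[OF m lin_comp[OF Sl \<sigma>_lin[OF g]] lin_comp[OF \<sigma>_lin[OF g] Sl] _ _ b])
    show "S (\<sigma> g \<one>\<^sub>E) = \<sigma> g (S \<one>\<^sub>E)" using g by (simp add: alg_hom_one[OF \<sigma>_hom] S1)
    fix t x c assume tx: "(t, x) \<in> X" and c: "c \<in> carrier E" and IH: "S (\<sigma> g c) = \<sigma> g (S c)"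
    note t = X_deg[OF tx] and x = X_closed[OF tx]
    have "\<sigma> (g \<cdot> t \<cdot> inv\<^sub>G g) (\<sigma> g (S c)) = \<sigma> g (\<sigma> t (S c))"
      using g t Sc[OF c] by (simp add: \<sigma>_mult[symmetric] G.m_assoc)
    then show "S (\<sigma> g (x \<star> c)) = \<sigma> g (S (x \<star> c))"
      using g t x c by (simp add: alg_hom_mult[OF \<sigma>_hom] SX[OF tx] SX[OF X_\<sigma>[OF g tx]] \<sigma>_closed IH Sc lin_map_minus[OF \<sigma>_lin m m])
  qed
  have S_Hm: "S b \<in> lin_span K E (Hm d)" if "b \<in> Hm d" for d b
    using that
  proof (induction rule: Hm_induct)
    case one
    then show ?case unfolding S1 by (rule lin_span_base[OF Hm_one])
  next
    case (mult t x e c)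
    note t = X_deg[OF mult(1)] and x = X_closed[OF mult(1)]
    note te = G.m_closed[OF t mult(2)]
    note U = submodule_lin_span[OF m Hm_sub[OF te]]
    \<comment> \<open>The element t.s has degree t e t^-1, so its product with x has degree t e. The
      sign leaves the family \<open>Hm\<close> but not its span.\<close>
    have "\<ominus>\<^bsub>E\<^esub> (\<sigma> t (S c) \<star> x) \<in> lin_span K E (Hm (t \<cdot> e))"
    proof (rule lin_map_lin_span[OF m m _ Hm_sub[OF mult(2)] U _ mult(4)])
      show "(\<lambda>s. \<ominus>\<^bsub>E\<^esub> (\<sigma> t s \<star> x)) \<in> lin_map K E E"
        using lin_smult[OF m m _ lin_mult1[OF algebra_E x \<sigma>_lin[OF t]], of "\<ominus>\<^bsub>K\<^esub> \<one>\<^bsub>K\<^esub>"]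
        by (rule lin_map_cong) (simp_all add: module_minus_eq[OF m] m x \<sigma>_closed t)
      fix s assume s: "s \<in> Hm e"
      have "\<sigma> t s \<star> x \<in> Hm (t \<cdot> e \<cdot> inv\<^sub>G t \<cdot> t)"
        by (rule Hm_mult[OF _ t Hm_\<sigma>[OF t mult(2) s] X_Hm[OF mult(1)]]) (use t mult(2) in simp)
      moreover have "t \<cdot> e \<cdot> inv\<^sub>G t \<cdot> t = t \<cdot> e" using t mult(2) by (simp add: G.m_assoc)
      ultimately have "\<sigma> t s \<star> x \<in> Hm (t \<cdot> e)" by simp
      then show "\<ominus>\<^bsub>E\<^esub> (\<sigma> t s \<star> x) \<in> lin_span K E (Hm (t \<cdot> e))"
        by (intro Em.submoduleE(3)[OF U] lin_span_base)
    qed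
    then show ?case by (simp only: SX[OF mult(1) Hm_closed[OF mult(2,3)]])
  qed
  let ?s = "\<lambda>x y. S x \<star> y" and ?t = "\<lambda>x y. x \<star> S y"
  have b1: "?s \<in> bilin K E E E" and b2: "?t \<in> bilin K E E E"
    by (rule P_lins Sl Sc | assumption)+
  note q1 = tlift_pt[OF m m m b1] and q2 = tlift_pt[OF m m m b2] and l1 = tlift_lin[OF m m m b1] and l2 = tlift_lin[OF m m m b2]
  \<comment> \<open>The two terms are S(xa) b = -(t.S a) x b and S(t.a) x b = (t.S a) x b. They
    cancel on every tensor, in agreement with the vanishing counit of xc.\<close>
  have 1: "tlift K E ?s (Lop t x s) = \<zero>\<^bsub>E\<^esub>" if tx: "(t, x) \<in> X" and s: "s \<in> carrier EE" for t x s
  proof -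
    note t = X_deg[OF tx] and x = X_closed[OF tx]
    show ?thesis
      by (rule EE_eqI[OF s m lin_comp[OF l1 Lop_lin[OF t x]] lin_zero[OF m]])
        (use t x in \<open>simp add: Lop q1 lin_map_add[OF l1] pE_closed SX[OF tx] S\<sigma> \<sigma>_closed Sc E.l_minus E.m_assoc E.l_neg\<close>)
  qed
  \<comment> \<open>Now xa S b and (t.a) S(xb) combine to x m - (t.m) x with m = a S b. This does
    not vanish in general; for the coproduct of c the induction hypothesis makes m a multiple of 1,
    which t fixes and x commutes with.\<close>
  have 2: "tlift K E ?t (Lop t x s) =
      x \<star> tlift K E ?t s \<oplus>\<^bsub>E\<^esub> (\<sigma> t (tlift K E ?t s)) \<star> (\<ominus>\<^bsub>E\<^esub> x)"
    if tx: "(t, x) \<in> X" and s: "s \<in> carrier EE" for t x s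
  proof -
    note t = X_deg[OF tx] and x = X_closed[OF tx]
    show ?thesis
      by (rule EE_eqI[OF s m lin_comp[OF l2 Lop_lin[OF t x]] lin_add[OF module_EE m lin_mult2[OF algebra_E x l2]
              lin_mult1[OF algebra_E E.a_inv_closed[OF x] lin_comp[OF \<sigma>_lin[OF t] l2]]]])
        (use t x in \<open>simp add: Lop q2 lin_map_add[OF l2] pE_closed SX[OF tx] alg_hom_mult[OF \<sigma>_hom] \<sigma>_closed Sc E.r_minus E.m_assoc\<close>)
  qed
  have co: "(\<lambda>a. counit E a \<odot>\<^sub>E \<one>\<^sub>E) \<in> lin_map K E E"
    by (rule lin_scal[OF m m counit_lin E.one_closed])
  have "is_antipode K E S"
    unfolding is_antipode_def
  proof (intro conjI ballI Sl)
    fix a assume a: "a \<in> carrier E"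
    show "tlift K E ?s (comult E a) = counit E a \<odot>\<^sub>E \<one>\<^sub>E"
      by (rule lin_eq_Hm[OF m lin_comp[OF l1 comult_lin] co _ _ a])
        (simp_all add: comult_one q1 S1 counit_one comult_X_mult 1 comult_closed counit_X_mult)
    show "tlift K E ?t (comult E a) = counit E a \<odot>\<^sub>E \<one>\<^sub>E"
    proof (rule lin_eq_Hm[OF m lin_comp[OF l2 comult_lin] co _ _ a])
      fix t x c assume tx: "(t, x) \<in> X" and c: "c \<in> carrier E"
        and IH: "tlift K E ?t (comult E c) = counit E c \<odot>\<^sub>E \<one>\<^sub>E"
      note t = X_deg[OF tx] and x = X_closed[OF tx]
      show "tlift K E ?t (comult E (x \<star> c)) = counit E (x \<star> c) \<odot>\<^sub>E \<one>\<^sub>E"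
        using t x c
        by (simp add: comult_X_mult[OF tx] 2[OF tx] comult_closed IH counit_X_mult[OF tx] counit_closed lin_map_smult[OF \<sigma>_lin]
            alg_hom_one[OF \<sigma>_hom] k_algebra.smult_mult_left[OF algebra_E] k_algebra.smult_mult_right[OF algebra_E]
            Em.smult_r_minus E.r_neg)
    qed (simp add: comult_one q2 S1 counit_one)
  qed
  with S\<sigma> S_Hm show ?thesis by blast
qed

lemma braided_hopf: "braided_hopf K G E \<sigma> Hm act co"
proof (intro braided_hopf.intro braided_hopf_axioms.intro crossed_algebra_axioms)
  show "k_coalgebra K E"
    by (rule k_coalgebra.intro[OF field_K module_E comult_lin counit_lin coassoc counit_laws])
  show "comult E (\<sigma> g b) = tlift K EE (\<lambda>x y. pE (\<sigma> g x) (\<sigma> g y)) (comult E b)"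
    if "g \<in> carrier G" "b \<in> carrier E" for g b
    using comult_\<sigma>[OF that] by (simp add: sig2_def)
  show "counit E b = \<zero>\<^bsub>K\<^esub>" if "b \<in> Hm d" "d \<noteq> \<one>\<^sub>G" for d b
    using that by (induction rule: Hm_induct) (simp_all add: counit_X_mult Hm_closed)
qed (rule counit_\<sigma> comult_Hm comult_hom counit_hom antipode; assumption?)+

end

section \<open>The Fomin--Kirillov algebra as a primitively generated braided Hopf algebra\<close>

context fomin_kirillov
begin

sublocale CA: crossed_algebra K "sym_group N" A \<sigma> Hm "fk_act K N" co
  by (rule fk_crossed_algebra)

abbreviation "AT \<equiv> tensor K A A"

lemma gen_facts:
  assumes "i \<in> {1..N}" "j \<in> {1..N}" "i \<noteq> j"
  shows "(i, j) \<in> P" "(j, i) \<in> P" "gen i j \<in> carrier A" "gen j i \<in> carrier A" "transpose i j \<in> carrier G"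
    "gen i j \<in> Hm (transpose i j)" "gen j i \<in> Hm (transpose i j)"
    "gen i j \<oplus>\<^bsub>A\<^esub> gen j i = \<zero>\<^bsub>A\<^esub>" "gen i j \<otimes>\<^bsub>A\<^esub> gen i j = \<zero>\<^bsub>A\<^esub>" "gen j i = \<ominus>\<^bsub>A\<^esub> gen i j"
proof -
  show p: "(i, j) \<in> P" "(j, i) \<in> P" using assms unfolding pair_iff by blast+
  show c: "gen i j \<in> carrier A" "gen j i \<in> carrier A" by (rule gen_closed[OF p(1)], rule gen_closed[OF p(2)])
  show "transpose i j \<in> carrier G" by (rule transpose_G[OF p(1)])
  show "gen i j \<in> Hm (transpose i j)" by (rule gen_Hm[OF p(1)])
  show "gen j i \<in> Hm (transpose i j)" using gen_Hm[OF p(2)] by (simp only: transpose_commute)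
  show s: "gen i j \<oplus>\<^bsub>A\<^esub> gen j i = \<zero>\<^bsub>A\<^esub>" "gen i j \<otimes>\<^bsub>A\<^esub> gen i j = \<zero>\<^bsub>A\<^esub>"
    using gen_sat assms unfolding fk_sat_def by blast+
  show "gen j i = \<ominus>\<^bsub>A\<^esub> gen i j"
    using AA.minus_equality[of "gen j i" "gen i j"] s(1) c by (simp add: AA.a_comm)
qed

text \<open>Sorts the terms of the cyclic relation in the braided square: the primitive parts
  together, and each mixed term next to the one that cancels it, which stems from another of the
  three products.\<close>

lemma (in abelian_monoid) pair_sums_rearrange:
  assumes "{p1, p2, p3, a, b, c, a', b', c'} \<subseteq> carrier G"
  shows "(p1 \<oplus> (a \<oplus> c')) \<oplus> (p2 \<oplus> (b \<oplus> a')) \<oplus> (p3 \<oplus> (c \<oplus> b')) = (p1 \<oplus> p2 \<oplus> p3) \<oplus> ((a \<oplus> a') \<oplus> (b \<oplus> b') \<oplus> (c \<oplus> c'))"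
  using assms by (simp add: a_ac)

lemma comult_gen_sat:
  "fk_sat N CA.BS (\<lambda>i j. pt K A A (gen i j) \<one>\<^bsub>A\<^esub> \<oplus>\<^bsub>AT\<^esub> pt K A A \<one>\<^bsub>A\<^esub> (gen i j))" (is "fk_sat N _ ?\<phi>")
proof -
  note m = module_A and mT = module_tensor[OF module_A module_A]
  interpret AT: module K AT by (rule mT)
  interpret BS: ring CA.BS by (rule k_algebra.is_ring[OF CA.BS_algebra])
  have BS_sub: "carrier CA.BS = carrier AT" "add CA.BS = add AT" "zero CA.BS = zero AT" by simp_all
  let ?p = "pt K A A"
  define D where "D u = ?p u \<one>\<^bsub>A\<^esub> \<oplus>\<^bsub>AT\<^esub> ?p \<one>\<^bsub>A\<^esub> u" for u
  have D: "D \<in> lin_map K A AT" unfolding D_def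
    by (intro lin_add m mT lin_pt1 lin_pt2 AA.one_closed lin_id)
  note Dc = lin_map_closed[OF D] and pc = pt_closed[OF m m]
  have ann: "?p x y \<oplus>\<^bsub>AT\<^esub> ?p x' y = \<zero>\<^bsub>AT\<^esub>" if "x \<in> carrier A" "x' \<in> carrier A" "y \<in> carrier A" "x \<oplus>\<^bsub>A\<^esub> x' = \<zero>\<^bsub>A\<^esub>" for x x' y
    using that by (simp add: pt_add_left[OF m m, symmetric] pt_zero_left[OF m m])
  \<comment> \<open>The product of two primitive elements is the primitive expression of their
    product plus two mixed terms. The first parts satisfy the relations by linearity of D, so only
    the mixed terms have to be controlled.\<close>
  have prod: "D (gen i j) \<otimes>\<^bsub>CA.BS\<^esub> D (gen l n) = D (gen i j \<otimes>\<^bsub>A\<^esub> gen l n) \<oplus>\<^bsub>AT\<^esub>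
      (?p (gen i j) (gen l n) \<oplus>\<^bsub>AT\<^esub> ?p (gen (transpose i j l) (transpose i j n)) (gen i j))"
    if ij: "i \<in> {1..N}" "j \<in> {1..N}" "i \<noteq> j" and ln: "l \<in> {1..N}" "n \<in> {1..N}" "l \<noteq> n" for i j l n
  proof -
    note x = gen_facts[OF ij] and y = gen_facts[OF ln]
    note z = gen_closed[OF perm_pair[OF x(5) y(1)]]
    note mult = CA.BS_mult[OF _ G.one_closed CA.Hm_one] CA.BS_mult[OF _ x(5,6)]
    note c = pc[OF x(3) AA.one_closed] pc[OF AA.one_closed x(3)] pc[OF y(3) AA.one_closed] pc[OF AA.one_closed y(3)]
    note c' = c[folded BS_sub(1)]
    have "D (gen i j) \<otimes>\<^bsub>CA.BS\<^esub> D (gen l n) =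
        (?p (gen i j) \<one>\<^bsub>A\<^esub> \<otimes>\<^bsub>CA.BS\<^esub> ?p (gen l n) \<one>\<^bsub>A\<^esub> \<oplus>\<^bsub>AT\<^esub> ?p (gen i j) \<one>\<^bsub>A\<^esub> \<otimes>\<^bsub>CA.BS\<^esub> ?p \<one>\<^bsub>A\<^esub> (gen l n)) \<oplus>\<^bsub>AT\<^esub>
        (?p \<one>\<^bsub>A\<^esub> (gen i j) \<otimes>\<^bsub>CA.BS\<^esub> ?p (gen l n) \<one>\<^bsub>A\<^esub> \<oplus>\<^bsub>AT\<^esub> ?p \<one>\<^bsub>A\<^esub> (gen i j) \<otimes>\<^bsub>CA.BS\<^esub> ?p \<one>\<^bsub>A\<^esub> (gen l n))"
      unfolding D_def BS_sub(2)[symmetric] BS.l_distr[OF c'(1,2) BS.a_closed[OF c'(3,4)]]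
        BS.r_distr[OF c'(3,4) c'(1)] BS.r_distr[OF c'(3,4) c'(2)] ..
    also have "\<dots> = (?p (gen i j \<otimes>\<^bsub>A\<^esub> gen l n) \<one>\<^bsub>A\<^esub> \<oplus>\<^bsub>AT\<^esub> ?p (gen i j) (gen l n)) \<oplus>\<^bsub>AT\<^esub>
        (?p (gen (transpose i j l) (transpose i j n)) (gen i j) \<oplus>\<^bsub>AT\<^esub> ?p \<one>\<^bsub>A\<^esub> (gen i j \<otimes>\<^bsub>A\<^esub> gen l n))"
      using x(1,3,5) y(1,3) z by (simp add: mult \<sigma>_one \<sigma>_gen[OF x(5) y(1)] alg_hom_one[OF \<sigma>_hom])
    also have "\<dots> = D (gen i j \<otimes>\<^bsub>A\<^esub> gen l n) \<oplus>\<^bsub>AT\<^esub>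
      (?p (gen i j) (gen l n) \<oplus>\<^bsub>AT\<^esub> ?p (gen (transpose i j l) (transpose i j n)) (gen i j))"
      unfolding D_def using x(3) y(3) z by (simp add: pc AT.a_ac)
    finally show ?thesis .
  qed
  have "fk_sat N CA.BS (\<lambda>i j. D (gen i j))"
    unfolding fk_sat_def BS_sub
  proof (intro conjI ballI impI)
    fix i j assume ij: "i \<in> {1..N}" "j \<in> {1..N}" "i \<noteq> j"
    note x = gen_facts[OF ij]
    show "D (gen i j) \<in> carrier AT" by (rule Dc[OF x(3)])
    show "D (gen i j) \<oplus>\<^bsub>AT\<^esub> D (gen j i) = \<zero>\<^bsub>AT\<^esub>"
      unfolding lin_map_add[OF D x(3,4), symmetric] x(8) by (rule lin_map_zero[OF D m mT])
    \<comment> \<open>The mixed terms are [ij] \<otimes> [ij] and [ji] \<otimes> [ij], since a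
      transposition reverses its own generator; antisymmetry cancels them.\<close>
    show "D (gen i j) \<otimes>\<^bsub>CA.BS\<^esub> D (gen i j) = \<zero>\<^bsub>AT\<^esub>"
      using ann[OF x(3,4,3,8)] by (simp add: prod[OF ij ij] x(9) lin_map_zero[OF D m mT])
  next
    fix i j l n assume *: "i \<in> {1..N}" "j \<in> {1..N}" "l \<in> {1..N}" "n \<in> {1..N}" "distinct [i, j, l, n]"
    have ij: "i \<noteq> j" "l \<noteq> n" and t: "transpose i j l = l" "transpose i j n = n" "transpose l n i = i" "transpose l n j = j"
      using *(5) by (auto simp: transpose_def)
    note x = gen_facts[OF *(1,2) ij(1)] and y = gen_facts[OF *(3,4) ij(2)]
    have s: "gen i j \<otimes>\<^bsub>A\<^esub> gen l n = gen l n \<otimes>\<^bsub>A\<^esub> gen i j" using gen_sat * unfolding fk_sat_def by blast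
    show "D (gen i j) \<otimes>\<^bsub>CA.BS\<^esub> D (gen l n) = D (gen l n) \<otimes>\<^bsub>CA.BS\<^esub> D (gen i j)"
      unfolding prod[OF *(1,2) ij(1) *(3,4) ij(2)] prod[OF *(3,4) ij(2) *(1,2) ij(1)] t s
      using AT.a_comm[OF pc[OF x(3) y(3)] pc[OF y(3) x(3)]] by simp
  next
    fix i j l assume *: "i \<in> {1..N}" "j \<in> {1..N}" "l \<in> {1..N}" "distinct [i, j, l]"
    have ij: "i \<noteq> j" "j \<noteq> l" "l \<noteq> i" using *(4) by auto
    then have t: "transpose i j j = i" "transpose i j l = l" "transpose j l l = j" "transpose j l i = i" "transpose l i i = l" "transpose l i j = j"
      by (auto simp: transpose_def)
    note x = gen_facts[OF *(1,2) ij(1)] and y = gen_facts[OF *(2,3) ij(2)] and z = gen_facts[OF *(3,1) ij(3)]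
    have s: "gen i j \<otimes>\<^bsub>A\<^esub> gen j l \<oplus>\<^bsub>A\<^esub> gen j l \<otimes>\<^bsub>A\<^esub> gen l i \<oplus>\<^bsub>A\<^esub> gen l i \<otimes>\<^bsub>A\<^esub> gen i j = \<zero>\<^bsub>A\<^esub>"
      using gen_sat * unfolding fk_sat_def by blast
    have "D (gen i j \<otimes>\<^bsub>A\<^esub> gen j l) \<oplus>\<^bsub>AT\<^esub> D (gen j l \<otimes>\<^bsub>A\<^esub> gen l i) \<oplus>\<^bsub>AT\<^esub> D (gen l i \<otimes>\<^bsub>A\<^esub> gen i j) = \<zero>\<^bsub>AT\<^esub>"
      using x(3) y(3) z(3) by (simp add: lin_map_add[OF D, symmetric] s lin_map_zero[OF D m mT])
    moreover note ann[OF x(3,4) y(3) x(8)] ann[OF y(3,4) z(3) y(8)] ann[OF z(3,4) x(3) z(8)]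
    ultimately show "D (gen i j) \<otimes>\<^bsub>CA.BS\<^esub> D (gen j l) \<oplus>\<^bsub>AT\<^esub> D (gen j l) \<otimes>\<^bsub>CA.BS\<^esub> D (gen l i) \<oplus>\<^bsub>AT\<^esub>
        D (gen l i) \<otimes>\<^bsub>CA.BS\<^esub> D (gen i j) = \<zero>\<^bsub>AT\<^esub>"
      unfolding prod[OF *(1,2) ij(1) *(2,3) ij(2)] prod[OF *(2,3) ij(2) *(3,1) ij(3)] prod[OF *(3,1) ij(3) *(1,2) ij(1)] t
      by (subst AT.pair_sums_rearrange) (use x(3,4) y(3,4) z(3,4) in \<open>simp_all add: pc Dc\<close>)
  qed
  then show ?thesis by (simp only: D_def)
qed

text \<open>The values [ji] = -[ij] are those of the antipode on generators. A braided opposite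
  product of two of them moves the second by the transposition of the first and reverses the order,
  which again gives relations of the algebra.\<close>

lemma antipode_gen_sat: "fk_sat N CA.braided_op (\<lambda>i j. gen j i)"
proof -
  have mult: "gen j i \<otimes>\<^bsub>CA.braided_op\<^esub> gen n l = gen (transpose i j n) (transpose i j l) \<otimes>\<^bsub>A\<^esub> gen j i"
    if "i \<in> {1..N}" "j \<in> {1..N}" "i \<noteq> j" "l \<in> {1..N}" "n \<in> {1..N}" "l \<noteq> n" for i j l n
    using gen_facts(5,7)[OF that(1-3)] gen_facts(2,4)[OF that(4-6)] by (simp add: CA.braided_op_mult \<sigma>_gen)
  show ?thesis unfolding fk_sat_def
  proof (intro conjI ballI impI)
    fix i j assume ij: "i \<in> {1..N}" "j \<in> {1..N}" "i \<noteq> j"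
    note x = gen_facts[OF ij]
    show "gen j i \<in> carrier CA.braided_op" "gen j i \<oplus>\<^bsub>CA.braided_op\<^esub> gen i j = \<zero>\<^bsub>CA.braided_op\<^esub>"
      using x AA.a_comm[OF x(3,4)] by (simp_all add: CA.braided_op_simps)
    show "gen j i \<otimes>\<^bsub>CA.braided_op\<^esub> gen j i = \<zero>\<^bsub>CA.braided_op\<^esub>"
      unfolding mult[OF ij ij] using x(3,9) by (simp add: CA.braided_op_simps x(10) AA.r_minus)
  next
    fix i j l n assume *: "i \<in> {1..N}" "j \<in> {1..N}" "l \<in> {1..N}" "n \<in> {1..N}" "distinct [i, j, l, n]"
    have ij: "i \<noteq> j" "l \<noteq> n" and t: "transpose i j l = l" "transpose i j n = n" "transpose l n i = i" "transpose l n j = j"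
      and d: "distinct [n, l, j, i]"
      using *(5) by (auto simp: transpose_def)
    show "gen j i \<otimes>\<^bsub>CA.braided_op\<^esub> gen n l = gen n l \<otimes>\<^bsub>CA.braided_op\<^esub> gen j i"
      unfolding mult[OF *(1,2) ij(1) *(3,4) ij(2)] mult[OF *(3,4) ij(2) *(1,2) ij(1)] t
      using gen_sat *(1-4) d unfolding fk_sat_def by blast
  next
    fix i j l assume *: "i \<in> {1..N}" "j \<in> {1..N}" "l \<in> {1..N}" "distinct [i, j, l]"
    have ij: "i \<noteq> j" "j \<noteq> l" "l \<noteq> i" using *(4) by auto
    then have t: "transpose i j j = i" "transpose i j l = l" "transpose j l l = j" "transpose j l i = i" "transpose l i i = l" "transpose l i j = j"
      by (auto simp: transpose_def)
    note x = gen_facts[OF *(1,2) ij(1)] and y = gen_facts[OF *(2,3) ij(2)] and z = gen_facts[OF *(3,1) ij(3)]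
    have s: "gen i j \<otimes>\<^bsub>A\<^esub> gen j l \<oplus>\<^bsub>A\<^esub> gen j l \<otimes>\<^bsub>A\<^esub> gen l i \<oplus>\<^bsub>A\<^esub> gen l i \<otimes>\<^bsub>A\<^esub> gen i j = \<zero>\<^bsub>A\<^esub>"
      using gen_sat * unfolding fk_sat_def by blast
    let ?a = "gen i j \<otimes>\<^bsub>A\<^esub> gen j l" and ?b = "gen j l \<otimes>\<^bsub>A\<^esub> gen l i" and ?c = "gen l i \<otimes>\<^bsub>A\<^esub> gen i j"
    \<comment> \<open>The three braided opposite products come out as the negatives of the three
      terms of the cyclic relation, shifted by one place: [ji] with [lj] gives [li][ji] = -[li][ij],
      and so on around.\<close>
    have "\<ominus>\<^bsub>A\<^esub> ?c \<oplus>\<^bsub>A\<^esub> \<ominus>\<^bsub>A\<^esub> ?a \<oplus>\<^bsub>A\<^esub> \<ominus>\<^bsub>A\<^esub> ?b = \<ominus>\<^bsub>A\<^esub> (?a \<oplus>\<^bsub>A\<^esub> ?b \<oplus>\<^bsub>A\<^esub> ?c)"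
      using x(3) y(3) z(3) by (simp add: AA.minus_add AA.a_ac)
    then show "gen j i \<otimes>\<^bsub>CA.braided_op\<^esub> gen l j \<oplus>\<^bsub>CA.braided_op\<^esub> gen l j \<otimes>\<^bsub>CA.braided_op\<^esub> gen i l \<oplus>\<^bsub>CA.braided_op\<^esub>
        gen i l \<otimes>\<^bsub>CA.braided_op\<^esub> gen j i = \<zero>\<^bsub>CA.braided_op\<^esub>"
      unfolding mult[OF *(1,2) ij(1) *(2,3) ij(2)] mult[OF *(2,3) ij(2) *(3,1) ij(3)] mult[OF *(3,1) ij(3) *(1,2) ij(1)] t
      using x(3) y(3) z(3) by (simp add: CA.braided_op_simps(2,3) x(10) y(10) z(10) AA.r_minus s)
  qed
qed

lemma left_braiding_fk: "left_braiding K (fk_alg K N) = left_braiding K A"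
  by (intro ext) (simp add: left_braiding_def tensor_fk)

lemma braided_square_fk: "braided_square K (fk_alg K N) \<Psi> = braided_square K A \<Psi>"
  by (simp add: braided_square_def tensor_fk fk_simps)

lemma comult_eq: "comult A = fk_hom K N CA.BS (\<lambda>i j. pt K A A (gen i j) \<one>\<^bsub>A\<^esub> \<oplus>\<^bsub>AT\<^esub> pt K A A \<one>\<^bsub>A\<^esub> (gen i j))"
  by (simp add: fk_simps fk_comult_def Let_def left_braiding_fk braided_square_fk tensor_fk)

lemma counit_sat: "fk_sat N (ground K) (\<lambda>i j. \<zero>\<^bsub>K\<^esub>)"
  by (simp add: fk_sat_def)

lemma fk_primitively_generated:
  "primitively_generated K (sym_group N) A \<sigma> Hm (fk_act K N) co {(transpose i j, gen i j) |i j. (i, j) \<in> P}"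
proof (intro primitively_generated.intro primitively_generated_axioms.intro fk_crossed_algebra)
  note ch = fk_univ[OF CA.BS_algebra comult_gen_sat, folded comult_eq]
    and eh = fk_univ[OF k_algebra_ground counit_sat, folded fk_simps(8)]
    and ah = fk_univ[OF CA.braided_op_algebra antipode_gen_sat]
  show "comult A \<in> alg_hom K A CA.BS" by (rule ch(1))
  show "counit A \<in> alg_hom K A (ground K)" by (rule eh(1))
  let ?X = "{(transpose i j, gen i j) |i j. (i, j) \<in> P}"
  fix t x assume "(t, x) \<in> ?X"
  then obtain i j where ij: "(i, j) \<in> P" and tx: "t = transpose i j" "x = gen i j" by blast
  show "t \<in> carrier G" "x \<in> Hm t" unfolding tx using ij by (rule transpose_G, rule gen_Hm)
  show "comult A x = pt K A A x \<one>\<^bsub>A\<^esub> \<oplus>\<^bsub>AT\<^esub> pt K A A \<one>\<^bsub>A\<^esub> x" unfolding tx by (rule ch(2)[OF ij])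
  show "counit A x = \<zero>\<^bsub>K\<^esub>" unfolding tx by (rule eh(2)[OF ij])
  fix g assume g: "g \<in> carrier G"
  have "g \<otimes>\<^bsub>G\<^esub> transpose i j \<otimes>\<^bsub>G\<^esub> inv\<^sub>G g = transpose (g i) (g j)"
    using transpose_conj[OF g, of i j] transpose_G[OF perm_pair[OF g ij]] g
    by (simp add: G.m_assoc flip: transpose_conj)
  then show "(g \<otimes>\<^bsub>G\<^esub> t \<otimes>\<^bsub>G\<^esub> inv\<^sub>G g, \<sigma> g x) \<in> ?X"
    using perm_pair[OF g ij] \<sigma>_gen[OF g ij] unfolding tx by auto
next
  note ah = fk_univ[OF CA.braided_op_algebra antipode_gen_sat]
  have "fk_hom K N CA.braided_op (\<lambda>i j. gen j i) (gen i j) = \<ominus>\<^bsub>A\<^esub> gen i j" if "(i, j) \<in> P" for i j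
    using ah(2)[OF that] gen_facts(10)[of i j] that unfolding pair_iff by simp
  then show "\<exists>S\<in>alg_hom K A CA.braided_op. \<forall>(t, x)\<in>{(transpose i j, gen i j) |i j. (i, j) \<in> P}. S x = \<ominus>\<^bsub>A\<^esub> x"
    by (intro bexI[OF _ ah(1)]) auto
next
  fix b d Q assume b: "b \<in> Hm d" and one: "Q \<one>\<^bsub>G\<^esub> \<one>\<^bsub>A\<^esub>"
    and mult: "\<And>t x e c. \<lbrakk>(t, x) \<in> {(transpose i j, gen i j) |i j. (i, j) \<in> P}; e \<in> carrier G; c \<in> Hm e; Q e c\<rbrakk> \<Longrightarrow> Q (t \<otimes>\<^bsub>G\<^esub> e) (x \<otimes>\<^bsub>A\<^esub> c)"
  from b obtain w where w: "w \<in> lists P" "b = mon w" "d = deg w" unfolding Hm_def by blast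
  have "Q (deg w) (mon w)" using w(1)
  proof (induction w rule: mon_induct)
    case (Cons i j w)
    have "mon w \<in> Hm (deg w)" using Cons(2) unfolding Hm_def by blast
    then show ?case unfolding mon_Cons[OF Cons(1,2)] deg_Cons
      using Cons(1) by (intro mult deg_closed[OF Cons(2)] Cons(3)) auto
  qed (simp add: one mon_Nil deg_Nil)
  then show "Q d b" by (simp only: w)
qed

sublocale PG: primitively_generated K "sym_group N" A \<sigma> Hm "fk_act K N" co "{(transpose i j, gen i j) |i j. (i, j) \<in> P}"
  by (rule fk_primitively_generated)

sublocale BH: braided_hopf K "sym_group N" A \<sigma> Hm "fk_act K N" co
  by (rule PG.braided_hopf)

lemma gen_comult_counit:
  assumes "(i, j) \<in> P"
  shows "comult A (gen i j) = pt K A A (gen i j) \<one>\<^bsub>A\<^esub> \<oplus>\<^bsub>AT\<^esub> pt K A A \<one>\<^bsub>A\<^esub> (gen i j)" "counit A (gen i j) = \<zero>\<^bsub>K\<^esub>"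
  using PG.comult_X PG.counit_X assms by blast+

lemma left_gen:
  assumes ij: "i \<in> {1..N}" "j \<in> {1..N}" "i \<noteq> j"
  shows "(\<forall>g\<in>carrier G. BH.lp \<one>\<^bsub>A\<^esub> (\<delta> g) \<otimes>\<^bsub>BH.LA\<^esub> BH.lp (gen i j) \<one>\<^bsub>KG\<^esub> =
      BH.lp (gen (g i) (g j)) \<one>\<^bsub>KG\<^esub> \<otimes>\<^bsub>BH.LA\<^esub> BH.lp \<one>\<^bsub>A\<^esub> (\<delta> g)) \<and>
    comult BH.LA (BH.lp (gen i j) \<one>\<^bsub>KG\<^esub>) =
      pt K BH.LA BH.LA (BH.lp (gen i j) \<one>\<^bsub>KG\<^esub>) \<one>\<^bsub>BH.LA\<^esub> \<oplus>\<^bsub>tensor K BH.LA BH.LA\<^esub>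
      pt K BH.LA BH.LA (BH.lp \<one>\<^bsub>A\<^esub> (\<delta> (transpose i j))) (BH.lp (gen i j) \<one>\<^bsub>KG\<^esub>) \<and>
    counit BH.LA (BH.lp (gen i j) \<one>\<^bsub>KG\<^esub>) = \<zero>\<^bsub>K\<^esub>"
proof -
  note x = gen_facts[OF ij]
  show ?thesis
    using BH.left_relation[OF _ x(3)] BH.left_comult_primitive[OF x(5,6) gen_comult_counit(1)[OF x(1)]]
      BH.left_counit[OF x(3)] gen_comult_counit(2)[OF x(1)] \<sigma>_gen[OF _ x(1)] by simp
qed

lemma right_gen:
  assumes ij: "i \<in> {1..N}" "j \<in> {1..N}" "i \<noteq> j"
  shows "(\<forall>f\<in>carrier FG. BH.rp \<one>\<^bsub>FG\<^esub> (gen i j) \<otimes>\<^bsub>BH.RA\<^esub> BH.rp f \<one>\<^bsub>A\<^esub> =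
      BH.rp (\<R> (transpose i j) f) \<one>\<^bsub>A\<^esub> \<otimes>\<^bsub>BH.RA\<^esub> BH.rp \<one>\<^bsub>FG\<^esub> (gen i j)) \<and>
    comult BH.RA (BH.rp \<one>\<^bsub>FG\<^esub> (gen i j)) =
      (\<Oplus>\<^bsub>tensor K BH.RA BH.RA\<^esub>g\<in>carrier G. pt K BH.RA BH.RA (BH.rp \<one>\<^bsub>FG\<^esub> (gen (g i) (g j))) (BH.rp (\<delta> g) \<one>\<^bsub>A\<^esub>))
        \<oplus>\<^bsub>tensor K BH.RA BH.RA\<^esub> pt K BH.RA BH.RA \<one>\<^bsub>BH.RA\<^esub> (BH.rp \<one>\<^bsub>FG\<^esub> (gen i j)) \<and>
    counit BH.RA (BH.rp \<one>\<^bsub>FG\<^esub> (gen i j)) = \<zero>\<^bsub>K\<^esub>"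
proof -
  note x = gen_facts[OF ij]
  note h = BH.RA_hopf
  have mR: "module K BH.RA" by (rule k_algebra.is_module[OF hopf_algebra.is_algebra[OF h]])
  have "(\<Oplus>\<^bsub>tensor K BH.RA BH.RA\<^esub>g\<in>carrier G. pt K BH.RA BH.RA (BH.rp \<one>\<^bsub>FG\<^esub> (\<sigma> g (gen i j))) (BH.rp (\<delta> g) \<one>\<^bsub>A\<^esub>)) =
      (\<Oplus>\<^bsub>tensor K BH.RA BH.RA\<^esub>g\<in>carrier G. pt K BH.RA BH.RA (BH.rp \<one>\<^bsub>FG\<^esub> (gen (g i) (g j))) (BH.rp (\<delta> g) \<one>\<^bsub>A\<^esub>))"
  proof (rule finsum_congI[OF module_tensor[OF mR mR]])
    fix g assume g: "g \<in> carrier G"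
    show "pt K BH.RA BH.RA (BH.rp \<one>\<^bsub>FG\<^esub> (\<sigma> g (gen i j))) (BH.rp (\<delta> g) \<one>\<^bsub>A\<^esub>) =
        pt K BH.RA BH.RA (BH.rp \<one>\<^bsub>FG\<^esub> (gen (g i) (g j))) (BH.rp (\<delta> g) \<one>\<^bsub>A\<^esub>)"
      by (simp only: \<sigma>_gen[OF g x(1)])
    show "pt K BH.RA BH.RA (BH.rp \<one>\<^bsub>FG\<^esub> (gen (g i) (g j))) (BH.rp (\<delta> g) \<one>\<^bsub>A\<^esub>) \<in> carrier (tensor K BH.RA BH.RA)"
      using gen_closed[OF perm_pair[OF g x(1)]] g
      by (intro pt_closed[OF mR mR]) (simp_all add: BH.RA_lin BH.rp_closed FG_one_closed \<delta>_FG)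
  qed
  then show ?thesis
    using BH.right_relation[OF x(5,6)] BH.right_comult_primitive[OF x(3) gen_comult_counit(1)[OF x(1)]]
      BH.right_counit[OF x(3)] gen_comult_counit(2)[OF x(1)] by simp
qed

end

theorem corollary6p3:
  fixes K :: "('k, 'm) ring_scheme" and N :: nat
  assumes "field K"
    and char_zero: "\<forall>n::nat. n > 0 \<longrightarrow> [n] \<cdot>\<^bsub>K\<^esub> \<one>\<^bsub>K\<^esub> \<noteq> \<zero>\<^bsub>K\<^esub>"
    and "N \<ge> 2"
  shows
    "(let H = group_algebra K (sym_group N);
          E = fk K N;
          act = fk_act K N;
          coact = fk_coact K N;
          A = left_biproduct K H E act coact;
          \<iota>E = (\<lambda>b. pt K E H b \<one>\<^bsub>H\<^esub>);
          \<iota>H = (\<lambda>h. pt K E H \<one>\<^bsub>E\<^esub> h);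
          gen = (\<lambda>i j. \<iota>E (fk_gen K N i j))
      in left_braided_group K H E act coact \<and>
         hopf_algebra K A \<and>
         \<iota>E \<in> alg_hom K E A \<and> inj_on \<iota>E (carrier E) \<and>
         \<iota>H \<in> hopf_hom K H A \<and> inj_on \<iota>H (carrier H) \<and>
         alg_span K A (\<iota>E ` carrier E \<union> \<iota>H ` carrier H) = carrier A \<and>
         tlift K A (\<lambda>b h. \<iota>E b \<otimes>\<^bsub>A\<^esub> \<iota>H h) \<in> lin_map K (tensor K E H) A \<and>
         bij_betw (tlift K A (\<lambda>b h. \<iota>E b \<otimes>\<^bsub>A\<^esub> \<iota>H h)) (carrier (tensor K E H)) (carrier A) \<and>
         (\<forall>i\<in>{1..N}. \<forall>j\<in>{1..N}. i \<noteq> j \<longrightarrow>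
            (\<forall>g\<in>carrier (sym_group N).
               \<iota>H (single K g) \<otimes>\<^bsub>A\<^esub> gen i j = gen (g i) (g j) \<otimes>\<^bsub>A\<^esub> \<iota>H (single K g)) \<and>
            comult A (gen i j) =
              pt K A A (gen i j) \<one>\<^bsub>A\<^esub> \<oplus>\<^bsub>tensor K A A\<^esub>
              pt K A A (\<iota>H (single K (transpose i j))) (gen i j) \<and>
            counit A (gen i j) = \<zero>\<^bsub>K\<^esub>))
     \<and>
     (let H = function_algebra K (sym_group N);
          E = fk K N;
          act = dual_act K (sym_group N) E (fk_coact K N);
          coact = dual_coact K (sym_group N) E (fk_act K N);
          A = right_biproduct K H E act coact;
          \<iota>E = (\<lambda>b. pt K H E \<one>\<^bsub>H\<^esub> b);
          \<iota>H = (\<lambda>h. pt K H E h \<one>\<^bsub>E\<^esub>);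
          gen = (\<lambda>i j. \<iota>E (fk_gen K N i j))
      in right_braided_group K H E act coact \<and>
         hopf_algebra K A \<and>
         \<iota>E \<in> alg_hom K E A \<and> inj_on \<iota>E (carrier E) \<and>
         \<iota>H \<in> hopf_hom K H A \<and> inj_on \<iota>H (carrier H) \<and>
         alg_span K A (\<iota>H ` carrier H \<union> \<iota>E ` carrier E) = carrier A \<and>
         tlift K A (\<lambda>h b. \<iota>H h \<otimes>\<^bsub>A\<^esub> \<iota>E b) \<in> lin_map K (tensor K H E) A \<and>
         bij_betw (tlift K A (\<lambda>h b. \<iota>H h \<otimes>\<^bsub>A\<^esub> \<iota>E b)) (carrier (tensor K H E)) (carrier A) \<and>
         (\<forall>i\<in>{1..N}. \<forall>j\<in>{1..N}. i \<noteq> j \<longrightarrow>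
            (\<forall>f\<in>carrier H.
               gen i j \<otimes>\<^bsub>A\<^esub> \<iota>H f =
               \<iota>H (right_transl K (sym_group N) (transpose i j) f) \<otimes>\<^bsub>A\<^esub> gen i j) \<and>
            comult A (gen i j) =
              (\<Oplus>\<^bsub>tensor K A A\<^esub>g\<in>carrier (sym_group N).
                 pt K A A (gen (g i) (g j)) (\<iota>H (single K g))) \<oplus>\<^bsub>tensor K A A\<^esub>
              pt K A A \<one>\<^bsub>A\<^esub> (gen i j) \<and>
            counit A (gen i j) = \<zero>\<^bsub>K\<^esub>))"
proof -
  interpret K: field K by fact
  interpret fomin_kirillov K N by unfold_locales
  show ?thesis
    unfolding Let_def
    using BH.left_conclusion BH.right_conclusion
    by (elim conjE, intro conjI)
      (assumption | (intro ballI impI, rule left_gen; assumption) | (intro ballI impI, rule right_gen; assumption))+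
qed

end
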